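(* Let $M$ and $N$ be two compact complex manifolds. Suppose that the line bundle $\mathcal{O}_{T_M^*}(-1)$ over $\mathbb{P}(T_M)$ is RC-positive and that the line bundle $\mathcal{O}_{T_N^*}(1)$ over $\mathbb{P}(T_N)$ is nef. Then any holomorphic map from $M$ to $N$ is constant.
   Context: Complex manifolds are connected (usual convention). $T_M$ denotes the holomorphic tangent bundle and $T_M^*$ the holomorphic cotangent bundle. Projective bundles: for a holomorphic vector bundle $E\to X$, $\pi:\mathbb{P}(E^* )\to X$ is the bundle whose fiber over $x$ is the set of lines through the origin in $E_x^*$ (equivalently, hyperplanes of $E_x$). The tautological line bundle $\mathcal{O}_E(1)\to\mathbb{P}(E^* )$ is the quotient $\pi^*E/S$, where $S_{[\xi]}=\xi^{-1}(0)\subset E_x$ for $\xi\in E_x^*\setminus\{0\}$; $\mathcal{O}_E(-1)$ is its dual. Thus $\mathcal{O}_{T_M^*}(\pm1)$ live over $\mathbb{P}(T_M)$ (lines in $T_M$). RC-positive line bundle: a holomorphic line bundle $L$ over a complex manifold $X$ is RC-positive if it admits a smooth Hermitian metric $h$ whose Chern curvature form $-\sqrt{-1}\partial\bar\partial\log h$ has at least one positive eigenvalue at each point of $X$ (i.e. at each $q\in X$ there is $u\in T_qX$ with $R(u,\bar u)>0$). Nef line bundle: a holomorphic line bundle $L$ over a compact complex manifold $X$ with a fixed Hermitian metric $\omega$ is nef if for every $\varepsilon>0$ there is a smooth Hermitian metric $h_\varepsilon$ on $L$ with $-\sqrt{-1}\partial\bar\partial\log h_\varepsilon\ge-\varepsilon\omega$.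 *)

theory Defs
  imports "HOL-Analysis.Analysis"
begin

text \<open>
  Since the dimension \<open>2n - 1\<close> of a projectivised tangent bundle has to be computed from \<open>n\<close>,
  complex \<open>n\<close>-space consists of the sequences that vanish from index \<open>n\<close> on, with the topology
  induced by the product topology (as in the library's \<open>Euclidean_space\<close> over the reals).
\<close>

definition cspace :: "nat \<Rightarrow> (nat \<Rightarrow> complex) set" where
  "cspace n = {x. \<forall>i\<ge>n. x i = 0}"

abbreviation open_cspace :: "nat \<Rightarrow> (nat \<Rightarrow> complex) set \<Rightarrow> bool" where
  "open_cspace n W \<equiv> openin (top_of_set (cspace n)) W"

text \<open>With \<open>z\<^sub>j = x\<^sub>j + \<i> y\<^sub>j\<close>, the choices \<open>w = 1\<close> and \<open>w = \<i>\<close> give the partial derivatives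
  with respect to \<open>x\<^sub>j\<close> and \<open>y\<^sub>j\<close>.\<close>

definition coord_line :: "((nat \<Rightarrow> complex) \<Rightarrow> complex) \<Rightarrow> nat \<Rightarrow> complex \<Rightarrow> (nat \<Rightarrow> complex) \<Rightarrow> real \<Rightarrow> complex" where
  "coord_line F j w x = (\<lambda>t. F (x(j := x j + of_real t * w)))"

definition real_partial :: "nat \<Rightarrow> complex \<Rightarrow> ((nat \<Rightarrow> complex) \<Rightarrow> complex) \<Rightarrow> (nat \<Rightarrow> complex) \<Rightarrow> complex" where
  "real_partial j w F x = vector_derivative (coord_line F j w x) (at 0)"

primrec C_k :: "nat \<Rightarrow> nat \<Rightarrow> (nat \<Rightarrow> complex) set \<Rightarrow> ((nat \<Rightarrow> complex) \<Rightarrow> complex) \<Rightarrow> bool" where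
  "C_k 0 n W F \<longleftrightarrow> continuous_on W F"
| "C_k (Suc k) n W F \<longleftrightarrow> continuous_on W F \<and>
     (\<forall>j<n. \<forall>w\<in>{1, \<i>}. (\<forall>x\<in>W. coord_line F j w x differentiable (at 0)) \<and>
        C_k k n W (real_partial j w F))"

definition smooth_fn :: "nat \<Rightarrow> (nat \<Rightarrow> complex) set \<Rightarrow> ((nat \<Rightarrow> complex) \<Rightarrow> complex) \<Rightarrow> bool" where
  "smooth_fn n W F \<longleftrightarrow> (\<forall>k. C_k k n W F)"

definition d_z :: "nat \<Rightarrow> ((nat \<Rightarrow> complex) \<Rightarrow> complex) \<Rightarrow> (nat \<Rightarrow> complex) \<Rightarrow> complex" where
  "d_z j F x = (real_partial j 1 F x - \<i> * real_partial j \<i> F x) / 2"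

definition d_zbar :: "nat \<Rightarrow> ((nat \<Rightarrow> complex) \<Rightarrow> complex) \<Rightarrow> (nat \<Rightarrow> complex) \<Rightarrow> complex" where
  "d_zbar j F x = (real_partial j 1 F x + \<i> * real_partial j \<i> F x) / 2"

text \<open>Holomorphic functions of several variables: smooth solutions of the Cauchy-Riemann equations.\<close>

definition holo_fn :: "nat \<Rightarrow> (nat \<Rightarrow> complex) set \<Rightarrow> ((nat \<Rightarrow> complex) \<Rightarrow> complex) \<Rightarrow> bool" where
  "holo_fn n W F \<longleftrightarrow> smooth_fn n W F \<and> (\<forall>x\<in>W. \<forall>j<n. d_zbar j F x = 0)"

text \<open>A chart is a domain together with a coordinate map, whose values off the domain are
  irrelevant.\<close>

type_synonym 'a chart = "'a set \<times> ('a \<Rightarrow> nat \<Rightarrow> complex)"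

abbreviation cdom :: "'a chart \<Rightarrow> 'a set" where "cdom c \<equiv> fst c"
abbreviation cmap :: "'a chart \<Rightarrow> 'a \<Rightarrow> nat \<Rightarrow> complex" where "cmap c \<equiv> snd c"
abbreviation cinv :: "'a chart \<Rightarrow> (nat \<Rightarrow> complex) \<Rightarrow> 'a" where "cinv c \<equiv> inv_into (fst c) (snd c)"

record 'a cmanifold =
  cdim :: nat
  atlas :: "'a chart set"

definition carrier_of :: "'a cmanifold \<Rightarrow> 'a set" where
  "carrier_of X = (\<Union>c\<in>atlas X. cdom c)"

text \<open>The topology is the one determined by the atlas.  For an atlas as in \<open>complex_manifold\<close>
  below it is the unique topology for which every chart is a homeomorphism from an open
  set onto an open subset of complex \<open>n\<close>-space.\<close>

definition mtop :: "'a cmanifold \<Rightarrow> 'a topology" where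
  "mtop X = topology_generated_by
     {{p \<in> cdom c. cmap c p \<in> W} | c W. c \<in> atlas X \<and> open_cspace (cdim X) W}"

definition complex_manifold :: "'a cmanifold \<Rightarrow> bool" where
  "complex_manifold X \<longleftrightarrow>
     (\<forall>c\<in>atlas X. inj_on (cmap c) (cdom c) \<and> open_cspace (cdim X) (cmap c ` cdom c)) \<and>
     (\<forall>c\<in>atlas X. \<forall>d\<in>atlas X.
        open_cspace (cdim X) (cmap c ` (cdom c \<inter> cdom d)) \<and>
        (\<forall>i<cdim X. holo_fn (cdim X) (cmap c ` (cdom c \<inter> cdom d)) (\<lambda>x. cmap d (cinv c x) i))) \<and>
     Hausdorff_space (mtop X) \<and> second_countable (mtop X) \<and> connected_space (mtop X)"

definition holomorphic_map :: "'a cmanifold \<Rightarrow> 'b cmanifold \<Rightarrow> ('a \<Rightarrow> 'b) \<Rightarrow> bool" where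
  "holomorphic_map X Y f \<longleftrightarrow>
     continuous_map (mtop X) (mtop Y) f \<and>
     (\<forall>c\<in>atlas X. \<forall>d\<in>atlas Y. \<forall>i<cdim Y.
        holo_fn (cdim X) (cmap c ` {p \<in> cdom c. f p \<in> cdom d}) (\<lambda>x. cmap d (f (cinv c x)) i))"

text \<open>A tangent vector of type \<open>(1,0)\<close> at \<open>p\<close> is given by its components \<open>v c i\<close>, meaning
  \<open>v = (\<Sum>i<n. v c i \<partial>/\<partial>z\<^sub>i)\<close>, in every chart \<open>c\<close> around \<open>p\<close>, subject to the transformation law;
  at the other arguments it is 0.\<close>

type_synonym 'a tvec = "'a chart \<Rightarrow> nat \<Rightarrow> complex"

definition tangent_space :: "'a cmanifold \<Rightarrow> 'a \<Rightarrow> 'a tvec set" where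
  "tangent_space X p = {v.
     (\<forall>c. c \<in> atlas X \<and> p \<in> cdom c \<longrightarrow> v c \<in> cspace (cdim X)) \<and>
     (\<forall>c. \<not> (c \<in> atlas X \<and> p \<in> cdom c) \<longrightarrow> v c = (\<lambda>i. 0)) \<and>
     (\<forall>c\<in>atlas X. \<forall>d\<in>atlas X. p \<in> cdom c \<inter> cdom d \<longrightarrow>
        (\<forall>i<cdim X. v d i =
           (\<Sum>j<cdim X. d_z j (\<lambda>x. cmap d (cinv c x) i) (cmap c p) * v c j)))}"

definition tzero :: "'a tvec" where
  "tzero = (\<lambda>c i. 0)"

definition tadd :: "'a tvec \<Rightarrow> 'a tvec \<Rightarrow> 'a tvec" where
  "tadd u v = (\<lambda>c i. u c i + v c i)"

definition tscale :: "complex \<Rightarrow> 'a tvec \<Rightarrow> 'a tvec" where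
  "tscale a v = (\<lambda>c i. a * v c i)"

text \<open>Complex linear forms on the tangent space, extended by 0.\<close>

definition cotangent_space :: "'a cmanifold \<Rightarrow> 'a \<Rightarrow> ('a tvec \<Rightarrow> complex) set" where
  "cotangent_space X p = {\<alpha>.
     (\<forall>u\<in>tangent_space X p. \<forall>v\<in>tangent_space X p. \<alpha> (tadd u v) = \<alpha> u + \<alpha> v) \<and>
     (\<forall>a. \<forall>v\<in>tangent_space X p. \<alpha> (tscale a v) = a * \<alpha> v) \<and>
     (\<forall>v. v \<notin> tangent_space X p \<longrightarrow> \<alpha> v = 0)}"

definition coord_form :: "'a cmanifold \<Rightarrow> 'a chart \<Rightarrow> nat \<Rightarrow> 'a \<Rightarrow> 'a tvec \<Rightarrow> complex" where
  "coord_form X c k p = (\<lambda>v. if v \<in> tangent_space X p then v c k else 0)"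

text \<open>Hermitian metrics on a manifold: in every chart \<open>g = \<Sum> G\<^sub>i\<^sub>j dz\<^sub>i \<otimes> d\<close>\<open>z\<^sub>j\<close>-bar with smooth
  coefficients \<open>G\<^sub>i\<^sub>j\<close> (hence \<open>g\<close> is sesquilinear), Hermitian symmetric and positive definite.\<close>

definition hermitian_metric :: "'a cmanifold \<Rightarrow> ('a \<Rightarrow> 'a tvec \<Rightarrow> 'a tvec \<Rightarrow> complex) \<Rightarrow> bool" where
  "hermitian_metric X g \<longleftrightarrow>
     (\<forall>c\<in>atlas X. \<exists>G. (\<forall>i<cdim X. \<forall>j<cdim X. smooth_fn (cdim X) (cmap c ` cdom c) (G i j)) \<and>
        (\<forall>p\<in>cdom c. \<forall>u\<in>tangent_space X p. \<forall>v\<in>tangent_space X p.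
           g p u v = (\<Sum>i<cdim X. \<Sum>j<cdim X. G i j (cmap c p) * u c i * cnj (v c j)))) \<and>
     (\<forall>p\<in>carrier_of X. \<forall>u\<in>tangent_space X p. \<forall>v\<in>tangent_space X p. g p v u = cnj (g p u v)) \<and>
     (\<forall>p\<in>carrier_of X. \<forall>u\<in>tangent_space X p. u \<noteq> tzero \<longrightarrow> Re (g p u u) > 0)"

text \<open>A line bundle is given by its fibres, their scalar multiplication (which, the fibres
  being one-dimensional, determines their addition) and nowhere vanishing local holomorphic
  frames, that is pairs \<open>(V, e)\<close> of an open set and a section over it.  The sets \<open>V\<close> cover
  the base, and any two frames differ by a holomorphic function.\<close>

record ('x, 'l) line_bundle =
  fibre :: "'x \<Rightarrow> 'l set"
  scale :: "'x \<Rightarrow> complex \<Rightarrow> 'l \<Rightarrow> 'l"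
  frames :: "('x set \<times> ('x \<Rightarrow> 'l)) set"

text \<open>On a one-dimensional space a linear form is the same as a homogeneous function.\<close>

definition dual_bundle :: "('x, 'l) line_bundle \<Rightarrow> ('x, 'l \<Rightarrow> complex) line_bundle" where
  "dual_bundle L = \<lparr>
     fibre = (\<lambda>q. {\<xi>. (\<forall>a. \<forall>v\<in>fibre L q. \<xi> (scale L q a v) = a * \<xi> v) \<and> (\<forall>v. v \<notin> fibre L q \<longrightarrow> \<xi> v = 0)}),
     scale = (\<lambda>q a \<xi> v. a * \<xi> v),
     frames = {(V, \<lambda>q v. if v \<in> fibre L q then (THE a. v = scale L q a (e q)) else 0) | V e. (V, e) \<in> frames L} \<rparr>"

text \<open>A Hermitian metric on a line bundle, given as the squared norm \<open>h q v = |v|\<^sup>2\<close>.\<close>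

definition bundle_metric :: "'x cmanifold \<Rightarrow> ('x, 'l) line_bundle \<Rightarrow> ('x \<Rightarrow> 'l \<Rightarrow> real) \<Rightarrow> bool" where
  "bundle_metric X L h \<longleftrightarrow>
     (\<forall>q\<in>carrier_of X. \<forall>a. \<forall>v\<in>fibre L q. h q (scale L q a v) = (cmod a)\<^sup>2 * h q v) \<and>
     (\<forall>(V, e)\<in>frames L. (\<forall>q\<in>V. h q (e q) > 0) \<and>
        (\<forall>c\<in>atlas X. smooth_fn (cdim X) (cmap c ` (cdom c \<inter> V))
           (\<lambda>x. of_real (h (cinv c x) (e (cinv c x))))))"

text \<open>The value \<open>R(u, u\<close>-bar\<open>)\<close> of the Chern curvature form, computed in the chart \<open>c\<close> and the
  holomorphic frame \<open>e\<close>, as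
  \<open>- \<Sum> \<partial>\<^sup>2 log h(e) / \<partial>z\<^sub>i \<partial>\<close>\<open>z\<^sub>j\<close>-bar \<open>u\<^sub>i\<close> \<open>u\<^sub>j\<close>-bar.  It depends neither on \<open>c\<close> nor on \<open>e\<close>,
  and the sum is a real number, so that taking \<open>Re\<close> only changes its type.\<close>

definition levi :: "nat \<Rightarrow> ((nat \<Rightarrow> complex) \<Rightarrow> complex) \<Rightarrow> (nat \<Rightarrow> complex) \<Rightarrow> (nat \<Rightarrow> complex) \<Rightarrow> complex" where
  "levi n F x u = (\<Sum>i<n. \<Sum>j<n. d_z i (d_zbar j F) x * u i * cnj (u j))"

definition curvature :: "'x cmanifold \<Rightarrow> ('x \<Rightarrow> 'l \<Rightarrow> real) \<Rightarrow> 'x chart \<Rightarrow> ('x \<Rightarrow> 'l) \<Rightarrow> 'x \<Rightarrow> 'x tvec \<Rightarrow> real" where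
  "curvature X h c e q u =
     - Re (levi (cdim X) (\<lambda>x. of_real (ln (h (cinv c x) (e (cinv c x))))) (cmap c q) (u c))"

definition RC_positive :: "'x cmanifold \<Rightarrow> ('x, 'l) line_bundle \<Rightarrow> bool" where
  "RC_positive X L \<longleftrightarrow> (\<exists>h. bundle_metric X L h \<and>
     (\<forall>q\<in>carrier_of X. \<exists>u\<in>tangent_space X q.
        \<forall>c\<in>atlas X. \<forall>(V, e)\<in>frames L. q \<in> cdom c \<inter> V \<longrightarrow> curvature X h c e q u > 0))"

definition nef :: "'x cmanifold \<Rightarrow> ('x \<Rightarrow> 'x tvec \<Rightarrow> 'x tvec \<Rightarrow> complex) \<Rightarrow> ('x, 'l) line_bundle \<Rightarrow> bool" where
  "nef X g L \<longleftrightarrow> (\<forall>\<epsilon>>0. \<exists>h. bundle_metric X L h \<and>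
     (\<forall>q\<in>carrier_of X. \<forall>u\<in>tangent_space X q.
        \<forall>c\<in>atlas X. \<forall>(V, e)\<in>frames L. q \<in> cdom c \<inter> V \<longrightarrow>
          curvature X h c e q u \<ge> - \<epsilon> * Re (g q u u)))"

text \<open>The points over \<open>p\<close> are the pairs \<open>(p, l)\<close> with \<open>l\<close> a line through the origin of the tangent
  space at \<open>p\<close>.\<close>

definition tangent_lines :: "'a cmanifold \<Rightarrow> 'a \<Rightarrow> 'a tvec set set" where
  "tangent_lines X p = {range (\<lambda>a. tscale a v) | v. v \<in> tangent_space X p \<and> v \<noteq> tzero}"

definition proj_dom :: "'a cmanifold \<Rightarrow> 'a chart \<Rightarrow> nat \<Rightarrow> ('a \<times> 'a tvec set) set" where
  "proj_dom X c k = {(p, l). p \<in> cdom c \<and> l \<in> tangent_lines X p \<and> (\<exists>v\<in>l. v c k \<noteq> 0)}"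

text \<open>For \<open>l\<close> spanned by \<open>v\<close> with \<open>v\<^sub>k = 1\<close> the coordinates of \<open>(p, l)\<close> are
  \<open>(z\<^sub>0, \<dots>, z\<^bsub>n-1\<^esub>, v\<^sub>0, \<dots>, v\<^bsub>k-1\<^esub>, v\<^bsub>k+1\<^esub>, \<dots>, v\<^bsub>n-1\<^esub>)\<close>.\<close>

definition proj_map :: "'a cmanifold \<Rightarrow> 'a chart \<Rightarrow> nat \<Rightarrow> 'a \<times> 'a tvec set \<Rightarrow> nat \<Rightarrow> complex" where
  "proj_map X c k = (\<lambda>(p, l). let n = cdim X; v = (THE v. v \<in> l \<and> v c k = 1) in
     (\<lambda>i. if i < n then cmap c p i
          else if i < n + k then v c (i - n)
          else if i < 2 * n - 1 then v c (i - n + 1)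
          else 0))"

definition proj_tangent :: "'a cmanifold \<Rightarrow> ('a \<times> 'a tvec set) cmanifold" where
  "proj_tangent X = \<lparr> cdim = 2 * cdim X - 1,
     atlas = {(proj_dom X c k, proj_map X c k) | c k. c \<in> atlas X \<and> k < cdim X} \<rparr>"

text \<open>For \<open>E\<close> the cotangent bundle, \<open>E\<^sup>*\<close> is identified with the tangent bundle, a tangent
  vector \<open>v\<close> being the linear form \<open>\<alpha> \<mapsto> \<alpha> v\<close> on the cotangent space.  So \<open>taut_sub X (p, l)\<close>
  is the kernel \<open>S\<close> of the linear form belonging to the line \<open>l\<close>, and the fibre of \<open>O(1)\<close> is
  the quotient by it, consisting of cosets.  The coordinate forms \<open>dz\<^sub>k\<close> of a chart project to
  local frames of the quotient where they do not vanish on \<open>l\<close>.\<close>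

definition taut_sub :: "'a cmanifold \<Rightarrow> 'a \<times> 'a tvec set \<Rightarrow> ('a tvec \<Rightarrow> complex) set" where
  "taut_sub X = (\<lambda>(p, l). {\<alpha> \<in> cotangent_space X p. \<forall>v\<in>l. \<alpha> v = 0})"

definition taut_coset :: "'a cmanifold \<Rightarrow> 'a \<times> 'a tvec set \<Rightarrow> ('a tvec \<Rightarrow> complex) \<Rightarrow> ('a tvec \<Rightarrow> complex) set" where
  "taut_coset X q \<alpha> = {\<lambda>v. \<alpha> v + \<beta> v | \<beta>. \<beta> \<in> taut_sub X q}"

definition O_cotangent_1 :: "'a cmanifold \<Rightarrow> ('a \<times> 'a tvec set, ('a tvec \<Rightarrow> complex) set) line_bundle" where
  "O_cotangent_1 X = \<lparr>
     fibre = (\<lambda>q. taut_coset X q ` cotangent_space X (fst q)),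
     scale = (\<lambda>q a A. \<Union>\<alpha>\<in>A. taut_coset X q (\<lambda>v. a * \<alpha> v)),
     frames = {(proj_dom X c k, \<lambda>q. taut_coset X q (coord_form X c k (fst q))) | c k.
                 c \<in> atlas X \<and> k < cdim X} \<rparr>"

definition O_cotangent_minus1 ::
    "'a cmanifold \<Rightarrow> ('a \<times> 'a tvec set, ('a tvec \<Rightarrow> complex) set \<Rightarrow> complex) line_bundle" where
  "O_cotangent_minus1 X = dual_bundle (O_cotangent_1 X)"

end

theory Submission
  imports Defs "HOL-Complex_Analysis.Complex_Analysis"
begin

text \<open>
  For a holomorphic map \<open>f : M \<rightarrow> N\<close> with \<open>df \<noteq> 0\<close> the maximum principle is applied, on the lines of \<open>T\<^sub>M\<close>
  on which \<open>df\<close> does not vanish, to the logarithm of \<open>K(df v) / H(v)\<close>.  Here \<open>H\<close> is the RC-positive metric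
  on \<open>O(-1)\<close> over \<open>P(T\<^sub>M)\<close>, and \<open>K\<close> is the dual of a metric on \<open>O(1)\<close> over \<open>P(T\<^sub>N)\<close> whose
  curvature is at least \<open>-\<epsilon> g\<close>.  At a maximum take a direction \<open>u\<close> in which \<open>H\<close> has positive curvature,
  and the Laplacian along a holomorphic disc with velocity \<open>u\<close>: the contribution of \<open>H\<close> is bounded
  below, uniformly in \<open>\<epsilon>\<close>, but the error \<open>\<epsilon> g(df u, df u)\<close> is not under control where \<open>df v\<close> is small,
  since the induced map of projectivised bundles degenerates there.  The trouble comes only from the
  directions along the fibres of \<open>P(T\<^sub>N)\<close>.  So one adds \<open>\<eta>\<close> times a local function that is strictly
  plurisubharmonic along the fibres, namely
  \<open>ln \<bar>w\<^sub>k\<bar>\<^sup>2 + \<delta> \<Sum>\<^sub>a \<bar>w\<^sub>a / w\<^sub>k\<bar>\<^sup>2 - \<mu> \<bar>y - b\<bar>\<^sup>2 / r\<^sup>2\<close> for a vector \<open>w\<close> at the point with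
  coordinates \<open>y\<close>, with \<open>\<eta>\<close> proportional to \<open>\<epsilon>\<close>, and maximises over finitely many coordinate patches as
  well.  For large \<open>\<mu>\<close>, which does not depend on \<open>\<epsilon>\<close>, the maximum lies in the interior of its patch,
  and for small \<open>\<epsilon>\<close> the inequality for the Laplacian is contradictory.
\<close>

section \<open>Calculus on complex coordinate space\<close>

text \<open>The obstacle is uniformity in \<epsilon>: nothing bounds the metrics \<kappa>N supplied
  by nefness as \<epsilon> tends to 0, so no constant may depend on them. Different patches are
  therefore compared at one and the same vector, where the global part, the log-norm on
  \<open>N\<close> minus \<open>1 + \<eta>\<close> times the log-norm on \<open>M\<close>, cancels.
  What is left is the change of the logarithm of a component between two charts, and this is
  controlled by one auxiliary metric \<kappa>1, the one for \<epsilon> = 1; hence \<mu> can be fixed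
  before \<epsilon>. The factor \<open>1 + \<eta>\<close> is forced by homogeneity: the test
  function must depend only on the line spanned by the vector. Vectors killed by the differential do
  no harm, since the test function tends to minus infinity towards them and a maximum still exists.
  At the maximum the choice \<open>\<eta> * \<delta> = \<epsilon> * C0\<close> makes the fibre
  directions cancel exactly, and the remaining error is \<epsilon> times a constant, whereas
  RC-positivity, made uniform by compactness and rescaling, contributes at least 1.\<close>

lemma open_cspaceD:
  assumes "open_cspace n W" "x \<in> W"
  obtains e where "e > 0" "\<And>y. y \<in> cspace n \<Longrightarrow> (\<And>i. i < n \<Longrightarrow> cmod (y i - x i) < e) \<Longrightarrow> y \<in> W"
proof -
  obtain T where T: "open T" "W = cspace n \<inter> T"
    using assms(1) by (auto simp: openin_open)
  have xT: "x \<in> T" and xc: "x \<in> cspace n" using assms(2) T(2) by auto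
  have "openin (product_topology (\<lambda>i. euclidean) UNIV) T"
    using T(1) by (simp add: euclidean_product_topology)
  from product_topology_open_contains_basis[OF this xT]
  obtain X where X: "x \<in> (\<Pi>\<^sub>E i\<in>UNIV. X i)" "\<And>i. open (X i)" "(\<Pi>\<^sub>E i\<in>UNIV. X i) \<subseteq> T"
    by auto
  have "\<forall>i. \<exists>e>0. ball (x i) e \<subseteq> X i"
    using X(1,2) by (meson PiE_mem UNIV_I open_contains_ball)
  then obtain e where e: "\<And>i. e i > 0" "\<And>i. ball (x i) (e i) \<subseteq> X i" by metis
  \<comment> \<open>The coordinates from \<open>n\<close> on vanish on \<open>cspace n\<close>, so
    finitely many radii suffice; the inserted 1 keeps the minimum meaningful for
    \<open>n = 0\<close>.\<close>
  define m where "m = Min (insert 1 (e ` {..<n}))"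
  have m0: "m > 0" unfolding m_def using e by (subst Min_gr_iff) auto
  have mi: "m \<le> e i" if "i < n" for i unfolding m_def using that by (intro Min_le) auto
  show ?thesis
  proof (rule that[OF m0])
    fix y assume y: "y \<in> cspace n" "\<And>i. i < n \<Longrightarrow> cmod (y i - x i) < m"
    have "y i \<in> X i" for i
    proof (cases "i < n")
      case True
      then have "y i \<in> ball (x i) (e i)"
        using y(2)[OF True] mi[OF True] by (simp add: dist_norm norm_minus_commute)
      then show ?thesis using e(2) by blast
    next
      case False
      then have "y i = x i" using y(1) xc by (auto simp: cspace_def)
      then show ?thesis using X(1) by (auto simp: PiE_iff)
    qed
    then show "y \<in> W" using X(3) T(2) y(1) by (auto simp: PiE_iff)
  qed
qed

lemma open_cspace_box:
  assumes "open_cspace n W" "x \<in> W"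
  shows "\<exists>e>0. \<forall>y\<in>cspace n. (\<forall>i<n. cmod (y i - x i) < e) \<longrightarrow> y \<in> W"
  by (rule open_cspaceD[OF assms]) blast

lemma open_Collect_close: "open {y. \<forall>i<n::nat. cmod (y i - x i) < (e::real)}"
proof -
  have "{y. \<forall>i<n. cmod (y i - x i) < e} = (\<Inter>i\<in>{..<n}. {y. cmod (y i - x i) < e})" by auto
  moreover have "open {y::nat\<Rightarrow>complex. cmod (y i - x i) < e}" for i
    by (intro open_Collect_less continuous_intros continuous_on_product_coordinates)
  then have "open (\<Inter>i\<in>{..<n}. {y. cmod (y i - x i) < e})" by (intro open_INT) auto
  ultimately show ?thesis by (simp only:)
qed

lemma open_cspace_subset: "open_cspace n W \<Longrightarrow> W \<subseteq> cspace n"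
  by (auto simp: openin_open)

text \<open>Coordinatewise continuity is enough, because near a point of \<open>W\<close> the first
  \<open>n\<close> coordinates decide membership once the values lie in
  \<open>cspace n\<close>.\<close>

lemma eventually_in_open_cspace:
  fixes Y :: "'b::t2_space \<Rightarrow> nat \<Rightarrow> complex"
  assumes W: "open_cspace n W" "Y t0 \<in> W" and "\<forall>\<^sub>F t in nhds t0. Y t \<in> cspace n"
    and "\<And>j. j < n \<Longrightarrow> isCont (\<lambda>t. Y t j) t0"
  shows "\<forall>\<^sub>F t in nhds t0. Y t \<in> W"
proof -
  obtain e where e: "e > 0" "\<And>y. y \<in> cspace n \<Longrightarrow> (\<And>i. i < n \<Longrightarrow> cmod (y i - Y t0 i) < e) \<Longrightarrow> y \<in> W"
    using open_cspaceD[OF W] by metis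
  have "\<forall>\<^sub>F t in nhds t0. \<forall>j\<in>{..<n}. cmod (Y t j - Y t0 j) < e"
  proof (intro eventually_ball_finite ballI)
    fix j assume "j \<in> {..<n}"
    then have "((\<lambda>t. Y t j) \<longlongrightarrow> Y t0 j) (nhds t0)"
      using assms(4)[of j] by (simp add: isCont_def tendsto_nhds_iff)
    then show "\<forall>\<^sub>F t in nhds t0. cmod (Y t j - Y t0 j) < e"
      using e(1) by (auto simp: tendsto_iff dist_norm)
  qed auto
  with assms(3) show ?thesis by eventually_elim (use e in auto)
qed

lemma cspace_upd: "x \<in> cspace n \<Longrightarrow> j < n \<Longrightarrow> x(j := a) \<in> cspace n"
  by (auto simp: cspace_def)

section \<open>Strict differentiability and the chain rule for C^1 functions\<close>

lemma C1_D:
  assumes "C_k (Suc k) n W F" "x \<in> W" "j < n" "w \<in> {1, \<i>}"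
  shows "(coord_line F j w x has_vector_derivative real_partial j w F x) (at 0)"
    "continuous_on W F" "C_k k n W (real_partial j w F)" "continuous_on W (real_partial j w F)"
proof -
  have *: "coord_line F j w x differentiable (at 0)" "C_k k n W (real_partial j w F)" "continuous_on W F"
    using assms by auto
  then show "(coord_line F j w x has_vector_derivative real_partial j w F x) (at 0)"
    by (simp add: real_partial_def vector_derivative_works)
  show "continuous_on W (real_partial j w F)" using *(2) by (cases k) auto
  show "continuous_on W F" "C_k k n W (real_partial j w F)" using * by auto
qed

text \<open>The line based at the point with parameter \<open>s\<close> is the original line with
  shifted parameter, so the derivative at 0 that defines \<open>real_partial\<close> moves to
  \<open>s\<close>.\<close>

lemma has_vector_derivative_coord_line:
  assumes "C_k (Suc k) n W F" "x(j := x j + of_real s * w) \<in> W" "j < n" "w \<in> {1, \<i>}"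
  shows "(coord_line F j w x has_vector_derivative real_partial j w F (x(j := x j + of_real s * w))) (at s)"
proof -
  let ?y = "x(j := x j + of_real s * w)"
  have "(coord_line F j w ?y has_vector_derivative real_partial j w F ?y) (at 0)"
    by (rule C1_D(1)[OF assms])
  moreover have "coord_line F j w ?y = (\<lambda>t. coord_line F j w x (t + s))"
    by (auto simp: coord_line_def fun_eq_iff algebra_simps)
  ultimately have "((\<lambda>t. coord_line F j w x (t + s)) has_vector_derivative real_partial j w F ?y) (at 0)"
    by simp
  then have "((\<lambda>t. coord_line F j w x (t + s)) \<circ> (\<lambda>t. t - s) has_vector_derivative 1 *\<^sub>R real_partial j w F ?y) (at s)"
    by (intro vector_diff_chain_at) (auto intro!: derivative_eq_intros)
  then show ?thesis by (simp add: o_def)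
qed

text \<open>The mean value inequality for \<open>g s - s *\<^sub>R D\<close>; it compares an
  increment with a prescribed value \<open>D\<close> of the derivative.\<close>

lemma mvt_bound:
  fixes g :: "real \<Rightarrow> complex"
  assumes "\<And>s. s \<in> {0..1} \<Longrightarrow> (g has_vector_derivative g' s) (at s)"
    and "\<And>s. s \<in> {0..1} \<Longrightarrow> cmod (g' s - D) \<le> B"
  shows "cmod (g 1 - g 0 - D) \<le> B"
proof -
  have "norm ((g 1 - 1 *\<^sub>R D) - (g 0 - 0 *\<^sub>R D)) \<le> B * norm (1 - 0 :: real)"
  proof (rule differentiable_bound[of "{0..1}" _ "\<lambda>s h. h *\<^sub>R (g' s - D)"])
    fix s :: real assume s: "s \<in> {0..1}"
    have "((\<lambda>s. g s - s *\<^sub>R D) has_vector_derivative (g' s - D)) (at s)"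
      by (rule derivative_eq_intros assms(1)[OF s] refl | simp)+
    then show "((\<lambda>s. g s - s *\<^sub>R D) has_derivative (\<lambda>h. h *\<^sub>R (g' s - D))) (at s within {0..1})"
      unfolding has_vector_derivative_def by (rule has_derivative_at_withinI)
    show "onorm (\<lambda>h. h *\<^sub>R (g' s - D)) \<le> B"
      using assms(2)[OF s] by (intro onorm_le) (auto simp: mult.commute[of B] intro!: mult_left_mono)
  qed auto
  then show ?thesis by (simp add: algebra_simps)
qed

text \<open>Meant for a path from \<open>a\<close> to \<open>b\<close> that first changes the real
  and then the imaginary part. Its points mix coordinates of \<open>a\<close> and \<open>b\<close>,
  so only the real and the imaginary part of the distance to \<open>c\<close> stay below
  \<open>e\<close>, and the modulus below \<open>2 * e\<close>.\<close>

lemma cmod_close_segment: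
  assumes "cmod (a - c) < e" "cmod (b - c) < e" "s \<in> {0..1}"
  shows "\<bar>Re (a + of_real (s * Re (b - a)) - c)\<bar> < e" "\<bar>Im (a + of_real (s * Im (b - a)) * \<i> - c)\<bar> < e"
proof -
  have conv: "\<bar>p + s * (q - p) - r\<bar> < e" if "\<bar>p - r\<bar> < e" "\<bar>q - r\<bar> < e" for p q r :: real
  proof -
    have "p + s * (q - p) - r = (1 - s) * (p - r) + s * (q - r)" by (simp add: algebra_simps)
    moreover have "\<bar>(1 - s) * (p - r) + s * (q - r)\<bar> \<le> (1 - s) * \<bar>p - r\<bar> + s * \<bar>q - r\<bar>"
      using assms(3) by (intro order_trans[OF abs_triangle_ineq]) (auto simp: abs_mult)
    moreover have "(1 - s) * \<bar>p - r\<bar> + s * \<bar>q - r\<bar> < e"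
      using assms(3) that by (intro convex_bound_lt) auto
    ultimately show ?thesis by simp
  qed
  have *: "\<bar>Re a - Re c\<bar> < e" "\<bar>Re b - Re c\<bar> < e" "\<bar>Im a - Im c\<bar> < e" "\<bar>Im b - Im c\<bar> < e"
    using abs_Re_le_cmod[of "a - c"] abs_Im_le_cmod[of "a - c"] abs_Re_le_cmod[of "b - c"]
      abs_Im_le_cmod[of "b - c"] assms by auto
  show "\<bar>Re (a + of_real (s * Re (b - a)) - c)\<bar> < e" using conv[OF *(1,2)] by simp
  show "\<bar>Im (a + of_real (s * Im (b - a)) * \<i> - c)\<bar> < e" using conv[OF *(3,4)] by simp
qed

text \<open>Proved by changing one real coordinate at a time.\<close>

lemma C1_strict:
  assumes W: "open_cspace n W" "x \<in> W" and F: "C_k (Suc k) n W F" and eps: "\<epsilon> > 0"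
  shows "\<exists>e>0. \<forall>y\<in>cspace n. \<forall>z\<in>cspace n.
    (\<forall>i<n. cmod (y i - x i) < e) \<longrightarrow> (\<forall>i<n. cmod (z i - x i) < e) \<longrightarrow>
    y \<in> W \<and> cmod (F z - F y - (\<Sum>j<n. Re (z j - y j) * real_partial j 1 F x + Im (z j - y j) * real_partial j \<i> F x))
      \<le> \<epsilon> * (\<Sum>j<n. cmod (z j - y j))"
proof -
  have xc: "x \<in> cspace n" using W open_cspace_subset by blast
  let ?V = "W \<inter> (\<Inter>j\<in>{..<n}. \<Inter>w\<in>{1, \<i>}. {y \<in> W. cmod (real_partial j w F y - real_partial j w F x) < \<epsilon>/2})"
  have "open_cspace n {y \<in> W. cmod (real_partial j w F y - real_partial j w F x) < \<epsilon>/2}" if "j < n" "w \<in> {1, \<i>}" for j w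
  proof -
    have "continuous_on W (\<lambda>y. cmod (real_partial j w F y - real_partial j w F x))"
      by (intro continuous_intros C1_D(4)[OF F W(2) that])
    from continuous_openin_preimage_gen[OF this open_lessThan[of "\<epsilon>/2"]]
    have "openin (top_of_set W) {y \<in> W. cmod (real_partial j w F y - real_partial j w F x) < \<epsilon>/2}"
      by (simp add: vimage_def Int_def)
    then show ?thesis using W(1) openin_trans by blast
  qed
  then have "open_cspace n ?V"
    using W(1) by (cases "n = 0") (simp, intro openin_Int openin_INT2, auto simp: lessThan_empty_iff)
  moreover have "x \<in> ?V" using W(2) eps by auto
  ultimately have "\<exists>e>0. \<forall>y\<in>cspace n. (\<forall>i<n. cmod (y i - x i) < e) \<longrightarrow> y \<in> ?V"
    by (rule open_cspace_box)
  then obtain e where e0: "e > 0" and e': "\<forall>y\<in>cspace n. (\<forall>i<n. cmod (y i - x i) < e) \<longrightarrow> y \<in> ?V"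
    by (elim exE conjE)
  have e: True "y \<in> ?V" if "y \<in> cspace n" "\<And>i. i < n \<Longrightarrow> cmod (y i - x i) < e" for y
    by simp (rule e'[rule_format, OF that])
  show ?thesis
  \<comment> \<open>Half the radius, because the points on the path from \<open>y\<close> to
    \<open>z\<close> are controlled in real and imaginary parts separately.\<close>
  proof (intro exI[of _ "e/2"] conjI[of "e/2 > 0"] ballI impI)
    show "e/2 > 0" using e0 by simp
    fix y z assume "y \<in> cspace n" "z \<in> cspace n" "\<forall>i<n. cmod (y i - x i) < e/2" "\<forall>i<n. cmod (z i - x i) < e/2"
    then have y: "y \<in> cspace n" "\<And>i. i < n \<Longrightarrow> cmod (y i - x i) < e/2"
      and z: "z \<in> cspace n" "\<And>i. i < n \<Longrightarrow> cmod (z i - x i) < e/2" by auto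
    define m where "m k = (\<lambda>i. if i < k then z i else y i)" for k :: nat
    define L where "L j = Re (z j - y j) * real_partial j 1 F x + Im (z j - y j) * real_partial j \<i> F x" for j
    have mbox: "m k \<in> cspace n" "\<And>i. i < n \<Longrightarrow> cmod (m k i - x i) < e/2" for k
      using y z by (auto simp: m_def cspace_def)
    have step: "cmod (F (m (Suc j)) - F (m j) - L j) \<le> \<epsilon> * cmod (z j - y j)" if j: "j < n" for j
    proof -
      let ?\<Delta> = "z j - y j"
      define m' where "m' = (m j)(j := y j + Re ?\<Delta>)"
      have in1: "(m j)(j := y j + of_real (s * Re ?\<Delta>)) \<in> ?V" if s: "s \<in> {0..1}" for s
      proof (rule e(2))
        show "(m j)(j := y j + of_real (s * Re ?\<Delta>)) \<in> cspace n"
          using mbox(1) j by (rule cspace_upd)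
        fix i assume i: "i < n"
        have "cmod (y j + of_real (s * Re ?\<Delta>) - x j) < e"
          using cmod_close_segment(1)[OF y(2)[OF j] z(2)[OF j] s] y(2)[OF j]
            abs_Im_le_cmod[of "y j - x j"] cmod_le[of "y j + of_real (s * Re ?\<Delta>) - x j"]
          by simp
        then show "cmod (((m j)(j := y j + of_real (s * Re ?\<Delta>))) i - x i) < e"
          using mbox(2)[OF i, of j] e0 by auto
      qed
      have in2: "m'(j := m' j + of_real (s * Im ?\<Delta>) * \<i>) \<in> ?V" if s: "s \<in> {0..1}" for s
      proof (rule e(2))
        show "m'(j := m' j + of_real (s * Im ?\<Delta>) * \<i>) \<in> cspace n"
          unfolding m'_def by (intro cspace_upd mbox(1) j)
        fix i assume i: "i < n"
        have "cmod (y j + Re ?\<Delta> + of_real (s * Im ?\<Delta>) * \<i> - x j) < e"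
          using cmod_close_segment(2)[OF y(2)[OF j] z(2)[OF j] s] z(2)[OF j]
            abs_Re_le_cmod[of "z j - x j"] cmod_le[of "y j + Re ?\<Delta> + of_real (s * Im ?\<Delta>) * \<i> - x j"]
          by simp
        then show "cmod ((m'(j := m' j + of_real (s * Im ?\<Delta>) * \<i>)) i - x i) < e"
          using mbox(2)[OF i, of j] e0 by (auto simp: m'_def)
      qed
      have mj: "m j j = y j" "m' j = y j + Re ?\<Delta>" by (auto simp: m_def m'_def)
      \<comment> \<open>Serves both halves of a step: \<open>w = 1\<close> moves the real part of
        the coordinate, \<open>w = \<i>\<close> the imaginary part.\<close>
      have gen: "cmod (F (b(j := b j + of_real r * w)) - F b - r * real_partial j w F x) \<le> \<bar>r\<bar> * (\<epsilon>/2)"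
        if w: "w \<in> {1, \<i>}" and B: "\<And>s. s \<in> {0..1} \<Longrightarrow> b(j := b j + of_real (s * r) * w) \<in> ?V" for b r w
      proof -
        let ?g = "\<lambda>s. coord_line F j w b (s * r)"
        have "cmod (?g 1 - ?g 0 - r *\<^sub>R real_partial j w F x) \<le> \<bar>r\<bar> * (\<epsilon>/2)"
        proof (rule mvt_bound)
          fix s :: real assume s: "s \<in> {0..1}"
          let ?q = "b(j := b j + of_real (s * r) * w)"
          have q: "?q \<in> W" using B[OF s] by blast
          have "(coord_line F j w b \<circ> (\<lambda>s. s * r) has_vector_derivative r *\<^sub>R real_partial j w F ?q) (at s)"
            by (rule vector_diff_chain_at[where f = "\<lambda>s. s * r" and g = "coord_line F j w b" and x = s and f' = r and g' = "real_partial j w F ?q",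
                OF _ has_vector_derivative_coord_line[OF F q j w]])
              (auto intro!: derivative_eq_intros)
          then show "(?g has_vector_derivative r *\<^sub>R real_partial j w F ?q) (at s)"
            by (simp add: o_def)
          have "cmod (real_partial j w F ?q - real_partial j w F x) < \<epsilon>/2"
            using B[OF s] j w by blast
          then show "cmod (r *\<^sub>R real_partial j w F ?q - r *\<^sub>R real_partial j w F x) \<le> \<bar>r\<bar> * (\<epsilon>/2)"
            unfolding scaleR_diff_right[symmetric] norm_scaleR by (intro mult_left_mono) auto
        qed
        then show ?thesis by (simp add: coord_line_def scaleR_conv_of_real)
      qed
      have 1: "cmod (F m' - F (m j) - Re ?\<Delta> * real_partial j 1 F x) \<le> \<bar>Re ?\<Delta>\<bar> * (\<epsilon>/2)"
        using gen[of 1 "m j" "Re ?\<Delta>"] in1 unfolding m'_def mj by simp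
      have 2: "cmod (F (m'(j := m' j + Im ?\<Delta> * \<i>)) - F m' - Im ?\<Delta> * real_partial j \<i> F x) \<le> \<bar>Im ?\<Delta>\<bar> * (\<epsilon>/2)"
        using gen[of \<i> m' "Im ?\<Delta>"] in2 by simp
      have "y j + Re ?\<Delta> + Im ?\<Delta> * \<i> = z j" by (simp add: complex_eq_iff)
      then have m3: "m'(j := m' j + Im ?\<Delta> * \<i>) = m (Suc j)" unfolding mj
        by (auto simp: m'_def m_def fun_eq_iff less_Suc_eq)
      have "F (m (Suc j)) - F (m j) - L j = (F (m (Suc j)) - F m' - Im ?\<Delta> * real_partial j \<i> F x)
          + (F m' - F (m j) - Re ?\<Delta> * real_partial j 1 F x)" by (simp add: L_def)
      then have "cmod (F (m (Suc j)) - F (m j) - L j) \<le> \<bar>Im ?\<Delta>\<bar> * (\<epsilon>/2) + \<bar>Re ?\<Delta>\<bar> * (\<epsilon>/2)"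
        using 1 2 m3 norm_triangle_mono by metis
      also have "\<dots> \<le> cmod ?\<Delta> * (\<epsilon>/2) + cmod ?\<Delta> * (\<epsilon>/2)"
        using eps by (intro add_mono mult_right_mono abs_Im_le_cmod abs_Re_le_cmod) auto
      finally show ?thesis by (simp add: mult.commute)
    qed
    have ind: "cmod (F (m k) - F (m 0) - (\<Sum>j<k. L j)) \<le> \<epsilon> * (\<Sum>j<k. cmod (z j - y j))" if "k \<le> n" for k
      using that
    proof (induction k)
      case (Suc k)
      have "F (m (Suc k)) - F (m 0) - (\<Sum>j<Suc k. L j) = (F (m k) - F (m 0) - (\<Sum>j<k. L j)) + (F (m (Suc k)) - F (m k) - L k)"
        by simp
      moreover have "cmod (F (m k) - F (m 0) - (\<Sum>j<k. L j)) \<le> \<epsilon> * (\<Sum>j<k. cmod (z j - y j))"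
        "cmod (F (m (Suc k)) - F (m k) - L k) \<le> \<epsilon> * cmod (z k - y k)"
        using Suc step by auto
      ultimately have "cmod (F (m (Suc k)) - F (m 0) - (\<Sum>j<Suc k. L j)) \<le> \<epsilon> * (\<Sum>j<k. cmod (z j - y j)) + \<epsilon> * cmod (z k - y k)"
        using norm_triangle_mono by metis
      then show ?case by (simp add: distrib_left)
    qed simp
    have "m n = z" "m 0 = y" using y(1) z(1) by (auto simp: m_def cspace_def fun_eq_iff)
    moreover have "y \<in> W" using e(2)[of y] y e0 by force
    ultimately show "y \<in> W \<and> cmod (F z - F y - (\<Sum>j<n. Re (z j - y j) * real_partial j 1 F x + Im (z j - y j) * real_partial j \<i> F x))
      \<le> \<epsilon> * (\<Sum>j<n. cmod (z j - y j))" using ind[of n] by (simp add: L_def)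
  qed
qed

text \<open>In the chain rule this turns an error that is small against the increment of the inner
  function into one that is small against \<open>t - t0\<close>.\<close>

lemma has_derivative_bound_ev:
  assumes "(f has_derivative f') (at t0)"
  obtains B where "B > 0" "\<forall>\<^sub>F t in nhds t0. norm (f t - f t0) \<le> B * norm (t - t0)"
proof -
  have bl: "bounded_linear f'" using assms has_derivative_bounded_linear by blast
  then obtain K where K: "K > 0" "\<And>h. norm (f' h) \<le> norm h * K"
    using bounded_linear.pos_bounded by blast
  obtain d where d: "d > 0" "\<And>y. norm (y - t0) < d \<Longrightarrow> norm (f y - f t0 - f' (y - t0)) \<le> 1 * norm (y - t0)"
    using assms unfolding has_derivative_at_alt using zero_less_one by blast
  show ?thesis
  proof (rule that[of "K + 1"])
    show "\<forall>\<^sub>F t in nhds t0. norm (f t - f t0) \<le> (K + 1) * norm (t - t0)"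
      unfolding eventually_nhds_metric
    proof (intro exI conjI allI impI)
      fix y assume "dist y t0 < d"
      then have *: "norm (f y - f t0 - f' (y - t0)) \<le> norm (y - t0)" using d(2)[of y] by (simp add: dist_norm)
      have "norm (f y - f t0) \<le> norm (f y - f t0 - f' (y - t0)) + norm (f' (y - t0))"
        by (metis diff_add_cancel norm_triangle_ineq)
      then show "norm (f y - f t0) \<le> (K + 1) * norm (y - t0)"
        using * K(2)[of "y - t0"] by (simp add: algebra_simps)
    qed (use d in auto)
  qed (use K in auto)
qed

text \<open>\<open>F (Y t)\<close> is split into a remainder \<open>R\<close>, which has derivative
  0 at \<open>t0\<close> by strict differentiability, and a real linear expression in the increments
  of \<open>Y\<close>. The parameter space is left arbitrary, as both complex discs and real lines
  are substituted later.\<close>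

lemma C1_chain_real:
  fixes Y :: "'b::real_normed_vector \<Rightarrow> nat \<Rightarrow> complex"
  assumes W: "open_cspace n W" "Y t0 \<in> W" and F: "C_k (Suc k) n W F"
    and Yc: "\<forall>\<^sub>F t in nhds t0. Y t \<in> cspace n"
    and D: "\<And>j. j < n \<Longrightarrow> ((\<lambda>t. Y t j) has_derivative Y' j) (at t0)"
  shows "((\<lambda>t. F (Y t)) has_derivative (\<lambda>h. \<Sum>j<n. Re (Y' j h) * real_partial j 1 F (Y t0)
            + Im (Y' j h) * real_partial j \<i> F (Y t0))) (at t0)"
proof -
  let ?L = "\<lambda>u. \<Sum>j<n. Re (u j) * real_partial j 1 F (Y t0) + Im (u j) * real_partial j \<i> F (Y t0)"
  define R where "R t = F (Y t) - F (Y t0) - ?L (\<lambda>j. Y t j - Y t0 j)" for t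
  have x: "Y t0 \<in> cspace n" using W open_cspace_subset by blast
  have "\<exists>B>0. \<forall>\<^sub>F t in nhds t0. norm (Y t j - Y t0 j) \<le> B * norm (t - t0)" if "j < n" for j
    using has_derivative_bound_ev[OF D[OF that]] by metis
  then obtain B where B: "\<And>j. j < n \<Longrightarrow> B j > 0"
      "\<And>j. j < n \<Longrightarrow> \<forall>\<^sub>F t in nhds t0. norm (Y t j - Y t0 j) \<le> B j * norm (t - t0)" by metis
  \<comment> \<open>The summand 1 keeps \<open>M\<close> positive for \<open>n = 0\<close>, so that
    one can divide by it.\<close>
  define M where "M = (\<Sum>j<n. B j) + 1"
  have "(\<Sum>j<n. B j) \<ge> 0" using B(1) by (intro sum_nonneg) (auto intro: less_imp_le)
  then have M: "M > 0" by (simp add: M_def)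
  have "(R has_derivative (\<lambda>h. 0)) (at t0)"
    unfolding has_derivative_at_alt
  proof (intro conjI allI impI)
    fix \<epsilon> :: real assume eps: "\<epsilon> > 0"
    have "\<epsilon> / M > 0" using eps M by simp
    from C1_strict[OF W F this] obtain e where e: "e > 0" "\<forall>y\<in>cspace n. \<forall>z\<in>cspace n.
      (\<forall>i<n. cmod (y i - Y t0 i) < e) \<longrightarrow> (\<forall>i<n. cmod (z i - Y t0 i) < e) \<longrightarrow>
      y \<in> W \<and> cmod (F z - F y - ?L (\<lambda>j. z j - y j)) \<le> \<epsilon> / M * (\<Sum>j<n. cmod (z j - y j))"
      by (elim exE conjE)
    have cl: "\<forall>\<^sub>F t in nhds t0. \<forall>j\<in>{..<n}. cmod (Y t j - Y t0 j) < e \<and> norm (Y t j - Y t0 j) \<le> B j * norm (t - t0)"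
    proof (intro eventually_ball_finite ballI)
      fix j assume j: "j \<in> {..<n}"
      then have "((\<lambda>t. Y t j) \<longlongrightarrow> Y t0 j) (nhds t0)"
        using has_derivative_continuous[OF D[of j]] by (simp add: isCont_def tendsto_nhds_iff)
      then have "\<forall>\<^sub>F t in nhds t0. cmod (Y t j - Y t0 j) < e"
        using e(1) by (auto simp: tendsto_iff dist_norm)
      then show "\<forall>\<^sub>F t in nhds t0. cmod (Y t j - Y t0 j) < e \<and> norm (Y t j - Y t0 j) \<le> B j * norm (t - t0)"
        using B(2)[of j] j by (auto elim: eventually_elim2)
    qed auto
    have "\<forall>\<^sub>F t in nhds t0. norm (R t - R t0 - 0) \<le> \<epsilon> * norm (t - t0)"
      using cl Yc
    proof eventually_elim
      case (elim t)
      have "norm (R t) \<le> \<epsilon> / M * (\<Sum>j<n. cmod (Y t j - Y t0 j))"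
        unfolding R_def using e(2)[THEN bspec, OF x, THEN bspec, OF elim(2)] elim(1) e(1) by simp
      also have "\<dots> \<le> \<epsilon> / M * (\<Sum>j<n. B j * norm (t - t0))"
        using elim eps M by (intro mult_left_mono sum_mono) auto
      also have "\<dots> = \<epsilon> / M * ((\<Sum>j<n. B j) * norm (t - t0))" by (simp add: sum_distrib_right)
      also have "\<dots> \<le> \<epsilon> / M * (M * norm (t - t0))"
        using eps M by (intro mult_left_mono mult_right_mono) (auto simp: M_def)
      also have "\<dots> = \<epsilon> * norm (t - t0)" using M by simp
      finally show ?case by (simp add: R_def)
    qed
    then show "\<exists>d>0. \<forall>y. norm (y - t0) < d \<longrightarrow> norm (R y - R t0 - 0) \<le> \<epsilon> * norm (y - t0)"
      unfolding eventually_nhds_metric dist_norm by blast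
  qed (rule bounded_linear_zero)
  moreover have "((\<lambda>t. ?L (\<lambda>j. Y t j - Y t0 j)) has_derivative (\<lambda>h. ?L (\<lambda>j. Y' j h))) (at t0)"
  proof (rule has_derivative_sum)
    fix j assume "j \<in> {..<n}"
    then have d: "((\<lambda>t. Y t j - Y t0 j) has_derivative Y' j) (at t0)"
      using D[of j] by (auto intro!: derivative_eq_intros)
    have "((\<lambda>t. complex_of_real (Re (Y t j - Y t0 j)) * a + complex_of_real (Im (Y t j - Y t0 j)) * b) has_derivative
         (\<lambda>h. complex_of_real (Re (Y' j h)) * a + complex_of_real (Im (Y' j h)) * b)) (at t0)" for a b
      by (intro has_derivative_add has_derivative_mult_left has_derivative_of_real
           bounded_linear.has_derivative[OF bounded_linear_Re d] bounded_linear.has_derivative[OF bounded_linear_Im d])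
    then show "((\<lambda>t. Re (Y t j - Y t0 j) * real_partial j 1 F (Y t0) + Im (Y t j - Y t0 j) * real_partial j \<i> F (Y t0)) has_derivative
         (\<lambda>h. Re (Y' j h) * real_partial j 1 F (Y t0) + Im (Y' j h) * real_partial j \<i> F (Y t0))) (at t0)" .
  qed
  ultimately have "((\<lambda>t. F (Y t0) + (R t + ?L (\<lambda>j. Y t j - Y t0 j))) has_derivative (\<lambda>h. 0 + (0 + ?L (\<lambda>j. Y' j h)))) (at t0)"
    by (rule has_derivative_add[OF has_derivative_const has_derivative_add])
  moreover have "F (Y t0) + (R t + ?L (\<lambda>j. Y t j - Y t0 j)) = F (Y t)" for t
    unfolding R_def by (simp only: diff_add_cancel add.commute[of "F (Y t0)"])
  ultimately show ?thesis by (simp only: add_0_left)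
qed

lemma real_partial_wirtinger:
  "complex_of_real (Re a) * real_partial j 1 F x + complex_of_real (Im a) * real_partial j \<i> F x
    = d_z j F x * a + d_zbar j F x * cnj a"
proof -
  obtain p q where a: "a = complex_of_real p + \<i> * complex_of_real q" using complex_eq by metis
  have "cnj a = complex_of_real p - \<i> * complex_of_real q" "Re a = p" "Im a = q" unfolding a by simp_all
  then show ?thesis unfolding d_z_def d_zbar_def by (simp add: a field_simps)
qed

lemma C1_chain:
  fixes Y :: "'b::real_normed_vector \<Rightarrow> nat \<Rightarrow> complex"
  assumes "open_cspace n W" "Y t0 \<in> W" "C_k (Suc k) n W F"
    and "\<forall>\<^sub>F t in nhds t0. Y t \<in> cspace n"
    and "\<And>j. j < n \<Longrightarrow> ((\<lambda>t. Y t j) has_derivative Y' j) (at t0)"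
  shows "((\<lambda>t. F (Y t)) has_derivative (\<lambda>h. \<Sum>j<n. d_z j F (Y t0) * Y' j h + d_zbar j F (Y t0) * cnj (Y' j h))) (at t0)"
  using C1_chain_real[where Y = Y and ?t0.0 = t0, OF assms] by (simp only: real_partial_wirtinger)

section \<open>Symmetry of mixed partial derivatives\<close>

lemma coord_line_real_diff:
  assumes W: "open_cspace n W" "x \<in> W" and F: "C_k (Suc k) n W F" and "j < n" "w \<in> {1, \<i>}" "\<epsilon> > 0"
  obtains e where "e > 0" "\<And>s t w' i. i < n \<Longrightarrow> w' \<in> {1, \<i>} \<Longrightarrow> \<bar>s\<bar> < e \<Longrightarrow> \<bar>t\<bar> < e \<Longrightarrow>
     x(i := x i + of_real s * w') \<in> W \<and>
     (let b = x(i := x i + of_real s * w') in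
     b(j := b j + of_real t * w) \<in> W \<and>
     cmod (F (b(j := b j + of_real t * w)) - F b - t * real_partial j w F x) \<le> \<epsilon> * \<bar>t\<bar>)"
proof -
  from C1_strict[OF W F \<open>\<epsilon> > 0\<close>] obtain e where e: "e > 0" "\<forall>y\<in>cspace n. \<forall>z\<in>cspace n.
      (\<forall>i<n. cmod (y i - x i) < e) \<longrightarrow> (\<forall>i<n. cmod (z i - x i) < e) \<longrightarrow>
      y \<in> W \<and> cmod (F z - F y - (\<Sum>j<n. Re (z j - y j) * real_partial j 1 F x + Im (z j - y j) * real_partial j \<i> F x))
       \<le> \<epsilon> * (\<Sum>j<n. cmod (z j - y j))" by (elim exE conjE)
  have x: "x \<in> cspace n" using W open_cspace_subset by blast
  show ?thesis
  proof (rule that[of "e/2"])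
    fix s t :: real and w' i assume i: "i < n" and w': "w' \<in> {1, \<i>}" and st: "\<bar>s\<bar> < e/2" "\<bar>t\<bar> < e/2"
    define b where "b = x(i := x i + of_real s * w')"
    define c where "c = b(j := b j + of_real t * w)"
    have bc: "b \<in> cspace n" "c \<in> cspace n" unfolding b_def c_def using x i \<open>j < n\<close> by (auto intro!: cspace_upd)
    have nw: "cmod w = 1" "cmod w' = 1" using w' \<open>w \<in> _\<close> by auto
    have cb: "cmod (b l - x l) \<le> \<bar>s\<bar>" for l using nw by (auto simp: b_def norm_mult)
    have cc: "cmod (c l - b l) \<le> \<bar>t\<bar>" for l using nw by (auto simp: c_def norm_mult)
    have "cmod (b l - x l) < e" "cmod (c l - x l) < e" for l
      using cb[of l] cc[of l] st e(1) norm_triangle_ineq[of "c l - b l" "b l - x l"] by auto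
    with e(2)[THEN bspec, OF bc(1), THEN bspec, OF bc(2)] e(2)[THEN bspec, OF bc(2), THEN bspec, OF bc(1)] have
      1: "b \<in> W" "c \<in> W" "cmod (F c - F b - (\<Sum>l<n. Re (c l - b l) * real_partial l 1 F x + Im (c l - b l) * real_partial l \<i> F x))
       \<le> \<epsilon> * (\<Sum>l<n. cmod (c l - b l))" by auto
    have "(\<Sum>l<n. Re (c l - b l) * real_partial l 1 F x + Im (c l - b l) * real_partial l \<i> F x)
       = (\<Sum>l<n. if l = j then t * real_partial j w F x else 0)"
      using \<open>w \<in> _\<close> by (intro sum.cong) (auto simp: c_def)
    moreover have "(\<Sum>l<n. cmod (c l - b l)) = (\<Sum>l<n. if l = j then \<bar>t\<bar> else 0)"
      using nw by (intro sum.cong) (auto simp: c_def norm_mult)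
    ultimately have "cmod (F c - F b - t * real_partial j w F x) \<le> \<epsilon> * \<bar>t\<bar>"
      using 1(3) \<open>j < n\<close> by simp
    with 1 show "x(i := x i + of_real s * w') \<in> W \<and>
     (let b = x(i := x i + of_real s * w') in
     b(j := b j + of_real t * w) \<in> W \<and>
     cmod (F (b(j := b j + of_real t * w)) - F b - t * real_partial j w F x) \<le> \<epsilon> * \<bar>t\<bar>)"
      unfolding Let_def b_def[symmetric] c_def[symmetric] by blast
  qed (use e in auto)
qed

text \<open>The second difference is the increment in direction \<open>j\<close> of the difference
  between \<open>F\<close> translated in direction \<open>i\<close> and \<open>F\<close> itself. The
  mean value inequality reduces it to values of \<open>real_partial j w F\<close> at two nearby
  points, and strict differentiability of that function compares these.\<close>

lemma second_difference:
  assumes W: "open_cspace n W" "x \<in> W" and F: "C_k (Suc (Suc k)) n W F" and i: "i < n" "w' \<in> {1, \<i>}"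
    and j: "j < n" "w \<in> {1, \<i>}" and eps: "\<epsilon> > 0"
  shows "\<exists>e>0. \<forall>s. \<bar>s\<bar> < e \<longrightarrow>
      cmod (F ((x(i := x i + of_real s * w'))(j := (x(i := x i + of_real s * w')) j + of_real s * w))
        - F (x(i := x i + of_real s * w')) - F (x(j := x j + of_real s * w)) + F x
        - (of_real s)\<^sup>2 * real_partial i w' (real_partial j w F) x) \<le> \<epsilon> * s^2"
proof -
  let ?G = "real_partial j w F"
  have G: "C_k (Suc k) n W ?G" using C1_D(3)[OF F W(2) j] .
  obtain e where e: "e > 0"
    and e2: "\<And>s t w'' j. j < n \<Longrightarrow> w'' \<in> {1, \<i>} \<Longrightarrow> \<bar>s\<bar> < e \<Longrightarrow> \<bar>t\<bar> < e \<Longrightarrow>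
     x(j := x j + of_real s * w'') \<in> W \<and>
     (let b = x(j := x j + of_real s * w'') in
     b(i := b i + of_real t * w') \<in> W \<and>
     cmod (?G (b(i := b i + of_real t * w')) - ?G b - t * real_partial i w' ?G x) \<le> \<epsilon> * \<bar>t\<bar>)"
    by (rule coord_line_real_diff[OF W G i eps]) metis
  note e2 = e2[unfolded Let_def]
  show ?thesis
  proof (intro exI[of _ e] conjI allI impI e)
    fix s assume s: "\<bar>s\<bar> < e"
    define b where "b = x(i := x i + of_real s * w')"
    define c where "c = x(j := x j + of_real s * w)"
    define B where "B u = b(j := b j + of_real u * w)" for u :: real
    define C where "C u = x(j := x j + of_real u * w)" for u :: real
    have sw: "B u = (C u)(i := C u i + of_real s * w')" for u by (auto simp: B_def C_def b_def fun_eq_iff)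
    let ?g = "\<lambda>u. F (B (u * s)) - F (C (u * s))"
    have "cmod (?g 1 - ?g 0 - s *\<^sub>R (s *\<^sub>R real_partial i w' ?G x)) \<le> \<bar>s\<bar> * (\<epsilon> * \<bar>s\<bar>)"
    proof (rule mvt_bound)
      fix u :: real assume u: "u \<in> {0..1}"
      have us: "\<bar>u * s\<bar> < e" using u s by (simp add: abs_mult) (metis abs_ge_zero le_less_trans mult_left_le_one_le)
      from e2[OF j us s] have *: "C (u * s) \<in> W" "B (u * s) \<in> W"
        "cmod (?G (B (u * s)) - ?G (C (u * s)) - s * real_partial i w' ?G x) \<le> \<epsilon> * \<bar>s\<bar>"
        unfolding sw C_def[symmetric] by auto
      have lin: "((\<lambda>u. u * s) has_vector_derivative s) (at u)" by (auto intro!: derivative_eq_intros)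
      have 1: "((\<lambda>u. coord_line F j w b (u * s)) has_vector_derivative s *\<^sub>R ?G (B (u * s))) (at u)"
        using vector_diff_chain_at[where f = "\<lambda>u. u * s" and g = "coord_line F j w b" and x = u and f' = s,
           OF lin has_vector_derivative_coord_line[where x = b and s = "u * s", OF F _ j]] *(2)
        unfolding B_def[symmetric] by (simp add: o_def)
      have 2: "((\<lambda>u. coord_line F j w x (u * s)) has_vector_derivative s *\<^sub>R ?G (C (u * s))) (at u)"
        using vector_diff_chain_at[where f = "\<lambda>u. u * s" and g = "coord_line F j w x" and x = u and f' = s,
           OF lin has_vector_derivative_coord_line[where x = x and s = "u * s", OF F _ j]] *(1)
        unfolding C_def[symmetric] by (simp add: o_def)
      show "(?g has_vector_derivative s *\<^sub>R (?G (B (u * s)) - ?G (C (u * s)))) (at u)"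
        using has_vector_derivative_diff[OF 1 2] by (simp add: coord_line_def B_def C_def scaleR_diff_right)
      show "cmod (s *\<^sub>R (?G (B (u * s)) - ?G (C (u * s))) - s *\<^sub>R (s *\<^sub>R real_partial i w' ?G x)) \<le> \<bar>s\<bar> * (\<epsilon> * \<bar>s\<bar>)"
        using *(3) unfolding scaleR_diff_right[symmetric] norm_scaleR
        by (intro mult_left_mono) (auto simp: scaleR_conv_of_real)
    qed
    moreover have "B 0 = b" "C 0 = x" by (auto simp: B_def C_def)
    moreover have "\<bar>s\<bar> * (\<epsilon> * \<bar>s\<bar>) = \<epsilon> * s^2" by (simp add: power2_eq_square)
    ultimately have "cmod (F (B s) - F (C s) - (F b - F x) - (of_real s)\<^sup>2 * real_partial i w' ?G x) \<le> \<epsilon> * s^2"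
      by (simp add: scaleR_conv_of_real power2_eq_square mult.assoc)
    moreover have "F (B s) - F (C s) - (F b - F x) = F (B s) - F b - F (C s) + F x" by simp
    ultimately show "cmod (F ((x(i := x i + of_real s * w'))(j := (x(i := x i + of_real s * w')) j + of_real s * w))
        - F (x(i := x i + of_real s * w')) - F (x(j := x j + of_real s * w)) + F x
        - (of_real s)\<^sup>2 * real_partial i w' (real_partial j w F) x) \<le> \<epsilon> * s^2"
      unfolding b_def[symmetric] B_def C_def by simp
  qed
qed

text \<open>Exchanging the two directions leaves the second difference unchanged, while
  \<open>second_difference\<close> approximates it by \<open>s\<^sup>2\<close> times either mixed
  derivative.\<close>

lemma real_partial_commute:
  assumes W: "open_cspace n W" "x \<in> W" and F: "C_k (Suc (Suc k)) n W F" and i: "i < n" "w' \<in> {1, \<i>}"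
    and j: "j < n" "w \<in> {1, \<i>}"
  shows "real_partial i w' (real_partial j w F) x = real_partial j w (real_partial i w' F) x"
proof (rule ccontr)
  let ?a = "real_partial i w' (real_partial j w F) x" and ?b = "real_partial j w (real_partial i w' F) x"
  assume ne: "?a \<noteq> ?b"
  \<comment> \<open>The two estimates together give
    \<open>cmod (?a - ?b) \<le> 2 * \<epsilon>\<close>, which a quarter of this distance
    contradicts.\<close>
  define \<epsilon> where "\<epsilon> = cmod (?a - ?b) / 4"
  have eps: "\<epsilon> > 0" using ne by (simp add: \<epsilon>_def)
  obtain e1 where e1: "e1 > 0" "\<forall>s. \<bar>s\<bar> < e1 \<longrightarrow>
      cmod (F ((x(i := x i + of_real s * w'))(j := (x(i := x i + of_real s * w')) j + of_real s * w))
        - F (x(i := x i + of_real s * w')) - F (x(j := x j + of_real s * w)) + F x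
        - (of_real s)\<^sup>2 * ?a) \<le> \<epsilon> * s^2"
    using second_difference[OF W F i j eps] by (elim exE conjE)
  obtain e2 where e2: "e2 > 0" "\<forall>s. \<bar>s\<bar> < e2 \<longrightarrow>
      cmod (F ((x(j := x j + of_real s * w))(i := (x(j := x j + of_real s * w)) i + of_real s * w'))
        - F (x(j := x j + of_real s * w)) - F (x(i := x i + of_real s * w')) + F x
        - (of_real s)\<^sup>2 * ?b) \<le> \<epsilon> * s^2"
    using second_difference[OF W F j i eps] by (elim exE conjE)
  define s where "s = min e1 e2 / 2"
  have s: "s > 0" "\<bar>s\<bar> < e1" "\<bar>s\<bar> < e2" using e1(1) e2(1) by (auto simp: s_def)
  define b where "b = x(i := x i + of_real s * w')"
  define c where "c = x(j := x j + of_real s * w)"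
  define P where "P = F (b(j := b j + of_real s * w)) - F b - F c + F x"
  have "c(i := c i + of_real s * w') = b(j := b j + of_real s * w)" by (auto simp: b_def c_def fun_eq_iff)
  then have A: "cmod (P - (of_real s)\<^sup>2 * ?a) \<le> \<epsilon> * s^2" "cmod (P - (of_real s)\<^sup>2 * ?b) \<le> \<epsilon> * s^2"
    using e1(2)[rule_format, OF s(2)] e2(2)[rule_format, OF s(3)] unfolding b_def[symmetric] c_def[symmetric] P_def
    by (simp_all add: algebra_simps)
  have "s^2 * cmod (?a - ?b) = cmod ((P - (of_real s)\<^sup>2 * ?b) - (P - (of_real s)\<^sup>2 * ?a))"
    by (simp add: norm_mult right_diff_distrib[symmetric] norm_power)
  also have "\<dots> \<le> 2 * \<epsilon> * s^2" using A norm_triangle_ineq4[of "P - (of_real s)\<^sup>2 * ?b" "P - (of_real s)\<^sup>2 * ?a"] by linarith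
  finally have "cmod (?a - ?b) \<le> 2 * \<epsilon>" using s(1) by (simp add: mult.commute)
  then show False using eps unfolding \<epsilon>_def by simp
qed

section \<open>Locality and closure properties of the classes \<open>C_k\<close>\<close>

lemma coord_line_ev_in:
  assumes "open_cspace n W" "x \<in> W" "j < n"
  shows "\<forall>\<^sub>F t in nhds (0::real). x(j := x j + of_real t * w) \<in> W"
proof (rule eventually_in_open_cspace)
  show "open_cspace n W" "x(j := x j + complex_of_real 0 * w) \<in> W" using assms by simp_all
  have "x \<in> cspace n" using assms open_cspace_subset by blast
  then show "\<forall>\<^sub>F t in nhds 0. x(j := x j + complex_of_real t * w) \<in> cspace n"
    using assms(3) by (simp add: cspace_upd)
  show "isCont (\<lambda>t. (x(j := x j + complex_of_real t * w)) i) 0" for i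
    by (cases "i = j") auto
qed

text \<open>A coordinate line through a point of an open set stays in the set for small parameters.
  This permits differentiating formulas that are valid on \<open>W\<close> only.\<close>

lemma coord_line_cong:
  assumes W: "open_cspace n W" "x \<in> W" "j < n" and eq: "\<And>y. y \<in> W \<Longrightarrow> F y = G y"
  shows "(coord_line F j w x has_vector_derivative D) (at 0) \<longleftrightarrow> (coord_line G j w x has_vector_derivative D) (at 0)"
    and "real_partial j w F x = real_partial j w G x"
    and "coord_line F j w x differentiable (at 0) \<longleftrightarrow> coord_line G j w x differentiable (at 0)"
proof -
  have ev: "\<forall>\<^sub>F t in nhds 0. coord_line F j w x t = coord_line G j w x t"
    using coord_line_ev_in[where w = w, OF W] by eventually_elim (simp add: coord_line_def eq)
  have 0: "coord_line F j w x 0 = coord_line G j w x 0" using W(2) by (simp add: coord_line_def eq)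
  show *: "(coord_line F j w x has_vector_derivative D) (at 0) \<longleftrightarrow> (coord_line G j w x has_vector_derivative D) (at 0)" for D
    using ev 0 by (intro has_vector_derivative_cong_ev) auto
  show "real_partial j w F x = real_partial j w G x"
    unfolding real_partial_def vector_derivative_def using * by simp
  show "coord_line F j w x differentiable (at 0) \<longleftrightarrow> coord_line G j w x differentiable (at 0)"
    using * vector_derivative_works differentiableI_vector by blast
qed

lemma C_k_cong:
  assumes W: "open_cspace n W" and "\<And>y. y \<in> W \<Longrightarrow> F y = G y" and "C_k k n W F"
  shows "C_k k n W G"
  using assms(2,3)
proof (induction k arbitrary: F G)
  case 0
  then show ?case by (simp cong: continuous_on_cong)
next
  case (Suc k)
  have "continuous_on W G" using Suc.prems by (simp cong: continuous_on_cong)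
  moreover have "coord_line G j w x differentiable (at 0)" if "j < n" "w \<in> {1, \<i>}" "x \<in> W" for j w x
    using coord_line_cong(3)[where F = F and G = G, OF W that(3,1) Suc.prems(1)] Suc.prems(2) that by auto
  moreover have "C_k k n W (real_partial j w G)" if "j < n" "w \<in> {1, \<i>}" for j w
  proof (rule Suc.IH)
    show "real_partial j w F y = real_partial j w G y" if "y \<in> W" for y
      using coord_line_cong(2)[where F = F and G = G, OF W that \<open>j < n\<close> Suc.prems(1)] by auto
    show "C_k k n W (real_partial j w F)" using Suc.prems(2) that by auto
  qed
  ultimately show ?case by auto
qed

text \<open>The form in which regularity is proved below: formulas for the partial derivatives are
  exhibited, and the formulas are shown to be regular.\<close>

lemma C_k_SucI:
  assumes W: "open_cspace n W" and "continuous_on W F"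
    and D: "\<And>j w x. j < n \<Longrightarrow> w \<in> {1, \<i>} \<Longrightarrow> x \<in> W \<Longrightarrow> (coord_line F j w x has_vector_derivative P j w x) (at 0)"
    and P: "\<And>j w. j < n \<Longrightarrow> w \<in> {1, \<i>} \<Longrightarrow> C_k k n W (P j w)"
  shows "C_k (Suc k) n W F"
proof -
  have "real_partial j w F x = P j w x" if "j < n" "w \<in> {1, \<i>}" "x \<in> W" for j w x
    using D[OF that] by (simp add: real_partial_def vector_derivative_at)
  then have "C_k k n W (real_partial j w F)" if "j < n" "w \<in> {1, \<i>}" for j w
    using that by (intro C_k_cong[OF W _ P]) auto
  moreover have "coord_line F j w x differentiable (at 0)" if "j < n" "w \<in> {1, \<i>}" "x \<in> W" for j w x
    using D[OF that] by (rule differentiableI_vector)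
  ultimately show ?thesis using assms(2) by simp
qed

lemma C_k_decrease: "C_k (Suc k) n W F \<Longrightarrow> C_k k n W F"
proof (induction k arbitrary: F)
  case (Suc k)
  have *: "continuous_on W F" "\<forall>j<n. \<forall>w\<in>{1, \<i>}. (\<forall>x\<in>W. coord_line F j w x differentiable (at 0)) \<and>
        C_k (Suc k) n W (real_partial j w F)"
    using iffD1[OF C_k.simps(2)[of "Suc k"] Suc.prems] by (rule conjunct1, rule conjunct2)
  show ?case unfolding C_k.simps(2)[of k]
  proof (intro conjI allI impI ballI)
    fix j w assume jw: "j < n" "w \<in> {1, \<i>}"
    show "coord_line F j w x differentiable (at 0)" if "x \<in> W" for x
      using conjunct1[OF *(2)[rule_format, OF jw]] that by (rule bspec)
    show "C_k k n W (real_partial j w F)"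
      using *(2)[rule_format, OF jw] by (elim conjE) (rule Suc.IH)
  qed (rule *(1))
qed simp

lemma C1_quotient:
  assumes W: "open_cspace n W" and F: "C_k (Suc 0) n W F" and G: "C_k (Suc 0) n W G" and nz: "\<And>x. x \<in> W \<Longrightarrow> G x \<noteq> 0"
  shows "C_k (Suc 0) n W (\<lambda>x. F x / G x)"
proof (rule C_k_SucI[OF W])
  show "continuous_on W (\<lambda>x. F x / G x)"
    using F G nz by (intro continuous_intros) auto
  fix j w assume jw: "j < n" "w \<in> {1, \<i>}"
  show "(coord_line (\<lambda>x. F x / G x) j w x has_vector_derivative
      (real_partial j w F x * G x - F x * real_partial j w G x) / (G x * G x)) (at 0)" if x: "x \<in> W" for x
  proof -
    have "(inverse \<circ> coord_line G j w x has_vector_derivative real_partial j w G x * - (inverse (G x) * inverse (G x))) (at 0)"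
      using nz[OF x] by (intro field_vector_diff_chain_at[OF C1_D(1)[OF G x jw]])
         (auto simp: coord_line_def power2_eq_square intro!: derivative_eq_intros)
    from has_vector_derivative_mult[OF C1_D(1)[OF F x jw] this] nz[OF x]
    have "((\<lambda>t. coord_line F j w x t * inverse (coord_line G j w x t)) has_vector_derivative
      F x * (real_partial j w G x * - (inverse (G x) * inverse (G x))) + real_partial j w F x * inverse (G x)) (at 0)"
      by (simp add: o_def coord_line_def)
    moreover have "F x * (real_partial j w G x * - (inverse (G x) * inverse (G x))) + real_partial j w F x * inverse (G x)
       = (real_partial j w F x * G x - F x * real_partial j w G x) / (G x * G x)"
      using nz[OF x] by (simp add: field_simps)
    ultimately show ?thesis by (simp add: coord_line_def divide_inverse)
  qed
  show "C_k 0 n W (\<lambda>x. (real_partial j w F x * G x - F x * real_partial j w G x) / (G x * G x))"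
    using F G nz jw by (auto intro!: continuous_intros)
qed

text \<open>The detour through the complex \<open>Ln\<close> makes the complex chain rule available;
  on positive reals it agrees with the real logarithm.\<close>

lemma C2_ln:
  assumes W: "open_cspace n W" and F: "C_k (Suc (Suc 0)) n W (\<lambda>x. of_real (r x))" and pos: "\<And>x. x \<in> W \<Longrightarrow> r x > 0"
  shows "C_k (Suc (Suc 0)) n W (\<lambda>x. of_real (ln (r x)))"
proof -
  let ?F = "\<lambda>x. complex_of_real (r x)"
  have nn: "?F x \<notin> \<real>\<^sub>\<le>\<^sub>0" if "x \<in> W" for x using pos[OF that] by (simp add: complex_nonpos_Reals_iff)
  have "C_k (Suc (Suc 0)) n W (\<lambda>x. Ln (?F x))"
  proof (rule C_k_SucI[OF W])
    show "continuous_on W (\<lambda>x. Ln (?F x))"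
    proof (rule continuous_on_compose2[OF holomorphic_on_imp_continuous_on[OF holomorphic_on_Ln]])
      show "continuous_on W ?F" using C1_D(2)[OF F] F by simp
      show "?F ` W \<subseteq> - \<real>\<^sub>\<le>\<^sub>0" using nn by auto
    qed auto
    fix j w assume jw: "j < n" "w \<in> {1, \<i>}"
    show "(coord_line (\<lambda>x. Ln (?F x)) j w x has_vector_derivative real_partial j w ?F x / ?F x) (at 0)" if x: "x \<in> W" for x
    proof -
      have "(Ln \<circ> coord_line ?F j w x has_vector_derivative real_partial j w ?F x * inverse (?F x)) (at 0)"
        using nn[OF x] by (intro field_vector_diff_chain_at[OF C1_D(1)[OF F x jw]])
           (auto simp: coord_line_def intro!: has_field_derivative_Ln)
      then show ?thesis by (simp add: o_def coord_line_def divide_inverse)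
    qed
    show "C_k (Suc 0) n W (\<lambda>x. real_partial j w ?F x / ?F x)"
    proof (rule C1_quotient[OF W])
      show "C_k (Suc 0) n W (real_partial j w ?F)" using F jw C_k.simps(2)[of "Suc 0" n W ?F] by blast
      show "C_k (Suc 0) n W ?F" by (rule C_k_decrease[OF F])
      show "?F x \<noteq> 0" if "x \<in> W" for x using pos[OF that] by simp
    qed
  qed
  then show ?thesis
    by (rule C_k_cong[OF W, rotated]) (simp add: Ln_of_real pos)
qed

section \<open>Complex differentiability along holomorphic discs\<close>

lemma analytic_at_iff_ev: "g analytic_on {z} \<longleftrightarrow> (\<forall>\<^sub>F t in nhds z. g field_differentiable at t)"
  unfolding analytic_at eventually_nhds holomorphic_on_def
  by (metis at_within_open)

lemma analytic_at_cong_ev: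
  assumes "\<forall>\<^sub>F t in nhds z. f t = g t" "f analytic_on {z}"
  shows "g analytic_on {z}" "deriv g z = deriv f z"
proof -
  show "g analytic_on {z}" using analytic_at_cong[OF assms(1) refl] assms(2) by simp
  show "deriv g z = deriv f z" using deriv_cong_ev[OF assms(1) refl] by simp
qed

lemma analytic_at_has_deriv: "f analytic_on {z} \<Longrightarrow> (f has_field_derivative deriv f z) (at z)"
  by (simp add: analytic_on_imp_differentiable_at field_differentiable_derivI)

text \<open>The germ at 0 of a holomorphic disc in complex \<open>n\<close>-space; everything is
  asked near 0 only, because discs read in a chart make sense only as long as they stay in its
  domain.\<close>

definition adisc :: "nat \<Rightarrow> (complex \<Rightarrow> nat \<Rightarrow> complex) \<Rightarrow> bool" where
  "adisc n Y \<longleftrightarrow> (\<forall>\<^sub>F t in nhds 0. Y t \<in> cspace n) \<and> (\<forall>j<n. (\<lambda>t. Y t j) analytic_on {0})"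

lemma adisc_ev_in:
  assumes "adisc n Y" "open_cspace n W" "Y 0 \<in> W"
  shows "\<forall>\<^sub>F t in nhds 0. Y t \<in> W"
  using assms by (intro eventually_in_open_cspace)
    (auto simp: adisc_def intro: analytic_at_imp_isCont)

lemma adisc_ev_diff:
  assumes "adisc n Y"
  shows "\<forall>\<^sub>F t in nhds 0. \<forall>j\<in>{..<n}. ((\<lambda>t. Y t j) has_field_derivative deriv (\<lambda>t. Y t j) t) (at t)"
proof (intro eventually_ball_finite ballI)
  fix j assume "j \<in> {..<n}"
  then have "\<forall>\<^sub>F t in nhds 0. (\<lambda>t. Y t j) field_differentiable at t"
    using assms by (auto simp: adisc_def analytic_at_iff_ev)
  then show "\<forall>\<^sub>F t in nhds 0. ((\<lambda>t. Y t j) has_field_derivative deriv (\<lambda>t. Y t j) t) (at t)"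
    by eventually_elim (rule field_differentiable_derivI)
qed simp

text \<open>\<open>hdiff n F x D\<close>: the function \<open>F\<close> is complex differentiable along every holomorphic disc through
  \<open>x\<close>, with complex gradient \<open>D\<close>.  Unlike \<open>holo_fn\<close> this notion is obviously stable under
  composition.\<close>

definition hdiff :: "nat \<Rightarrow> ((nat \<Rightarrow> complex) \<Rightarrow> complex) \<Rightarrow> (nat \<Rightarrow> complex) \<Rightarrow> (nat \<Rightarrow> complex) \<Rightarrow> bool" where
  "hdiff n F x D \<longleftrightarrow> (\<forall>Y. adisc n Y \<longrightarrow> Y 0 = x \<longrightarrow> (\<lambda>t. F (Y t)) analytic_on {0} \<and>
     ((\<lambda>t. F (Y t)) has_field_derivative (\<Sum>j<n. D j * deriv (\<lambda>t. Y t j) 0)) (at 0))"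

lemma hdiffD:
  assumes "hdiff n F (Y 0) D" "adisc n Y"
  shows "(\<lambda>t. F (Y t)) analytic_on {0}"
    "((\<lambda>t. F (Y t)) has_field_derivative (\<Sum>j<n. D j * deriv (\<lambda>t. Y t j) 0)) (at 0)"
    "deriv (\<lambda>t. F (Y t)) 0 = (\<Sum>j<n. D j * deriv (\<lambda>t. Y t j) 0)"
  using assms by (auto simp: hdiff_def intro: DERIV_imp_deriv)

text \<open>By the Cauchy-Riemann equations the antilinear part of the chain rule vanishes, and it
  does so at all parameters near 0, which is why the composition is analytic and not merely
  differentiable at 0.\<close>

lemma hdiff_C1:
  assumes W: "open_cspace n W" "x \<in> W" and F: "C_k (Suc k) n W F"
    and CR: "\<And>y j. y \<in> W \<Longrightarrow> j < n \<Longrightarrow> d_zbar j F y = 0"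
  shows "hdiff n F x (\<lambda>j. d_z j F x)"
  unfolding hdiff_def
proof (intro allI impI)
  fix Y assume Y: "adisc n Y" "Y 0 = x"
  have "\<forall>\<^sub>F t in nhds 0. \<forall>\<^sub>F s in nhds t. Y s \<in> cspace n"
    using Y(1) by (simp add: adisc_def eventually_eventually)
  moreover have "\<forall>\<^sub>F t in nhds 0. Y t \<in> W" using adisc_ev_in[OF Y(1) W(1)] Y(2) W(2) by simp
  ultimately have ev: "\<forall>\<^sub>F t in nhds 0. ((\<lambda>t. F (Y t)) has_field_derivative (\<Sum>j<n. d_z j F (Y t) * deriv (\<lambda>t. Y t j) t)) (at t)"
    using adisc_ev_diff[OF Y(1)]
  proof eventually_elim
    case (elim t)
    have "((\<lambda>t. F (Y t)) has_derivative (\<lambda>h. \<Sum>j<n. d_z j F (Y t) * (deriv (\<lambda>t. Y t j) t * h)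
       + d_zbar j F (Y t) * cnj (deriv (\<lambda>t. Y t j) t * h))) (at t)"
      using elim(3) by (intro C1_chain[where Y = Y and ?t0.0 = t and W = W, OF W(1) elim(2) F elim(1)])
        (auto simp: has_field_derivative_def)
    moreover have "(\<lambda>h. \<Sum>j<n. d_z j F (Y t) * (deriv (\<lambda>t. Y t j) t * h)
       + d_zbar j F (Y t) * cnj (deriv (\<lambda>t. Y t j) t * h)) = (*) (\<Sum>j<n. d_z j F (Y t) * deriv (\<lambda>t. Y t j) t)"
      using CR[OF elim(2)] by (auto simp: fun_eq_iff sum_distrib_right mult.assoc)
    ultimately show ?case by (simp add: has_field_derivative_def)
  qed
  have "\<forall>\<^sub>F t in nhds 0. (\<lambda>t. F (Y t)) field_differentiable at t"
    using ev by eventually_elim (auto simp: field_differentiable_def)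
  moreover have "((\<lambda>t. F (Y t)) has_field_derivative (\<Sum>j<n. d_z j F (Y 0) * deriv (\<lambda>t. Y t j) 0)) (at 0)"
    using ev eventually_nhds_x_imp_x[where P = "\<lambda>t. ((\<lambda>t. F (Y t)) has_field_derivative (\<Sum>j<n. d_z j F (Y t) * deriv (\<lambda>t. Y t j) t)) (at t)"]
    by blast
  ultimately show "(\<lambda>t. F (Y t)) analytic_on {0} \<and>
     ((\<lambda>t. F (Y t)) has_field_derivative (\<Sum>j<n. d_z j F x * deriv (\<lambda>t. Y t j) 0)) (at 0)"
    using Y(2) by (simp add: analytic_at_iff_ev)
qed

lemma holo_fn_C_k: "holo_fn n W F \<Longrightarrow> C_k k n W F"
  by (simp add: holo_fn_def smooth_fn_def)

lemma hdiff_holo: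
  assumes "open_cspace n W" "x \<in> W" "holo_fn n W F"
  shows "hdiff n F x (\<lambda>j. d_z j F x)"
  using assms by (intro hdiff_C1[where k = 0]) (auto simp: holo_fn_C_k simp del: C_k.simps, simp add: holo_fn_def)

lemma adisc_line:
  assumes "x \<in> cspace n" "u \<in> cspace n"
  shows "adisc n (\<lambda>t i. x i + t * u i)" "deriv (\<lambda>t. x i + t * u i) 0 = u i"
proof -
  show "adisc n (\<lambda>t i. x i + t * u i)"
    using assms by (auto simp: adisc_def cspace_def intro!: analytic_intros)
  have "((\<lambda>t. x i + t * u i) has_field_derivative u i) (at 0)" by (auto intro!: derivative_eq_intros)
  then show "deriv (\<lambda>t. x i + t * u i) 0 = u i" by (rule DERIV_imp_deriv)
qed

text \<open>The gradient is unique: the disc in the \<open>j\<close>-th coordinate direction shows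
  that the two real partial derivatives are \<open>D j\<close> and
  \<open>\<i> * D j\<close>.\<close>

lemma hdiff_partial:
  assumes "hdiff n F x D" "x \<in> cspace n" "j < n"
  shows "d_z j F x = D j"
proof -
  define u where "u = (\<lambda>i. if i = j then 1 else 0 :: complex)"
  have u: "u \<in> cspace n" using assms(3) by (auto simp: u_def cspace_def)
  define Y where "Y = (\<lambda>t i. x i + t * u i)"
  have Y: "adisc n Y" "\<And>i. deriv (\<lambda>t. Y t i) 0 = u i" "Y 0 = x"
    using adisc_line[OF assms(2) u] by (auto simp: Y_def)
  have "((\<lambda>t. F (Y t)) has_field_derivative (\<Sum>i<n. D i * u i)) (at 0)"
    using hdiffD(2)[of n F Y D] assms(1) Y by simp
  moreover have "(\<Sum>i<n. D i * u i) = (\<Sum>i<n. if i = j then D j else 0)" by (intro sum.cong) (auto simp: u_def)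
  ultimately have d: "((\<lambda>t. F (Y t)) has_field_derivative D j) (at (of_real 0 * w))" for w using assms(3) by simp
  have "real_partial j w F x = w * D j" for w
  proof -
    have "((\<lambda>t. F (Y t)) \<circ> (\<lambda>s. of_real s * w) has_vector_derivative w * D j) (at 0)"
      by (rule field_vector_diff_chain_at[where x = 0 and f = "\<lambda>s. of_real s * w", OF _ d]) (auto intro!: derivative_eq_intros)
    moreover have "(\<lambda>t. F (Y t)) \<circ> (\<lambda>s. of_real s * w) = coord_line F j w x"
      by (auto simp: fun_eq_iff coord_line_def Y_def u_def intro!: arg_cong[where f = F])
    ultimately show ?thesis by (simp add: real_partial_def vector_derivative_at)
  qed
  then show ?thesis by (simp add: d_z_def)
qed

lemma hdiff_const: "hdiff n (\<lambda>x. c) x (\<lambda>j. 0)"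
  by (simp add: hdiff_def)

lemma hdiff_coord:
  assumes "i < n"
  shows "hdiff n (\<lambda>x. x i) x (\<lambda>j. if j = i then 1 else 0)"
proof -
  have "(\<Sum>j<n. (if j = i then 1 else 0) * deriv (\<lambda>t. Y t j) 0) = deriv (\<lambda>t. Y t i) 0" for Y :: "complex \<Rightarrow> nat \<Rightarrow> complex"
    using assms by (simp add: if_distrib[where f = "\<lambda>c. c * _"] cong: if_cong)
  then show ?thesis using assms by (auto simp: hdiff_def adisc_def intro: analytic_at_has_deriv)
qed

lemma hdiff_add:
  assumes "hdiff n F x D" "hdiff n G x E"
  shows "hdiff n (\<lambda>y. F y + G y) x (\<lambda>j. D j + E j)"
  using assms unfolding hdiff_def
  by (auto simp: distrib_right sum.distrib intro!: analytic_on_add DERIV_add)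

lemma hdiff_mult:
  assumes "hdiff n F x D" "hdiff n G x E"
  shows "hdiff n (\<lambda>y. F y * G y) x (\<lambda>j. D j * G x + E j * F x)"
  unfolding hdiff_def
proof (intro allI impI conjI)
  fix Y assume Y: "adisc n Y" "Y 0 = x"
  show "(\<lambda>t. F (Y t) * G (Y t)) analytic_on {0}"
    using assms Y by (auto simp: hdiff_def intro!: analytic_on_mult)
  have "((\<lambda>t. F (Y t) * G (Y t)) has_field_derivative
     (\<Sum>j<n. D j * deriv (\<lambda>t. Y t j) 0) * G (Y 0) + (\<Sum>j<n. E j * deriv (\<lambda>t. Y t j) 0) * F (Y 0)) (at 0)"
    using assms Y by (intro DERIV_mult[where f = "\<lambda>t. F (Y t)" and g = "\<lambda>t. G (Y t)"]) (auto simp: hdiff_def)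
  then show "((\<lambda>t. F (Y t) * G (Y t)) has_field_derivative (\<Sum>j<n. (D j * G x + E j * F x) * deriv (\<lambda>t. Y t j) 0)) (at 0)"
    using Y(2) by (simp add: sum_distrib_left sum.distrib distrib_right distrib_left mult_ac)
qed

lemma hdiff_inverse:
  assumes "hdiff n F x D" "F x \<noteq> 0"
  shows "hdiff n (\<lambda>y. inverse (F y)) x (\<lambda>j. - (D j / (F x)\<^sup>2))"
  unfolding hdiff_def
proof (intro allI impI conjI)
  fix Y assume Y: "adisc n Y" "Y 0 = x"
  show "(\<lambda>t. inverse (F (Y t))) analytic_on {0}"
    using assms Y by (auto simp: hdiff_def intro!: analytic_on_inverse)
  have "((\<lambda>t. inverse (F (Y t))) has_field_derivative
     - ((\<Sum>j<n. D j * deriv (\<lambda>t. Y t j) 0) * inverse (F (Y 0) ^ Suc (Suc 0)))) (at 0)"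
    using assms Y by (intro DERIV_inverse_fun) (auto simp: hdiff_def)
  then show "((\<lambda>t. inverse (F (Y t))) has_field_derivative (\<Sum>j<n. - (D j / (F x)\<^sup>2) * deriv (\<lambda>t. Y t j) 0)) (at 0)"
    using Y(2) by (simp add: sum_distrib_left sum_negf divide_inverse power2_eq_square mult_ac)
qed

lemma hdiff_sum:
  assumes "\<And>i. i \<in> I \<Longrightarrow> \<exists>D. hdiff n (F i) x D"
  shows "\<exists>D. hdiff n (\<lambda>y. \<Sum>i\<in>I. F i y) x D"
  using assms
proof (induction I rule: infinite_finite_induct)
  case (insert i I)
  obtain D where "hdiff n (F i) x D" using insert.prems[of i] by auto
  moreover obtain E where "hdiff n (\<lambda>y. \<Sum>i\<in>I. F i y) x E" using insert.IH insert.prems by auto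
  ultimately have "hdiff n (\<lambda>y. F i y + (\<Sum>i\<in>I. F i y)) x (\<lambda>j. D j + E j)" by (rule hdiff_add)
  then show ?case using insert.hyps by auto
qed (simp_all, (rule exI, rule hdiff_const)+)

lemma adisc_comp:
  assumes "\<And>i. i < n \<Longrightarrow> \<exists>D. hdiff N (\<lambda>X. \<Psi> X i) (Y 0) D" "adisc N Y" "\<And>X. \<Psi> X \<in> cspace n"
  shows "adisc n (\<lambda>t. \<Psi> (Y t))"
  unfolding adisc_def[of n]
proof (intro conjI allI impI)
  fix i assume "i < n"
  from assms(1)[OF this] obtain D where "hdiff N (\<lambda>X. \<Psi> X i) (Y 0) D" ..
  from hdiffD(1)[where F = "\<lambda>X. \<Psi> X i" and Y = Y, OF this assms(2)] show "(\<lambda>t. \<Psi> (Y t) i) analytic_on {0}" .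
qed (use assms(3) in simp)

text \<open>\<open>\<Psi>\<close> carries discs to discs, so a disc for the composition becomes a
  disc for \<open>F\<close>, and its velocity depends linearly on that of the original disc.\<close>

lemma hdiff_comp:
  assumes "\<And>i. i < n \<Longrightarrow> \<exists>D. hdiff N (\<lambda>X. \<Psi> X i) X0 D" "\<And>X. \<Psi> X \<in> cspace n" "hdiff n F (\<Psi> X0) D"
  shows "\<exists>D. hdiff N (\<lambda>X. F (\<Psi> X)) X0 D"
proof -
  define E where "E i = (SOME D. hdiff N (\<lambda>X. \<Psi> X i) X0 D)" for i
  have E: "hdiff N (\<lambda>X. \<Psi> X i) X0 (E i)" if "i < n" for i
    unfolding E_def by (rule someI_ex[OF assms(1)[OF that]])
  have "hdiff N (\<lambda>X. F (\<Psi> X)) X0 (\<lambda>j. \<Sum>i<n. D i * E i j)"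
    unfolding hdiff_def
  proof (intro allI impI)
    fix Y assume Y: "adisc N Y" "Y 0 = X0"
    have a: "adisc n (\<lambda>t. \<Psi> (Y t))"
      by (rule adisc_comp[where \<Psi> = \<Psi> and N = N]) (use assms(1,2) Y in simp_all)
    have d: "deriv (\<lambda>t. \<Psi> (Y t) i) 0 = (\<Sum>j<N. E i j * deriv (\<lambda>t. Y t j) 0)" if "i < n" for i
      using hdiffD(3)[where F = "\<lambda>X. \<Psi> X i" and Y = Y and D = "E i" and n = N] E[OF that] Y by simp
    have "(\<Sum>i<n. D i * (\<Sum>j<N. E i j * deriv (\<lambda>t. Y t j) 0)) = (\<Sum>j<N. (\<Sum>i<n. D i * E i j) * deriv (\<lambda>t. Y t j) 0)"
      by (simp only: sum_distrib_left sum_distrib_right mult.assoc) (rule sum.swap)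
    then show "(\<lambda>t. F (\<Psi> (Y t))) analytic_on {0} \<and>
      ((\<lambda>t. F (\<Psi> (Y t))) has_field_derivative (\<Sum>j<N. (\<Sum>i<n. D i * E i j) * deriv (\<lambda>t. Y t j) 0)) (at 0)"
      using hdiffD(1,2)[where F = F and Y = "\<lambda>t. \<Psi> (Y t)" and D = D and n = n] a assms(3) Y(2) d by simp
  qed
  then show ?thesis by blast
qed

section \<open>Complex derivatives of holomorphic functions\<close>

lemma real_partial_lincomb:
  assumes "C_k (Suc k) n W F" "C_k (Suc k) n W G" "x \<in> W" "j < n" "w \<in> {1, \<i>}"
  shows "(coord_line (\<lambda>y. a * F y + b * G y) j w x has_vector_derivative a * real_partial j w F x + b * real_partial j w G x) (at 0)"
    and "real_partial j w (\<lambda>y. a * F y + b * G y) x = a * real_partial j w F x + b * real_partial j w G x"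
proof -
  show *: "(coord_line (\<lambda>y. a * F y + b * G y) j w x has_vector_derivative a * real_partial j w F x + b * real_partial j w G x) (at 0)"
    using has_vector_derivative_add[OF has_vector_derivative_mult_right[OF C1_D(1)[OF assms(1,3-5)], of a]
        has_vector_derivative_mult_right[OF C1_D(1)[OF assms(2,3-5)], of b]]
    by (simp add: coord_line_def)
  then show "real_partial j w (\<lambda>y. a * F y + b * G y) x = a * real_partial j w F x + b * real_partial j w G x"
    by (simp add: real_partial_def vector_derivative_at)
qed

lemma C1_lincomb:
  assumes W: "open_cspace n W" and F: "C_k (Suc 0) n W F" and G: "C_k (Suc 0) n W G"
  shows "C_k (Suc 0) n W (\<lambda>y. a * F y + b * G y)"
proof (rule C_k_SucI[OF W])
  show "continuous_on W (\<lambda>y. a * F y + b * G y)" using F G by (auto intro!: continuous_intros)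
  fix j w assume jw: "j < n" "w \<in> {1, \<i>}"
  show "(coord_line (\<lambda>y. a * F y + b * G y) j w x has_vector_derivative a * real_partial j w F x + b * real_partial j w G x) (at 0)"
    if "x \<in> W" for x by (rule real_partial_lincomb(1)[OF F G that jw])
  show "C_k 0 n W (\<lambda>x. a * real_partial j w F x + b * real_partial j w G x)"
    using F G jw by (auto intro!: continuous_intros)
qed

lemma d_z_lincomb: "d_z j F = (\<lambda>x. (1/2) * real_partial j 1 F x + (- \<i>/2) * real_partial j \<i> F x)"
  "d_zbar j F = (\<lambda>x. (1/2) * real_partial j 1 F x + (\<i>/2) * real_partial j \<i> F x)"
  by (auto simp: d_z_def d_zbar_def fun_eq_iff field_simps)

lemma C_k_real_partial:
  assumes "C_k (Suc k) n W F" "j < n" "w \<in> {1, \<i>}"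
  shows "C_k k n W (real_partial j w F)"
  using iffD1[OF C_k.simps(2) assms(1)] assms(2,3) by blast

lemma C1_d_z:
  assumes W: "open_cspace n W" and F: "C_k (Suc (Suc 0)) n W F" and j: "j < n"
  shows "C_k (Suc 0) n W (d_z j F)" "C_k (Suc 0) n W (d_zbar j F)"
  unfolding d_z_lincomb by (intro C1_lincomb W C_k_real_partial[OF F j]; simp)+

lemma d_z_d_zbar_commute:
  assumes W: "open_cspace n W" "x \<in> W" and F: "C_k (Suc (Suc 0)) n W F" and ij: "i < n" "j < n"
  shows "d_zbar i (d_z j F) x = d_z j (d_zbar i F) x"
proof -
  have w: "1 \<in> {1, \<i>}" "\<i> \<in> {1, \<i>}" by auto
  note r = C_k_real_partial[OF F _ w(1)] C_k_real_partial[OF F _ w(2)]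
  have dz: "real_partial l w (d_z m F) x = (1/2) * real_partial l w (real_partial m 1 F) x + (- \<i>/2) * real_partial l w (real_partial m \<i> F) x"
    "real_partial l w (d_zbar m F) x = (1/2) * real_partial l w (real_partial m 1 F) x + (\<i>/2) * real_partial l w (real_partial m \<i> F) x"
    if "l < n" "m < n" "w \<in> {1, \<i>}" for l m w
    unfolding d_z_lincomb by (rule real_partial_lincomb(2)[OF r(1)[OF that(2)] r(2)[OF that(2)] W(2) that(1,3)])+
  note c = real_partial_commute[OF W F ij(1) _ ij(2)]
  show ?thesis
    unfolding d_z_def[of j "d_zbar i F"] d_zbar_def[of i "d_z j F"] dz[OF ij w(1)] dz[OF ij w(2)]
      dz[OF ij(2,1) w(1)] dz[OF ij(2,1) w(2)] c[OF w(1) w(1)] c[OF w(1) w(2)] c[OF w(2) w(1)] c[OF w(2) w(2)]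
    by (simp add: field_simps)
qed

text \<open>The Cauchy-Riemann equations may be differentiated, since \<open>d_zbar i\<close> and
  \<open>d_z j\<close> commute. This is what makes the components of a differential, and the
  transition functions of a projectivised bundle, holomorphic.\<close>

lemma hdiff_d_z:
  assumes W: "open_cspace n W" "x \<in> W" and F: "holo_fn n W F" and j: "j < n"
  shows "\<exists>D. hdiff n (d_z j F) x D"
proof -
  note F2 = holo_fn_C_k[OF F, of "Suc (Suc 0)"]
  have "hdiff n (d_z j F) x (\<lambda>i. d_z i (d_z j F) x)"
  proof (rule hdiff_C1[OF W C1_d_z(1)[OF W(1) F2 j]])
    fix y i assume y: "y \<in> W" and i: "i < n"
    have "d_zbar i F z = 0" if "z \<in> W" for z using F i that by (simp add: holo_fn_def)
    then have "real_partial j w (d_zbar i F) y = real_partial j w (\<lambda>z. 0) y" for w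
      by (intro coord_line_cong(2)[OF W(1) y j]) auto
    moreover have "real_partial j w (\<lambda>z. 0) y = 0" for w by (simp add: real_partial_def coord_line_def)
    ultimately have "d_z j (d_zbar i F) y = 0" by (simp add: d_z_def)
    then show "d_zbar i (d_z j F) y = 0" using d_z_d_zbar_commute[OF W(1) y F2 i j] by simp
  qed
  then show ?thesis by blast
qed

section \<open>The Laplacian along a holomorphic disc\<close>

text \<open>\<open>has_lap \<phi> L\<close>: at 0 the sum of the second derivatives of \<open>\<phi>\<close> along the two coordinate axes is \<open>L\<close>.\<close>

definition has_lap :: "(complex \<Rightarrow> complex) \<Rightarrow> complex \<Rightarrow> bool" where
  "has_lap \<phi> L \<longleftrightarrow> (\<exists>p q. (\<forall>w\<in>{1, \<i>}.
     (\<forall>\<^sub>F s in nhds 0. ((\<lambda>s. \<phi> (of_real s * w)) has_vector_derivative p w s) (at s)) \<and>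
     (p w has_vector_derivative q w) (at 0)) \<and> L = q 1 + q \<i>)"

lemma has_lapI:
  assumes "\<And>w. w \<in> {1, \<i>} \<Longrightarrow> \<forall>\<^sub>F s in nhds 0. ((\<lambda>s. \<phi> (of_real s * w)) has_vector_derivative p w s) (at s)"
    and "\<And>w. w \<in> {1, \<i>} \<Longrightarrow> (p w has_vector_derivative q w) (at 0)" and "L = q 1 + q \<i>"
  shows "has_lap \<phi> L"
  unfolding has_lap_def using assms by (intro exI[of _ p] exI[of _ q]) blast

lemma has_lapE:
  assumes "has_lap \<phi> L"
  obtains p q where "\<And>w. w \<in> {1, \<i>} \<Longrightarrow> \<forall>\<^sub>F s in nhds 0. ((\<lambda>s. \<phi> (of_real s * w)) has_vector_derivative p w s) (at s)"
    "\<And>w. w \<in> {1, \<i>} \<Longrightarrow> (p w has_vector_derivative q w) (at 0)" "L = q 1 + q \<i>"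
proof -
  obtain p q where h: "\<forall>w\<in>{1, \<i>}.
     (\<forall>\<^sub>F s in nhds 0. ((\<lambda>s. \<phi> (of_real s * w)) has_vector_derivative p w s) (at s)) \<and>
     (p w has_vector_derivative q w) (at 0)" "L = q 1 + q \<i>"
    using assms unfolding has_lap_def by (elim exE conjE)
  show ?thesis by (rule that[of p q]) (use h in auto)
qed

lemma has_lap_lincomb:
  assumes "has_lap \<phi> L" "has_lap \<psi> K"
  shows "has_lap (\<lambda>t. a * \<phi> t + b * \<psi> t) (a * L + b * K)"
proof (rule has_lapE[OF assms(1)], rule has_lapE[OF assms(2)])
  fix p q p' q'
  assume 1: "\<And>w. w \<in> {1, \<i>} \<Longrightarrow> \<forall>\<^sub>F s in nhds 0. ((\<lambda>s. \<phi> (of_real s * w)) has_vector_derivative p w s) (at s)"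
      "\<And>w. w \<in> {1, \<i>} \<Longrightarrow> (p w has_vector_derivative q w) (at 0)" "L = q 1 + q \<i>"
    and 2: "\<And>w. w \<in> {1, \<i>} \<Longrightarrow> \<forall>\<^sub>F s in nhds 0. ((\<lambda>s. \<psi> (of_real s * w)) has_vector_derivative p' w s) (at s)"
      "\<And>w. w \<in> {1, \<i>} \<Longrightarrow> (p' w has_vector_derivative q' w) (at 0)" "K = q' 1 + q' \<i>"
  show ?thesis
  proof (rule has_lapI[where p = "\<lambda>w s. a * p w s + b * p' w s" and q = "\<lambda>w. a * q w + b * q' w"])
    fix w assume w: "w \<in> {1, \<i>}"
    show "\<forall>\<^sub>F s in nhds 0. ((\<lambda>s. a * \<phi> (of_real s * w) + b * \<psi> (of_real s * w)) has_vector_derivative a * p w s + b * p' w s) (at s)"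
      using 1(1)[OF w] 2(1)[OF w]
      by eventually_elim (intro has_vector_derivative_add has_vector_derivative_mult_right)
    show "((\<lambda>s. a * p w s + b * p' w s) has_vector_derivative a * q w + b * q' w) (at 0)"
      by (intro has_vector_derivative_add has_vector_derivative_mult_right 1(2)[OF w] 2(2)[OF w])
  qed (simp add: 1(3) 2(3) algebra_simps)
qed

lemma has_lap_const: "has_lap (\<lambda>t. c) 0"
  by (rule has_lapI[where p = "\<lambda>w s. 0" and q = "\<lambda>w. 0"]) auto

lemma has_lap_cmult: "has_lap \<phi> L \<Longrightarrow> has_lap (\<lambda>t. a * \<phi> t) (a * L)"
  using has_lap_lincomb[OF _ has_lap_const, of \<phi> L a 0 0] by simp

lemma has_lap_add: "has_lap \<phi> L \<Longrightarrow> has_lap \<psi> K \<Longrightarrow> has_lap (\<lambda>t. \<phi> t + \<psi> t) (L + K)"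
  using has_lap_lincomb[of \<phi> L \<psi> K 1 1] by simp

lemma has_lap_sum:
  assumes "\<And>i. i \<in> I \<Longrightarrow> has_lap (\<phi> i) (L i)"
  shows "has_lap (\<lambda>t. \<Sum>i\<in>I. \<phi> i t) (\<Sum>i\<in>I. L i)"
  using assms
proof (induction I rule: infinite_finite_induct)
  case (insert i I)
  have "has_lap (\<lambda>t. \<phi> i t + (\<Sum>i\<in>I. \<phi> i t)) (L i + (\<Sum>i\<in>I. L i))"
    by (rule has_lap_add) (use insert in auto)
  then show ?case using insert.hyps by simp
qed (simp_all add: has_lap_const)

lemma tendsto_line: "((\<lambda>s. complex_of_real s * w) \<longlongrightarrow> 0) (nhds 0)"
proof -
  have "isCont (\<lambda>s. complex_of_real s * w) 0" by (intro continuous_intros)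
  then show ?thesis by (simp add: isCont_def tendsto_nhds_iff)
qed

lemma eventually_line:
  assumes "\<forall>\<^sub>F t in nhds 0. P t"
  shows "\<forall>\<^sub>F s in nhds 0. P (complex_of_real s * w)"
  using tendsto_line[of w] assms unfolding filterlim_iff by blast

text \<open>The first derivatives are taken at nearby parameters too, so agreement on a
  neighbourhood of 0 is passed on to neighbourhoods of those.\<close>

lemma has_lap_cong_ev:
  assumes ev: "\<forall>\<^sub>F t in nhds 0. \<phi> t = \<psi> t" and L: "has_lap \<phi> L"
  shows "has_lap \<psi> L"
proof (rule has_lapE[OF L])
  fix p q
  assume 1: "\<And>w. w \<in> {1, \<i>} \<Longrightarrow> \<forall>\<^sub>F s in nhds 0. ((\<lambda>s. \<phi> (of_real s * w)) has_vector_derivative p w s) (at s)"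
      "\<And>w. w \<in> {1, \<i>} \<Longrightarrow> (p w has_vector_derivative q w) (at 0)" "L = q 1 + q \<i>"
  show ?thesis
  proof (rule has_lapI[OF _ 1(2,3)])
    fix w :: complex assume w: "w \<in> {1, \<i>}"
    have "\<forall>\<^sub>F s in nhds 0. \<phi> (of_real s * w) = \<psi> (of_real s * w)"
      using eventually_line[where P = "\<lambda>t. \<phi> t = \<psi> t", OF ev] .
    then have "\<forall>\<^sub>F s in nhds 0. \<forall>\<^sub>F s' in nhds s. \<phi> (of_real s' * w) = \<psi> (of_real s' * w)"
      by (simp add: eventually_eventually)
    with 1(1)[OF w] show "\<forall>\<^sub>F s in nhds 0. ((\<lambda>s. \<psi> (of_real s * w)) has_vector_derivative p w s) (at s)"
    proof eventually_elim
      case (elim s)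
      have "\<phi> (of_real s * w) = \<psi> (of_real s * w)"
        using eventually_nhds_x_imp_x[where P = "\<lambda>s'. \<phi> (of_real s' * w) = \<psi> (of_real s' * w)", OF elim(2)] .
      then have "((\<lambda>s. \<phi> (of_real s * w)) has_vector_derivative p w s) (at s) \<longleftrightarrow> ((\<lambda>s. \<psi> (of_real s * w)) has_vector_derivative p w s) (at s)"
        using elim(2) by (intro has_vector_derivative_cong_ev) (auto elim: eventually_mono)
      then show ?case using elim(1) by blast
    qed
  qed
qed

lemma vector_derivative_line:
  assumes "(b has_field_derivative b') (at (of_real s * w))"
  shows "((\<lambda>s. b (of_real s * w)) has_vector_derivative w * b') (at s)"
proof -
  have "(b \<circ> (\<lambda>s. of_real s * w) has_vector_derivative w * b') (at s)"
    by (rule field_vector_diff_chain_at[where f = "\<lambda>s. of_real s * w" and x = s, OF _ assms])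
      (auto intro!: derivative_eq_intros)
  then show ?thesis by (simp add: o_def)
qed

lemma analytic_line:
  assumes "b analytic_on {0}"
  shows "\<forall>\<^sub>F s in nhds 0. ((\<lambda>s. b (of_real s * w)) has_vector_derivative w * deriv b (of_real s * w)) (at s)"
    "((\<lambda>s. deriv b (of_real s * w)) has_vector_derivative w * deriv (deriv b) 0) (at 0)"
proof -
  have "\<forall>\<^sub>F t in nhds 0. b field_differentiable at t" using assms by (simp add: analytic_at_iff_ev)
  then have "\<forall>\<^sub>F s in nhds 0. b field_differentiable at (of_real s * w)"
    by (rule eventually_line[where P = "\<lambda>t. b field_differentiable at t"])
  then show "\<forall>\<^sub>F s in nhds 0. ((\<lambda>s. b (of_real s * w)) has_vector_derivative w * deriv b (of_real s * w)) (at s)"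
    by eventually_elim (rule vector_derivative_line, rule field_differentiable_derivI)
  have "deriv b analytic_on {0}" using assms by (rule analytic_deriv)
  then show "((\<lambda>s. deriv b (of_real s * w)) has_vector_derivative w * deriv (deriv b) 0) (at 0)"
    by (intro vector_derivative_line) (simp add: analytic_at_has_deriv)
qed

text \<open>The second derivative of \<open>b\<close> enters with the factor
  \<open>w\<^sup>2\<close> or its conjugate, and these cancel between 1 and \<i>. In the product
  each axis contributes twice the squared modulus of the first derivative.\<close>

lemma has_lap_analytic:
  assumes "b analytic_on {0}"
  shows "has_lap b 0" "has_lap (\<lambda>t. cnj (b t)) 0"
    "has_lap (\<lambda>t. b t * cnj (b t)) (4 * (deriv b 0 * cnj (deriv b 0)))"
proof -
  note l = analytic_line[OF assms]
  have ll: "((\<lambda>s. w * deriv b (of_real s * w)) has_vector_derivative w * (w * deriv (deriv b) 0)) (at 0)" for w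
    by (rule has_vector_derivative_mult_right[OF l(2)])
  show "has_lap b 0"
    by (rule has_lapI[where p = "\<lambda>w s. w * deriv b (of_real s * w)" and q = "\<lambda>w. w * (w * deriv (deriv b) 0)"])
      (use l(1) ll in auto)
  show "has_lap (\<lambda>t. cnj (b t)) 0"
  proof (rule has_lapI[where p = "\<lambda>w s. cnj (w * deriv b (of_real s * w))" and q = "\<lambda>w. cnj (w * (w * deriv (deriv b) 0))"])
    show "\<forall>\<^sub>F s in nhds 0. ((\<lambda>s. cnj (b (complex_of_real s * w))) has_vector_derivative cnj (w * deriv b (complex_of_real s * w))) (at s)" for w
      using l(1)[of w] by eventually_elim (rule has_vector_derivative_cnj)
    show "((\<lambda>s. cnj (w * deriv b (complex_of_real s * w))) has_vector_derivative cnj (w * (w * deriv (deriv b) 0))) (at 0)" for w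
      by (rule has_vector_derivative_cnj[OF ll])
  qed simp
  show "has_lap (\<lambda>t. b t * cnj (b t)) (4 * (deriv b 0 * cnj (deriv b 0)))"
  proof (rule has_lapI[where p = "\<lambda>w s. b (of_real s * w) * cnj (w * deriv b (of_real s * w)) + w * deriv b (of_real s * w) * cnj (b (of_real s * w))"
       and q = "\<lambda>w. (b 0 * cnj (w * (w * deriv (deriv b) 0)) + w * deriv b 0 * cnj (w * deriv b 0))
         + (w * deriv b 0 * cnj (w * deriv b 0) + w * (w * deriv (deriv b) 0) * cnj (b 0))"])
    show "\<forall>\<^sub>F s in nhds 0. ((\<lambda>s. b (of_real s * w) * cnj (b (of_real s * w))) has_vector_derivative
       b (of_real s * w) * cnj (w * deriv b (of_real s * w)) + w * deriv b (of_real s * w) * cnj (b (of_real s * w))) (at s)" for w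
      using l(1)[of w] by eventually_elim (intro has_vector_derivative_mult has_vector_derivative_cnj)
    fix w
    have b0: "((\<lambda>s. b (of_real s * w)) has_vector_derivative w * deriv b 0) (at 0)"
      using eventually_nhds_x_imp_x[where P = "\<lambda>s. ((\<lambda>s. b (of_real s * w)) has_vector_derivative w * deriv b (of_real s * w)) (at s)", OF l(1)] by simp
    show "((\<lambda>s. b (of_real s * w) * cnj (w * deriv b (of_real s * w)) + w * deriv b (of_real s * w) * cnj (b (of_real s * w))) has_vector_derivative
       (b 0 * cnj (w * (w * deriv (deriv b) 0)) + w * deriv b 0 * cnj (w * deriv b 0))
         + (w * deriv b 0 * cnj (w * deriv b 0) + w * (w * deriv (deriv b) 0) * cnj (b 0))) (at 0)"
      using has_vector_derivative_add[OF has_vector_derivative_mult[OF b0 has_vector_derivative_cnj[OF ll[of w]]]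
        has_vector_derivative_mult[OF ll[of w] has_vector_derivative_cnj[OF b0]]] by simp
  qed (simp add: algebra_simps)
qed

text \<open>Near 0 the quotient \<open>g t / g 0\<close> stays close to 1, so it has a holomorphic
  logarithm \<open>b\<close>, and the function in question is a constant plus
  \<open>b + cnj b\<close>.\<close>

lemma has_lap_ln_norm:
  assumes "g analytic_on {0}" "g 0 \<noteq> 0"
  shows "has_lap (\<lambda>t. of_real (ln ((cmod (g t))\<^sup>2))) 0"
proof -
  define b where "b = (\<lambda>t. Ln (g t / g 0))"
  have an: "(\<lambda>t. g t / g 0) analytic_on {0}" using assms by (auto intro!: analytic_intros)
  have b: "b analytic_on {0}" unfolding b_def using assms by (intro analytic_on_ln an) auto
  have "isCont (\<lambda>t. g t / g 0) 0" using an by (rule analytic_at_imp_isCont)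
  then have "((\<lambda>t. g t / g 0) \<longlongrightarrow> g 0 / g 0) (nhds 0)" by (simp add: isCont_def tendsto_nhds_iff)
  then have "\<forall>\<^sub>F t in nhds 0. dist (g t / g 0) 1 < 1" using assms(2) by (auto simp: tendsto_iff)
  then have ev: "\<forall>\<^sub>F t in nhds 0. of_real (ln ((cmod (g 0))\<^sup>2)) + (b t + cnj (b t)) = of_real (ln ((cmod (g t))\<^sup>2))"
  proof eventually_elim
    case (elim t)
    then have nz: "g t / g 0 \<noteq> 0" by (auto simp: dist_norm)
    have "b t + cnj (b t) = of_real (2 * Re (b t))" by (simp add: complex_add_cnj)
    also have "Re (b t) = ln (cmod (g t)) - ln (cmod (g 0))"
      using nz by (simp add: b_def norm_divide ln_div)
    finally show ?case using nz by (simp add: ln_realpow algebra_simps)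
  qed
  have "has_lap (\<lambda>t. of_real (ln ((cmod (g 0))\<^sup>2)) + (b t + cnj (b t))) (0 + (0 + 0))"
    by (intro has_lap_add has_lap_const has_lap_analytic b)
  from has_lap_cong_ev[OF ev this] show ?thesis by simp
qed

text \<open>The unmixed second derivatives of \<open>F\<close> and the second derivatives of
  \<open>Y\<close> carry the factor \<open>w\<^sup>2\<close> or its conjugate and cancel between the
  two axes. The mixed derivatives carry \<open>w * cnj w = 1\<close> and occur twice on each axis,
  whence the factor 4.\<close>

lemma has_lap_comp:
  assumes W: "open_cspace n W" "Y 0 \<in> W" and F: "C_k (Suc (Suc 0)) n W F" and Y: "adisc n Y"
  shows "has_lap (\<lambda>t. F (Y t)) (4 * levi n F (Y 0) (\<lambda>j. deriv (\<lambda>t. Y t j) 0))"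
proof -
  define a where "a j = deriv (\<lambda>t. Y t j)" for j
  have an: "(\<lambda>t. Y t j) analytic_on {0}" if "j < n" for j using Y that by (simp add: adisc_def)
  have line: "\<forall>\<^sub>F s in nhds 0. Y (of_real s * w) \<in> W \<and> (\<forall>\<^sub>F s' in nhds s. Y (of_real s' * w) \<in> cspace n) \<and>
      (\<forall>j\<in>{..<n}. ((\<lambda>s. Y (of_real s * w) j) has_vector_derivative w * a j (of_real s * w)) (at s))" for w
  proof (intro eventually_conj)
    show "\<forall>\<^sub>F s in nhds 0. Y (of_real s * w) \<in> W"
      by (rule eventually_line[where P = "\<lambda>t. Y t \<in> W", OF adisc_ev_in[OF Y W]])
    have "\<forall>\<^sub>F t in nhds 0. Y t \<in> cspace n" using Y by (simp add: adisc_def)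
    from eventually_line[where P = "\<lambda>t. Y t \<in> cspace n", OF this]
    show "\<forall>\<^sub>F s in nhds 0. \<forall>\<^sub>F s' in nhds s. Y (of_real s' * w) \<in> cspace n"
      by (simp add: eventually_eventually)
    show "\<forall>\<^sub>F s in nhds 0. \<forall>j\<in>{..<n}. ((\<lambda>s. Y (of_real s * w) j) has_vector_derivative w * a j (of_real s * w)) (at s)"
      unfolding a_def using analytic_line(1)[OF an] by (intro eventually_ball_finite ballI) auto
  qed
  have chain: "((\<lambda>s. G (Y (of_real s * w))) has_vector_derivative
       (\<Sum>j<n. d_z j G (Y (of_real s * w)) * (w * a j (of_real s * w)) + d_zbar j G (Y (of_real s * w)) * cnj (w * a j (of_real s * w)))) (at s)"
    if G: "C_k (Suc k) n W G" and s: "Y (of_real s * w) \<in> W" "\<forall>\<^sub>F s' in nhds s. Y (of_real s' * w) \<in> cspace n"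
      "\<forall>j\<in>{..<n}. ((\<lambda>s. Y (of_real s * w) j) has_vector_derivative w * a j (of_real s * w)) (at s)" for G k s w
  proof -
    have "((\<lambda>s. G (Y (of_real s * w))) has_derivative (\<lambda>h. \<Sum>j<n. d_z j G (Y (of_real s * w)) * (h *\<^sub>R (w * a j (of_real s * w)))
        + d_zbar j G (Y (of_real s * w)) * cnj (h *\<^sub>R (w * a j (of_real s * w))))) (at s)"
      using s(3) by (intro C1_chain[where Y = "\<lambda>s. Y (of_real s * w)" and ?t0.0 = s, OF W(1) s(1) G s(2)])
        (auto simp: has_vector_derivative_def)
    then show ?thesis unfolding has_vector_derivative_def
      by (simp add: scaleR_sum_right scaleR_add_right)
  qed
  have l0: "Y (of_real 0 * w) \<in> W" "\<forall>\<^sub>F s' in nhds 0. Y (of_real s' * w) \<in> cspace n"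
      "\<forall>j\<in>{..<n}. ((\<lambda>s. Y (of_real s * w) j) has_vector_derivative w * a j (of_real 0 * w)) (at 0)" for w
    using eventually_nhds_x_imp_x[where P = "\<lambda>s. Y (of_real s * w) \<in> W \<and> (\<forall>\<^sub>F s' in nhds s. Y (of_real s' * w) \<in> cspace n) \<and>
      (\<forall>j\<in>{..<n}. ((\<lambda>s. Y (of_real s * w) j) has_vector_derivative w * a j (of_real s * w)) (at s))", OF line] by blast+
  define u where "u j = a j 0" for j
  have ueq: "(\<lambda>j. deriv (\<lambda>t. Y t j) 0) = u" by (simp add: u_def a_def fun_eq_iff)
  define c where "c j = deriv (a j) 0" for j
  define zz where "zz j = (\<Sum>i<n. d_z i (d_z j F) (Y 0) * u i)" for j
  define bz where "bz j = (\<Sum>i<n. d_zbar i (d_z j F) (Y 0) * cnj (u i))" for j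
  define zb where "zb j = (\<Sum>i<n. d_z i (d_zbar j F) (Y 0) * u i)" for j
  define bb where "bb j = (\<Sum>i<n. d_zbar i (d_zbar j F) (Y 0) * cnj (u i))" for j
  have D1: "((\<lambda>s. d_z j F (Y (of_real s * w))) has_vector_derivative w * zz j + cnj w * bz j) (at 0)"
    "((\<lambda>s. d_zbar j F (Y (of_real s * w))) has_vector_derivative w * zb j + cnj w * bb j) (at 0)" if j: "j < n" for j w
    using chain[OF C1_d_z(1)[OF W(1) F j] l0] chain[OF C1_d_z(2)[OF W(1) F j] l0]
    by (simp_all add: zz_def bz_def zb_def bb_def u_def sum.distrib sum_distrib_left mult_ac)
  have D2: "((\<lambda>s. w * a j (of_real s * w)) has_vector_derivative w * (w * c j)) (at 0)" if "j < n" for j w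
    unfolding a_def c_def by (intro has_vector_derivative_mult_right analytic_line(2)[OF an[OF that]])
  let ?q = "\<lambda>w. \<Sum>j<n. (d_z j F (Y 0) * (w * (w * c j)) + (w * zz j + cnj w * bz j) * (w * u j))
        + (d_zbar j F (Y 0) * cnj (w * (w * c j)) + (w * zb j + cnj w * bb j) * cnj (w * u j))"
  show ?thesis
  proof (rule has_lapI[where p = "\<lambda>w s. \<Sum>j<n. d_z j F (Y (of_real s * w)) * (w * a j (of_real s * w)) + d_zbar j F (Y (of_real s * w)) * cnj (w * a j (of_real s * w))"
        and q = ?q])
    fix w
    show "\<forall>\<^sub>F s in nhds 0. ((\<lambda>s. F (Y (of_real s * w))) has_vector_derivative
       (\<Sum>j<n. d_z j F (Y (of_real s * w)) * (w * a j (of_real s * w)) + d_zbar j F (Y (of_real s * w)) * cnj (w * a j (of_real s * w)))) (at s)"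
      using line[of w] by eventually_elim (rule chain[OF F], blast+)
    show "((\<lambda>s. \<Sum>j<n. d_z j F (Y (of_real s * w)) * (w * a j (of_real s * w)) + d_zbar j F (Y (of_real s * w)) * cnj (w * a j (of_real s * w)))
      has_vector_derivative ?q w) (at 0)"
    proof (rule has_vector_derivative_sum, goal_cases)
      case (1 j)
      then have j: "j < n" by simp
      show ?case
        using has_vector_derivative_add[OF has_vector_derivative_mult[OF D1(1)[OF j] D2[OF j]]
            has_vector_derivative_mult[OF D1(2)[OF j] has_vector_derivative_cnj[OF D2[OF j]]], of w w w w] by (simp add: u_def)
    qed
  next
    have "?q 1 + ?q \<i> = (\<Sum>j<n. 2 * (bz j * u j) + 2 * (zb j * cnj (u j)))"
      by (simp add: sum.distrib[symmetric] algebra_simps)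
    also have "\<dots> = 2 * (\<Sum>j<n. bz j * u j) + 2 * (\<Sum>j<n. zb j * cnj (u j))"
      by (simp add: sum.distrib sum_distrib_left)
    also have "(\<Sum>j<n. zb j * cnj (u j)) = levi n F (Y 0) u"
      unfolding levi_def zb_def sum_distrib_right by (subst sum.swap) simp
    also have "(\<Sum>j<n. bz j * u j) = levi n F (Y 0) u"
      unfolding levi_def bz_def sum_distrib_right
      by (intro sum.cong refl) (simp add: d_z_d_zbar_commute[OF W F] mult_ac)
    finally show "4 * levi n F (Y 0) (\<lambda>j. deriv (\<lambda>t. Y t j) 0) = ?q 1 + ?q \<i>"
      by (simp add: ueq)
  qed
qed

text \<open>Otherwise \<open>p\<close> would vanish at 0 and be positive just to the right of it,
  and by the mean value theorem \<open>r\<close> would exceed \<open>r 0\<close> there.\<close>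

lemma second_derivative_le_0:
  fixes r :: "real \<Rightarrow> real"
  assumes r: "\<forall>\<^sub>F s in nhds 0. (r has_real_derivative p s) (at s)" and p: "(p has_real_derivative q) (at 0)"
    and max: "\<forall>\<^sub>F s in nhds 0. r s \<le> r 0"
  shows "q \<le> 0"
proof (rule ccontr)
  assume "\<not> q \<le> 0"
  then have q: "q > 0" by simp
  obtain d where d: "d > 0" "\<And>s. \<bar>s\<bar> < d \<Longrightarrow> (r has_real_derivative p s) (at s) \<and> r s \<le> r 0"
    using eventually_conj[OF r max] unfolding eventually_nhds_metric by (auto simp: dist_norm)
  have p0: "p 0 = 0"
    by (rule DERIV_local_max[of r "p 0" 0 d]) (use d in auto)
  obtain e where e: "e > 0" "\<And>h. 0 < h \<Longrightarrow> h < e \<Longrightarrow> p 0 < p (0 + h)"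
    using DERIV_pos_inc_right[OF p q] by auto
  define b where "b = min d e / 2"
  have b: "b > 0" "b < d" "b < e" using d(1) e(1) by (auto simp: b_def)
  have "\<exists>z. 0 < z \<and> z < b \<and> r b - r 0 = (b - 0) * p z"
    by (rule MVT2) (use b d in auto)
  then obtain z where z: "0 < z" "z < b" "r b - r 0 = b * p z" by auto
  have "p z > 0" using e(2)[of z] z b p0 by auto
  then have "r b > r 0" using z(3) b by (metis diff_gt_0_iff_gt mult_pos_pos)
  then show False using d(2)[of b] b by auto
qed

lemma has_lap_max:
  assumes L: "has_lap (\<lambda>t. of_real (\<phi> t)) L" and max: "\<forall>\<^sub>F t in nhds 0. \<phi> t \<le> \<phi> 0"
  shows "Re L \<le> 0"
proof (rule has_lapE[OF L])
  fix p q
  assume 1: "\<And>w. w \<in> {1, \<i>} \<Longrightarrow> \<forall>\<^sub>F s in nhds 0. ((\<lambda>s. complex_of_real (\<phi> (of_real s * w))) has_vector_derivative p w s) (at s)"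
      "\<And>w. w \<in> {1, \<i>} \<Longrightarrow> (p w has_vector_derivative q w) (at 0)" "L = q 1 + q \<i>"
  have "Re (q w) \<le> 0" if w: "w \<in> {1, \<i>}" for w
  proof (rule second_derivative_le_0)
    show "\<forall>\<^sub>F s in nhds 0. ((\<lambda>s. \<phi> (of_real s * w)) has_real_derivative Re (p w s)) (at s)"
      using 1(1)[OF w] by eventually_elim (auto dest: bounded_linear.has_vector_derivative[OF bounded_linear_Re] simp: has_real_derivative_iff_has_vector_derivative)
    show "((\<lambda>s. Re (p w s)) has_real_derivative Re (q w)) (at 0)"
      using 1(2)[OF w] by (auto dest: bounded_linear.has_vector_derivative[OF bounded_linear_Re] simp: has_real_derivative_iff_has_vector_derivative)
    show "\<forall>\<^sub>F s in nhds 0. \<phi> (of_real s * w) \<le> \<phi> (of_real 0 * w)"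
      using eventually_line[where P = "\<lambda>t. \<phi> t \<le> \<phi> 0", OF max] by simp
  qed
  then have "Re (q 1) \<le> 0" "Re (q \<i>) \<le> 0" by auto
  then show ?thesis using 1(3) by simp
qed

section \<open>Charts, velocities and push-forward\<close>

text \<open>The components from \<open>n\<close> on vanish identically on \<open>U\<close>, so
  continuity has to be supplied only for the first \<open>n\<close>.\<close>

lemma open_cspace_preimage:
  assumes U: "open_cspace m U" and \<Phi>: "\<And>x. x \<in> U \<Longrightarrow> \<Phi> x \<in> cspace n"
    and cont: "\<And>i. i < n \<Longrightarrow> continuous_on U (\<lambda>x. \<Phi> x i)" and W: "open_cspace n W"
  shows "open_cspace m {x \<in> U. \<Phi> x \<in> W}"
proof -
  obtain T where T: "open T" "W = cspace n \<inter> T" using W by (auto simp: openin_open)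
  have "continuous_on U (\<lambda>x. \<Phi> x i)" for i
  proof (cases "i < n")
    case False
    then show ?thesis using \<Phi> by (subst continuous_on_cong[OF refl, of _ _ "\<lambda>x. 0"]) (auto simp: cspace_def)
  qed (rule cont)
  then have "continuous_on U \<Phi>" by (intro continuous_on_coordinatewise_then_product)
  from continuous_openin_preimage_gen[OF this T(1)]
  have "openin (top_of_set U) {x \<in> U. \<Phi> x \<in> T}" by (simp add: vimage_def Int_def)
  moreover have "{x \<in> U. \<Phi> x \<in> T} = {x \<in> U. \<Phi> x \<in> W}" using \<Phi> T(2) by auto
  ultimately show ?thesis using U openin_trans by metis
qed

lemma cinv_cmap: "inj_on (cmap c) (cdom c) \<Longrightarrow> p \<in> cdom c \<Longrightarrow> cinv c (cmap c p) = p"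
  by (rule inv_into_f_f)

lemma cmap_cinv: "x \<in> cmap c ` cdom c \<Longrightarrow> cmap c (cinv c x) = x" "x \<in> cmap c ` cdom c \<Longrightarrow> cinv c x \<in> cdom c"
  by (rule f_inv_into_f, assumption) (rule inv_into_into)

lemma chart_facts:
  assumes "complex_manifold X" "c \<in> atlas X"
  shows "inj_on (cmap c) (cdom c)" "open_cspace (cdim X) (cmap c ` cdom c)"
    "p \<in> cdom c \<Longrightarrow> cmap c p \<in> cspace (cdim X)" "p \<in> cdom c \<Longrightarrow> cinv c (cmap c p) = p"
    "d \<in> atlas X \<Longrightarrow> open_cspace (cdim X) (cmap c ` (cdom c \<inter> cdom d))"
    "d \<in> atlas X \<Longrightarrow> i < cdim X \<Longrightarrow> holo_fn (cdim X) (cmap c ` (cdom c \<inter> cdom d)) (\<lambda>x. cmap d (cinv c x) i)"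
proof -
  show inj: "inj_on (cmap c) (cdom c)" "open_cspace (cdim X) (cmap c ` cdom c)"
    using assms by (auto simp: complex_manifold_def)
  show "p \<in> cdom c \<Longrightarrow> cmap c p \<in> cspace (cdim X)"
    using open_cspace_subset[OF inj(2)] by blast
  show "p \<in> cdom c \<Longrightarrow> cinv c (cmap c p) = p" using inj(1) by (rule cinv_cmap)
  show "d \<in> atlas X \<Longrightarrow> open_cspace (cdim X) (cmap c ` (cdom c \<inter> cdom d))"
    "d \<in> atlas X \<Longrightarrow> i < cdim X \<Longrightarrow> holo_fn (cdim X) (cmap c ` (cdom c \<inter> cdom d)) (\<lambda>x. cmap d (cinv c x) i)"
    using assms by (auto simp: complex_manifold_def)
qed

lemma topspace_mtop:
  assumes "complex_manifold X"
  shows "topspace (mtop X) = carrier_of X"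
proof -
  have "p \<in> \<Union> {{p \<in> cdom c. cmap c p \<in> W} |c W. c \<in> atlas X \<and> open_cspace (cdim X) W}" if "c \<in> atlas X" "p \<in> cdom c" for c p
  proof -
    have "p \<in> {p \<in> cdom c. cmap c p \<in> cmap c ` cdom c}" using that by auto
    then show ?thesis using chart_facts(2)[OF assms that(1)] that(1) by blast
  qed
  then show ?thesis unfolding mtop_def topology_generated_by_topspace carrier_of_def by blast
qed

lemma openin_mtop_chart:
  assumes "c \<in> atlas X" "open_cspace (cdim X) W"
  shows "openin (mtop X) {p \<in> cdom c. cmap c p \<in> W}"
  unfolding mtop_def by (rule topology_generated_by_Basis) (use assms in blast)

lemma openin_cdom:
  assumes "complex_manifold X" "c \<in> atlas X"
  shows "openin (mtop X) (cdom c)"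
proof -
  have "{p \<in> cdom c. cmap c p \<in> cmap c ` cdom c} = cdom c" by auto
  then show ?thesis using openin_mtop_chart[OF assms(2) chart_facts(2)[OF assms]] by simp
qed

lemma holo_fn_continuous: "holo_fn n W F \<Longrightarrow> continuous_on W F"
  using holo_fn_C_k[of n W F 0] by simp

text \<open>Induction over the generation of the topology: injectivity of the chart handles
  intersections, and continuity of the transition functions handles the generating sets.\<close>

lemma open_chart_image:
  assumes X: "complex_manifold X" and c: "c \<in> atlas X" and U: "openin (mtop X) U"
  shows "open_cspace (cdim X) (cmap c ` (U \<inter> cdom c))"
proof -
  note inj = chart_facts(1)[OF X c]
  have "generate_topology_on {{p \<in> cdom c. cmap c p \<in> W} |c W. c \<in> atlas X \<and> open_cspace (cdim X) W} U"
    using U unfolding mtop_def openin_topology_generated_by_iff .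
  then show ?thesis
  proof induction
    case (Int a b)
    have "cmap c ` ((a \<inter> b) \<inter> cdom c) = cmap c ` (a \<inter> cdom c) \<inter> cmap c ` (b \<inter> cdom c)"
      using inj by (auto simp: inj_on_def)
    then show ?case using Int.IH by (metis openin_Int)
  next
    case (UN K)
    have "cmap c ` (\<Union>K \<inter> cdom c) = (\<Union>k\<in>K. cmap c ` (k \<inter> cdom c))" by auto
    then show ?case using UN.IH by auto
  next
    case (Basis s)
    then obtain d W where d: "s = {p \<in> cdom d. cmap d p \<in> W}" "d \<in> atlas X" "open_cspace (cdim X) W" by blast
    let ?U = "cmap c ` (cdom c \<inter> cdom d)"
    have "open_cspace (cdim X) {x \<in> ?U. cmap d (cinv c x) \<in> W}"
    proof (rule open_cspace_preimage[OF chart_facts(5)[OF X c d(2)] _ _ d(3)])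
      show "cmap d (cinv c x) \<in> cspace (cdim X)" if "x \<in> ?U" for x
        using that chart_facts(3,4)[OF X] c d(2) by force
      show "continuous_on ?U (\<lambda>x. cmap d (cinv c x) i)" if "i < cdim X" for i
        using chart_facts(6)[OF X c d(2) that] by (rule holo_fn_continuous)
    qed
    moreover have "{x \<in> ?U. cmap d (cinv c x) \<in> W} = cmap c ` (s \<inter> cdom c)"
      using chart_facts(4)[OF X c] by (auto simp: d(1))
    ultimately show ?case by simp
  qed auto
qed

section \<open>Holomorphic discs in a manifold and their velocities\<close>

definition hol_disc :: "'a cmanifold \<Rightarrow> (complex \<Rightarrow> 'a) \<Rightarrow> bool" where
  "hol_disc X \<gamma> \<longleftrightarrow> \<gamma> 0 \<in> carrier_of X \<and> (\<forall>c\<in>atlas X. \<gamma> 0 \<in> cdom c \<longrightarrow>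
     (\<forall>\<^sub>F t in nhds 0. \<gamma> t \<in> cdom c) \<and> adisc (cdim X) (\<lambda>t. cmap c (\<gamma> t)))"

text \<open>The default values 0 follow the convention in \<open>tangent_space\<close>, so that a
  velocity is literally a tangent vector.\<close>

definition velocity :: "'a cmanifold \<Rightarrow> (complex \<Rightarrow> 'a) \<Rightarrow> 'a tvec" where
  "velocity X \<gamma> = (\<lambda>c i. if c \<in> atlas X \<and> \<gamma> 0 \<in> cdom c \<and> i < cdim X then deriv (\<lambda>t. cmap c (\<gamma> t) i) 0 else 0)"

lemma adisc_cong_ev:
  assumes "\<forall>\<^sub>F t in nhds 0. Y t = Z t" "adisc n Y"
  shows "adisc n Z"
  unfolding adisc_def
proof (intro conjI allI impI)
  show "\<forall>\<^sub>F t in nhds 0. Z t \<in> cspace n"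
    using assms unfolding adisc_def by (auto elim: eventually_elim2)
  fix j assume "j < n"
  then have "(\<lambda>t. Y t j) analytic_on {0}" using assms(2) by (simp add: adisc_def)
  moreover have "\<forall>\<^sub>F t in nhds 0. Y t j = Z t j" using assms(1) by eventually_elim simp
  ultimately show "(\<lambda>t. Z t j) analytic_on {0}"
    by (intro analytic_at_cong_ev(1)[where f = "\<lambda>t. Y t j" and g = "\<lambda>t. Z t j"])
qed

text \<open>The part of the manifold axioms that is needed to have velocity vectors; it is easier to check
  for a projectivised tangent bundle than the full axioms.\<close>

definition hdiff_atlas :: "'a cmanifold \<Rightarrow> bool" where
  "hdiff_atlas X \<longleftrightarrow> (\<forall>c\<in>atlas X. inj_on (cmap c) (cdom c) \<and> cmap c ` cdom c \<subseteq> cspace (cdim X)) \<and>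
     (\<forall>c\<in>atlas X. \<forall>d\<in>atlas X. \<forall>p\<in>cdom c \<inter> cdom d. \<forall>i<cdim X.
        \<exists>D. hdiff (cdim X) (\<lambda>x. cmap d (cinv c x) i) (cmap c p) D)"

lemma hdiff_transition:
  assumes "complex_manifold X" "c \<in> atlas X" "d \<in> atlas X" "p \<in> cdom c" "p \<in> cdom d" "i < cdim X"
  shows "hdiff (cdim X) (\<lambda>x. cmap d (cinv c x) i) (cmap c p) (\<lambda>j. d_z j (\<lambda>x. cmap d (cinv c x) i) (cmap c p))"
  by (rule hdiff_holo[OF chart_facts(5)[OF assms(1-3)] _ chart_facts(6)[OF assms(1-3,6)]]) (use assms in auto)

lemma hdiff_atlas_manifold:
  assumes "complex_manifold X"
  shows "hdiff_atlas X"
  unfolding hdiff_atlas_def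
proof (intro conjI ballI allI impI)
  fix c d p i assume "c \<in> atlas X" "d \<in> atlas X" "p \<in> cdom c \<inter> cdom d" "i < cdim X"
  then show "\<exists>D. hdiff (cdim X) (\<lambda>x. cmap d (cinv c x) i) (cmap c p) D"
    using hdiff_transition[OF assms, of c d p i] by blast
qed (use chart_facts[OF assms] in auto)

text \<open>The transformation law of tangent vectors is the chain rule along the disc;
  \<open>hdiff_partial\<close> identifies the gradient of the transition function with the
  derivatives \<open>d_z\<close> in that law.\<close>

lemma velocity_tangent:
  assumes X: "hdiff_atlas X" and \<gamma>: "hol_disc X \<gamma>"
  shows "velocity X \<gamma> \<in> tangent_space X (\<gamma> 0)"
proof -
  have "velocity X \<gamma> d i = (\<Sum>j<cdim X. d_z j (\<lambda>x. cmap d (cinv c x) i) (cmap c (\<gamma> 0)) * velocity X \<gamma> c j)"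
    if cd: "c \<in> atlas X" "d \<in> atlas X" "\<gamma> 0 \<in> cdom c \<inter> cdom d" and i: "i < cdim X" for c d i
  proof -
    have c0: "inj_on (cmap c) (cdom c)" "cmap c (\<gamma> 0) \<in> cspace (cdim X)" using X cd by (auto simp: hdiff_atlas_def)
    obtain D where D: "hdiff (cdim X) (\<lambda>x. cmap d (cinv c x) i) (cmap c (\<gamma> 0)) D"
      using X cd i unfolding hdiff_atlas_def by blast
    have ev: "\<forall>\<^sub>F t in nhds 0. \<gamma> t \<in> cdom c" and ad: "adisc (cdim X) (\<lambda>t. cmap c (\<gamma> t))"
      using \<gamma> cd by (auto simp: hol_disc_def)
    have "\<forall>\<^sub>F t in nhds 0. cmap d (cinv c (cmap c (\<gamma> t))) i = cmap d (\<gamma> t) i"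
      using ev by eventually_elim (simp add: cinv_cmap[OF c0(1)])
    then have "deriv (\<lambda>t. cmap d (\<gamma> t) i) 0 = deriv (\<lambda>t. cmap d (cinv c (cmap c (\<gamma> t))) i) 0"
      using deriv_cong_ev[where f = "\<lambda>t. cmap d (cinv c (cmap c (\<gamma> t))) i" and g = "\<lambda>t. cmap d (\<gamma> t) i" and x = 0] by simp
    also have "\<dots> = (\<Sum>j<cdim X. D j * deriv (\<lambda>t. cmap c (\<gamma> t) j) 0)"
      by (rule hdiffD(3)[where Y = "\<lambda>t. cmap c (\<gamma> t)" and F = "\<lambda>x. cmap d (cinv c x) i", OF D ad])
    also have "\<dots> = (\<Sum>j<cdim X. d_z j (\<lambda>x. cmap d (cinv c x) i) (cmap c (\<gamma> 0)) * velocity X \<gamma> c j)"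
      using cd by (intro sum.cong) (auto simp: hdiff_partial[OF D c0(2)] velocity_def)
    finally show ?thesis using cd i by (simp add: velocity_def)
  qed
  moreover have "velocity X \<gamma> c \<in> cspace (cdim X)" for c by (simp add: velocity_def cspace_def)
  moreover have "velocity X \<gamma> c = (\<lambda>i. 0)" if "\<not> (c \<in> atlas X \<and> \<gamma> 0 \<in> cdom c)" for c
    using that by (auto simp: velocity_def fun_eq_iff)
  ultimately show ?thesis unfolding tangent_space_def by blast
qed

text \<open>One chart suffices: near 0 the disc stays in the overlap with any other chart around its
  centre, and the transition functions are complex differentiable along discs.\<close>

lemma hol_discI:
  assumes X: "complex_manifold X" and c: "c \<in> atlas X" "\<gamma> 0 \<in> cdom c"
    and ev: "\<forall>\<^sub>F t in nhds 0. \<gamma> t \<in> cdom c" and ad: "adisc (cdim X) (\<lambda>t. cmap c (\<gamma> t))"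
  shows "hol_disc X \<gamma>"
  unfolding hol_disc_def
proof (intro conjI ballI impI)
  show "\<gamma> 0 \<in> carrier_of X" using c by (auto simp: carrier_of_def)
  fix d assume d: "d \<in> atlas X" "\<gamma> 0 \<in> cdom d"
  let ?U = "cmap c ` (cdom c \<inter> cdom d)"
  have "\<forall>\<^sub>F t in nhds 0. cmap c (\<gamma> t) \<in> ?U"
    using c d by (intro adisc_ev_in[where Y = "\<lambda>t. cmap c (\<gamma> t)", OF ad chart_facts(5)[OF X c(1) d(1)]]) auto
  with ev show evd: "\<forall>\<^sub>F t in nhds 0. \<gamma> t \<in> cdom d"
  proof eventually_elim
    case (elim t)
    then show ?case using chart_facts(1)[OF X c(1)] by (auto simp: inj_on_def)
  qed
  show "adisc (cdim X) (\<lambda>t. cmap d (\<gamma> t))"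
    unfolding adisc_def
  proof (intro conjI allI impI)
    show "\<forall>\<^sub>F t in nhds 0. cmap d (\<gamma> t) \<in> cspace (cdim X)"
      using evd by eventually_elim (rule chart_facts(3)[OF X d(1)])
    fix i assume i: "i < cdim X"
    have "(\<lambda>t. cmap d (cinv c (cmap c (\<gamma> t))) i) analytic_on {0}"
      by (rule hdiffD(1)[where Y = "\<lambda>t. cmap c (\<gamma> t)", OF hdiff_transition[OF X c(1) d(1) c(2) d(2) i] ad])
    moreover have "\<forall>\<^sub>F t in nhds 0. cmap d (cinv c (cmap c (\<gamma> t))) i = cmap d (\<gamma> t) i"
      using ev by eventually_elim (simp add: chart_facts(4)[OF X c(1)])
    ultimately show "(\<lambda>t. cmap d (\<gamma> t) i) analytic_on {0}"
      by (intro analytic_at_cong_ev(1)[where f = "\<lambda>t. cmap d (cinv c (cmap c (\<gamma> t))) i" and g = "\<lambda>t. cmap d (\<gamma> t) i"])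
  qed
qed

lemma hol_disc_chart:
  assumes X: "complex_manifold X" and c: "c \<in> atlas X" and Y: "adisc (cdim X) Y" "Y 0 \<in> cmap c ` cdom c"
  shows "hol_disc X (\<lambda>t. cinv c (Y t))" "\<forall>\<^sub>F t in nhds 0. cinv c (Y t) \<in> cdom c \<and> cmap c (cinv c (Y t)) = Y t"
proof -
  show ev: "\<forall>\<^sub>F t in nhds 0. cinv c (Y t) \<in> cdom c \<and> cmap c (cinv c (Y t)) = Y t"
    using adisc_ev_in[OF Y(1) chart_facts(2)[OF X c] Y(2)] by eventually_elim (simp add: cmap_cinv)
  show "hol_disc X (\<lambda>t. cinv c (Y t))"
  proof (rule hol_discI[OF X c])
    show "cinv c (Y 0) \<in> cdom c" using Y(2) by (rule cmap_cinv)
    show "\<forall>\<^sub>F t in nhds 0. cinv c (Y t) \<in> cdom c" using ev by eventually_elim simp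
    have "\<forall>\<^sub>F t in nhds 0. Y t = cmap c (cinv c (Y t))" using ev by eventually_elim simp
    from adisc_cong_ev[OF this Y(1)] show "adisc (cdim X) (\<lambda>t. cmap c (cinv c (Y t)))" .
  qed
qed

lemma tangent_facts:
  assumes "v \<in> tangent_space X p" "c \<in> atlas X" "p \<in> cdom c"
  shows "v c \<in> cspace (cdim X)"
    "d \<in> atlas X \<Longrightarrow> p \<in> cdom d \<Longrightarrow> i < cdim X \<Longrightarrow> v d i = (\<Sum>j<cdim X. d_z j (\<lambda>x. cmap d (cinv c x) i) (cmap c p) * v c j)"
  using assms unfolding tangent_space_def mem_Collect_eq by (blast, blast)

lemma tangent_outside: "v \<in> tangent_space X p \<Longrightarrow> \<not> (c \<in> atlas X \<and> p \<in> cdom c) \<Longrightarrow> v c i = 0"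
proof -
  assume v: "v \<in> tangent_space X p" and "\<not> (c \<in> atlas X \<and> p \<in> cdom c)"
  then have "v c = (\<lambda>i. 0)" unfolding tangent_space_def mem_Collect_eq by blast
  then show ?thesis by simp
qed

text \<open>The transformation law determines the components in all other charts around
  \<open>p\<close>, and the default values settle the remaining arguments.\<close>

lemma tangent_eqI:
  assumes "v \<in> tangent_space X p" "w \<in> tangent_space X p" "c \<in> atlas X" "p \<in> cdom c" "\<And>i. i < cdim X \<Longrightarrow> v c i = w c i"
  shows "v = w"
proof (intro ext)
  fix d i
  show "v d i = w d i"
  proof (cases "d \<in> atlas X \<and> p \<in> cdom d")
    case d: True
    show ?thesis
    proof (cases "i < cdim X")
      case True
      show ?thesis
        using tangent_facts(2)[OF assms(1,3,4) _ _ True, of d] tangent_facts(2)[OF assms(2,3,4) _ _ True, of d] d assms(5) by simp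
    next
      case False
      then show ?thesis
        using tangent_facts(1)[OF assms(1)] tangent_facts(1)[OF assms(2)] d by (simp add: cspace_def)
    qed
  next
    case False
    then show ?thesis using tangent_outside[OF assms(1) False] tangent_outside[OF assms(2) False] by simp
  qed
qed

text \<open>The tangent vector with components \<open>v\<close> in the chart \<open>c\<close>.
  Obtaining it as the velocity of a coordinate line gives the transformation law for free.\<close>

definition tvec_of :: "'a cmanifold \<Rightarrow> 'a chart \<Rightarrow> 'a \<Rightarrow> (nat \<Rightarrow> complex) \<Rightarrow> 'a tvec" where
  "tvec_of X c p v = velocity X (\<lambda>t. cinv c (\<lambda>i. cmap c p i + t * v i))"

lemma tvec_of:
  assumes X: "complex_manifold X" and c: "c \<in> atlas X" "p \<in> cdom c" and v: "v \<in> cspace (cdim X)"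
  shows "hol_disc X (\<lambda>t. cinv c (\<lambda>i. cmap c p i + t * v i))" "tvec_of X c p v \<in> tangent_space X p"
    "tvec_of X c p v c = v"
proof -
  note cp = chart_facts(3,4)[OF X c]
  note Y = adisc_line[OF cp(1) v]
  have x: "cmap c p \<in> cmap c ` cdom c" using c by simp
  note h = hol_disc_chart[where Y = "\<lambda>t i. cmap c p i + t * v i", OF X c(1) Y(1)]
  show 1: "hol_disc X (\<lambda>t. cinv c (\<lambda>i. cmap c p i + t * v i))" using h(1) x by simp
  show "tvec_of X c p v \<in> tangent_space X p"
    using velocity_tangent[OF hdiff_atlas_manifold[OF X] 1] cp(2) by (simp add: tvec_of_def)
  have ev: "\<forall>\<^sub>F t in nhds 0. cmap c (cinv c (\<lambda>i. cmap c p i + t * v i)) = (\<lambda>i. cmap c p i + t * v i)"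
    using h(2) x by (auto elim: eventually_mono)
  have "deriv (\<lambda>t. cmap c (cinv c (\<lambda>i. cmap c p i + t * v i)) i) 0 = v i" for i
  proof -
    have "deriv (\<lambda>t. cmap c (cinv c (\<lambda>i. cmap c p i + t * v i)) i) 0 = deriv (\<lambda>t. cmap c p i + t * v i) 0"
      using ev by (intro deriv_cong_ev) (auto elim: eventually_mono)
    then show ?thesis using Y(2) by simp
  qed
  then show "tvec_of X c p v c = v"
    using v c cp(2) by (auto simp: tvec_of_def velocity_def cspace_def fun_eq_iff)
qed

lemma tangent_space_scale:
  assumes "v \<in> tangent_space X p"
  shows "tscale a v \<in> tangent_space X p"
  unfolding tangent_space_def mem_Collect_eq
proof (intro conjI allI impI ballI)
  fix c assume "c \<in> atlas X \<and> p \<in> cdom c"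
  then show "tscale a v c \<in> cspace (cdim X)"
    using tangent_facts(1)[OF assms, of c] by (simp add: tscale_def cspace_def)
next
  fix c assume "\<not> (c \<in> atlas X \<and> p \<in> cdom c)"
  then show "tscale a v c = (\<lambda>i. 0)" using tangent_outside[OF assms] by (simp add: tscale_def fun_eq_iff)
next
  fix c d i assume "c \<in> atlas X" "d \<in> atlas X" "p \<in> cdom c \<inter> cdom d" "i < cdim X"
  then show "tscale a v d i = (\<Sum>j<cdim X. d_z j (\<lambda>x. cmap d (cinv c x) i) (cmap c p) * tscale a v c j)"
    using tangent_facts(2)[OF assms, of c d i] by (simp add: tscale_def sum_distrib_left mult_ac)
qed

text \<open>The differential of \<open>f\<close> at \<open>p\<close>. The chart around
  \<open>p\<close> is chosen arbitrarily; the lemma \<open>push\<close> shows that every other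
  choice gives the same vector.\<close>

definition push :: "'a cmanifold \<Rightarrow> 'b cmanifold \<Rightarrow> ('a \<Rightarrow> 'b) \<Rightarrow> 'a \<Rightarrow> 'a tvec \<Rightarrow> 'b tvec" where
  "push M N f p v = (let c = (SOME c. c \<in> atlas M \<and> p \<in> cdom c) in
     (\<lambda>d a. if d \<in> atlas N \<and> f p \<in> cdom d \<and> a < cdim N then
       (\<Sum>j<cdim M. d_z j (\<lambda>x. cmap d (f (cinv c x)) a) (cmap c p) * v c j) else 0))"

context
  fixes M :: "'a cmanifold" and N :: "'b cmanifold" and f :: "'a \<Rightarrow> 'b"
  assumes M: "complex_manifold M" and N: "complex_manifold N" and f: "holomorphic_map M N f"
begin

lemma map_carrier: "p \<in> carrier_of M \<Longrightarrow> f p \<in> carrier_of N"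
  using f topspace_mtop[OF M] topspace_mtop[OF N] unfolding holomorphic_map_def continuous_map_def by blast

lemma map_coord_open:
  assumes "c \<in> atlas M" "d \<in> atlas N"
  shows "open_cspace (cdim M) (cmap c ` {p \<in> cdom c. f p \<in> cdom d})"
proof -
  have "openin (mtop M) {p \<in> topspace (mtop M). f p \<in> cdom d}"
    using f openin_cdom[OF N assms(2)] by (intro openin_continuous_map_preimage) (auto simp: holomorphic_map_def)
  from open_chart_image[OF M assms(1) this]
  have "open_cspace (cdim M) (cmap c ` ({p \<in> topspace (mtop M). f p \<in> cdom d} \<inter> cdom c))" .
  moreover have "{p \<in> topspace (mtop M). f p \<in> cdom d} \<inter> cdom c = {p \<in> cdom c. f p \<in> cdom d}"
    using assms(1) by (auto simp: topspace_mtop[OF M] carrier_of_def)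
  ultimately show ?thesis by simp
qed

lemma map_coord_holo:
  assumes "c \<in> atlas M" "d \<in> atlas N" "i < cdim N"
  shows "holo_fn (cdim M) (cmap c ` {p \<in> cdom c. f p \<in> cdom d}) (\<lambda>x. cmap d (f (cinv c x)) i)"
  using f assms by (simp add: holomorphic_map_def)

lemma map_coord_hdiff:
  assumes "c \<in> atlas M" "d \<in> atlas N" "i < cdim N" "p \<in> cdom c" "f p \<in> cdom d"
  shows "hdiff (cdim M) (\<lambda>x. cmap d (f (cinv c x)) i) (cmap c p) (\<lambda>j. d_z j (\<lambda>x. cmap d (f (cinv c x)) i) (cmap c p))"
    "j < cdim M \<Longrightarrow> \<exists>D. hdiff (cdim M) (d_z j (\<lambda>x. cmap d (f (cinv c x)) i)) (cmap c p) D"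
  using assms by (intro hdiff_holo[OF map_coord_open _ map_coord_holo] hdiff_d_z[OF map_coord_open _ map_coord_holo]; auto)+

lemma map_disc:
  assumes \<gamma>: "hol_disc M \<gamma>" and c: "c \<in> atlas M" "\<gamma> 0 \<in> cdom c" and d: "d \<in> atlas N" "f (\<gamma> 0) \<in> cdom d"
  shows "\<forall>\<^sub>F t in nhds 0. f (\<gamma> t) \<in> cdom d" "adisc (cdim N) (\<lambda>t. cmap d (f (\<gamma> t)))"
    "a < cdim N \<Longrightarrow> deriv (\<lambda>t. cmap d (f (\<gamma> t)) a) 0 =
       (\<Sum>j<cdim M. d_z j (\<lambda>x. cmap d (f (cinv c x)) a) (cmap c (\<gamma> 0)) * velocity M \<gamma> c j)"
proof -
  have evc: "\<forall>\<^sub>F t in nhds 0. \<gamma> t \<in> cdom c" and ad: "adisc (cdim M) (\<lambda>t. cmap c (\<gamma> t))"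
    using \<gamma> c by (auto simp: hol_disc_def)
  let ?U = "cmap c ` {p \<in> cdom c. f p \<in> cdom d}"
  have "\<forall>\<^sub>F t in nhds 0. cmap c (\<gamma> t) \<in> ?U"
    using c d by (intro adisc_ev_in[where Y = "\<lambda>t. cmap c (\<gamma> t)", OF ad map_coord_open[OF c(1) d(1)]]) auto
  with evc show evd: "\<forall>\<^sub>F t in nhds 0. f (\<gamma> t) \<in> cdom d"
  proof eventually_elim
    case (elim t)
    then show ?case using chart_facts(1)[OF M c(1)] by (auto simp: inj_on_def)
  qed
  have cong: "\<forall>\<^sub>F t in nhds 0. cmap d (f (cinv c (cmap c (\<gamma> t)))) i = cmap d (f (\<gamma> t)) i" for i
    using evc by eventually_elim (simp add: chart_facts(4)[OF M c(1)])
  note h = hdiffD[where Y = "\<lambda>t. cmap c (\<gamma> t)" and F = "\<lambda>x. cmap d (f (cinv c x)) i" for i, OF map_coord_hdiff(1)[OF c(1) d(1) _ c(2) d(2)] ad]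
  note cg = analytic_at_cong_ev[where f = "\<lambda>t. cmap d (f (cinv c (cmap c (\<gamma> t)))) i" and g = "\<lambda>t. cmap d (f (\<gamma> t)) i" and z = 0 for i, OF cong h(1)]
  show "adisc (cdim N) (\<lambda>t. cmap d (f (\<gamma> t)))"
    unfolding adisc_def
  proof (intro conjI allI impI)
    show "\<forall>\<^sub>F t in nhds 0. cmap d (f (\<gamma> t)) \<in> cspace (cdim N)"
      using evd by eventually_elim (rule chart_facts(3)[OF N d(1)])
    show "(\<lambda>t. cmap d (f (\<gamma> t)) i) analytic_on {0}" if "i < cdim N" for i by (rule cg(1)[OF that])
  qed
  show "a < cdim N \<Longrightarrow> deriv (\<lambda>t. cmap d (f (\<gamma> t)) a) 0 =
       (\<Sum>j<cdim M. d_z j (\<lambda>x. cmap d (f (cinv c x)) a) (cmap c (\<gamma> 0)) * velocity M \<gamma> c j)"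
    using cg(2)[of a] h(3)[of a] c by (simp add: velocity_def)
qed

lemma map_hol_disc:
  assumes \<gamma>: "hol_disc M \<gamma>"
  shows "hol_disc N (\<lambda>t. f (\<gamma> t))"
proof -
  obtain c where c: "c \<in> atlas M" "\<gamma> 0 \<in> cdom c" using \<gamma> by (auto simp: hol_disc_def carrier_of_def)
  have "\<gamma> 0 \<in> carrier_of M" using \<gamma> by (simp add: hol_disc_def)
  then show ?thesis unfolding hol_disc_def using map_carrier map_disc(1,2)[OF \<gamma> c] by blast
qed

lemma push_velocity:
  assumes \<gamma>: "hol_disc M \<gamma>"
  shows "velocity N (\<lambda>t. f (\<gamma> t)) = push M N f (\<gamma> 0) (velocity M \<gamma>)"
proof -
  have ex: "\<exists>c. c \<in> atlas M \<and> \<gamma> 0 \<in> cdom c" using \<gamma> by (auto simp: hol_disc_def carrier_of_def)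
  define c where "c = (SOME c. c \<in> atlas M \<and> \<gamma> 0 \<in> cdom c)"
  have c: "c \<in> atlas M" "\<gamma> 0 \<in> cdom c" using someI_ex[OF ex] by (auto simp: c_def)
  show ?thesis
    unfolding push_def Let_def c_def[symmetric] by (intro ext) (simp add: velocity_def[of N] map_disc(3)[OF \<gamma> c])
qed

text \<open>\<open>v\<close> is the velocity of a disc. By \<open>push_velocity\<close> the
  push-forward is then the velocity of the image disc, which is a tangent vector and can be computed
  in any chart \<open>c\<close>.\<close>

lemma push:
  assumes p: "p \<in> carrier_of M" and v: "v \<in> tangent_space M p"
  shows "push M N f p v \<in> tangent_space N (f p)"
    "\<And>c d a. c \<in> atlas M \<Longrightarrow> p \<in> cdom c \<Longrightarrow> d \<in> atlas N \<Longrightarrow> f p \<in> cdom d \<Longrightarrow> a < cdim N \<Longrightarrow>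
      push M N f p v d a = (\<Sum>j<cdim M. d_z j (\<lambda>x. cmap d (f (cinv c x)) a) (cmap c p) * v c j)"
proof -
  have main: "push M N f p v \<in> tangent_space N (f p) \<and> (\<forall>d a. d \<in> atlas N \<longrightarrow> f p \<in> cdom d \<longrightarrow> a < cdim N \<longrightarrow>
      push M N f p v d a = (\<Sum>j<cdim M. d_z j (\<lambda>x. cmap d (f (cinv c x)) a) (cmap c p) * v c j))"
    if c: "c \<in> atlas M" "p \<in> cdom c" for c
  proof -
    let ?\<gamma> = "\<lambda>t. cinv c (\<lambda>i. cmap c p i + t * v c i)"
    note t = tvec_of[OF M c tangent_facts(1)[OF v c]]
    have "tvec_of M c p (v c) = v" using t(3) by (intro tangent_eqI[OF t(2) v c]) simp
    then have vel: "velocity M ?\<gamma> = v" by (simp add: tvec_of_def)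
    have p0: "?\<gamma> 0 = p" using chart_facts(4)[OF M c] by simp
    have pv: "velocity N (\<lambda>t. f (?\<gamma> t)) = push M N f p v"
      using push_velocity[OF t(1)] vel p0 by simp
    have "push M N f p v \<in> tangent_space N (f p)"
      using velocity_tangent[OF hdiff_atlas_manifold[OF N] map_hol_disc[OF t(1)]] pv p0 by simp
    moreover have "push M N f p v d a = (\<Sum>j<cdim M. d_z j (\<lambda>x. cmap d (f (cinv c x)) a) (cmap c p) * v c j)"
      if d: "d \<in> atlas N" "f p \<in> cdom d" and a: "a < cdim N" for d a
    proof -
      have "push M N f p v d a = deriv (\<lambda>t. cmap d (f (?\<gamma> t)) a) 0"
        using d a p0 unfolding pv[symmetric] velocity_def by simp
      then show ?thesis using map_disc(3)[OF t(1) c(1) _ d(1) _ a] p0 c(2) d(2) vel by simp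
    qed
    ultimately show ?thesis by blast
  qed
  then show "push M N f p v \<in> tangent_space N (f p)" using p by (auto simp: carrier_of_def)
  show "\<And>c d a. c \<in> atlas M \<Longrightarrow> p \<in> cdom c \<Longrightarrow> d \<in> atlas N \<Longrightarrow> f p \<in> cdom d \<Longrightarrow> a < cdim N \<Longrightarrow>
      push M N f p v d a = (\<Sum>j<cdim M. d_z j (\<lambda>x. cmap d (f (cinv c x)) a) (cmap c p) * v c j)"
    using main by blast
qed

lemma push_scale: "push M N f p (tscale a v) = tscale a (push M N f p v)"
  unfolding push_def Let_def tscale_def by (auto simp: fun_eq_iff sum_distrib_left mult_ac)

end

section \<open>Projectivised tangent bundles\<close>

text \<open>This keeps the dimension \<open>2 * n - 1\<close> in one syntactic form.\<close>

declare One_nat_def [simp del]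

definition line_at :: "'a \<Rightarrow> 'a tvec \<Rightarrow> 'a \<times> 'a tvec set" where
  "line_at p v = (p, range (\<lambda>a. tscale a v))"

text \<open>The coordinates of a line in terms of any vector \<open>v\<close> spanning it, whereas
  \<open>proj_map\<close> refers to the normalised one.\<close>

definition pcoord :: "nat \<Rightarrow> nat \<Rightarrow> (nat \<Rightarrow> complex) \<Rightarrow> (nat \<Rightarrow> complex) \<Rightarrow> nat \<Rightarrow> complex" where
  "pcoord n k x v = (\<lambda>i. if i < n then x i else if i < n + k then v (i - n) / v k
     else if i < 2 * n - 1 then v (i - n + 1) / v k else 0)"

definition base_part :: "nat \<Rightarrow> (nat \<Rightarrow> complex) \<Rightarrow> nat \<Rightarrow> complex" where
  "base_part n Z = (\<lambda>i. if i < n then Z i else 0)"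

text \<open>Together with \<open>base_part\<close> this inverts \<open>pcoord\<close>: it is the
  representative whose \<open>k\<close>-th component is 1. Beyond \<open>k\<close> the index is one
  lower, because that component is left out of the coordinates.\<close>

definition fibre_part :: "nat \<Rightarrow> nat \<Rightarrow> (nat \<Rightarrow> complex) \<Rightarrow> nat \<Rightarrow> complex" where
  "fibre_part n k Z = (\<lambda>i. if i < k then Z (n + i) else if i = k then 1 else if i < n then Z (n + i - 1) else 0)"

lemma base_part_cspace: "base_part n Z \<in> cspace n"
  by (simp add: base_part_def cspace_def)

lemma fibre_part_cspace: "k < n \<Longrightarrow> fibre_part n k Z \<in> cspace n"
  by (simp add: fibre_part_def cspace_def)

lemma fibre_part_k: "fibre_part n k Z k = 1"
  by (simp add: fibre_part_def)

lemma pcoord_cspace: "k < n \<Longrightarrow> pcoord n k x v \<in> cspace (2 * n - 1)"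
  by (auto simp: pcoord_def cspace_def)

lemma base_part_pcoord: "x \<in> cspace n \<Longrightarrow> base_part n (pcoord n k x v) = x"
  by (auto simp: base_part_def pcoord_def cspace_def fun_eq_iff)

lemma fibre_part_pcoord:
  assumes "v \<in> cspace n" "k < n" "v k \<noteq> 0"
  shows "fibre_part n k (pcoord n k x v) i = v i / v k"
  using assms by (auto simp: fibre_part_def pcoord_def cspace_def)

lemma pcoord_parts:
  assumes "Z \<in> cspace (2 * n - 1)" "k < n"
  shows "pcoord n k (base_part n Z) (fibre_part n k Z) = Z"
proof
  fix i
  consider "i < n" | "n \<le> i" "i < n + k" | "n + k \<le> i" "i < 2 * n - 1" | "i \<ge> 2 * n - 1" "i \<ge> n + k" using assms(2) by linarith
  then show "pcoord n k (base_part n Z) (fibre_part n k Z) i = Z i"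
  proof cases
    \<comment> \<open>Here \<open>i - n + 1\<close> exceeds \<open>k\<close>, so the third branch of
      \<open>fibre_part\<close> applies and undoes the shift.\<close>
    case 3
    then have "i - n + 1 > k" "i - n + 1 < n" "n + (i - n + 1) - 1 = i" using assms(2) by linarith+
    then show ?thesis using 3 assms(2) by (simp add: pcoord_def fibre_part_def)
  next
    case 4
    then show ?thesis using assms by (auto simp: pcoord_def cspace_def)
  qed (auto simp: pcoord_def fibre_part_def base_part_def)
qed

lemma proj_tangent_simps [simp]:
  "cdim (proj_tangent X) = 2 * cdim X - 1"
  "atlas (proj_tangent X) = {(proj_dom X c k, proj_map X c k) | c k. c \<in> atlas X \<and> k < cdim X}"
  by (simp_all add: proj_tangent_def)

lemma tscale_one [simp]: "tscale 1 v = v"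
  by (simp add: tscale_def)

lemma tscale_tscale [simp]: "tscale a (tscale b v) = tscale (a * b) v"
  by (simp add: tscale_def mult.assoc)

lemma line_at_scale:
  assumes "a \<noteq> 0"
  shows "line_at p (tscale a v) = line_at p v"
proof -
  have "range (\<lambda>b. tscale (b * a) v) = range (\<lambda>b. tscale b v)"
  proof (intro equalityI subsetI)
    fix w assume "w \<in> range (\<lambda>b. tscale b v)"
    then obtain b where "w = tscale b v" by blast
    then have "w = tscale ((b / a) * a) v" using assms by simp
    then show "w \<in> range (\<lambda>b. tscale (b * a) v)" by blast
  qed blast
  then show ?thesis by (simp add: line_at_def)
qed

lemma not_tzeroI: "v c k \<noteq> 0 \<Longrightarrow> v \<noteq> tzero"
  by (auto simp: tzero_def)

lemma line_at_in_proj_dom: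
  assumes "v \<in> tangent_space X p" "p \<in> cdom c" "v c k \<noteq> 0"
  shows "line_at p v \<in> proj_dom X c k"
proof -
  have "v \<in> range (\<lambda>a. tscale a v)" by (rule range_eqI[of _ _ 1]) simp
  then show ?thesis using assms not_tzeroI[of v c k]
    unfolding proj_dom_def line_at_def tangent_lines_def by blast
qed

lemma proj_domE:
  assumes "q \<in> proj_dom X c k"
  obtains p v where "q = line_at p v" "p \<in> cdom c" "v \<in> tangent_space X p" "v c k \<noteq> 0"
proof -
  obtain p l where q: "q = (p, l)" "p \<in> cdom c" "l \<in> tangent_lines X p" "\<exists>v\<in>l. v c k \<noteq> 0"
    using assms unfolding proj_dom_def by blast
  then obtain v where v: "l = range (\<lambda>a. tscale a v)" "v \<in> tangent_space X p" unfolding tangent_lines_def by blast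
  have "v c k \<noteq> 0" using q(4) v(1) by (auto simp: tscale_def)
  then show ?thesis using that[of p v] q v by (simp add: line_at_def)
qed

lemma line_at_dom: "line_at p v \<in> proj_dom X c k \<longleftrightarrow> p \<in> cdom c \<and> range (\<lambda>a. tscale a v) \<in> tangent_lines X p \<and> v c k \<noteq> 0"
  by (auto simp: proj_dom_def line_at_def tscale_def intro!: exI[of _ 1])

lemma proj_map_line_at:
  assumes "v c k \<noteq> 0"
  shows "proj_map X c k (line_at p v) = pcoord (cdim X) k (cmap c p) (v c)"
proof -
  have "(THE u. u \<in> range (\<lambda>a. tscale a v) \<and> u c k = 1) = tscale (1 / v c k) v"
  proof (rule the_equality)
    show "tscale (1 / v c k) v \<in> range (\<lambda>a. tscale a v) \<and> tscale (1 / v c k) v c k = 1"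
      using assms by (intro conjI range_eqI[of _ _ "1 / v c k"]) (auto simp: tscale_def)
    fix u assume u: "u \<in> range (\<lambda>a. tscale a v) \<and> u c k = 1"
    then obtain a where a: "u = tscale a v" by blast
    then have "a = 1 / v c k" using u assms by (simp add: tscale_def field_simps)
    then show "u = tscale (1 / v c k) v" using a by simp
  qed
  then show ?thesis unfolding proj_map_def line_at_def Let_def prod.case
    by (simp only:) (simp add: pcoord_def tscale_def fun_eq_iff)
qed

text \<open>The image of the chart of the projectivised bundle belonging to \<open>c\<close> and
  \<open>k\<close>. It is the same for all \<open>k\<close>, since any base point can be combined
  with any values of the fibre coordinates.\<close>

definition proj_img :: "'a cmanifold \<Rightarrow> 'a chart \<Rightarrow> (nat \<Rightarrow> complex) set" where
  "proj_img X c = {Z \<in> cspace (2 * cdim X - 1). base_part (cdim X) Z \<in> cmap c ` cdom c}"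

context
  fixes X :: "'a cmanifold"
  assumes X: "complex_manifold X"
begin

lemma proj_img_open: "c \<in> atlas X \<Longrightarrow> open_cspace (2 * cdim X - 1) (proj_img X c)"
  unfolding proj_img_def
  by (rule open_cspace_preimage[OF _ base_part_cspace _ chart_facts(2)[OF X]])
    (auto simp: base_part_def intro!: continuous_on_product_coordinates continuous_on_subset[OF continuous_on_product_coordinates])

lemma pcoord_img:
  assumes "c \<in> atlas X" "k < cdim X" "p \<in> cdom c"
  shows "pcoord (cdim X) k (cmap c p) v \<in> proj_img X c"
  using assms chart_facts(3)[OF X] by (simp add: proj_img_def pcoord_cspace base_part_pcoord)

lemma proj_map_in_img:
  assumes "c \<in> atlas X" "k < cdim X" "q \<in> proj_dom X c k"
  shows "proj_map X c k q \<in> proj_img X c"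
proof -
  obtain p v where "q = line_at p v" "p \<in> cdom c" "v \<in> tangent_space X p" "v c k \<noteq> 0"
    using assms(3) by (rule proj_domE)
  then show ?thesis using pcoord_img[OF assms(1,2)] by (simp add: proj_map_line_at)
qed

lemma proj_map_inj:
  assumes c: "c \<in> atlas X" and k: "k < cdim X"
  shows "inj_on (proj_map X c k) (proj_dom X c k)"
proof (rule inj_onI)
  fix q q' assume q: "q \<in> proj_dom X c k" "q' \<in> proj_dom X c k" and eq: "proj_map X c k q = proj_map X c k q'"
  obtain p v where v: "q = line_at p v" "p \<in> cdom c" "v \<in> tangent_space X p" "v c k \<noteq> 0"
    using q(1) by (rule proj_domE)
  obtain p' v' where v': "q' = line_at p' v'" "p' \<in> cdom c" "v' \<in> tangent_space X p'" "v' c k \<noteq> 0"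
    using q(2) by (rule proj_domE)
  have e: "pcoord (cdim X) k (cmap c p) (v c) = pcoord (cdim X) k (cmap c p') (v' c)"
    using eq v(1,4) v'(1,4) by (simp add: proj_map_line_at)
  have "cmap c p = cmap c p'"
    using arg_cong[OF e, of "base_part (cdim X)"]
    by (simp only: base_part_pcoord[OF chart_facts(3)[OF X c v(2)]] base_part_pcoord[OF chart_facts(3)[OF X c v'(2)]])
  then have "cinv c (cmap c p) = cinv c (cmap c p')" by (rule arg_cong)
  then have pp: "p' = p"
    unfolding chart_facts(4)[OF X c v(2)] chart_facts(4)[OF X c v'(2)] by (rule sym)
  have "v c i / v c k = v' c i / v' c k" for i
  proof -
    have 1: "fibre_part (cdim X) k (pcoord (cdim X) k (cmap c p) (v c)) i = v c i / v c k"
      by (rule fibre_part_pcoord[OF tangent_facts(1)[OF v(3) c v(2)] k v(4)])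
    have 2: "fibre_part (cdim X) k (pcoord (cdim X) k (cmap c p') (v' c)) i = v' c i / v' c k"
      by (rule fibre_part_pcoord[OF tangent_facts(1)[OF v'(3) c v'(2)] k v'(4)])
    show ?thesis using 1 2 unfolding e by simp
  qed
  then have "tscale (1 / v c k) v = tscale (1 / v' c k) v'"
    using v'(3) pp by (intro tangent_eqI[OF tangent_space_scale[OF v(3)] tangent_space_scale _ v(2)] c)
      (auto simp: tscale_def)
  then have "line_at p (tscale (1 / v c k) v) = line_at p (tscale (1 / v' c k) v')" by simp
  then show "q = q'" using v v' pp by (simp add: line_at_scale)
qed

text \<open>An explicit preimage of \<open>Z\<close>, spanned by the vector whose
  \<open>k\<close>-th component is 1. Later computations in these charts use this
  representative.\<close>

lemma proj_img_point:
  assumes c: "c \<in> atlas X" and k: "k < cdim X" and Z: "Z \<in> proj_img X c"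
  defines "p \<equiv> cinv c (base_part (cdim X) Z)"
  defines "v \<equiv> tvec_of X c p (fibre_part (cdim X) k Z)"
  shows "p \<in> cdom c" "cmap c p = base_part (cdim X) Z" "v \<in> tangent_space X p" "v c = fibre_part (cdim X) k Z"
    "line_at p v \<in> proj_dom X c k" "proj_map X c k (line_at p v) = Z"
proof -
  have b: "base_part (cdim X) Z \<in> cmap c ` cdom c" "Z \<in> cspace (2 * cdim X - 1)" using Z by (auto simp: proj_img_def)
  show p: "p \<in> cdom c" "cmap c p = base_part (cdim X) Z" using cmap_cinv[OF b(1)] by (auto simp: p_def)
  show v: "v \<in> tangent_space X p" "v c = fibre_part (cdim X) k Z"
    using tvec_of[OF X c p(1) fibre_part_cspace[OF k]] by (auto simp: v_def)
  then have vk: "v c k \<noteq> 0" by (simp add: fibre_part_k)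
  show "line_at p v \<in> proj_dom X c k" by (rule line_at_in_proj_dom[OF v(1) p(1) vk])
  show "proj_map X c k (line_at p v) = Z"
    using proj_map_line_at[of v c k X p, OF vk] p(2) v(2) pcoord_parts[OF b(2) k] by simp
qed

lemma proj_map_image:
  assumes "c \<in> atlas X" "k < cdim X"
  shows "proj_map X c k ` proj_dom X c k = proj_img X c"
  using proj_map_in_img[OF assms] proj_img_point(5,6)[OF assms] by force

lemma proj_cinv:
  assumes c: "c \<in> atlas X" and k: "k < cdim X" and v: "v \<in> tangent_space X p" "p \<in> cdom c" "v c k \<noteq> 0"
  shows "cinv (proj_dom X c k, proj_map X c k) (pcoord (cdim X) k (cmap c p) (v c)) = line_at p v"
  using inv_into_f_f[OF proj_map_inj[OF c k] line_at_in_proj_dom[OF v]] proj_map_line_at[of v c k X p, OF v(3)] by simp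

lemma adisc_pcoord:
  assumes k: "k < n" and y: "adisc n y" and w: "\<And>i. i < n \<Longrightarrow> (\<lambda>t. w t i) analytic_on {0}" and wk: "w 0 k \<noteq> (0::complex)"
  shows "adisc (2 * n - 1) (\<lambda>t. pcoord n k (y t) (w t))"
  unfolding adisc_def
proof (intro conjI allI impI)
  show "\<forall>\<^sub>F t in nhds 0. pcoord n k (y t) (w t) \<in> cspace (2 * n - 1)" using k by (simp add: pcoord_cspace)
  fix i assume i: "i < 2 * n - 1"
  consider "i < n" | "n \<le> i" "i < n + k" | "n + k \<le> i" by linarith
  then show "(\<lambda>t. pcoord n k (y t) (w t) i) analytic_on {0}"
  proof cases
    case 1
    then show ?thesis using y by (simp add: pcoord_def adisc_def)
  next
    case 2
    then have "i - n < n" using k by linarith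
    from analytic_on_divide[OF w[OF this] w[OF k]] show ?thesis using 2 wk by (simp add: pcoord_def)
  next
    case 3
    then have "i - n + 1 < n" using i by linarith
    from analytic_on_divide[OF w[OF this] w[OF k]] show ?thesis using 3 i k wk by (simp add: pcoord_def)
  qed
qed

text \<open>Lifts a disc by means of a holomorphic family of tangent vectors along it. It will be
  applied to an image disc under \<open>f\<close> and to push-forwards of vectors on
  \<open>M\<close>.\<close>

lemma proj_disc:
  assumes \<gamma>: "hol_disc X \<gamma>" and W: "\<forall>\<^sub>F t in nhds 0. W t \<in> tangent_space X (\<gamma> t)"
    and an: "\<And>d i. d \<in> atlas X \<Longrightarrow> \<gamma> 0 \<in> cdom d \<Longrightarrow> i < cdim X \<Longrightarrow> (\<lambda>t. W t d i) analytic_on {0}"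
  shows "\<And>d k. d \<in> atlas X \<Longrightarrow> \<gamma> 0 \<in> cdom d \<Longrightarrow> k < cdim X \<Longrightarrow> W 0 d k \<noteq> 0 \<Longrightarrow>
      \<forall>\<^sub>F t in nhds 0. line_at (\<gamma> t) (W t) \<in> proj_dom X d k \<and>
        proj_map X d k (line_at (\<gamma> t) (W t)) = pcoord (cdim X) k (cmap d (\<gamma> t)) (W t d)"
    and "W 0 \<noteq> tzero \<Longrightarrow> hol_disc (proj_tangent X) (\<lambda>t. line_at (\<gamma> t) (W t))"
proof -
  show ev: "\<forall>\<^sub>F t in nhds 0. line_at (\<gamma> t) (W t) \<in> proj_dom X d k \<and>
        proj_map X d k (line_at (\<gamma> t) (W t)) = pcoord (cdim X) k (cmap d (\<gamma> t)) (W t d)"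
    if d: "d \<in> atlas X" "\<gamma> 0 \<in> cdom d" and k: "k < cdim X" "W 0 d k \<noteq> 0" for d k
  proof -
    have "isCont (\<lambda>t. W t d k) 0" by (rule analytic_at_imp_isCont[OF an[OF d k(1)]])
    then have "((\<lambda>t. W t d k) \<longlongrightarrow> W 0 d k) (nhds 0)" by (simp add: isCont_def tendsto_nhds_iff)
    then have "\<forall>\<^sub>F t in nhds 0. W t d k \<noteq> 0" using k(2) by (rule tendsto_imp_eventually_ne)
    moreover have "\<forall>\<^sub>F t in nhds 0. \<gamma> t \<in> cdom d" using \<gamma> d by (simp add: hol_disc_def)
    ultimately show ?thesis using W
      by eventually_elim (intro conjI line_at_in_proj_dom proj_map_line_at)
  qed
  have W0: "W 0 \<in> tangent_space X (\<gamma> 0)"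
    by (rule eventually_nhds_x_imp_x[where P = "\<lambda>t. W t \<in> tangent_space X (\<gamma> t)", OF W])
  assume "W 0 \<noteq> tzero"
  then obtain c i where "W 0 c i \<noteq> 0" by (auto simp: tzero_def fun_eq_iff)
  then have ci: "c \<in> atlas X" "\<gamma> 0 \<in> cdom c" "i < cdim X"
    using tangent_outside[OF W0, of c i] tangent_facts(1)[OF W0, of c] unfolding cspace_def mem_Collect_eq
    by (blast, blast, meson not_less)
  show "hol_disc (proj_tangent X) (\<lambda>t. line_at (\<gamma> t) (W t))"
    unfolding hol_disc_def
  proof (intro conjI ballI impI)
    show "line_at (\<gamma> 0) (W 0) \<in> carrier_of (proj_tangent X)"
      unfolding carrier_of_def
    proof (rule UN_I)
      show "(proj_dom X c i, proj_map X c i) \<in> atlas (proj_tangent X)"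
        unfolding proj_tangent_simps using ci by blast
      show "line_at (\<gamma> 0) (W 0) \<in> cdom (proj_dom X c i, proj_map X c i)"
        using line_at_in_proj_dom[OF W0 ci(2) \<open>W 0 c i \<noteq> 0\<close>] by simp
    qed
    fix C assume C: "C \<in> atlas (proj_tangent X)" "line_at (\<gamma> 0) (W 0) \<in> cdom C"
    then obtain d k where d: "C = (proj_dom X d k, proj_map X d k)" "d \<in> atlas X" "k < cdim X" by auto
    then have dk: "\<gamma> 0 \<in> cdom d" "W 0 d k \<noteq> 0" using C(2) by (auto simp: line_at_dom)
    note e = ev[OF d(2) dk(1) d(3) dk(2)]
    show "\<forall>\<^sub>F t in nhds 0. line_at (\<gamma> t) (W t) \<in> cdom C" using e unfolding d(1) by (auto elim: eventually_mono)
    have "adisc (2 * cdim X - 1) (\<lambda>t. pcoord (cdim X) k (cmap d (\<gamma> t)) (W t d))"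
      using \<gamma> d dk by (intro adisc_pcoord an) (auto simp: hol_disc_def)
    moreover have "\<forall>\<^sub>F t in nhds 0. pcoord (cdim X) k (cmap d (\<gamma> t)) (W t d) = cmap C (line_at (\<gamma> t) (W t))"
      using e unfolding d(1) by eventually_elim simp
    ultimately show "adisc (cdim (proj_tangent X)) (\<lambda>t. cmap C (line_at (\<gamma> t) (W t)))"
      by (simp add: adisc_cong_ev)
  qed
qed

section \<open>Transition functions of a projectivised tangent bundle\<close>

lemma hdiff_base_part:
  assumes "i < n"
  shows "\<exists>D. hdiff (2 * n - 1) (\<lambda>Z. base_part n Z i) Z0 D"
proof -
  have "i < 2 * n - 1" using assms by linarith
  from hdiff_coord[OF this, of Z0] show ?thesis using assms by (auto simp: base_part_def)
qed

lemma hdiff_fibre_part: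
  assumes "i < n" "k < n"
  shows "\<exists>D. hdiff (2 * n - 1) (\<lambda>Z. fibre_part n k Z i) Z0 D"
proof -
  consider "i < k" | "i = k" | "i > k" by linarith
  then show ?thesis
  proof cases
    case 1
    then have "n + i < 2 * n - 1" using assms by linarith
    from hdiff_coord[OF this, of Z0] show ?thesis using 1 by (auto simp: fibre_part_def)
  next
    case 2
    then show ?thesis using hdiff_const by (auto simp: fibre_part_def)
  next
    case 3
    then have "n + i - 1 < 2 * n - 1" using assms by linarith
    from hdiff_coord[OF this, of Z0] show ?thesis using 3 assms by (auto simp: fibre_part_def)
  qed
qed

text \<open>The transition functions of the projectivised bundle are quotients of the components of
  \<open>D\<tau>(x) v\<close>, where \<open>\<tau>\<close> is a transition function of the base.\<close>

lemma hdiff_atlas_proj: "hdiff_atlas (proj_tangent X)"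
  unfolding hdiff_atlas_def
proof (intro conjI ballI allI impI)
  fix C assume "C \<in> atlas (proj_tangent X)"
  then obtain c k where C: "C = (proj_dom X c k, proj_map X c k)" "c \<in> atlas X" "k < cdim X" by auto
  show "inj_on (cmap C) (cdom C)" using proj_map_inj[OF C(2,3)] C(1) by simp
  have "proj_img X c \<subseteq> cspace (2 * cdim X - 1)" by (auto simp: proj_img_def)
  then show "cmap C ` cdom C \<subseteq> cspace (cdim (proj_tangent X))"
    using proj_map_image[OF C(2,3)] C(1) by simp
next
  fix C D q i
  assume "C \<in> atlas (proj_tangent X)" "D \<in> atlas (proj_tangent X)" and q: "q \<in> cdom C \<inter> cdom D"
    and i: "i < cdim (proj_tangent X)"
  then obtain c k d l where C: "C = (proj_dom X c k, proj_map X c k)" "c \<in> atlas X" "k < cdim X"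
    and D: "D = (proj_dom X d l, proj_map X d l)" "d \<in> atlas X" "l < cdim X" by auto
  have "q \<in> proj_dom X c k" using q C by simp
  then obtain p v where v: "q = line_at p v" "p \<in> cdom c" "v \<in> tangent_space X p" "v c k \<noteq> 0"
    by (rule proj_domE)
  have dl: "p \<in> cdom d" "v d l \<noteq> 0" using q v(1) D(1) by (auto simp: line_at_dom)
  let ?n = "cdim X" let ?N = "2 * ?n - 1"
  define Z0 where "Z0 = pcoord ?n k (cmap c p) (v c)"
  have CZ: "cmap C q = Z0" using C(1) v proj_map_line_at[of v c k X p, OF v(4)] by (simp add: Z0_def)
  have Zi: "Z0 \<in> proj_img X c" unfolding Z0_def by (rule pcoord_img[OF C(2,3) v(2)])
  have bZ: "base_part ?n Z0 = cmap c p" unfolding Z0_def using chart_facts(3)[OF X C(2) v(2)] by (rule base_part_pcoord)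
  have fZ: "fibre_part ?n k Z0 j = v c j / v c k" for j
    unfolding Z0_def by (rule fibre_part_pcoord[OF tangent_facts(1)[OF v(3) C(2) v(2)] C(3) v(4)])
  define \<tau> where "\<tau> a = (\<lambda>x. cmap d (cinv c x) a)" for a
  define w where "w Z a = (\<Sum>j<?n. d_z j (\<tau> a) (base_part ?n Z) * fibre_part ?n k Z j)" for Z a
  have T: "holo_fn ?n (cmap c ` (cdom c \<inter> cdom d)) (\<tau> a)" if "a < ?n" for a
    unfolding \<tau>_def by (rule chart_facts(6)[OF X C(2) D(2) that])
  have U: "open_cspace ?n (cmap c ` (cdom c \<inter> cdom d))" "cmap c p \<in> cmap c ` (cdom c \<inter> cdom d)"
    using chart_facts(5)[OF X C(2) D(2)] v(2) dl(1) by auto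
  have h\<tau>: "\<exists>E. hdiff ?N (\<lambda>Z. \<tau> a (base_part ?n Z)) Z0 E" if "a < ?n" for a
    by (rule hdiff_comp[where \<Psi> = "base_part ?n" and F = "\<tau> a" and n = ?n, OF hdiff_base_part base_part_cspace])
      (auto simp: bZ intro: hdiff_holo[OF U T[OF that]])
  have hw: "\<exists>E. hdiff ?N (\<lambda>Z. w Z a) Z0 E" if a: "a < ?n" for a
    unfolding w_def
  proof (rule hdiff_sum)
    fix j assume "j \<in> {..<?n}"
    then have j: "j < ?n" by simp
    obtain E0 where E0: "hdiff ?n (d_z j (\<tau> a)) (base_part ?n Z0) E0" using hdiff_d_z[OF U T[OF a] j] bZ by auto
    obtain E where "hdiff ?N (\<lambda>Z. d_z j (\<tau> a) (base_part ?n Z)) Z0 E"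
      using hdiff_comp[where \<Psi> = "base_part ?n" and F = "d_z j (\<tau> a)" and n = ?n, OF hdiff_base_part base_part_cspace E0] by blast
    moreover obtain E' where "hdiff ?N (\<lambda>Z. fibre_part ?n k Z j) Z0 E'" using hdiff_fibre_part[OF j C(3)] by blast
    ultimately show "\<exists>D. hdiff ?N (\<lambda>Z. d_z j (\<tau> a) (base_part ?n Z) * fibre_part ?n k Z j) Z0 D"
      using hdiff_mult by blast
  qed
  have w0: "w Z0 a = v d a / v c k" if "a < ?n" for a
  proof -
    have "w Z0 a = (\<Sum>j<?n. d_z j (\<tau> a) (cmap c p) * v c j) / v c k"
      by (simp add: w_def bZ fZ sum_divide_distrib)
    then show ?thesis using tangent_facts(2)[OF v(3) C(2) v(2) D(2) dl(1) that] by (simp add: \<tau>_def)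
  qed
  have wl: "w Z0 l \<noteq> 0" using w0[OF D(3)] dl(2) v(4) by simp
  have hq: "\<exists>E. hdiff ?N (\<lambda>Z. w Z a / w Z l) Z0 E" if a: "a < ?n" for a
  proof -
    obtain E E' where "hdiff ?N (\<lambda>Z. w Z a) Z0 E" "hdiff ?N (\<lambda>Z. w Z l) Z0 E'" using hw a D(3) by blast
    from hdiff_mult[OF this(1) hdiff_inverse[OF this(2) wl]] show ?thesis unfolding divide_inverse by blast
  qed
  have expr: "\<exists>E. hdiff ?N (\<lambda>Z. pcoord ?n l (\<lambda>a. \<tau> a (base_part ?n Z)) (w Z) i) Z0 E"
  proof -
    consider "i < ?n" | "?n \<le> i" "i < ?n + l" | "?n + l \<le> i" by linarith
    then show ?thesis
    proof cases
      case 1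
      then show ?thesis using h\<tau>[of i] by (simp add: pcoord_def)
    next
      case 2
      then have "i - ?n < ?n" using D(3) by linarith
      from hq[OF this] show ?thesis using 2 by (simp add: pcoord_def)
    next
      case 3
      then have "i - ?n + 1 < ?n" using i by simp
      from hq[OF this] show ?thesis using 3 i by (simp add: pcoord_def)
    qed
  qed
  then obtain E where E: "hdiff ?N (\<lambda>Z. pcoord ?n l (\<lambda>a. \<tau> a (base_part ?n Z)) (w Z) i) Z0 E" by blast
  \<comment> \<open>The explicit formula agrees with the transition function only near the point, so
    the gradient is transferred along each disc separately.\<close>
  have "hdiff ?N (\<lambda>Z. cmap D (cinv C Z) i) Z0 E"
    unfolding hdiff_def
  proof (intro allI impI)
    fix Y assume Y: "adisc ?N Y" "Y 0 = Z0"
    obtain El where El: "hdiff ?N (\<lambda>Z. w Z l) Z0 El" using hw[OF D(3)] by blast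
    have "isCont (\<lambda>t. w (Y t) l) 0"
      using hdiffD(1)[where F = "\<lambda>Z. w Z l" and Y = Y, OF _ Y(1)] El Y(2) by (intro analytic_at_imp_isCont) auto
    then have "((\<lambda>t. w (Y t) l) \<longlongrightarrow> w Z0 l) (nhds 0)" using Y(2) by (simp add: isCont_def tendsto_nhds_iff)
    then have ev1: "\<forall>\<^sub>F t in nhds 0. w (Y t) l \<noteq> 0" using wl by (rule tendsto_imp_eventually_ne)
    have ev2: "\<forall>\<^sub>F t in nhds 0. Y t \<in> proj_img X c"
      using Zi Y(2) by (intro adisc_ev_in[OF Y(1) proj_img_open[OF C(2)]]) simp
    have "adisc ?n (\<lambda>t. base_part ?n (Y t))"
      by (rule adisc_comp[where \<Psi> = "base_part ?n" and N = ?N, OF hdiff_base_part Y(1) base_part_cspace])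
    then have ev3: "\<forall>\<^sub>F t in nhds 0. base_part ?n (Y t) \<in> cmap c ` (cdom c \<inter> cdom d)"
      using U Y(2) bZ by (intro adisc_ev_in[where Y = "\<lambda>t. base_part ?n (Y t)"]) auto
    have "\<forall>\<^sub>F t in nhds 0. pcoord ?n l (\<lambda>a. \<tau> a (base_part ?n (Y t))) (w (Y t)) i = cmap D (cinv C (Y t)) i"
      using ev1 ev2 ev3
    proof eventually_elim
      case (elim t)
      note P = proj_img_point[OF C(2,3) elim(2)]
      define p' where "p' = cinv c (base_part ?n (Y t))"
      define v' where "v' = tvec_of X c p' (fibre_part ?n k (Y t))"
      note P = P[folded p'_def, folded v'_def]
      have pd: "p' \<in> cdom d" using elim(3) chart_facts(4)[OF X C(2)] by (auto simp: p'_def)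
      have wv: "w (Y t) a = v' d a" if "a < ?n" for a
        using tangent_facts(2)[OF P(3) C(2) P(1) D(2) pd that] P(2,4) by (simp add: w_def \<tau>_def)
      have "cinv C (Y t) = line_at p' v'"
        using inv_into_f_f[OF proj_map_inj[OF C(2,3)] P(5)] P(6) by (simp add: C(1))
      moreover have "v' d l \<noteq> 0" using wv[OF D(3)] elim(1) by simp
      ultimately have "cmap D (cinv C (Y t)) = pcoord ?n l (cmap d p') (v' d)"
        by (simp add: D(1) proj_map_line_at)
      moreover have "pcoord ?n l (\<lambda>a. \<tau> a (base_part ?n (Y t))) (w (Y t)) i = pcoord ?n l (cmap d p') (v' d) i"
        using wv D(3) i by (auto simp: pcoord_def \<tau>_def p'_def)
      ultimately show ?case by simp
    qed
    from analytic_at_cong_ev[where f = "\<lambda>t. pcoord ?n l (\<lambda>a. \<tau> a (base_part ?n (Y t))) (w (Y t)) i" and g = "\<lambda>t. cmap D (cinv C (Y t)) i" and z = 0, OF this]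
    show "(\<lambda>t. cmap D (cinv C (Y t)) i) analytic_on {0} \<and>
      ((\<lambda>t. cmap D (cinv C (Y t)) i) has_field_derivative (\<Sum>j<?N. E j * deriv (\<lambda>t. Y t j) 0)) (at 0)"
      using hdiffD[where F = "\<lambda>Z. pcoord ?n l (\<lambda>a. \<tau> a (base_part ?n Z)) (w Z) i" and Y = Y and D = E and n = ?N] E Y
        analytic_at_has_deriv[of "\<lambda>t. cmap D (cinv C (Y t)) i" 0] by simp
  qed
  then show "\<exists>E. hdiff (cdim (proj_tangent X)) (\<lambda>Z. cmap D (cinv C Z) i) (cmap C q) E"
    using CZ by auto
qed

end

section \<open>Metrics on the tautological bundles\<close>

lemma tangent_space_add:
  assumes "u \<in> tangent_space X p" "v \<in> tangent_space X p"
  shows "tadd u v \<in> tangent_space X p"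
  unfolding tangent_space_def mem_Collect_eq
proof (intro conjI allI impI ballI)
  fix c assume "c \<in> atlas X \<and> p \<in> cdom c"
  then show "tadd u v c \<in> cspace (cdim X)"
    using tangent_facts(1)[OF assms(1), of c] tangent_facts(1)[OF assms(2), of c] by (simp add: tadd_def cspace_def)
next
  fix c assume "\<not> (c \<in> atlas X \<and> p \<in> cdom c)"
  then show "tadd u v c = (\<lambda>i. 0)"
    using tangent_outside[OF assms(1)] tangent_outside[OF assms(2)] by (simp add: tadd_def fun_eq_iff)
next
  fix c d i assume "c \<in> atlas X" "d \<in> atlas X" "p \<in> cdom c \<inter> cdom d" "i < cdim X"
  then show "tadd u v d i = (\<Sum>j<cdim X. d_z j (\<lambda>x. cmap d (cinv c x) i) (cmap c p) * tadd u v c j)"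
    using tangent_facts(2)[OF assms(1), of c d i] tangent_facts(2)[OF assms(2), of c d i]
    by (simp add: tadd_def distrib_left sum.distrib)
qed

lemma cotangent_lincomb:
  assumes "\<alpha> \<in> cotangent_space X p" "\<beta> \<in> cotangent_space X p"
  shows "(\<lambda>v. a * \<alpha> v + b * \<beta> v) \<in> cotangent_space X p"
  using assms unfolding cotangent_space_def by (simp add: algebra_simps)

lemma coord_form_cotangent: "coord_form X c k p \<in> cotangent_space X p"
  unfolding cotangent_space_def coord_form_def
  by (auto simp: tangent_space_add tangent_space_scale) (simp_all add: tadd_def tscale_def)

lemma taut_sub_line_at:
  assumes v: "v \<in> tangent_space X p"
  shows "taut_sub X (line_at p v) = {\<alpha> \<in> cotangent_space X p. \<alpha> v = 0}"
proof -
  have "(\<forall>w\<in>range (\<lambda>a. tscale a v). \<alpha> w = 0) \<longleftrightarrow> \<alpha> v = 0" if "\<alpha> \<in> cotangent_space X p" for \<alpha>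
  proof
    have "\<alpha> (tscale a v) = a * \<alpha> v" for a using that v by (simp add: cotangent_space_def)
    then show "\<alpha> v = 0 \<Longrightarrow> \<forall>w\<in>range (\<lambda>a. tscale a v). \<alpha> w = 0" by auto
    assume "\<forall>w\<in>range (\<lambda>a. tscale a v). \<alpha> w = 0"
    moreover have "v \<in> range (\<lambda>a. tscale a v)" by (rule range_eqI[of _ _ 1]) simp
    ultimately show "\<alpha> v = 0" by blast
  qed
  then show ?thesis by (auto simp: taut_sub_def line_at_def)
qed

lemma taut_coset_subset:
  assumes v: "v \<in> tangent_space X p" and "\<alpha> \<in> cotangent_space X p" "\<beta> \<in> cotangent_space X p" "\<alpha> v = \<beta> v"
  shows "taut_coset X (line_at p v) \<alpha> \<subseteq> taut_coset X (line_at p v) \<beta>"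
proof
  fix \<omega> assume "\<omega> \<in> taut_coset X (line_at p v) \<alpha>"
  then obtain s where s: "\<omega> = (\<lambda>w. \<alpha> w + s w)" "s \<in> cotangent_space X p" "s v = 0"
    by (auto simp: taut_coset_def taut_sub_line_at[OF v])
  define r where "r = (\<lambda>w. 1 * (1 * \<alpha> w + (-1) * \<beta> w) + 1 * s w)"
  have "r \<in> cotangent_space X p" unfolding r_def by (intro cotangent_lincomb[where \<alpha> = "\<lambda>w. 1 * \<alpha> w + (-1) * \<beta> w"] cotangent_lincomb assms s)
  moreover have "r v = 0" using assms(4) s(3) by (simp add: r_def)
  moreover have "\<omega> = (\<lambda>w. \<beta> w + r w)" using s(1) by (simp add: r_def fun_eq_iff)
  ultimately show "\<omega> \<in> taut_coset X (line_at p v) \<beta>"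
    by (auto simp: taut_coset_def taut_sub_line_at[OF v])
qed

text \<open>Evaluation at \<open>v\<close> identifies the fibre of the quotient over the line of
  \<open>v\<close> with the complex numbers; statements about cosets are reduced to this.\<close>

lemma taut_coset_eq_iff:
  assumes v: "v \<in> tangent_space X p" and \<alpha>: "\<alpha> \<in> cotangent_space X p" and \<beta>: "\<beta> \<in> cotangent_space X p"
  shows "taut_coset X (line_at p v) \<alpha> = taut_coset X (line_at p v) \<beta> \<longleftrightarrow> \<alpha> v = \<beta> v"
proof
  assume "taut_coset X (line_at p v) \<alpha> = taut_coset X (line_at p v) \<beta>"
  moreover have "(\<lambda>w. 0) \<in> taut_sub X (line_at p v)"
    unfolding taut_sub_line_at[OF v] using cotangent_lincomb[OF \<alpha> \<alpha>, of 0 0] by simp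
  then have "\<alpha> \<in> taut_coset X (line_at p v) \<alpha>" by (auto simp: taut_coset_def intro!: exI[of _ "\<lambda>w. 0"])
  ultimately have "\<alpha> \<in> taut_coset X (line_at p v) \<beta>" by simp
  then show "\<alpha> v = \<beta> v" by (auto simp: taut_coset_def taut_sub_line_at[OF v])
next
  assume e: "\<alpha> v = \<beta> v"
  show "taut_coset X (line_at p v) \<alpha> = taut_coset X (line_at p v) \<beta>"
    using taut_coset_subset[OF v \<alpha> \<beta> e] taut_coset_subset[OF v \<beta> \<alpha> e[symmetric]] by blast
qed

text \<open>\<open>scale\<close> takes a union over all representatives of the coset. They agree at
  \<open>v\<close>, so all members of the union are the same coset.\<close>

lemma taut_coset_scale:
  assumes v: "v \<in> tangent_space X p" and \<alpha>: "\<alpha> \<in> cotangent_space X p"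
  shows "scale (O_cotangent_1 X) (line_at p v) a (taut_coset X (line_at p v) \<alpha>) = taut_coset X (line_at p v) (\<lambda>w. a * \<alpha> w)"
proof -
  have s: "(\<lambda>w. a * \<beta> w) \<in> cotangent_space X p" if "\<beta> \<in> cotangent_space X p" for \<beta>
    using cotangent_lincomb[OF that that, of a 0] by simp
  have "taut_coset X (line_at p v) (\<lambda>w. a * \<beta> w) = taut_coset X (line_at p v) (\<lambda>w. a * \<alpha> w)"
    if \<beta>: "\<beta> \<in> taut_coset X (line_at p v) \<alpha>" for \<beta>
  proof -
    obtain s where 1: "\<beta> = (\<lambda>w. \<alpha> w + s w)" "s \<in> cotangent_space X p" "s v = 0"
      using \<beta> by (auto simp: taut_coset_def taut_sub_line_at[OF v])
    have bc: "\<beta> \<in> cotangent_space X p" using cotangent_lincomb[OF \<alpha> 1(2), of 1 1] 1(1) by simp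
    have "a * \<beta> v = a * \<alpha> v" using 1(3) by (simp add: 1(1))
    then show ?thesis by (rule iffD2[OF taut_coset_eq_iff[OF v s[OF bc] s[OF \<alpha>]]])
  qed
  moreover have "(\<lambda>w. 0) \<in> taut_sub X (line_at p v)"
    unfolding taut_sub_line_at[OF v] using cotangent_lincomb[OF \<alpha> \<alpha>, of 0 0] by simp
  then have "\<alpha> \<in> taut_coset X (line_at p v) \<alpha>" by (auto simp: taut_coset_def intro!: exI[of _ "\<lambda>w. 0"])
  then have "taut_coset X (line_at p v) \<alpha> \<noteq> {}" by blast
  ultimately show ?thesis unfolding O_cotangent_1_def line_bundle.simps by (intro SUP_eq_const)
qed

lemma cotangent_scale: "\<alpha> \<in> cotangent_space X p \<Longrightarrow> (\<lambda>w. a * \<alpha> w) \<in> cotangent_space X p"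
  using cotangent_lincomb[of \<alpha> X p \<alpha> a 0] by simp

definition cot_frame :: "'a cmanifold \<Rightarrow> 'a chart \<Rightarrow> nat \<Rightarrow> 'a \<times> 'a tvec set \<Rightarrow> ('a tvec \<Rightarrow> complex) set" where
  "cot_frame X c k = (\<lambda>q. taut_coset X q (coord_form X c k (fst q)))"

text \<open>At \<open>v\<close> the two coordinate forms take the values \<open>v c k\<close> and
  \<open>v d l\<close>, and the value at \<open>v\<close> determines the coset.\<close>

lemma cot_frame_change:
  assumes v: "v \<in> tangent_space X p" "v d l \<noteq> 0"
  shows "cot_frame X c k (line_at p v) = scale (O_cotangent_1 X) (line_at p v) (v c k / v d l) (cot_frame X d l (line_at p v))"
proof -
  have fst: "fst (line_at p v) = p" by (simp add: line_at_def)
  have "coord_form X c k p v = (v c k / v d l) * coord_form X d l p v" using v by (simp add: coord_form_def)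
  then have "cot_frame X c k (line_at p v) = taut_coset X (line_at p v) (\<lambda>w. (v c k / v d l) * coord_form X d l p w)"
    unfolding cot_frame_def fst
    by (intro iffD2[OF taut_coset_eq_iff[OF v(1) coord_form_cotangent cotangent_scale[OF coord_form_cotangent]]])
  then show ?thesis
    unfolding cot_frame_def fst by (simp only: taut_coset_scale[OF v(1) coord_form_cotangent])
qed

lemma cot_frame_in_frames:
  assumes "c \<in> atlas X" "k < cdim X"
  shows "(proj_dom X c k, cot_frame X c k) \<in> frames (O_cotangent_1 X)"
  using assms unfolding O_cotangent_1_def cot_frame_def line_bundle.simps by blast

lemma cot_frame_fibre: "cot_frame X c k q \<in> fibre (O_cotangent_1 X) q"
  by (auto simp: cot_frame_def O_cotangent_1_def coord_form_cotangent)

text \<open>The frame that \<open>dual_bundle\<close> derives from \<open>cot_frame\<close>. By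
  \<open>dual_frame_value\<close> it is evaluation at \<open>tscale (1 / v c k) v\<close>, the usual
  local section of the tautological line subbundle.\<close>

definition dual_frame :: "'a cmanifold \<Rightarrow> 'a chart \<Rightarrow> nat \<Rightarrow> 'a \<times> 'a tvec set \<Rightarrow> ('a tvec \<Rightarrow> complex) set \<Rightarrow> complex" where
  "dual_frame X c k = (\<lambda>q A. if A \<in> fibre (O_cotangent_1 X) q then (THE a. A = scale (O_cotangent_1 X) q a (cot_frame X c k q)) else 0)"

lemma dual_frame_value:
  assumes v: "v \<in> tangent_space X p" "v c k \<noteq> 0" and \<beta>: "\<beta> \<in> cotangent_space X p"
  shows "dual_frame X c k (line_at p v) (taut_coset X (line_at p v) \<beta>) = \<beta> v / v c k"
proof -
  have fst: "fst (line_at p v) = p" by (simp add: line_at_def)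
  have "taut_coset X (line_at p v) \<beta> \<in> fibre (O_cotangent_1 X) (line_at p v)"
    using \<beta> by (auto simp: O_cotangent_1_def fst)
  moreover have "taut_coset X (line_at p v) \<beta> = scale (O_cotangent_1 X) (line_at p v) a (cot_frame X c k (line_at p v)) \<longleftrightarrow> a = \<beta> v / v c k" for a
  proof -
    have "scale (O_cotangent_1 X) (line_at p v) a (cot_frame X c k (line_at p v)) = taut_coset X (line_at p v) (\<lambda>w. a * coord_form X c k p w)"
      unfolding cot_frame_def fst by (rule taut_coset_scale[OF v(1) coord_form_cotangent])
    moreover have "taut_coset X (line_at p v) \<beta> = taut_coset X (line_at p v) (\<lambda>w. a * coord_form X c k p w) \<longleftrightarrow> \<beta> v = a * v c k"
      using taut_coset_eq_iff[OF v(1) \<beta> cotangent_scale[OF coord_form_cotangent[of X c k p], of a]] v(1) by (simp add: coord_form_def)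
    ultimately show ?thesis using v(2) by (simp add: field_simps) metis
  qed
  ultimately show ?thesis by (simp add: dual_frame_def)
qed

lemma dual_frame_change:
  assumes v: "v \<in> tangent_space X p" "v c k \<noteq> 0" "v d l \<noteq> 0"
  shows "dual_frame X c k (line_at p v) = scale (O_cotangent_minus1 X) (line_at p v) (v d l / v c k) (dual_frame X d l (line_at p v))"
    "dual_frame X d l (line_at p v) \<in> fibre (O_cotangent_minus1 X) (line_at p v)"
proof -
  have fst: "fst (line_at p v) = p" by (simp add: line_at_def)
  have fib: "fibre (O_cotangent_1 X) (line_at p v) = taut_coset X (line_at p v) ` cotangent_space X p"
    by (simp add: O_cotangent_1_def fst)
  have out: "dual_frame X c k (line_at p v) A = 0" if "A \<notin> taut_coset X (line_at p v) ` cotangent_space X p" for c k A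
    using that by (simp add: dual_frame_def fib)
  show "dual_frame X c k (line_at p v) = scale (O_cotangent_minus1 X) (line_at p v) (v d l / v c k) (dual_frame X d l (line_at p v))"
  proof
    fix A
    show "dual_frame X c k (line_at p v) A = scale (O_cotangent_minus1 X) (line_at p v) (v d l / v c k) (dual_frame X d l (line_at p v)) A"
    proof (cases "A \<in> taut_coset X (line_at p v) ` cotangent_space X p")
      case True
      then obtain \<beta> where "A = taut_coset X (line_at p v) \<beta>" "\<beta> \<in> cotangent_space X p" by blast
      then show ?thesis using v dual_frame_value[OF v(1)] by (simp add: O_cotangent_minus1_def dual_bundle_def)
    next
      case False
      then show ?thesis using out by (simp add: O_cotangent_minus1_def dual_bundle_def)
    qed
  qed
  have "dual_frame X d l (line_at p v) (scale (O_cotangent_1 X) (line_at p v) a A) = a * dual_frame X d l (line_at p v) A"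
    if A: "A \<in> taut_coset X (line_at p v) ` cotangent_space X p" for a A
  proof -
    obtain \<beta> where "A = taut_coset X (line_at p v) \<beta>" "\<beta> \<in> cotangent_space X p" using A by blast
    then show ?thesis using v
      by (simp add: taut_coset_scale dual_frame_value[OF v(1,3)] cotangent_scale)
  qed
  then show "dual_frame X d l (line_at p v) \<in> fibre (O_cotangent_minus1 X) (line_at p v)"
    using out by (auto simp: O_cotangent_minus1_def dual_bundle_def fib)
qed

text \<open>In the trivialisation \<open>v\<^sub>k = 1\<close> the metric \<open>\<bar>v\<bar>\<^sup>2\<close> on \<open>O(-1)\<close> is \<open>exp (\<kappa> c k)\<close>; the case \<open>s = -1\<close>
  describes metrics on \<open>O(1)\<close>.\<close>

definition log_metric :: "'a cmanifold \<Rightarrow> real \<Rightarrow> ('a chart \<Rightarrow> nat \<Rightarrow> (nat \<Rightarrow> complex) \<Rightarrow> real) \<Rightarrow> bool" where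
  "log_metric X s \<kappa> \<longleftrightarrow>
     (\<forall>c\<in>atlas X. \<forall>k<cdim X. C_k (Suc (Suc 0)) (2 * cdim X - 1) (proj_img X c) (\<lambda>Z. of_real (\<kappa> c k Z))) \<and>
     (\<forall>p v c d k l. c \<in> atlas X \<longrightarrow> d \<in> atlas X \<longrightarrow> k < cdim X \<longrightarrow> l < cdim X \<longrightarrow> p \<in> cdom c \<longrightarrow> p \<in> cdom d \<longrightarrow>
        v \<in> tangent_space X p \<longrightarrow> v c k \<noteq> 0 \<longrightarrow> v d l \<noteq> 0 \<longrightarrow>
        \<kappa> c k (pcoord (cdim X) k (cmap c p) (v c)) + s * ln ((cmod (v c k))\<^sup>2) =
        \<kappa> d l (pcoord (cdim X) l (cmap d p) (v d)) + s * ln ((cmod (v d l))\<^sup>2))"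

abbreviation proj_chart :: "'a cmanifold \<Rightarrow> 'a chart \<Rightarrow> nat \<Rightarrow> ('a \<times> 'a tvec set) chart" where
  "proj_chart X c k \<equiv> (proj_dom X c k, proj_map X c k)"

section \<open>Bundle metrics as potentials in charts\<close>

lemma log_metricI:
  assumes X: "complex_manifold X" and h: "bundle_metric (proj_tangent X) L h"
    and fr: "\<And>c k. c \<in> atlas X \<Longrightarrow> k < cdim X \<Longrightarrow> (proj_dom X c k, e c k) \<in> frames L"
    and ch: "\<And>p v c d k l. c \<in> atlas X \<Longrightarrow> d \<in> atlas X \<Longrightarrow> k < cdim X \<Longrightarrow> l < cdim X \<Longrightarrow> p \<in> cdom c \<Longrightarrow> p \<in> cdom d \<Longrightarrow>
        v \<in> tangent_space X p \<Longrightarrow> v c k \<noteq> 0 \<Longrightarrow> v d l \<noteq> 0 \<Longrightarrow>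
        ln (h (line_at p v) (e c k (line_at p v))) + s * ln ((cmod (v c k))\<^sup>2) =
        ln (h (line_at p v) (e d l (line_at p v))) + s * ln ((cmod (v d l))\<^sup>2)"
  shows "log_metric X s (\<lambda>c k Z. ln (h (cinv (proj_chart X c k) Z) (e c k (cinv (proj_chart X c k) Z))))"
  unfolding log_metric_def
proof (intro conjI ballI allI impI)
  fix c k assume c: "c \<in> atlas X" and k: "k < cdim X"
  have hb: "\<And>q. q \<in> proj_dom X c k \<Longrightarrow> h q (e c k q) > 0"
    "\<forall>C\<in>atlas (proj_tangent X). smooth_fn (cdim (proj_tangent X)) (cmap C ` (cdom C \<inter> proj_dom X c k))
           (\<lambda>x. of_real (h (cinv C x) (e c k (cinv C x))))"
    using h fr[OF c k] unfolding bundle_metric_def by blast+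
  have "proj_chart X c k \<in> atlas (proj_tangent X)" unfolding proj_tangent_simps using c k by blast
  from bspec[OF hb(2) this] have "smooth_fn (2 * cdim X - 1) (proj_img X c)
      (\<lambda>x. of_real (h (cinv (proj_chart X c k) x) (e c k (cinv (proj_chart X c k) x))))"
    by (simp add: proj_map_image[OF X c k])
  moreover have "cinv (proj_chart X c k) Z \<in> proj_dom X c k" if "Z \<in> proj_img X c" for Z
    using that cmap_cinv(2)[of Z "proj_chart X c k"] proj_map_image[OF X c k] by simp
  ultimately show "C_k (Suc (Suc 0)) (2 * cdim X - 1) (proj_img X c)
      (\<lambda>Z. of_real (ln (h (cinv (proj_chart X c k) Z) (e c k (cinv (proj_chart X c k) Z)))))"
    using hb(1) by (intro C2_ln proj_img_open[OF X c]) (auto simp: smooth_fn_def simp del: C_k.simps)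
next
  fix p v c d k l
  assume a: "c \<in> atlas X" "d \<in> atlas X" "k < cdim X" "l < cdim X" "p \<in> cdom c" "p \<in> cdom d"
        "v \<in> tangent_space X p" "v c k \<noteq> 0" "v d l \<noteq> 0"
  show "ln (h (cinv (proj_chart X c k) (pcoord (cdim X) k (cmap c p) (v c))) (e c k (cinv (proj_chart X c k) (pcoord (cdim X) k (cmap c p) (v c)))))
       + s * ln ((cmod (v c k))\<^sup>2) =
     ln (h (cinv (proj_chart X d l) (pcoord (cdim X) l (cmap d p) (v d))) (e d l (cinv (proj_chart X d l) (pcoord (cdim X) l (cmap d p) (v d)))))
       + s * ln ((cmod (v d l))\<^sup>2)"
    unfolding proj_cinv[OF X a(1,3,7,5,8)] proj_cinv[OF X a(2,4,7,6,9)] by (rule ch[OF a])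
qed

lemma line_at_carrier:
  assumes "c \<in> atlas X" "k < cdim X" "p \<in> cdom c" "v \<in> tangent_space X p" "v c k \<noteq> 0"
  shows "line_at p v \<in> carrier_of (proj_tangent X)"
  unfolding carrier_of_def
proof (rule UN_I)
  show "proj_chart X c k \<in> atlas (proj_tangent X)" unfolding proj_tangent_simps using assms by blast
  show "line_at p v \<in> cdom (proj_chart X c k)" using line_at_in_proj_dom assms by simp
qed

lemma ln_cmod_ratio:
  assumes "h = (cmod (a / b))\<^sup>2 * h'" "h' > 0" "a \<noteq> 0" "b \<noteq> 0"
  shows "ln h + ln ((cmod b)\<^sup>2) = ln h' + ln ((cmod a)\<^sup>2)"
  using assms by (simp add: ln_mult norm_divide ln_div power_divide)

text \<open>The curvature is minus the Levi form of the logarithm of the metric on a frame, so a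
  positive direction of the curvature is a negative direction of the potential.\<close>

lemma RC_positive_log_metric:
  assumes X: "complex_manifold X" and RC: "RC_positive (proj_tangent X) (O_cotangent_minus1 X)"
  obtains \<kappa> where "log_metric X 1 \<kappa>"
    "\<And>c k Z. c \<in> atlas X \<Longrightarrow> k < cdim X \<Longrightarrow> Z \<in> proj_img X c \<Longrightarrow>
       \<exists>u\<in>cspace (2 * cdim X - 1). Re (levi (2 * cdim X - 1) (\<lambda>Z. of_real (\<kappa> c k Z)) Z u) < 0"
proof -
  obtain h where h: "bundle_metric (proj_tangent X) (O_cotangent_minus1 X) h"
    and pos: "\<forall>q\<in>carrier_of (proj_tangent X). \<exists>u\<in>tangent_space (proj_tangent X) q.
        \<forall>C\<in>atlas (proj_tangent X). \<forall>(V, e)\<in>frames (O_cotangent_minus1 X). q \<in> cdom C \<inter> V \<longrightarrow> curvature (proj_tangent X) h C e q u > 0"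
    using RC unfolding RC_positive_def by blast
  have fr: "(proj_dom X c k, dual_frame X c k) \<in> frames (O_cotangent_minus1 X)" if "c \<in> atlas X" "k < cdim X" for c k
  proof -
    have "(proj_dom X c k, cot_frame X c k) \<in> frames (O_cotangent_1 X)"
      by (rule cot_frame_in_frames[OF that])
    then show ?thesis
      unfolding O_cotangent_minus1_def dual_bundle_def dual_frame_def line_bundle.simps by blast
  qed
  define \<kappa> where "\<kappa> = (\<lambda>c k Z. ln (h (cinv (proj_chart X c k) Z) (dual_frame X c k (cinv (proj_chart X c k) Z))))"
  show ?thesis
  proof (rule that[of \<kappa>])
    show "log_metric X 1 \<kappa>"
      unfolding \<kappa>_def
    proof (rule log_metricI[OF X h fr])
      fix p v c d k l
      assume a: "c \<in> atlas X" "d \<in> atlas X" "k < cdim X" "l < cdim X" "p \<in> cdom c" "p \<in> cdom d"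
        "v \<in> tangent_space X p" "v c k \<noteq> 0" "v d l \<noteq> 0"
      note dc = dual_frame_change[OF a(7-9)]
      have "h (line_at p v) (dual_frame X c k (line_at p v)) = (cmod (v d l / v c k))\<^sup>2 * h (line_at p v) (dual_frame X d l (line_at p v))"
        unfolding dc(1) using h line_at_carrier[OF a(1,3,5,7,8)] dc(2) unfolding bundle_metric_def by blast
      moreover have "h (line_at p v) (dual_frame X d l (line_at p v)) > 0"
        using h fr[OF a(2,4)] line_at_in_proj_dom[OF a(7,6,9)] unfolding bundle_metric_def by blast
      ultimately show "ln (h (line_at p v) (dual_frame X c k (line_at p v))) + 1 * ln ((cmod (v c k))\<^sup>2) =
        ln (h (line_at p v) (dual_frame X d l (line_at p v))) + 1 * ln ((cmod (v d l))\<^sup>2)"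
        using ln_cmod_ratio a(8,9) by simp
    qed
    fix c k Z assume c: "c \<in> atlas X" and k: "k < cdim X" and Z: "Z \<in> proj_img X c"
    define q where "q = line_at (cinv c (base_part (cdim X) Z)) (tvec_of X c (cinv c (base_part (cdim X) Z)) (fibre_part (cdim X) k Z))"
    note P = proj_img_point[OF X c k Z, folded q_def]
    have C: "proj_chart X c k \<in> atlas (proj_tangent X)" unfolding proj_tangent_simps using c k by blast
    have "q \<in> carrier_of (proj_tangent X)" using C P(5) unfolding carrier_of_def by force
    then obtain u where u: "u \<in> tangent_space (proj_tangent X) q"
      "curvature (proj_tangent X) h (proj_chart X c k) (dual_frame X c k) q u > 0"
      using pos C fr[OF c k] P(5) by fastforce
    have "u (proj_chart X c k) \<in> cspace (2 * cdim X - 1)"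
      using tangent_facts(1)[OF u(1) C] P(5) by simp
    moreover have "Re (levi (2 * cdim X - 1) (\<lambda>Z. of_real (\<kappa> c k Z)) Z (u (proj_chart X c k))) < 0"
      using u(2) P(6) by (simp add: curvature_def \<kappa>_def)
    ultimately show "\<exists>u\<in>cspace (2 * cdim X - 1). Re (levi (2 * cdim X - 1) (\<lambda>Z. of_real (\<kappa> c k Z)) Z u) < 0" by blast
  qed
qed

text \<open>The sign in the curvature turns the lower bound of nefness into an upper bound for the
  Levi form of the potential. The potential belongs to \<open>O(1)\<close>, hence the parameter -1
  of \<open>log_metric\<close>.\<close>

lemma nef_log_metric:
  assumes X: "complex_manifold X" and nef: "nef (proj_tangent X) g (O_cotangent_1 X)" and eps: "\<epsilon> > 0"
  obtains \<kappa> where "log_metric X (-1) \<kappa>"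
    "\<And>c k q u. c \<in> atlas X \<Longrightarrow> k < cdim X \<Longrightarrow> q \<in> proj_dom X c k \<Longrightarrow> u \<in> tangent_space (proj_tangent X) q \<Longrightarrow>
       Re (levi (2 * cdim X - 1) (\<lambda>Z. of_real (\<kappa> c k Z)) (proj_map X c k q) (u (proj_chart X c k))) \<le> \<epsilon> * Re (g q u u)"
proof -
  obtain h where h: "bundle_metric (proj_tangent X) (O_cotangent_1 X) h"
    and pos: "\<forall>q\<in>carrier_of (proj_tangent X). \<forall>u\<in>tangent_space (proj_tangent X) q.
        \<forall>C\<in>atlas (proj_tangent X). \<forall>(V, e)\<in>frames (O_cotangent_1 X). q \<in> cdom C \<inter> V \<longrightarrow>
          curvature (proj_tangent X) h C e q u \<ge> - \<epsilon> * Re (g q u u)"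
    using nef eps unfolding nef_def by blast
  have fr: "(proj_dom X c k, cot_frame X c k) \<in> frames (O_cotangent_1 X)" if "c \<in> atlas X" "k < cdim X" for c k
    by (rule cot_frame_in_frames[OF that])
  define \<kappa> where "\<kappa> = (\<lambda>c k Z. ln (h (cinv (proj_chart X c k) Z) (cot_frame X c k (cinv (proj_chart X c k) Z))))"
  show ?thesis
  proof (rule that[of \<kappa>])
    show "log_metric X (-1) \<kappa>"
      unfolding \<kappa>_def
    proof (rule log_metricI[OF X h fr])
      fix p v c d k l
      assume a: "c \<in> atlas X" "d \<in> atlas X" "k < cdim X" "l < cdim X" "p \<in> cdom c" "p \<in> cdom d"
        "v \<in> tangent_space X p" "v c k \<noteq> 0" "v d l \<noteq> 0"
      note dc = cot_frame_change[OF a(7,9), of c k]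
      have "h (line_at p v) (cot_frame X c k (line_at p v)) = (cmod (v c k / v d l))\<^sup>2 * h (line_at p v) (cot_frame X d l (line_at p v))"
        unfolding dc using h line_at_carrier[OF a(1,3,5,7,8)] cot_frame_fibre unfolding bundle_metric_def by blast
      moreover have "h (line_at p v) (cot_frame X d l (line_at p v)) > 0"
        using h fr[OF a(2,4)] line_at_in_proj_dom[OF a(7,6,9)] unfolding bundle_metric_def by blast
      ultimately show "ln (h (line_at p v) (cot_frame X c k (line_at p v))) + - 1 * ln ((cmod (v c k))\<^sup>2) =
        ln (h (line_at p v) (cot_frame X d l (line_at p v))) + - 1 * ln ((cmod (v d l))\<^sup>2)"
        using ln_cmod_ratio[of "h (line_at p v) (cot_frame X c k (line_at p v))" "v c k" "v d l"] a(8,9) by simp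
    qed
    fix c k q u assume c: "c \<in> atlas X" and k: "k < cdim X" and q: "q \<in> proj_dom X c k" and u: "u \<in> tangent_space (proj_tangent X) q"
    have C: "proj_chart X c k \<in> atlas (proj_tangent X)" unfolding proj_tangent_simps using c k by blast
    have "q \<in> carrier_of (proj_tangent X)" using C q unfolding carrier_of_def by force
    then have "curvature (proj_tangent X) h (proj_chart X c k) (cot_frame X c k) q u \<ge> - \<epsilon> * Re (g q u u)"
      using pos C fr[OF c k] q u by fastforce
    then show "Re (levi (2 * cdim X - 1) (\<lambda>Z. of_real (\<kappa> c k Z)) (proj_map X c k q) (u (proj_chart X c k))) \<le> \<epsilon> * Re (g q u u)"
      by (simp add: curvature_def \<kappa>_def)
  qed
qed

section \<open>Compactness\<close>

text \<open>By Tychonoff's theorem: the set is a product of closed discs and, from index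
  \<open>n\<close> on, of points.\<close>

lemma compact_cspace_box: "compact {x \<in> cspace n. \<forall>i<n. cmod (x i - a i) \<le> r i}"
proof -
  define B where "B i = (if i < n then cball (a i) (r i) else {0})" for i
  have "compactin (product_topology (\<lambda>i. euclidean) UNIV) (\<Pi>\<^sub>E i\<in>UNIV. B i)"
    by (simp add: compactin_PiE B_def)
  then have "compact (\<Pi>\<^sub>E i\<in>UNIV. B i)" by (simp add: euclidean_product_topology)
  moreover have "(\<Pi>\<^sub>E i\<in>UNIV. B i) = {x \<in> cspace n. \<forall>i<n. cmod (x i - a i) \<le> r i}"
    unfolding B_def cspace_def
    by (auto simp: PiE_iff dist_norm norm_minus_commute Ball_def split: if_splits)
  ultimately show ?thesis by simp
qed

text \<open>A sum of squared moduli rather than a maximum, because it also enters the test function,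
  where its Laplacian along a disc is computed.\<close>

definition sqdist :: "nat \<Rightarrow> (nat \<Rightarrow> complex) \<Rightarrow> (nat \<Rightarrow> complex) \<Rightarrow> real" where
  "sqdist n x a = (\<Sum>j<n. (cmod (x j - a j))\<^sup>2)"

lemma sqdist_nonneg: "sqdist n x a \<ge> 0"
  by (simp add: sqdist_def sum_nonneg)

lemma continuous_sqdist: "continuous_on S (\<lambda>x. sqdist n x a)"
  unfolding sqdist_def
  by (intro continuous_intros continuous_on_subset[OF continuous_on_product_coordinates]) auto

lemma sqdist_component:
  assumes "sqdist n x a \<le> r\<^sup>2" "r \<ge> 0" "j < n"
  shows "cmod (x j - a j) \<le> r"
proof -
  have "(cmod (x j - a j))\<^sup>2 \<le> sqdist n x a"
    unfolding sqdist_def by (rule member_le_sum) (use assms in auto)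
  then show ?thesis using assms by (meson order_trans power2_le_imp_le)
qed

definition cs_ball :: "nat \<Rightarrow> (nat \<Rightarrow> complex) \<Rightarrow> real \<Rightarrow> (nat \<Rightarrow> complex) set" where
  "cs_ball n a r = {x \<in> cspace n. sqdist n x a \<le> r\<^sup>2}"

lemma compact_cs_ball:
  assumes "r > 0"
  shows "compact (cs_ball n a r)"
proof -
  have "cs_ball n a r = {x \<in> cspace n. \<forall>i<n. cmod (x i - a i) \<le> r} \<inter> {x. sqdist n x a \<le> r\<^sup>2}"
    using sqdist_component assms by (auto simp: cs_ball_def)
  moreover have "closed {x. sqdist n x a \<le> r\<^sup>2}"
    by (intro closed_Collect_le continuous_sqdist continuous_intros)
  ultimately show ?thesis using compact_cspace_box by (simp add: compact_Int_closed)
qed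

type_synonym 'a patch = "'a chart \<times> (nat \<Rightarrow> complex) \<times> real"

definition is_patch :: "'a cmanifold \<Rightarrow> 'a patch \<Rightarrow> bool" where
  "is_patch X P \<longleftrightarrow> (case P of (c, a, r) \<Rightarrow> c \<in> atlas X \<and> r > 0 \<and> cs_ball (cdim X) a r \<subseteq> cmap c ` cdom c)"

text \<open>The balls of half the radius already cover; this margin later keeps a maximum of the
  test function away from the rim of its patch.\<close>

lemma finite_patches:
  assumes X: "complex_manifold X" and comp: "compact_space (mtop X)"
  obtains I where "finite I" "\<And>P. P \<in> I \<Longrightarrow> is_patch X P"
    "\<And>p. p \<in> carrier_of X \<Longrightarrow> \<exists>(c, a, r)\<in>I. p \<in> cdom c \<and> sqdist (cdim X) (cmap c p) a < r\<^sup>2 / 4"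
proof -
  let ?n = "cdim X"
  define U :: "'a patch \<Rightarrow> 'a set" where "U = (\<lambda>(c, a, r). {p \<in> cdom c. cmap c p \<in> {x \<in> cspace ?n. sqdist ?n x a < r\<^sup>2 / 4}})"
  have ex: "\<exists>P. is_patch X P \<and> p \<in> U P" if p: "p \<in> carrier_of X" for p
  proof -
    obtain c where c: "c \<in> atlas X" "p \<in> cdom c" using p by (auto simp: carrier_of_def)
    have x: "cmap c p \<in> cspace ?n" by (rule chart_facts(3)[OF X c])
    obtain e where e: "e > 0" "\<forall>y\<in>cspace ?n. (\<forall>i<?n. cmod (y i - cmap c p i) < e) \<longrightarrow> y \<in> cmap c ` cdom c"
      using open_cspace_box[OF chart_facts(2)[OF X c(1)], of "cmap c p"] c(2) by auto
    have "y \<in> cmap c ` cdom c" if "y \<in> cs_ball ?n (cmap c p) (e / 2)" for y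
    proof -
      have y: "y \<in> cspace ?n" "sqdist ?n y (cmap c p) \<le> (e / 2)\<^sup>2" using that by (auto simp: cs_ball_def)
      have "cmod (y i - cmap c p i) < e" if "i < ?n" for i
        using sqdist_component[OF y(2) _ that] e(1) by simp
      then show ?thesis using e(2) y(1) by blast
    qed
    then have "is_patch X (c, cmap c p, e / 2)" using c e(1) by (auto simp: is_patch_def)
    moreover have "p \<in> U (c, cmap c p, e / 2)" using c x e(1) by (simp add: U_def sqdist_def)
    ultimately show ?thesis by blast
  qed
  have op: "openin (mtop X) (U P)" if "is_patch X P" for P
  proof -
    obtain c a r where P: "P = (c, a, r)" by (cases P)
    have "openin (top_of_set (cspace ?n)) {x \<in> cspace ?n. sqdist ?n x a < r\<^sup>2 / 4}"
      using continuous_openin_preimage_gen[OF continuous_sqdist open_lessThan, of "cspace ?n" ?n a "r\<^sup>2 / 4"]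
      by (simp add: vimage_def Int_def)
    moreover have "c \<in> atlas X" using that by (simp add: P is_patch_def)
    ultimately show ?thesis unfolding P U_def prod.case by (intro openin_mtop_chart)
  qed
  have cov: "topspace (mtop X) \<subseteq> \<Union>(U ` {P. is_patch X P})" unfolding topspace_mtop[OF X] using ex by blast
  have "\<forall>u\<in>U ` {P. is_patch X P}. openin (mtop X) u" using op by blast
  from mp[OF spec[OF iffD1[OF compact_space_alt comp]] conjI[OF this cov]]
  have "\<exists>\<F>. finite \<F> \<and> \<F> \<subseteq> U ` {P. is_patch X P} \<and> topspace (mtop X) \<subseteq> \<Union>\<F>" .
  then obtain \<F> where F: "finite \<F>" "\<F> \<subseteq> U ` {P. is_patch X P}" "carrier_of X \<subseteq> \<Union>\<F>"
    using topspace_mtop[OF X] by auto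
  obtain I where I: "I \<subseteq> {P. is_patch X P}" "finite I" "\<F> = U ` I" using finite_subset_image[OF F(1,2)] by blast
  show ?thesis
  proof (rule that[OF I(2)])
    show "is_patch X P" if "P \<in> I" for P using that I(1) by blast
    fix p assume "p \<in> carrier_of X"
    then obtain P where P: "P \<in> I" "p \<in> U P" using F(3) I(3) by blast
    obtain c a r where "P = (c, a, r)" by (cases P)
    then show "\<exists>(c, a, r)\<in>I. p \<in> cdom c \<and> sqdist ?n (cmap c p) a < r\<^sup>2 / 4"
      using P by (intro bexI[of _ P]) (auto simp: U_def)
  qed
qed

lemma continuous_map_cinv:
  assumes X: "complex_manifold X" and c: "c \<in> atlas X"
  shows "continuous_map (top_of_set (cmap c ` cdom c)) (mtop X) (cinv c)"
  unfolding continuous_map_def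
proof (intro conjI allI impI)
  show "cinv c \<in> topspace (top_of_set (cmap c ` cdom c)) \<rightarrow> topspace (mtop X)"
    using c by (auto simp: topspace_mtop[OF X] carrier_of_def chart_facts(4)[OF X c] intro!: bexI[of _ c])
  fix U assume U: "openin (mtop X) U"
  have "{x \<in> topspace (top_of_set (cmap c ` cdom c)). cinv c x \<in> U} = cmap c ` (U \<inter> cdom c)"
    using chart_facts(4)[OF X c] by auto
  moreover have "openin (top_of_set (cmap c ` cdom c)) (cmap c ` (U \<inter> cdom c))"
    by (rule openin_subset_trans[OF open_chart_image[OF X c U] _ open_cspace_subset[OF chart_facts(2)[OF X c]]]) blast
  ultimately show "openin (top_of_set (cmap c ` cdom c)) {x \<in> topspace (top_of_set (cmap c ` cdom c)). cinv c x \<in> U}"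
    by simp
qed

text \<open>The ball is compact in the chart, so its image is compact in \<open>X\<close>, and
  compact subsets of a Hausdorff space are closed.\<close>

lemma closedin_patch:
  assumes X: "complex_manifold X" and P: "is_patch X (c, a, r)"
  shows "closedin (mtop X) {p \<in> cdom c. sqdist (cdim X) (cmap c p) a \<le> r\<^sup>2}"
proof -
  have c: "c \<in> atlas X" "r > 0" "cs_ball (cdim X) a r \<subseteq> cmap c ` cdom c" using P by (auto simp: is_patch_def)
  have "compactin (top_of_set (cmap c ` cdom c)) (cs_ball (cdim X) a r)"
    using compact_cs_ball[OF c(2)] c(3) by (simp add: compactin_subtopology)
  from image_compactin[OF this continuous_map_cinv[OF X c(1)]]
  have "compactin (mtop X) (cinv c ` cs_ball (cdim X) a r)" .
  moreover have "cinv c ` cs_ball (cdim X) a r = {p \<in> cdom c. sqdist (cdim X) (cmap c p) a \<le> r\<^sup>2}"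
  proof (intro equalityI subsetI)
    fix p assume "p \<in> cinv c ` cs_ball (cdim X) a r"
    then obtain x where x: "p = cinv c x" "x \<in> cs_ball (cdim X) a r" by blast
    then have "x \<in> cmap c ` cdom c" using c(3) by blast
    then show "p \<in> {p \<in> cdom c. sqdist (cdim X) (cmap c p) a \<le> r\<^sup>2}"
      using cmap_cinv[of x c] x by (simp add: cs_ball_def)
  next
    fix p assume "p \<in> {p \<in> cdom c. sqdist (cdim X) (cmap c p) a \<le> r\<^sup>2}"
    then show "p \<in> cinv c ` cs_ball (cdim X) a r"
      using chart_facts(3,4)[OF X c(1)] by (intro image_eqI[of _ _ "cmap c p"]) (auto simp: cs_ball_def)
  qed
  moreover have "Hausdorff_space (mtop X)" using X by (simp add: complex_manifold_def)
  ultimately show ?thesis using compactin_imp_closedin by metis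
qed

text \<open>By \<open>closedin_patch\<close> and continuity the condition on \<open>f\<close> cuts a
  closed subset out of a compact ball.\<close>

lemma compact_patch_preimage:
  assumes M: "complex_manifold M" and N: "complex_manifold N" and f: "holomorphic_map M N f"
    and P: "is_patch M (c, a, s)" and Q: "is_patch N (d, b, r)"
  shows "compact {x \<in> cs_ball (cdim M) a s. f (cinv c x) \<in> cdom d \<and> sqdist (cdim N) (cmap d (f (cinv c x))) b \<le> r\<^sup>2}"
proof -
  let ?K = "cs_ball (cdim M) a s"
  have c: "c \<in> atlas M" "s > 0" "?K \<subseteq> cmap c ` cdom c" using P by (auto simp: is_patch_def)
  have "continuous_map (top_of_set ?K) (mtop M) (cinv c)"
    using continuous_map_from_subtopology_mono[OF continuous_map_cinv[OF M c(1)] c(3)] .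
  then have "continuous_map (top_of_set ?K) (mtop N) (f \<circ> cinv c)"
    using f by (intro continuous_map_compose) (auto simp: holomorphic_map_def)
  from closedin_continuous_map_preimage[OF this closedin_patch[OF N Q]]
  have "closedin (top_of_set ?K) {x \<in> ?K. f (cinv c x) \<in> cdom d \<and> sqdist (cdim N) (cmap d (f (cinv c x))) b \<le> r\<^sup>2}"
    by simp
  then show ?thesis using compact_cs_ball[OF c(2)] closedin_compact by blast
qed

lemma C1_continuous_d_z:
  assumes "C_k (Suc k) n W F" "j < n"
  shows "continuous_on W (d_z j F)" "continuous_on W (d_zbar j F)"
proof -
  have "continuous_on W (real_partial j w F)" if "w \<in> {1, \<i>}" for w
    using C_k_real_partial[OF assms that] by (cases k) auto
  then show "continuous_on W (d_z j F)" "continuous_on W (d_zbar j F)"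
    unfolding d_z_lincomb by (auto intro!: continuous_intros)
qed

lemma levi_continuous:
  assumes W: "open_cspace n W" and F: "C_k (Suc (Suc 0)) n W F"
  shows "continuous_on W (\<lambda>x. levi n F x u)"
  unfolding levi_def
  by (intro continuous_intros C1_continuous_d_z(1)[OF C1_d_z(2)[OF W F]]) auto

lemma levi_scale: "levi n F x (\<lambda>i. of_real s * u i) = (of_real s)\<^sup>2 * levi n F x u"
  by (simp add: levi_def sum_distrib_left power2_eq_square mult_ac)

text \<open>For a fixed direction \<open>u\<close> negativity is an open condition on the point, so
  finitely many directions serve the whole compact set.\<close>

lemma levi_neg_uniform:
  assumes W: "open_cspace n W" and F: "C_k (Suc (Suc 0)) n W F" and K: "compact K" "K \<subseteq> W"
    and neg: "\<And>x. x \<in> K \<Longrightarrow> \<exists>u\<in>cspace n. Re (levi n F x u) < 0"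
  obtains R where "R \<ge> 0" "\<And>x. x \<in> K \<Longrightarrow> \<exists>u\<in>cspace n. Re (levi n F x u) \<le> -1 \<and> (\<forall>i<n. cmod (u i) \<le> R)"
proof -
  have "\<exists>u\<in>cspace n. Re (levi n F x u) < -1" if x: "x \<in> K" for x
  proof -
    obtain v where v: "v \<in> cspace n" "Re (levi n F x v) < 0" using neg[OF x] by blast
    \<comment> \<open>Scales the value of the Levi form to -2, which leaves room for the strict
      inequality that defines open sets.\<close>
    define s where "s = sqrt (2 / - Re (levi n F x v))"
    have s: "s\<^sup>2 = 2 / - Re (levi n F x v)" using v(2) by (simp add: s_def)
    have "Re ((of_real s)\<^sup>2 * levi n F x v) = s\<^sup>2 * Re (levi n F x v)" by (simp flip: of_real_power)
    then have "Re (levi n F x (\<lambda>i. of_real s * v i)) = -2" using s v(2) by (simp add: levi_scale)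
    moreover have "(\<lambda>i. of_real s * v i) \<in> cspace n" using v(1) by (simp add: cspace_def)
    ultimately show ?thesis by (intro bexI[of _ "\<lambda>i. of_real s * v i"]) auto
  qed
  then obtain u where u: "\<And>x. x \<in> K \<Longrightarrow> u x \<in> cspace n" "\<And>x. x \<in> K \<Longrightarrow> Re (levi n F x (u x)) < -1" by metis
  have "\<exists>T. open T \<and> {y \<in> W. Re (levi n F y (u x)) < -1} = W \<inter> T" for x
  proof -
    have "continuous_on W (\<lambda>y. Re (levi n F y (u x)))" by (intro continuous_intros levi_continuous[OF W F])
    from continuous_openin_preimage_gen[OF this open_lessThan[of "-1"]]
    show ?thesis by (auto simp: openin_open vimage_def Int_def)
  qed
  then obtain T where T: "\<And>x. open (T x)" "\<And>x. {y \<in> W. Re (levi n F y (u x)) < -1} = W \<inter> T x" by metis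
  have "K \<subseteq> (\<Union>x\<in>K. T x)" using T(2) u(2) K(2) by blast
  then obtain C where C: "C \<subseteq> K" "finite C" "K \<subseteq> (\<Union>x\<in>C. T x)"
    using compactE_image[OF K(1), of K T] T(1) by metis
  define R where "R = (\<Sum>x\<in>C. \<Sum>i<n. cmod (u x i))"
  show ?thesis
  proof (rule that[of R])
    show "R \<ge> 0" by (simp add: R_def sum_nonneg)
    fix y assume y: "y \<in> K"
    then obtain x where x: "x \<in> C" "y \<in> T x" using C(3) by blast
    then have "Re (levi n F y (u x)) < -1" using T(2)[of x] y K(2) by blast
    moreover have "cmod (u x i) \<le> R" if "i < n" for i
    proof -
      have "cmod (u x i) \<le> (\<Sum>i<n. cmod (u x i))" by (rule member_le_sum) (use that in auto)
      also have "\<dots> \<le> R" unfolding R_def using member_le_sum[of x C "\<lambda>x. \<Sum>i<n. cmod (u x i)"] x(1) C(2) by (simp add: sum_nonneg)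
      finally show ?thesis .
    qed
    ultimately show "\<exists>u\<in>cspace n. Re (levi n F y u) \<le> -1 \<and> (\<forall>i<n. cmod (u i) \<le> R)"
      using u(1) x(1) C(1) by (intro bexI[of _ "u x"]) auto
  qed
qed

text \<open>Where \<open>w i\<close> tends to 0 the bound forces \<open>\<phi> i\<close> to minus
  infinity. So the supremum is that over the compact sets on which \<open>w i\<close> is bounded
  below.\<close>

lemma max_attained:
  fixes \<phi> :: "'i \<Rightarrow> 'x::metric_space \<Rightarrow> real"
  assumes I: "finite I" and K: "\<And>i. i \<in> I \<Longrightarrow> compact (K i)"
    and w: "\<And>i. i \<in> I \<Longrightarrow> continuous_on (K i) (w i)"
    and \<phi>: "\<And>i. i \<in> I \<Longrightarrow> continuous_on {x \<in> K i. w i x > 0} (\<phi> i)"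
    and bd: "\<And>i x. i \<in> I \<Longrightarrow> x \<in> K i \<Longrightarrow> w i x > 0 \<Longrightarrow> \<phi> i x \<le> C + c * ln (w i x)" and c: "c > (0::real)"
    and ne: "i0 \<in> I" "x0 \<in> K i0" "w i0 x0 > 0"
  obtains i x where "i \<in> I" "x \<in> K i" "w i x > 0"
    "\<And>j y. j \<in> I \<Longrightarrow> y \<in> K j \<Longrightarrow> w j y > 0 \<Longrightarrow> \<phi> j y \<le> \<phi> i x"
proof -
  \<comment> \<open>Below this threshold the upper bound for \<phi> drops under the value at the
    given point \<open>x0\<close>.\<close>
  define \<rho> where "\<rho> = exp ((\<phi> i0 x0 - C) / c)"
  have \<rho>: "\<rho> > 0" by (simp add: \<rho>_def)
  have big: "w i x \<ge> \<rho>" if "i \<in> I" "x \<in> K i" "w i x > 0" "\<phi> i x \<ge> \<phi> i0 x0" for i x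
  proof -
    have "\<phi> i0 x0 - C \<le> c * ln (w i x)" using bd[OF that(1-3)] that(4) by simp
    then have "(\<phi> i0 x0 - C) / c \<le> ln (w i x)" using c by (simp add: field_simps)
    then show ?thesis using that(3) unfolding \<rho>_def by (simp add: ln_ge_iff)
  qed
  define E where "E i = {x \<in> K i. \<rho> \<le> w i x}" for i
  have E: "compact (E i)" "continuous_on (E i) (\<phi> i)" if "i \<in> I" for i
  proof -
    have "closedin (top_of_set (K i)) (K i \<inter> w i -` {\<rho>..})"
      by (rule continuous_closedin_preimage[OF w[OF that]]) simp
    moreover have "K i \<inter> w i -` {\<rho>..} = E i" by (auto simp: E_def)
    ultimately show "compact (E i)" using K[OF that] closedin_compact by metis
    show "continuous_on (E i) (\<phi> i)"
      by (rule continuous_on_subset[OF \<phi>[OF that]]) (use \<rho> in \<open>auto simp: E_def\<close>)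
  qed
  define V where "V = (\<Union>i\<in>I. \<phi> i ` E i)"
  have "compact V" unfolding V_def using I E by (intro compact_UN compact_continuous_image) auto
  moreover have x0: "x0 \<in> E i0" using big[OF ne] ne by (simp add: E_def)
  then have "V \<noteq> {}" using ne(1) by (auto simp: V_def)
  ultimately obtain m where m: "m \<in> V" "\<And>v. v \<in> V \<Longrightarrow> v \<le> m" using compact_attains_sup by metis
  then obtain i x where ix: "i \<in> I" "x \<in> E i" "m = \<phi> i x" by (auto simp: V_def)
  show ?thesis
  proof (rule that[OF ix(1)])
    show "x \<in> K i" "w i x > 0" using ix(2) \<rho> by (auto simp: E_def)
    fix j y assume y: "j \<in> I" "y \<in> K j" "w j y > 0"
    have m0: "\<phi> i0 x0 \<le> m" using m(2) ne(1) x0 by (auto simp: V_def)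
    show "\<phi> j y \<le> \<phi> i x"
    proof (cases "\<phi> j y \<ge> \<phi> i0 x0")
      case True
      then have "y \<in> E j" using big[OF y] y by (simp add: E_def)
      then have "\<phi> j y \<in> V" using y(1) by (auto simp: V_def)
      then show ?thesis using m(2) ix(3) by simp
    qed (use m0 ix(3) in auto)
  qed
qed

text \<open>In a coordinate box the components of \<open>f\<close> have derivative 0 along segments,
  so \<open>f\<close> is locally constant. A level set is then open and closed, and \<open>M\<close>
  is connected.\<close>

lemma constant_if_push_zero:
  assumes M: "complex_manifold M" and N: "complex_manifold N" and f: "holomorphic_map M N f"
    and zero: "\<And>p v. p \<in> carrier_of M \<Longrightarrow> v \<in> tangent_space M p \<Longrightarrow> push M N f p v = tzero"
  shows "f constant_on carrier_of M"
proof (cases "carrier_of M = {}")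
  case False
  then obtain p0 where p0: "p0 \<in> carrier_of M" by blast
  let ?m = "cdim M" let ?n = "cdim N"
  have loc: "\<exists>U. openin (mtop M) U \<and> p \<in> U \<and> (\<forall>q\<in>U. f q = f p)" if p: "p \<in> carrier_of M" for p
  proof -
    obtain c where c: "c \<in> atlas M" "p \<in> cdom c" using p by (auto simp: carrier_of_def)
    obtain d where d: "d \<in> atlas N" "f p \<in> cdom d"
      using map_carrier[OF M N f p] by (auto simp: carrier_of_def)
    let ?U = "cmap c ` {p \<in> cdom c. f p \<in> cdom d}"
    note U = map_coord_open[OF M N f c(1) d(1)]
    have xU: "cmap c p \<in> ?U" using c d by blast
    obtain e where e: "e > 0" "\<forall>y\<in>cspace ?m. (\<forall>i<?m. cmod (y i - cmap c p i) < e) \<longrightarrow> y \<in> ?U"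
      using open_cspace_box[OF U xU] by blast
    have dz: "d_z j (\<lambda>x. cmap d (f (cinv c x)) a) x = 0" if x: "x \<in> ?U" and ja: "j < ?m" "a < ?n" for x j a
    proof -
      obtain q where q: "q \<in> cdom c" "f q \<in> cdom d" "x = cmap c q" using x by blast
      have qM: "q \<in> carrier_of M" using c(1) q(1) by (auto simp: carrier_of_def)
      define w where "w = (\<lambda>i. if i = j then 1 else 0 :: complex)"
      have w: "w \<in> cspace ?m" using ja by (simp add: w_def cspace_def)
      note t = tvec_of(2,3)[OF M c(1) q(1) w]
      have "(\<Sum>i<?m. d_z i (\<lambda>x. cmap d (f (cinv c x)) a) x * w i) = 0"
        using push(2)[OF M N f qM t(1) c(1) q(1) d(1) q(2) ja(2)] zero[OF qM t(1)] t(2) q(3) by (simp add: tzero_def)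
      moreover have "(\<Sum>i<?m. d_z i (\<lambda>x. cmap d (f (cinv c x)) a) x * w i)
        = (\<Sum>i<?m. if i = j then d_z j (\<lambda>x. cmap d (f (cinv c x)) a) x else 0)"
        by (intro sum.cong) (auto simp: w_def)
      ultimately show ?thesis using ja(1) by simp
    qed
    define V where "V = {q \<in> cdom c. cmap c q \<in> {y \<in> cspace ?m. \<forall>i<?m. cmod (y i - cmap c p i) < e}}"
    have "open_cspace ?m {y \<in> cspace ?m. \<forall>i<?m. cmod (y i - cmap c p i) < e}"
      unfolding openin_open using open_Collect_close[of ?m "cmap c p" e] by blast
    then have "openin (mtop M) V" unfolding V_def by (rule openin_mtop_chart[OF c(1)])
    moreover have "p \<in> V" using c e(1) chart_facts(3)[OF M c] by (simp add: V_def)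
    moreover have "f q = f p" if q: "q \<in> V" for q
    proof -
      have qc: "q \<in> cdom c" and qb: "\<And>i. i < ?m \<Longrightarrow> cmod (cmap c q i - cmap c p i) < e" using q by (auto simp: V_def)
      have xc: "cmap c p \<in> cspace ?m" "cmap c q \<in> cspace ?m" using chart_facts(3)[OF M c(1)] c(2) qc by auto
      define Y where "Y s = (\<lambda>i. cmap c p i + of_real s * (cmap c q i - cmap c p i))" for s :: real
      have Yc: "Y s \<in> cspace ?m" for s using xc by (simp add: Y_def cspace_def)
      have YU: "Y s \<in> ?U" if "s \<in> {0..1}" for s
      proof -
        have "cmod (Y s i - cmap c p i) < e" if "i < ?m" for i
        proof -
          have "cmod (Y s i - cmap c p i) = s * cmod (cmap c q i - cmap c p i)"
            using \<open>s \<in> _\<close> by (simp add: Y_def norm_mult)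
          also have "\<dots> \<le> 1 * cmod (cmap c q i - cmap c p i)" using \<open>s \<in> _\<close> by (intro mult_right_mono) auto
          finally show ?thesis using qb[OF that] by simp
        qed
        then show ?thesis using e(2) Yc by blast
      qed
      have eq: "cmap d (f q) a = cmap d (f p) a" if a: "a < ?n" for a
      proof -
        let ?F = "\<lambda>x. cmap d (f (cinv c x)) a"
        note H = map_coord_holo[OF M N f c(1) d(1) a]
        have der: "((\<lambda>s. ?F (Y s)) has_vector_derivative 0) (at s)" if s: "s \<in> {0..1}" for s
        proof -
          have "((\<lambda>s. ?F (Y s)) has_derivative (\<lambda>h. \<Sum>j<?m. d_z j ?F (Y s) * (h *\<^sub>R (cmap c q j - cmap c p j))
              + d_zbar j ?F (Y s) * cnj (h *\<^sub>R (cmap c q j - cmap c p j)))) (at s)"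
          proof (rule C1_chain[where Y = Y and ?t0.0 = s and W = ?U, OF U YU[OF s] holo_fn_C_k[OF H]])
            show "\<forall>\<^sub>F t in nhds s. Y t \<in> cspace ?m" using Yc by simp
            show "((\<lambda>t. Y t j) has_derivative (\<lambda>h. h *\<^sub>R (cmap c q j - cmap c p j))) (at s)" for j
              unfolding Y_def by (auto intro!: derivative_eq_intros simp: scaleR_conv_of_real)
          qed
          moreover have "d_zbar j ?F (Y s) = 0" if "j < ?m" for j
            using H YU[OF s] that unfolding holo_fn_def by blast
          ultimately have "((\<lambda>s. ?F (Y s)) has_derivative (\<lambda>h. 0)) (at s)" using dz[OF YU[OF s] _ a] by simp
          then show ?thesis by (simp add: has_vector_derivative_def)
        qed
        have "cmod (?F (Y 1) - ?F (Y 0) - 0) \<le> 0" by (rule mvt_bound[OF der]) auto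
        moreover have "Y 1 = cmap c q" "Y 0 = cmap c p" by (auto simp: Y_def)
        ultimately show ?thesis using chart_facts(4)[OF M c(1)] c(2) qc by simp
      qed
      have "cmap c q \<in> ?U" using YU[of 1] by (simp add: Y_def)
      then have fq: "f q \<in> cdom d" using chart_facts(1)[OF M c(1)] qc by (auto simp: inj_on_def)
      have "cmap d (f q) i = cmap d (f p) i" for i
        using eq[of i] chart_facts(3)[OF N d(1) fq] chart_facts(3)[OF N d] by (cases "i < ?n") (auto simp: cspace_def)
      then have "cmap d (f q) = cmap d (f p)" by auto
      then show ?thesis using chart_facts(1)[OF N d(1)] fq d(2) by (auto simp: inj_on_def)
    qed
    ultimately show ?thesis by blast
  qed
  let ?S = "{p \<in> carrier_of M. f p = f p0}"
  \<comment> \<open>Stated for an arbitrary condition on the value, so as to cover both a level set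
    and its complement.\<close>
  have op: "openin (mtop M) {p \<in> carrier_of M. R (f p)}" for R
  proof (subst openin_subopen, intro ballI)
    fix p assume "p \<in> {p \<in> carrier_of M. R (f p)}"
    then have p: "p \<in> carrier_of M" "R (f p)" by auto
    obtain U where U: "openin (mtop M) U" "p \<in> U" "\<forall>q\<in>U. f q = f p" using loc[OF p(1)] by blast
    have "U \<subseteq> carrier_of M" using openin_subset[OF U(1)] topspace_mtop[OF M] by simp
    moreover have "R (f q)" if "q \<in> U" for q
      by (rule ssubst[where P = R, OF bspec[OF U(3) that] p(2)])
    ultimately have "U \<subseteq> {p \<in> carrier_of M. R (f p)}" by blast
    then show "\<exists>T. openin (mtop M) T \<and> p \<in> T \<and> T \<subseteq> {p \<in> carrier_of M. R (f p)}"
      using U(1,2) by (intro exI[of _ U] conjI)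
  qed
  have "topspace (mtop M) - ?S = {p \<in> carrier_of M. f p \<noteq> f p0}" using topspace_mtop[OF M] by auto
  then have "openin (mtop M) (topspace (mtop M) - ?S)" by (simp only: op[of "\<lambda>x. x \<noteq> f p0"])
  moreover have "?S \<subseteq> topspace (mtop M)" using topspace_mtop[OF M] by blast
  ultimately have "closedin (mtop M) ?S" unfolding closedin_def by (intro conjI)
  moreover have "connected_space (mtop M)" using M by (simp add: complex_manifold_def)
  ultimately have "?S = {} \<or> ?S = topspace (mtop M)"
    using op[of "\<lambda>x. x = f p0"] unfolding connected_space_clopen_in by blast
  then have "\<forall>p\<in>carrier_of M. f p = f p0" using p0 topspace_mtop[OF M] by blast
  then show ?thesis by (auto simp: constant_on_def)
qed (simp add: constant_on_def)

section \<open>The test function and its maximum\<close>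

text \<open>The logarithm of the squared norm of \<open>v\<close>. For \<open>s = -1\<close> the
  potential belongs to \<open>O(1)\<close> and enters with a minus sign, since the norm of a tangent
  vector is given by the dual metric. By \<open>lognorm_eq\<close> the chart and the component are
  immaterial.\<close>

definition lognorm :: "'a cmanifold \<Rightarrow> real \<Rightarrow> ('a chart \<Rightarrow> nat \<Rightarrow> (nat \<Rightarrow> complex) \<Rightarrow> real) \<Rightarrow> 'a \<Rightarrow> 'a tvec \<Rightarrow> real" where
  "lognorm X s \<kappa> p v = (SOME r. \<exists>c k. c \<in> atlas X \<and> k < cdim X \<and> p \<in> cdom c \<and> v c k \<noteq> 0 \<and>
     r = s * \<kappa> c k (pcoord (cdim X) k (cmap c p) (v c)) + ln ((cmod (v c k))\<^sup>2))"

lemma lognorm_eq: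
  assumes \<kappa>: "log_metric X s \<kappa>" and s: "s * s = 1" and c: "c \<in> atlas X" "k < cdim X" "p \<in> cdom c"
    and v: "v \<in> tangent_space X p" "v c k \<noteq> 0"
  shows "lognorm X s \<kappa> p v = s * \<kappa> c k (pcoord (cdim X) k (cmap c p) (v c)) + ln ((cmod (v c k))\<^sup>2)"
  unfolding lognorm_def
proof (rule some_equality)
  show "\<exists>d l. d \<in> atlas X \<and> l < cdim X \<and> p \<in> cdom d \<and> v d l \<noteq> 0 \<and>
     s * \<kappa> c k (pcoord (cdim X) k (cmap c p) (v c)) + ln ((cmod (v c k))\<^sup>2) =
     s * \<kappa> d l (pcoord (cdim X) l (cmap d p) (v d)) + ln ((cmod (v d l))\<^sup>2)"
    using c v by blast
  fix r assume "\<exists>d l. d \<in> atlas X \<and> l < cdim X \<and> p \<in> cdom d \<and> v d l \<noteq> 0 \<and>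
     r = s * \<kappa> d l (pcoord (cdim X) l (cmap d p) (v d)) + ln ((cmod (v d l))\<^sup>2)"
  then obtain d l where d: "d \<in> atlas X" "l < cdim X" "p \<in> cdom d" "v d l \<noteq> 0"
    "r = s * \<kappa> d l (pcoord (cdim X) l (cmap d p) (v d)) + ln ((cmod (v d l))\<^sup>2)" by blast
  let ?A = "\<kappa> c k (pcoord (cdim X) k (cmap c p) (v c))" and ?B = "\<kappa> d l (pcoord (cdim X) l (cmap d p) (v d))"
  have "?A + s * ln ((cmod (v c k))\<^sup>2) = ?B + s * ln ((cmod (v d l))\<^sup>2)"
    using \<kappa> c d(1-4) v unfolding log_metric_def by blast
  \<comment> \<open>Multiplication by \<open>s\<close>, whose square is 1, turns the invariance in
    \<open>log_metric\<close> into that of \<open>lognorm\<close>.\<close>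
  from arg_cong[OF this, of "\<lambda>x. s * x"]
  have "s * ?A + (s * s) * ln ((cmod (v c k))\<^sup>2) = s * ?B + (s * s) * ln ((cmod (v d l))\<^sup>2)"
    by (simp only: distrib_left mult.assoc)
  then show "r = s * ?A + ln ((cmod (v c k))\<^sup>2)" using s d(5) by simp
qed

lemma pcoord_scale: "a \<noteq> 0 \<Longrightarrow> pcoord n k x (\<lambda>i. a * v i) = pcoord n k x v"
  by (auto simp: pcoord_def)

lemma lognorm_scale:
  assumes \<kappa>: "log_metric X s \<kappa>" and s: "s * s = 1" and c: "c \<in> atlas X" "k < cdim X" "p \<in> cdom c"
    and v: "v \<in> tangent_space X p" "v c k \<noteq> 0" and a: "a \<noteq> 0"
  shows "lognorm X s \<kappa> p (tscale a v) = ln ((cmod a)\<^sup>2) + lognorm X s \<kappa> p v"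
proof -
  have e: "tscale a v c = (\<lambda>i. a * v c i)" by (simp add: tscale_def)
  have "tscale a v c k \<noteq> 0" using v(2) a by (simp add: e)
  from lognorm_eq[OF \<kappa> s c tangent_space_scale[OF v(1)] this]
  show ?thesis using lognorm_eq[OF \<kappa> s c v] v(2) a
    by (simp add: e pcoord_scale norm_mult power_mult_distrib ln_mult)
qed

text \<open>A compact part of a chart of the projectivised bundle. The bound
  \<open>\<rho> = 1\<close> is reached by dividing by a largest component, and
  \<open>\<rho> = 2\<close> is the range allowed on \<open>N\<close> by
  \<open>admissible\<close>.\<close>

definition proj_box :: "nat \<Rightarrow> (nat \<Rightarrow> complex) \<Rightarrow> real \<Rightarrow> real \<Rightarrow> (nat \<Rightarrow> complex) set" where
  "proj_box n a s \<rho> = {Z \<in> cspace (2 * n - 1). sqdist n Z a \<le> s\<^sup>2 \<and> (\<forall>i\<in>{n..<2*n-1}. cmod (Z i) \<le> \<rho>)}"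

lemma compact_proj_box:
  assumes "s > 0"
  shows "compact (proj_box n a s \<rho>)"
proof -
  have n: "n \<le> 2 * n - 1 \<or> n = 0" by linarith
  let ?a = "\<lambda>i. if i < n then a i else 0" and ?r = "\<lambda>i. if i < n then s else \<rho>"
  have "proj_box n a s \<rho> = {Z \<in> cspace (2 * n - 1). \<forall>i<2 * n - 1. cmod (Z i - ?a i) \<le> ?r i} \<inter> {Z. sqdist n Z a \<le> s\<^sup>2}"
  proof (intro equalityI subsetI)
    fix Z assume Z: "Z \<in> proj_box n a s \<rho>"
    then have "cmod (Z i - ?a i) \<le> ?r i" if "i < 2 * n - 1" for i
      using sqdist_component[of n Z a s i] assms that by (auto simp: proj_box_def)
    then show "Z \<in> {Z \<in> cspace (2 * n - 1). \<forall>i<2 * n - 1. cmod (Z i - ?a i) \<le> ?r i} \<inter> {Z. sqdist n Z a \<le> s\<^sup>2}"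
      using Z by (auto simp: proj_box_def)
  next
    fix Z assume Z: "Z \<in> {Z \<in> cspace (2 * n - 1). \<forall>i<2 * n - 1. cmod (Z i - ?a i) \<le> ?r i} \<inter> {Z. sqdist n Z a \<le> s\<^sup>2}"
    have "cmod (Z i) \<le> \<rho>" if "i \<in> {n..<2*n-1}" for i
    proof -
      have "cmod (Z i - ?a i) \<le> ?r i" using Z that by auto
      then show ?thesis using that by auto
    qed
    then show "Z \<in> proj_box n a s \<rho>" using Z by (auto simp: proj_box_def)
  qed
  moreover have "closed {Z. sqdist n Z a \<le> s\<^sup>2}"
    by (intro closed_Collect_le continuous_sqdist continuous_intros)
  ultimately show ?thesis using compact_cspace_box by (simp add: compact_Int_closed)
qed

lemma sqdist_base_part: "sqdist n (base_part n Z) a = sqdist n Z a"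
  by (simp add: sqdist_def base_part_def)

lemma proj_box_img:
  assumes "is_patch X (c, a, s)"
  shows "proj_box (cdim X) a s \<rho> \<subseteq> proj_img X c"
proof
  fix Z assume Z: "Z \<in> proj_box (cdim X) a s \<rho>"
  then have "base_part (cdim X) Z \<in> cs_ball (cdim X) a s"
    by (simp add: cs_ball_def base_part_cspace sqdist_base_part proj_box_def)
  then show "Z \<in> proj_img X c" using assms Z by (auto simp: proj_img_def proj_box_def is_patch_def)
qed

lemma pcoord_proj_box:
  assumes "k < n" "sqdist n x a \<le> s\<^sup>2" "v k \<noteq> 0" "\<And>i. i < n \<Longrightarrow> cmod (v i) \<le> \<rho> * cmod (v k)"
  shows "pcoord n k x v \<in> proj_box n a s \<rho>"
proof -
  have "cmod (v i / v k) \<le> \<rho>" if "i < n" for i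
    using assms(3) assms(4)[OF that] by (simp add: norm_divide divide_le_eq)
  moreover have "sqdist n (pcoord n k x v) a = sqdist n x a" by (simp add: sqdist_def pcoord_def)
  ultimately show ?thesis using assms(1,2) by (auto simp: proj_box_def pcoord_cspace) (auto simp: pcoord_def)
qed

lemma continuous_pcoord:
  assumes "\<And>i. i < n \<Longrightarrow> continuous_on S (\<lambda>Z. y Z i)" "\<And>i. i < n \<Longrightarrow> continuous_on S (\<lambda>Z. w Z i)"
    "\<And>Z. Z \<in> S \<Longrightarrow> w Z k \<noteq> 0" "k < n"
  shows "continuous_on S (\<lambda>Z. pcoord n k (y Z) (w Z))"
proof (rule continuous_on_coordinatewise_then_product)
  fix i
  consider "i < n" | "n \<le> i" "i < n + k" | "n + k \<le> i" "i < 2 * n - 1" | "i \<ge> 2 * n - 1" "n + k \<le> i" by linarith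
  then show "continuous_on S (\<lambda>Z. pcoord n k (y Z) (w Z) i)"
  proof cases
    case 2
    then have "i - n < n" using assms(4) by linarith
    then show ?thesis using 2 assms by (auto simp: pcoord_def intro!: continuous_intros)
  next
    case 3
    then have "i - n + 1 < n" by linarith
    then show ?thesis using 3 assms by (auto simp: pcoord_def intro!: continuous_intros)
  qed (use assms in \<open>auto simp: pcoord_def\<close>)
qed

lemma continuous_base_part: "continuous_on S (base_part n)"
proof (rule continuous_on_coordinatewise_then_product)
  show "continuous_on S (\<lambda>Z. base_part n Z i)" for i
    by (cases "i < n") (auto simp: base_part_def intro!: continuous_on_subset[OF continuous_on_product_coordinates])
qed

lemma continuous_fibre_part: "continuous_on S (\<lambda>Z. fibre_part n k Z i)"
  by (cases "i < k"; cases "i = k"; cases "i < n")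
    (auto simp: fibre_part_def intro!: continuous_on_subset[OF continuous_on_product_coordinates])

text \<open>The differential of \<open>f\<close> on the representative \<open>fibre_part\<close>, as
  an explicit function of the coordinates. Its continuity and analyticity can be read off;
  \<open>push_at_point\<close> identifies it with \<open>push\<close>.\<close>

definition push_coord :: "'a cmanifold \<Rightarrow> 'b cmanifold \<Rightarrow> ('a \<Rightarrow> 'b) \<Rightarrow> 'a chart \<Rightarrow> nat \<Rightarrow> 'b chart \<Rightarrow> (nat \<Rightarrow> complex) \<Rightarrow> nat \<Rightarrow> complex" where
  "push_coord M N f c l d Z a = (if a < cdim N then
     (\<Sum>j<cdim M. d_z j (\<lambda>x. cmap d (f (cinv c x)) a) (base_part (cdim M) Z) * fibre_part (cdim M) l Z j) else 0)"

text \<open>The term with the factor \<open>\<eta>\<close> is strictly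
  plurisubharmonic in the direction of the fibres of the projectivised bundle of \<open>N\<close>, and thus makes up
  for the small negative part of the curvature that nefness allows.\<close>

definition test_fn where
  "test_fn M N f \<kappa>M \<kappa>N \<eta> \<delta> \<mu> = (\<lambda>(d, b, r) k p v. let W = push M N f p v in
     lognorm N (-1) \<kappa>N (f p) W
     + \<eta> * (ln ((cmod (W d k))\<^sup>2) + \<delta> * (\<Sum>a<cdim N. (cmod (W d a / W d k))\<^sup>2) - \<mu> * (sqdist (cdim N) (cmap d (f p)) b / r\<^sup>2))
     - (1 + \<eta>) * lognorm M 1 \<kappa>M p v)"

text \<open>The vectors at which the test function may use the given patch and component. The factor
  2 instead of 1 leaves room: a largest component satisfies all the inequalities strictly, so
  switching to it brings the vector off the boundary.\<close>

definition admissible where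
  "admissible M N f = (\<lambda>(d, b, r) k p v. p \<in> carrier_of M \<and> v \<in> tangent_space M p \<and> f p \<in> cdom d \<and>
     sqdist (cdim N) (cmap d (f p)) b \<le> r\<^sup>2 \<and> push M N f p v d k \<noteq> 0 \<and>
     (\<forall>a<cdim N. cmod (push M N f p v d a) \<le> 2 * cmod (push M N f p v d k)))"

lemma maximal_component:
  assumes "w \<noteq> tzero" "w \<in> tangent_space X p" "c \<in> atlas X" "p \<in> cdom c"
  obtains k where "k < cdim X" "w c k \<noteq> 0" "\<And>a. a < cdim X \<Longrightarrow> cmod (w c a) \<le> cmod (w c k)"
proof -
  have "\<exists>i<cdim X. w c i \<noteq> 0"
  proof (rule ccontr)
    assume "\<not> (\<exists>i<cdim X. w c i \<noteq> 0)"
    moreover have "tzero \<in> tangent_space X p" using tangent_space_scale[OF assms(2), of 0] by (simp add: tscale_def tzero_def)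
    ultimately have "w = tzero" using tangent_eqI[OF assms(2) _ assms(3,4), of tzero] by (auto simp: tzero_def)
    then show False using assms(1) by simp
  qed
  then obtain i where i: "i < cdim X" "w c i \<noteq> 0" by blast
  let ?S = "(\<lambda>a. cmod (w c a)) ` {..<cdim X}"
  have "Max ?S \<in> ?S" using i by (intro Max_in) auto
  then obtain k where k: "k < cdim X" "cmod (w c k) = Max ?S" by auto
  have mx: "cmod (w c a) \<le> cmod (w c k)" if "a < cdim X" for a
    unfolding k(2) using that by (intro Max_ge) auto
  moreover have "w c k \<noteq> 0" using mx[OF i(1)] i(2) by auto
  ultimately show ?thesis using that k(1) by blast
qed

context
  fixes M :: "'a cmanifold" and N :: "'b cmanifold" and f :: "'a \<Rightarrow> 'b"
  assumes M: "complex_manifold M" and N: "complex_manifold N" and f: "holomorphic_map M N f"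
begin

lemma push_coord_continuous:
  assumes "c \<in> atlas M" "d \<in> atlas N"
  shows "continuous_on {Z. base_part (cdim M) Z \<in> cmap c ` {p \<in> cdom c. f p \<in> cdom d}} (\<lambda>Z. push_coord M N f c l d Z a)"
    "continuous_on {Z. base_part (cdim M) Z \<in> cmap c ` {p \<in> cdom c. f p \<in> cdom d}} (\<lambda>Z. cmap d (f (cinv c (base_part (cdim M) Z))) a)"
proof -
  let ?U = "cmap c ` {p \<in> cdom c. f p \<in> cdom d}" and ?D = "{Z. base_part (cdim M) Z \<in> cmap c ` {p \<in> cdom c. f p \<in> cdom d}}"
  have cmp: "continuous_on ?D (\<lambda>Z. F (base_part (cdim M) Z))" if "continuous_on ?U F" for F :: "_ \<Rightarrow> complex"
    by (rule continuous_on_compose2[OF that continuous_base_part]) auto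
  show "continuous_on ?D (\<lambda>Z. push_coord M N f c l d Z a)"
  proof (cases "a < cdim N")
    case True
    have "continuous_on ?U (d_z j (\<lambda>x. cmap d (f (cinv c x)) a))" if "j < cdim M" for j
      using C1_continuous_d_z(1)[OF holo_fn_C_k[OF map_coord_holo[OF M N f assms True], of "Suc 0"] that] .
    then show ?thesis unfolding push_coord_def using True
      by (auto intro!: continuous_intros cmp continuous_fibre_part)
  qed (simp add: push_coord_def)
  show "continuous_on ?D (\<lambda>Z. cmap d (f (cinv c (base_part (cdim M) Z))) a)"
  proof (cases "a < cdim N")
    case True
    show ?thesis by (rule cmp[OF holo_fn_continuous[OF map_coord_holo[OF M N f assms True]]])
  next
    case False
    have "cmap d (f (cinv c (base_part (cdim M) Z))) a = 0" if "Z \<in> ?D" for Z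
    proof -
      have "base_part (cdim M) Z \<in> cmap c ` {p \<in> cdom c. f p \<in> cdom d}" using that by simp
      then obtain p where "p \<in> cdom c" "f p \<in> cdom d" "base_part (cdim M) Z = cmap c p" by blast
      then have "cmap d (f (cinv c (base_part (cdim M) Z))) \<in> cspace (cdim N)"
        using chart_facts(4)[OF M assms(1)] chart_facts(3)[OF N assms(2)] by simp
      then show ?thesis using False by (simp add: cspace_def)
    qed
    then show ?thesis by (subst continuous_on_cong[OF refl, of _ _ "\<lambda>Z. 0"]) auto
  qed
qed

lemma push_at_point:
  assumes c: "c \<in> atlas M" and l: "l < cdim M" and Z: "Z \<in> proj_img M c" and d: "d \<in> atlas N"
  defines "p \<equiv> cinv c (base_part (cdim M) Z)"
  defines "v \<equiv> tvec_of M c p (fibre_part (cdim M) l Z)"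
  assumes fp: "f p \<in> cdom d"
  shows "push M N f p v d = push_coord M N f c l d Z" "push M N f p v \<in> tangent_space N (f p)" "p \<in> carrier_of M"
proof -
  note P = proj_img_point[OF M c l Z, folded p_def, folded v_def]
  show p: "p \<in> carrier_of M" using c P(1) by (auto simp: carrier_of_def)
  show t: "push M N f p v \<in> tangent_space N (f p)" by (rule push(1)[OF M N f p P(3)])
  show "push M N f p v d = push_coord M N f c l d Z"
  proof
    fix a
    show "push M N f p v d a = push_coord M N f c l d Z a"
    proof (cases "a < cdim N")
      case True
      then show ?thesis using push(2)[OF M N f p P(3) c P(1) d fp True] P(2,4) by (simp add: push_coord_def)
    next
      case False
      then show ?thesis using tangent_facts(1)[OF t d fp] by (simp add: push_coord_def cspace_def)
    qed
  qed
qed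

text \<open>The representative has \<open>l\<close>-th component 1, so the logarithmic term on
  \<open>M\<close> drops out, and the two on \<open>N\<close> combine to the coefficient
  \<open>1 + \<eta>\<close>.\<close>

lemma test_fn_coord:
  assumes \<kappa>M: "log_metric M 1 \<kappa>M" and \<kappa>N: "log_metric N (-1) \<kappa>N"
    and c: "c \<in> atlas M" and l: "l < cdim M" and Z: "Z \<in> proj_img M c" and d: "d \<in> atlas N" and k: "k < cdim N"
  defines "p \<equiv> cinv c (base_part (cdim M) Z)"
  defines "v \<equiv> tvec_of M c p (fibre_part (cdim M) l Z)"
  defines "w \<equiv> push_coord M N f c l d Z"
  assumes fp: "f p \<in> cdom d" and wk: "w k \<noteq> 0"
  shows "test_fn M N f \<kappa>M \<kappa>N \<eta> \<delta> \<mu> (d, b, r) k p v =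
    - \<kappa>N d k (pcoord (cdim N) k (cmap d (f p)) w) + (1 + \<eta>) * ln ((cmod (w k))\<^sup>2)
    + \<eta> * (\<delta> * (\<Sum>a<cdim N. (cmod (w a / w k))\<^sup>2) - \<mu> * (sqdist (cdim N) (cmap d (f p)) b / r\<^sup>2))
    - (1 + \<eta>) * \<kappa>M c l Z"
proof -
  note P = proj_img_point[OF M c l Z, folded p_def, folded v_def]
  note W = push_at_point[OF c l Z d, folded p_def, folded v_def, OF fp, folded w_def]
  have "pcoord (cdim M) l (cmap c p) (v c) = Z"
    using Z P(2,4) pcoord_parts[of Z "cdim M" l] l by (simp add: proj_img_def)
  moreover have "v c l = 1" using P(4) by (simp add: fibre_part_k)
  ultimately have "lognorm M 1 \<kappa>M p v = \<kappa>M c l Z"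
    using lognorm_eq[OF \<kappa>M _ c l P(1,3)] by simp
  moreover have "lognorm N (-1) \<kappa>N (f p) (push M N f p v) = - \<kappa>N d k (pcoord (cdim N) k (cmap d (f p)) w) + ln ((cmod (w k))\<^sup>2)"
    using lognorm_eq[OF \<kappa>N _ d k fp W(2)] W(1) wk by simp
  ultimately show ?thesis by (simp add: test_fn_def Let_def W(1) algebra_simps)
qed

text \<open>Scaling adds \<open>ln ((cmod a)\<^sup>2)\<close> with total coefficient
  \<open>1 + \<eta> - (1 + \<eta>) = 0\<close>; the other terms contain only quotients of components
  and the base point.\<close>

lemma test_fn_scale:
  assumes \<kappa>M: "log_metric M 1 \<kappa>M" and \<kappa>N: "log_metric N (-1) \<kappa>N"
    and p: "p \<in> carrier_of M" and v: "v \<in> tangent_space M p" "v c l \<noteq> 0" and c: "c \<in> atlas M" "p \<in> cdom c" "l < cdim M"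
    and d: "d \<in> atlas N" "f p \<in> cdom d" "k < cdim N" and wk: "push M N f p v d k \<noteq> 0" and a: "a \<noteq> 0"
  shows "test_fn M N f \<kappa>M \<kappa>N \<eta> \<delta> \<mu> (d, b, r) k p (tscale a v) = test_fn M N f \<kappa>M \<kappa>N \<eta> \<delta> \<mu> (d, b, r) k p v"
proof -
  have 1: "lognorm M 1 \<kappa>M p (tscale a v) = ln ((cmod a)\<^sup>2) + lognorm M 1 \<kappa>M p v"
    by (rule lognorm_scale[OF \<kappa>M _ c(1,3,2) v a]) simp
  have 2: "lognorm N (-1) \<kappa>N (f p) (tscale a (push M N f p v)) = ln ((cmod a)\<^sup>2) + lognorm N (-1) \<kappa>N (f p) (push M N f p v)"
    by (rule lognorm_scale[OF \<kappa>N _ d(1,3,2) push(1)[OF M N f p v(1)] wk a]) simp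
  have 3: "ln ((cmod (tscale a w d k))\<^sup>2) = ln ((cmod a)\<^sup>2) + ln ((cmod (w d k))\<^sup>2)" if "w d k \<noteq> 0" for w :: "'b tvec"
    using that a by (simp add: tscale_def norm_mult power_mult_distrib ln_mult)
  have 4: "tscale a w d i / tscale a w d k = w d i / w d k" for w :: "'b tvec" and i
    using a by (simp add: tscale_def)
  show ?thesis
    unfolding test_fn_def Let_def prod.case push_scale[OF M N f] 1 2 3[of "push M N f p v", OF wk] 4 by (simp add: algebra_simps)
qed

lemma admissible_scale:
  assumes "a \<noteq> 0" "admissible M N f D k p v"
  shows "admissible M N f D k p (tscale a v)"
proof -
  obtain d b r where D: "D = (d, b, r)" by (cases D)
  show ?thesis
    using assms tangent_space_scale[of v M p a] unfolding D admissible_def prod.case push_scale[OF M N f]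
    by (auto simp: tscale_def norm_mult)
qed

end

section \<open>Uniform bounds over finitely many patches\<close>

lemma finite_uniform_bound:
  fixes F :: "'j \<Rightarrow> 'x::metric_space \<Rightarrow> real"
  assumes "finite J" "\<And>j. j \<in> J \<Longrightarrow> compact (K j)" "\<And>j. j \<in> J \<Longrightarrow> continuous_on (K j) (F j)"
  obtains B where "B \<ge> 0" "\<And>j x. j \<in> J \<Longrightarrow> x \<in> K j \<Longrightarrow> \<bar>F j x\<bar> \<le> B"
proof -
  have "\<exists>b\<ge>0. \<forall>x\<in>K j. \<bar>F j x\<bar> \<le> b" if "j \<in> J" for j
  proof -
    have "bounded (F j ` K j)" by (intro compact_imp_bounded compact_continuous_image assms that)
    then obtain b where "\<forall>y\<in>F j ` K j. norm y \<le> b" by (auto simp: bounded_iff)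
    then show ?thesis by (intro exI[of _ "max b 0"]) (auto simp: le_max_iff_disj)
  qed
  then obtain b where b: "\<And>j. j \<in> J \<Longrightarrow> b j \<ge> 0" "\<And>j x. j \<in> J \<Longrightarrow> x \<in> K j \<Longrightarrow> \<bar>F j x\<bar> \<le> b j" by metis
  show ?thesis
  proof (rule that[of "sum b J"])
    show "sum b J \<ge> 0" by (intro sum_nonneg b)
    fix j x assume jx: "j \<in> J" "x \<in> K j"
    have "b j \<le> sum b J" by (rule member_le_sum) (use jx b assms(1) in auto)
    then show "\<bar>F j x\<bar> \<le> sum b J" using b(2)[OF jx] by simp
  qed
qed

lemma log_metric_continuous:
  assumes \<kappa>: "log_metric X s \<kappa>" and "c \<in> atlas X" "k < cdim X"
  shows "continuous_on (proj_img X c) (\<kappa> c k)"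
proof -
  have "C_k (Suc (Suc 0)) (2 * cdim X - 1) (proj_img X c) (\<lambda>Z. of_real (\<kappa> c k Z))"
    using assms unfolding log_metric_def by blast
  then have "continuous_on (proj_img X c) (\<lambda>Z. complex_of_real (\<kappa> c k Z))"
    unfolding C_k.simps(2)[of "Suc 0"] by (rule conjunct1)
  from continuous_on_Re[OF this] show ?thesis by simp
qed

definition patch_cover :: "'a cmanifold \<Rightarrow> 'a patch set \<Rightarrow> bool" where
  "patch_cover X I \<longleftrightarrow> finite I \<and> (\<forall>P\<in>I. is_patch X P) \<and>
     (\<forall>p\<in>carrier_of X. \<exists>(c, a, r)\<in>I. p \<in> cdom c \<and> sqdist (cdim X) (cmap c p) a < r\<^sup>2 / 4)"

lemma log_metric_bound:
  assumes X: "complex_manifold X" and \<kappa>: "log_metric X s \<kappa>" and I: "patch_cover X I"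
  obtains B where "B \<ge> 0" "\<And>c a r k Z. (c, a, r) \<in> I \<Longrightarrow> k < cdim X \<Longrightarrow> Z \<in> proj_box (cdim X) a r \<rho> \<Longrightarrow> \<bar>\<kappa> c k Z\<bar> \<le> B"
proof -
  let ?J = "I \<times> {..<cdim X}"
  let ?K = "\<lambda>((c, a, r), k). proj_box (cdim X) a r \<rho>" and ?F = "\<lambda>((c, a, r), k). \<kappa> c k"
  have fin: "finite ?J" using I by (simp add: patch_cover_def)
  have "compact (?K j) \<and> continuous_on (?K j) (?F j)" if "j \<in> ?J" for j
  proof -
    obtain c a r k where j: "j = ((c, a, r), k)" by (metis prod_cases4 prod.collapse)
    have P: "is_patch X (c, a, r)" "k < cdim X" using I that j by (auto simp: patch_cover_def)
    then show ?thesis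
      unfolding j prod.case using compact_proj_box continuous_on_subset[OF log_metric_continuous[OF \<kappa> _ P(2)] proj_box_img[OF P(1)]]
      by (auto simp: is_patch_def)
  qed
  then obtain B where B: "B \<ge> 0" "\<And>j x. j \<in> ?J \<Longrightarrow> x \<in> ?K j \<Longrightarrow> \<bar>?F j x\<bar> \<le> B"
    using finite_uniform_bound[OF fin, of ?K ?F] by metis
  show ?thesis
  proof (rule that[OF B(1)])
    fix c a r k Z assume "(c, a, r) \<in> I" "k < cdim X" "Z \<in> proj_box (cdim X) a r \<rho>"
    then show "\<bar>\<kappa> c k Z\<bar> \<le> B" using B(2)[of "((c, a, r), k)" Z] by simp
  qed
qed

text \<open>Dividing \<open>v\<close> by a largest component puts its coordinates into a compact
  box. Thus finitely many compact sets account for all lines in the tangent spaces of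
  \<open>M\<close>.\<close>

lemma normal_form:
  assumes M: "complex_manifold M" and PM: "patch_cover M PM" and p: "p \<in> carrier_of M"
    and v: "v \<in> tangent_space M p" "v \<noteq> tzero"
  obtains c a s l Z \<alpha> where "(c, a, s) \<in> PM" "l < cdim M" "p \<in> cdom c" "v c l \<noteq> 0" "Z \<in> proj_box (cdim M) a s 1" "\<alpha> \<noteq> 0"
    "cinv c (base_part (cdim M) Z) = p" "tvec_of M c p (fibre_part (cdim M) l Z) = tscale \<alpha> v"
proof -
  obtain c a s where P: "(c, a, s) \<in> PM" "p \<in> cdom c" "sqdist (cdim M) (cmap c p) a < s\<^sup>2 / 4"
    using PM p unfolding patch_cover_def by blast
  have c: "c \<in> atlas M" "s > 0" using PM P(1) by (auto simp: patch_cover_def is_patch_def)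
  obtain l where l: "l < cdim M" "v c l \<noteq> 0" "\<And>a. a < cdim M \<Longrightarrow> cmod (v c a) \<le> cmod (v c l)"
    using maximal_component[OF v(2,1) c(1) P(2)] by metis
  define Z where "Z = pcoord (cdim M) l (cmap c p) (v c)"
  have vc: "v c \<in> cspace (cdim M)" by (rule tangent_facts(1)[OF v(1) c(1) P(2)])
  have base: "base_part (cdim M) Z = cmap c p" unfolding Z_def by (rule base_part_pcoord[OF chart_facts(3)[OF M c(1) P(2)]])
  have fib: "fibre_part (cdim M) l Z = (\<lambda>i. v c i / v c l)"
    unfolding Z_def using fibre_part_pcoord[OF vc l(1,2)] by (rule ext)
  have t: "tvec_of M c p (fibre_part (cdim M) l Z) \<in> tangent_space M p" "tvec_of M c p (fibre_part (cdim M) l Z) c = fibre_part (cdim M) l Z"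
    using tvec_of(2,3)[OF M c(1) P(2) fibre_part_cspace[OF l(1)]] by auto
  have tv: "tvec_of M c p (fibre_part (cdim M) l Z) = tscale (1 / v c l) v"
    by (rule tangent_eqI[OF t(1) tangent_space_scale[OF v(1)] c(1) P(2)])
      (simp only: t(2), simp add: fib tscale_def)
  have "s\<^sup>2 / 4 \<le> s\<^sup>2" by simp
  then have sq: "sqdist (cdim M) (cmap c p) a \<le> s\<^sup>2" using P(3) by linarith
  have Zb: "Z \<in> proj_box (cdim M) a s 1"
    unfolding Z_def by (rule pcoord_proj_box[where v = "v c", OF l(1) sq l(2)]) (use l(3) in simp)
  show ?thesis
  proof (rule that[OF P(1) l(1) P(2) l(2) Zb _ _ tv])
    show "1 / v c l \<noteq> 0" using l(2) by simp
    show "cinv c (base_part (cdim M) Z) = p" using chart_facts(4)[OF M c(1) P(2)] by (simp add: base)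
  qed
qed

section \<open>Existence of a maximum\<close>

context
  fixes M :: "'a cmanifold" and N :: "'b cmanifold" and f :: "'a \<Rightarrow> 'b"
  assumes M: "complex_manifold M" and N: "complex_manifold N" and f: "holomorphic_map M N f"
begin

text \<open>The admissible points in one chart of the projectivised bundle of \<open>M\<close>.
  Points at which the component \<open>k\<close> vanishes are included to make the set
  closed.\<close>

definition piece where
  "piece = (\<lambda>(c, a, s) l (d, b, r) k. {Z \<in> proj_box (cdim M) a s 1.
     (f (cinv c (base_part (cdim M) Z)) \<in> cdom d \<and> sqdist (cdim N) (cmap d (f (cinv c (base_part (cdim M) Z)))) b \<le> r\<^sup>2) \<and>
     (\<forall>i<cdim N. cmod (push_coord M N f c l d Z i) \<le> 2 * cmod (push_coord M N f c l d Z k))})"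

lemma piece:
  assumes P: "is_patch M (c, a, s)" and Q: "is_patch N (d, b, r)" and l: "l < cdim M" and k: "k < cdim N"
  shows "compact (piece (c, a, s) l (d, b, r) k)"
    "piece (c, a, s) l (d, b, r) k \<subseteq> {Z. base_part (cdim M) Z \<in> cmap c ` {p \<in> cdom c. f p \<in> cdom d}}"
    "piece (c, a, s) l (d, b, r) k \<subseteq> proj_img M c"
proof -
  let ?m = "cdim M" and ?n = "cdim N"
  let ?D = "{Z. base_part ?m Z \<in> cmap c ` {p \<in> cdom c. f p \<in> cdom d}}"
  have c: "c \<in> atlas M" "s > 0" "cs_ball ?m a s \<subseteq> cmap c ` cdom c" and d: "d \<in> atlas N"
    using P Q by (auto simp: is_patch_def)
  define G where "G = {x \<in> cs_ball ?m a s. f (cinv c x) \<in> cdom d \<and> sqdist ?n (cmap d (f (cinv c x))) b \<le> r\<^sup>2}"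
  have Gc: "closed G" unfolding G_def by (rule compact_imp_closed[OF compact_patch_preimage[OF M N f P Q]])
  define S where "S = proj_box ?m a s 1 \<inter> base_part ?m -` G"
  have S: "compact S"
    unfolding S_def
    using continuous_closedin_preimage[OF continuous_base_part Gc] closedin_compact compact_proj_box[OF c(2)] by blast
  have SD: "S \<subseteq> ?D"
  proof
    fix Z assume "Z \<in> S"
    then have Z: "base_part ?m Z \<in> cs_ball ?m a s" "f (cinv c (base_part ?m Z)) \<in> cdom d" by (auto simp: S_def G_def)
    then have "base_part ?m Z \<in> cmap c ` cdom c" using c(3) by blast
    from cmap_cinv[OF this] Z(2) have "cinv c (base_part ?m Z) \<in> {p \<in> cdom c. f p \<in> cdom d}" "cmap c (cinv c (base_part ?m Z)) = base_part ?m Z" by auto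
    then show "Z \<in> ?D" by (metis (no_types, lifting) image_eqI mem_Collect_eq)
  qed
  \<comment> \<open>Expresses finitely many inequalities as the single condition
    \<open>h Z \<le> 0\<close> on a continuous function.\<close>
  define h where "h Z = (\<Sum>i<?n. max 0 (cmod (push_coord M N f c l d Z i) - 2 * cmod (push_coord M N f c l d Z k)))" for Z
  have "continuous_on S (\<lambda>Z. push_coord M N f c l d Z i)" for i
    by (rule continuous_on_subset[OF push_coord_continuous(1)[OF M N f c(1) d] SD])
  then have "continuous_on S h" unfolding h_def by (intro continuous_intros)
  from continuous_closedin_preimage[OF this closed_atMost[of 0]]
  have "compact (S \<inter> h -` {..0})" using S closedin_compact by blast
  moreover have "piece (c, a, s) l (d, b, r) k = S \<inter> h -` {..0}"
  proof -
    have mx: "max 0 (x - y) = (0::real) \<longleftrightarrow> x \<le> y" for x y by (auto simp: max_def)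
    have h0: "h Z \<le> 0 \<longleftrightarrow> (\<forall>i<?n. cmod (push_coord M N f c l d Z i) \<le> 2 * cmod (push_coord M N f c l d Z k))" for Z
    proof -
      have "h Z \<ge> 0" unfolding h_def by (intro sum_nonneg) auto
      then have "h Z \<le> 0 \<longleftrightarrow> h Z = 0" by auto
      also have "\<dots> \<longleftrightarrow> (\<forall>i\<in>{..<?n}. max 0 (cmod (push_coord M N f c l d Z i) - 2 * cmod (push_coord M N f c l d Z k)) = 0)"
        unfolding h_def by (rule sum_nonneg_eq_0_iff) auto
      also have "\<dots> \<longleftrightarrow> (\<forall>i<?n. cmod (push_coord M N f c l d Z i) \<le> 2 * cmod (push_coord M N f c l d Z k))"
        unfolding mx by auto
      finally show ?thesis .
    qed
    have "base_part ?m Z \<in> cs_ball ?m a s" if "Z \<in> proj_box ?m a s 1" for Z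
      using that by (simp add: cs_ball_def base_part_cspace sqdist_base_part proj_box_def)
    then show ?thesis unfolding piece_def prod.case S_def G_def using h0 by blast
  qed
  ultimately show "compact (piece (c, a, s) l (d, b, r) k)" "piece (c, a, s) l (d, b, r) k \<subseteq> ?D" using SD by auto
  show "piece (c, a, s) l (d, b, r) k \<subseteq> proj_img M c"
    using proj_box_img[OF P, of 1] by (auto simp: piece_def)
qed

lemma piece_admissible:
  assumes P: "is_patch M (c, a, s)" and Q: "is_patch N (d, b, r)" and l: "l < cdim M" and k: "k < cdim N"
    and Z: "Z \<in> proj_box (cdim M) a s 1"
  defines "p \<equiv> cinv c (base_part (cdim M) Z)"
  defines "v \<equiv> tvec_of M c p (fibre_part (cdim M) l Z)"
  shows "admissible M N f (d, b, r) k p v \<longleftrightarrow> Z \<in> piece (c, a, s) l (d, b, r) k \<and> push_coord M N f c l d Z k \<noteq> 0"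
proof -
  have cd: "c \<in> atlas M" "d \<in> atlas N" using P Q by (auto simp: is_patch_def)
  have Zi: "Z \<in> proj_img M c" using proj_box_img[OF P] Z by blast
  note Pp = proj_img_point[OF M cd(1) l Zi, folded p_def, folded v_def]
  show ?thesis
  proof (cases "f p \<in> cdom d")
    case True
    note W = push_at_point[OF M N f cd(1) l Zi cd(2), folded p_def, folded v_def, OF True]
    have "admissible M N f (d, b, r) k p v \<longleftrightarrow> sqdist (cdim N) (cmap d (f p)) b \<le> r\<^sup>2 \<and>
      push_coord M N f c l d Z k \<noteq> 0 \<and> (\<forall>a<cdim N. cmod (push_coord M N f c l d Z a) \<le> 2 * cmod (push_coord M N f c l d Z k))"
      unfolding admissible_def prod.case W(1) using W(3) Pp(3) True by blast
    moreover have "Z \<in> piece (c, a, s) l (d, b, r) k \<longleftrightarrow> sqdist (cdim N) (cmap d (f p)) b \<le> r\<^sup>2 \<and>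
      (\<forall>a<cdim N. cmod (push_coord M N f c l d Z a) \<le> 2 * cmod (push_coord M N f c l d Z k))"
      using True Z unfolding piece_def prod.case p_def by blast
    ultimately show ?thesis by blast
  next
    case False
    then have "Z \<notin> piece (c, a, s) l (d, b, r) k" unfolding piece_def prod.case p_def by blast
    moreover have "\<not> admissible M N f (d, b, r) k p v" using False unfolding admissible_def prod.case by blast
    ultimately show ?thesis by blast
  qed
qed

text \<open>The maximum is taken jointly over patches, components and vectors. It can therefore be
  compared both with other patches at the same vector, which shows that it is interior, and with
  nearby vectors, which gives the inequality for the Laplacian.\<close>

lemma test_fn_max:
  assumes \<kappa>M: "log_metric M 1 \<kappa>M" and \<kappa>N: "log_metric N (-1) \<kappa>N" and PM: "patch_cover M PM" and PN: "patch_cover N PN"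
    and \<eta>: "\<eta> > 0" and \<delta>: "\<delta> \<ge> 0" and \<mu>: "\<mu> \<ge> 0"
    and adm0: "D0 \<in> PN" "k0 < cdim N" "admissible M N f D0 k0 p0 v0"
  obtains D k p v where "D \<in> PN" "k < cdim N" "admissible M N f D k p v"
    "\<And>D' k' p' v'. D' \<in> PN \<Longrightarrow> k' < cdim N \<Longrightarrow> admissible M N f D' k' p' v' \<Longrightarrow>
       test_fn M N f \<kappa>M \<kappa>N \<eta> \<delta> \<mu> D' k' p' v' \<le> test_fn M N f \<kappa>M \<kappa>N \<eta> \<delta> \<mu> D k p v"
proof -
  let ?m = "cdim M" and ?n = "cdim N"
  let ?T = "test_fn M N f \<kappa>M \<kappa>N \<eta> \<delta> \<mu>"
  let ?I = "PM \<times> {..<?m} \<times> PN \<times> {..<?n}"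
  define K where "K = (\<lambda>(P, l, D, k). piece P l D k)"
  define pt where "pt = (\<lambda>(P :: 'a patch) Z. cinv (fst P) (base_part ?m Z))"
  define vc where "vc = (\<lambda>(P :: 'a patch) (l :: nat) Z. tvec_of M (fst P) (pt P Z) (fibre_part ?m l Z))"
  define w where "w = (\<lambda>(P :: 'a patch, l :: nat, D :: 'b patch, k :: nat) Z. cmod (push_coord M N f (fst P) l (fst D) Z k))"
  define \<phi> where "\<phi> = (\<lambda>(P, l, D, k) Z. ?T D k (pt P Z) (vc P l Z))"
  have PMi: "is_patch M P" if "P \<in> PM" for P using PM that by (simp add: patch_cover_def)
  have PNi: "is_patch N P" if "P \<in> PN" for P using PN that by (simp add: patch_cover_def)
  obtain B1 where B1: "\<And>d b r k Z. (d, b, r) \<in> PN \<Longrightarrow> k < ?n \<Longrightarrow> Z \<in> proj_box ?n b r 2 \<Longrightarrow> \<bar>\<kappa>N d k Z\<bar> \<le> B1"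
    using log_metric_bound[OF N \<kappa>N PN, of 2] by metis
  obtain B2 where B2: "\<And>c a s l Z. (c, a, s) \<in> PM \<Longrightarrow> l < ?m \<Longrightarrow> Z \<in> proj_box ?m a s 1 \<Longrightarrow> \<bar>\<kappa>M c l Z\<bar> \<le> B2"
    using log_metric_bound[OF M \<kappa>M PM, of 1] by metis
  \<comment> \<open>By homogeneity an admissible vector may be replaced by its normalised multiple,
    so its test value is also taken on one of the finitely many pieces.\<close>
  have reach: "\<exists>i\<in>?I. \<exists>Z\<in>K i. w i Z > 0 \<and> \<phi> i Z = ?T D k p v"
    if D: "D \<in> PN" and k: "k < ?n" and adm: "admissible M N f D k p v" for D k p v
  proof -
    obtain d b r where Dd: "D = (d, b, r)" by (cases D)
    have pv: "p \<in> carrier_of M" "v \<in> tangent_space M p" "f p \<in> cdom d" "push M N f p v d k \<noteq> 0"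
      using adm by (auto simp: admissible_def Dd)
    have "v \<noteq> tzero"
    proof
      assume "v = tzero"
      then have "v = tscale 0 v" by (simp add: tzero_def tscale_def)
      then have "push M N f p v = tscale 0 (push M N f p v)" by (metis push_scale[OF M N f])
      then have "push M N f p v d k = 0" by (metis tscale_def mult_zero_left)
      then show False using pv(4) by simp
    qed
    from normal_form[OF M PM pv(1,2) this] obtain c a s l Z \<alpha> where P: "(c, a, s) \<in> PM" "l < ?m" "p \<in> cdom c" "v c l \<noteq> 0"
      "Z \<in> proj_box ?m a s 1" "\<alpha> \<noteq> 0" "cinv c (base_part ?m Z) = p" "tvec_of M c p (fibre_part ?m l Z) = tscale \<alpha> v" by metis
    have cd: "c \<in> atlas M" "d \<in> atlas N" using PMi[OF P(1)] PNi[OF D] by (auto simp: is_patch_def Dd)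
    have "admissible M N f (d, b, r) k p (tscale \<alpha> v)" using admissible_scale[OF M N f P(6) adm] by (simp add: Dd)
    then have "Z \<in> piece (c, a, s) l (d, b, r) k \<and> push_coord M N f c l d Z k \<noteq> 0"
      using piece_admissible[OF PMi[OF P(1)] PNi[OF D, unfolded Dd] P(2) k P(5)] P(7,8) by simp
    moreover have "?T (d, b, r) k p (tscale \<alpha> v) = ?T (d, b, r) k p v"
      by (rule test_fn_scale[OF M N f \<kappa>M \<kappa>N pv(1,2) P(4) cd(1) P(3,2) cd(2) pv(3) k pv(4) P(6)])
    ultimately show ?thesis
      using P D k by (intro bexI[of _ "((c, a, s), l, (d, b, r), k)"] bexI[of _ Z])
        (auto simp: K_def w_def \<phi>_def pt_def vc_def Dd)
  qed
  obtain i0 Z0 where i0: "i0 \<in> ?I" "Z0 \<in> K i0" "w i0 Z0 > 0" using reach[OF adm0] by blast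
  have expr: "\<phi> ((c, a, s), l, (d, b, r), k) Z =
      - \<kappa>N d k (pcoord ?n k (cmap d (f (cinv c (base_part ?m Z)))) (push_coord M N f c l d Z))
      + (1 + \<eta>) * ln ((cmod (push_coord M N f c l d Z k))\<^sup>2)
      + \<eta> * (\<delta> * (\<Sum>i<?n. (cmod (push_coord M N f c l d Z i / push_coord M N f c l d Z k))\<^sup>2)
        - \<mu> * (sqdist ?n (cmap d (f (cinv c (base_part ?m Z)))) b / r\<^sup>2))
      - (1 + \<eta>) * \<kappa>M c l Z"
    and mem: "f (cinv c (base_part ?m Z)) \<in> cdom d" "sqdist ?n (cmap d (f (cinv c (base_part ?m Z)))) b \<le> r\<^sup>2"
      "\<And>i. i < ?n \<Longrightarrow> cmod (push_coord M N f c l d Z i) \<le> 2 * cmod (push_coord M N f c l d Z k)"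
      "Z \<in> proj_box ?m a s 1" "Z \<in> proj_img M c"
    if i: "(c, a, s) \<in> PM" "l < ?m" "(d, b, r) \<in> PN" "k < ?n" "Z \<in> K ((c, a, s), l, (d, b, r), k)" "w ((c, a, s), l, (d, b, r), k) Z > 0"
    for c a s l d b r k Z
  proof -
    have Zp: "Z \<in> piece (c, a, s) l (d, b, r) k" "push_coord M N f c l d Z k \<noteq> 0" using i(5,6) by (auto simp: K_def w_def)
    show mem: "f (cinv c (base_part ?m Z)) \<in> cdom d" "sqdist ?n (cmap d (f (cinv c (base_part ?m Z)))) b \<le> r\<^sup>2"
      "\<And>i. i < ?n \<Longrightarrow> cmod (push_coord M N f c l d Z i) \<le> 2 * cmod (push_coord M N f c l d Z k)"
      "Z \<in> proj_box ?m a s 1" using Zp(1) unfolding piece_def prod.case by blast+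
    show img: "Z \<in> proj_img M c" using piece(3)[OF PMi[OF i(1)] PNi[OF i(3)] i(2,4)] Zp(1) by blast
    have cd: "c \<in> atlas M" "d \<in> atlas N" using PMi[OF i(1)] PNi[OF i(3)] by (auto simp: is_patch_def)
    show "\<phi> ((c, a, s), l, (d, b, r), k) Z =
      - \<kappa>N d k (pcoord ?n k (cmap d (f (cinv c (base_part ?m Z)))) (push_coord M N f c l d Z))
      + (1 + \<eta>) * ln ((cmod (push_coord M N f c l d Z k))\<^sup>2)
      + \<eta> * (\<delta> * (\<Sum>i<?n. (cmod (push_coord M N f c l d Z i / push_coord M N f c l d Z k))\<^sup>2)
        - \<mu> * (sqdist ?n (cmap d (f (cinv c (base_part ?m Z)))) b / r\<^sup>2))
      - (1 + \<eta>) * \<kappa>M c l Z"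
      unfolding \<phi>_def pt_def vc_def prod.case fst_conv
      by (rule test_fn_coord[OF M N f \<kappa>M \<kappa>N cd(1) i(2) img cd(2) i(4) mem(1) Zp(2)])
  qed
  \<comment> \<open>The hypotheses of \<open>max_attained\<close> on each piece. The constant
    estimates all terms except the logarithm of the component \<open>k\<close>; its coefficient
    \<open>1 + \<eta>\<close> is doubled because \<open>w\<close> is the modulus and not its
    square.\<close>
  have Ki: "compact (K i) \<and> continuous_on (K i) (w i) \<and> continuous_on {x \<in> K i. w i x > 0} (\<phi> i) \<and>
      (\<forall>x\<in>K i. w i x > 0 \<longrightarrow> \<phi> i x \<le> (B1 + \<eta> * \<delta> * (4 * ?n) + (1 + \<eta>) * B2) + (2 * (1 + \<eta>)) * ln (w i x))" if i: "i \<in> ?I" for i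
  proof -
    obtain c a s l d b r k where ie: "i = ((c, a, s), l, (d, b, r), k)" by (metis prod.collapse)
    have i': "(c, a, s) \<in> PM" "l < ?m" "(d, b, r) \<in> PN" "k < ?n" using i ie by auto
    note pc = piece[OF PMi[OF i'(1)] PNi[OF i'(3)] i'(2,4)]
    have cd: "c \<in> atlas M" "d \<in> atlas N" using PMi[OF i'(1)] PNi[OF i'(3)] by (auto simp: is_patch_def)
    have KK: "K i = piece (c, a, s) l (d, b, r) k" by (simp add: K_def ie)
    note cont = continuous_on_subset[OF push_coord_continuous(1)[OF M N f cd] pc(2)]
      continuous_on_subset[OF push_coord_continuous(2)[OF M N f cd] pc(2)]
    let ?S = "{x \<in> K i. w i x > 0}"
    have SK: "?S \<subseteq> piece (c, a, s) l (d, b, r) k" by (auto simp: KK)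
    note contS = continuous_on_subset[OF cont(1) SK] continuous_on_subset[OF cont(2) SK]
    have nz: "push_coord M N f c l d Z k \<noteq> 0" if "Z \<in> ?S" for Z using that by (auto simp: w_def ie)
    have "continuous_on (K i) (w i)" unfolding KK using cont(1) by (auto simp: w_def ie intro!: continuous_intros)
    moreover have "continuous_on ?S (\<phi> i)"
    proof (subst continuous_on_cong[OF refl expr[OF i', folded ie]])
      show "Z \<in> ?S \<Longrightarrow> Z \<in> K i" "Z \<in> ?S \<Longrightarrow> w i Z > 0" for Z by auto
      have 1: "continuous_on ?S (\<lambda>Z. \<kappa>N d k (pcoord ?n k (cmap d (f (cinv c (base_part ?m Z)))) (push_coord M N f c l d Z)))"
      proof (rule continuous_on_compose2[OF log_metric_continuous[OF \<kappa>N cd(2) i'(4)]])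
        show "continuous_on ?S (\<lambda>Z. pcoord ?n k (cmap d (f (cinv c (base_part ?m Z)))) (push_coord M N f c l d Z))"
          by (intro continuous_pcoord contS nz i'(4))
        show "(\<lambda>Z. pcoord ?n k (cmap d (f (cinv c (base_part ?m Z)))) (push_coord M N f c l d Z)) ` ?S \<subseteq> proj_img N d"
          using mem(1)[OF i', folded ie] by (auto intro!: pcoord_img[OF N cd(2) i'(4)])
      qed
      have 2: "continuous_on ?S (\<kappa>M c l)"
        by (rule continuous_on_subset[OF log_metric_continuous[OF \<kappa>M cd(1) i'(2)]]) (use pc(3) SK in blast)
      show "continuous_on ?S (\<lambda>Z. - \<kappa>N d k (pcoord ?n k (cmap d (f (cinv c (base_part ?m Z)))) (push_coord M N f c l d Z))
      + (1 + \<eta>) * ln ((cmod (push_coord M N f c l d Z k))\<^sup>2)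
      + \<eta> * (\<delta> * (\<Sum>i<?n. (cmod (push_coord M N f c l d Z i / push_coord M N f c l d Z k))\<^sup>2)
        - \<mu> * (sqdist ?n (cmap d (f (cinv c (base_part ?m Z)))) b / r\<^sup>2))
      - (1 + \<eta>) * \<kappa>M c l Z)"
        unfolding sqdist_def using nz PNi[OF i'(3)]
        by (intro continuous_intros 1 2 contS) (auto simp: is_patch_def)
    qed
    moreover have "\<phi> i Z \<le> (B1 + \<eta> * \<delta> * (4 * ?n) + (1 + \<eta>) * B2) + (2 * (1 + \<eta>)) * ln (w i Z)"
      if Z: "Z \<in> K i" "w i Z > 0" for Z
    proof -
      note mm = mem[OF i' Z[unfolded ie]]
      have nk: "push_coord M N f c l d Z k \<noteq> 0" using nz Z by blast
      have "pcoord ?n k (cmap d (f (cinv c (base_part ?m Z)))) (push_coord M N f c l d Z) \<in> proj_box ?n b r 2"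
        by (rule pcoord_proj_box[where v = "push_coord M N f c l d Z", OF i'(4) mm(2) nk mm(3)])
      from B1[OF i'(3,4) this] have 1: "- \<kappa>N d k (pcoord ?n k (cmap d (f (cinv c (base_part ?m Z)))) (push_coord M N f c l d Z)) \<le> B1" by linarith
      have "- \<kappa>M c l Z \<le> B2" using B2[OF i'(1,2) mm(4)] by linarith
      then have 2: "(1 + \<eta>) * - \<kappa>M c l Z \<le> (1 + \<eta>) * B2" using \<eta> by (intro mult_left_mono) auto
      have "(cmod (push_coord M N f c l d Z j / push_coord M N f c l d Z k))\<^sup>2 \<le> 4" if "j < ?n" for j
      proof -
        have "cmod (push_coord M N f c l d Z j / push_coord M N f c l d Z k) \<le> 2"
          using mm(3)[OF that] nk by (simp add: norm_divide divide_le_eq)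
        from power_mono[OF this, of 2] show ?thesis by simp
      qed
      then have "(\<Sum>j<?n. (cmod (push_coord M N f c l d Z j / push_coord M N f c l d Z k))\<^sup>2) \<le> (\<Sum>j<?n. 4)"
        by (intro sum_mono) auto
      then have "\<delta> * (\<Sum>j<?n. (cmod (push_coord M N f c l d Z j / push_coord M N f c l d Z k))\<^sup>2) \<le> \<delta> * (4 * ?n)"
        using \<delta> by (intro mult_left_mono) (auto simp: mult.commute)
      moreover have "\<mu> * (sqdist ?n (cmap d (f (cinv c (base_part ?m Z)))) b / r\<^sup>2) \<ge> 0"
        using \<mu> by (intro mult_nonneg_nonneg divide_nonneg_nonneg sqdist_nonneg) auto
      ultimately have "\<delta> * (\<Sum>j<?n. (cmod (push_coord M N f c l d Z j / push_coord M N f c l d Z k))\<^sup>2)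
         - \<mu> * (sqdist ?n (cmap d (f (cinv c (base_part ?m Z)))) b / r\<^sup>2) \<le> \<delta> * (4 * ?n)" by linarith
      then have 3: "\<eta> * (\<delta> * (\<Sum>j<?n. (cmod (push_coord M N f c l d Z j / push_coord M N f c l d Z k))\<^sup>2)
         - \<mu> * (sqdist ?n (cmap d (f (cinv c (base_part ?m Z)))) b / r\<^sup>2)) \<le> \<eta> * (\<delta> * (4 * ?n))"
        using \<eta> by (intro mult_left_mono) auto
      have "ln ((cmod (push_coord M N f c l d Z k))\<^sup>2) = 2 * ln (w i Z)" using nk by (simp add: ie w_def ln_realpow)
      then have 4: "(1 + \<eta>) * ln ((cmod (push_coord M N f c l d Z k))\<^sup>2) = (2 * (1 + \<eta>)) * ln (w i Z)" by simp
      show ?thesis using expr[OF i' Z[unfolded ie], folded ie] 1 2 3 4 by linarith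
    qed
    ultimately show ?thesis using pc(1) KK by simp
  qed
  have fin: "finite ?I" using PM PN by (auto simp: patch_cover_def)
  have c2: "2 * (1 + \<eta>) > 0" using \<eta> by simp
  obtain i Z where mx: "i \<in> ?I" "Z \<in> K i" "w i Z > 0" "\<And>j y. j \<in> ?I \<Longrightarrow> y \<in> K j \<Longrightarrow> w j y > 0 \<Longrightarrow> \<phi> j y \<le> \<phi> i Z"
    by (rule max_attained[OF fin, of K w \<phi> "B1 + \<eta> * \<delta> * (4 * ?n) + (1 + \<eta>) * B2" "2 * (1 + \<eta>)", OF _ _ _ _ c2 i0]) (use Ki in blast)+
  obtain c a s l d b r k where ie: "i = ((c, a, s), l, (d, b, r), k)" by (metis prod.collapse)
  have i': "(c, a, s) \<in> PM" "l < ?m" "(d, b, r) \<in> PN" "k < ?n" using mx(1) ie by auto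
  have Zp: "Z \<in> piece (c, a, s) l (d, b, r) k \<and> push_coord M N f c l d Z k \<noteq> 0" using mx(2,3) by (auto simp: K_def w_def ie)
  then have Zb: "Z \<in> proj_box ?m a s 1" unfolding piece_def prod.case by blast
  have adm: "admissible M N f (d, b, r) k (pt (c, a, s) Z) (vc (c, a, s) l Z)"
    unfolding pt_def vc_def fst_conv
    by (rule iffD2[OF piece_admissible[OF PMi[OF i'(1)] PNi[OF i'(3)] i'(2,4) Zb] Zp])
  show ?thesis
  proof (rule that[OF i'(3,4) adm])
    fix D' k' p' v' assume "D' \<in> PN" "k' < ?n" "admissible M N f D' k' p' v'"
    from reach[OF this] obtain j y where "j \<in> ?I" "y \<in> K j" "w j y > 0" "\<phi> j y = ?T D' k' p' v'" by blast
    then have "?T D' k' p' v' \<le> \<phi> i Z" using mx(4) by metis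
    then show "?T D' k' p' v' \<le> ?T (d, b, r) k (pt (c, a, s) Z) (vc (c, a, s) l Z)" by (simp add: \<phi>_def ie)
  qed
qed

end

section \<open>Bounds that do not involve the metrics supplied by nefness\<close>

lemma hermitian_metric_chart_bound:
  assumes X: "complex_manifold X" and g: "hermitian_metric (proj_tangent X) g" and P: "is_patch X (d, b, r)" and k: "k < cdim X"
  shows "\<exists>C\<ge>0. \<forall>q U. q \<in> proj_dom X d k \<longrightarrow> proj_map X d k q \<in> proj_box (cdim X) b r 2 \<longrightarrow> U \<in> tangent_space (proj_tangent X) q \<longrightarrow>
       Re (g q U U) \<le> C * (\<Sum>i<2 * cdim X - 1. (cmod (U (proj_chart X d k) i))\<^sup>2)"
proof -
  let ?N = "2 * cdim X - 1" let ?C = "proj_chart X d k"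
  have d: "d \<in> atlas X" "r > 0" using P by (auto simp: is_patch_def)
  have C: "?C \<in> atlas (proj_tangent X)" unfolding proj_tangent_simps using d k by blast
  obtain G where G: "\<forall>i<?N. \<forall>j<?N. smooth_fn ?N (proj_img X d) (G i j)"
    "\<forall>p\<in>proj_dom X d k. \<forall>u\<in>tangent_space (proj_tangent X) p. \<forall>v\<in>tangent_space (proj_tangent X) p.
           g p u v = (\<Sum>i<?N. \<Sum>j<?N. G i j (proj_map X d k p) * u ?C i * cnj (v ?C j))"
    using bspec[OF conjunct1[OF g[unfolded hermitian_metric_def]] C] by (auto simp: proj_map_image[OF X d(1) k])
  let ?J = "{..<?N} \<times> {..<?N}"
  have "continuous_on (proj_box (cdim X) b r 2) (\<lambda>Z. cmod (G i j Z))" if "i < ?N" "j < ?N" for i j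
  proof -
    have "C_k 0 ?N (proj_img X d) (G i j)" using G(1) that unfolding smooth_fn_def by blast
    then show ?thesis using continuous_on_subset[OF _ proj_box_img[OF P]] by (auto intro!: continuous_intros)
  qed
  then have cont: "continuous_on (proj_box (cdim X) b r 2) (\<lambda>Z. cmod (G (fst ij) (snd ij) Z))" if "ij \<in> ?J" for ij
    using that by auto
  have finJ: "finite ?J" by simp
  have "\<exists>B\<ge>0. \<forall>ij\<in>?J. \<forall>Z\<in>proj_box (cdim X) b r 2. \<bar>cmod (G (fst ij) (snd ij) Z)\<bar> \<le> B"
  proof (rule finite_uniform_bound[of ?J "\<lambda>_. proj_box (cdim X) b r 2" "\<lambda>ij Z. cmod (G (fst ij) (snd ij) Z)",
        OF finJ compact_proj_box[OF d(2)] cont])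
    fix B :: real assume "B \<ge> 0" "\<And>ij Z. ij \<in> ?J \<Longrightarrow> Z \<in> proj_box (cdim X) b r 2 \<Longrightarrow> \<bar>cmod (G (fst ij) (snd ij) Z)\<bar> \<le> B"
    then show ?thesis by blast
  qed
  then obtain B where B0: "B \<ge> 0" "\<forall>ij\<in>?J. \<forall>Z\<in>proj_box (cdim X) b r 2. \<bar>cmod (G (fst ij) (snd ij) Z)\<bar> \<le> B"
    by (elim exE conjE)
  have B: "B \<ge> 0" "\<And>i j Z. i < ?N \<Longrightarrow> j < ?N \<Longrightarrow> Z \<in> proj_box (cdim X) b r 2 \<Longrightarrow> cmod (G i j Z) \<le> B"
    using B0 by simp_all
  show ?thesis
  proof (intro exI[of _ "B * ?N"] conjI allI impI)
    show "0 \<le> B * ?N" using B by simp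
    fix q U assume q: "q \<in> proj_dom X d k" "proj_map X d k q \<in> proj_box (cdim X) b r 2" and U: "U \<in> tangent_space (proj_tangent X) q"
    let ?u = "\<lambda>i. cmod (U ?C i)"
    have "Re (g q U U) \<le> cmod (\<Sum>i<?N. \<Sum>j<?N. G i j (proj_map X d k q) * U ?C i * cnj (U ?C j))"
    proof -
      have "g q U U = (\<Sum>i<?N. \<Sum>j<?N. G i j (proj_map X d k q) * U ?C i * cnj (U ?C j))" using G(2) q(1) U by blast
      then show ?thesis by (simp only: complex_Re_le_cmod)
    qed
    also have "\<dots> \<le> (\<Sum>i<?N. \<Sum>j<?N. cmod (G i j (proj_map X d k q) * U ?C i * cnj (U ?C j)))"
      by (intro order_trans[OF norm_sum] sum_mono norm_sum)
    also have "\<dots> \<le> (\<Sum>i<?N. \<Sum>j<?N. B * (?u i * ?u j))"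
      using B(2)[OF _ _ q(2)] by (intro sum_mono) (auto simp: norm_mult mult.assoc intro!: mult_right_mono)
    also have "\<dots> = B * (\<Sum>i<?N. ?u i)\<^sup>2"
      unfolding power2_eq_square sum_product by (simp only: sum_distrib_left)
    \<comment> \<open>Cauchy-Schwarz; the number of coordinates is absorbed into the
      constant.\<close>
    also have "\<dots> \<le> B * ((\<Sum>i<?N. (?u i)\<^sup>2) * ?N)"
      using sum_squared_le_sum_of_squares[of ?u "{..<?N}"] B(1) by (intro mult_left_mono) auto
    finally show "Re (g q U U) \<le> B * ?N * (\<Sum>i<?N. (?u i)\<^sup>2)" by (simp add: mult_ac)
  qed
qed

text \<open>The sum of the individual constants dominates each of them, and \<open>Q j\<close>
  survives enlarging the constant.\<close>

lemma finite_choice_sum: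
  assumes J: "finite J" and ex: "\<And>j. j \<in> J \<Longrightarrow> \<exists>C\<ge>0. Q j (C::real)" and mono: "\<And>j C C'. C \<le> C' \<Longrightarrow> Q j C \<Longrightarrow> Q j C'"
  obtains C where "C \<ge> 0" "\<And>j. j \<in> J \<Longrightarrow> Q j C"
proof -
  obtain c where c: "\<And>j. j \<in> J \<Longrightarrow> c j \<ge> 0" "\<And>j. j \<in> J \<Longrightarrow> Q j (c j)" using ex by metis
  show ?thesis
  proof (rule that[of "sum c J"])
    show "sum c J \<ge> 0" by (intro sum_nonneg c)
    fix j assume j: "j \<in> J"
    have "c j \<le> sum c J" by (rule member_le_sum) (use j c J in auto)
    then show "Q j (sum c J)" using mono c(2)[OF j] by blast
  qed
qed

lemma hermitian_metric_bound:
  assumes X: "complex_manifold X" and g: "hermitian_metric (proj_tangent X) g" and I: "patch_cover X I"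
  obtains C where "C \<ge> 0" "\<And>d b r k q U. (d, b, r) \<in> I \<Longrightarrow> k < cdim X \<Longrightarrow> q \<in> proj_dom X d k \<Longrightarrow>
     proj_map X d k q \<in> proj_box (cdim X) b r 2 \<Longrightarrow> U \<in> tangent_space (proj_tangent X) q \<Longrightarrow>
     Re (g q U U) \<le> C * (\<Sum>i<2 * cdim X - 1. (cmod (U (proj_chart X d k) i))\<^sup>2)"
proof -
  define Q where "Q = (\<lambda>((d, b, r), k) C. \<forall>q U. q \<in> proj_dom X d k \<longrightarrow> proj_map X d k q \<in> proj_box (cdim X) b r 2 \<longrightarrow>
     U \<in> tangent_space (proj_tangent X) q \<longrightarrow> Re (g q U U) \<le> C * (\<Sum>i<2 * cdim X - 1. (cmod (U (proj_chart X d k) i))\<^sup>2))"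
  have fin: "finite (I \<times> {..<cdim X})" using I by (simp add: patch_cover_def)
  obtain C where C: "C \<ge> 0" "\<And>j. j \<in> I \<times> {..<cdim X} \<Longrightarrow> Q j C"
  proof (rule finite_choice_sum[OF fin, of Q])
    fix j assume "j \<in> I \<times> {..<cdim X}"
    moreover obtain d b r k where j: "j = ((d, b, r), k)" by (metis prod.collapse)
    ultimately have "is_patch X (d, b, r)" "k < cdim X" using I by (auto simp: patch_cover_def)
    from hermitian_metric_chart_bound[OF X g this] show "\<exists>C\<ge>0. Q j C" unfolding Q_def j prod.case .
  next
    fix j and C C' :: real assume "C \<le> C'" "Q j C"
    moreover obtain d b r k where j: "j = ((d, b, r), k)" by (metis prod.collapse)
    moreover have "C * (\<Sum>i<2 * cdim X - 1. (cmod (U (proj_chart X d k) i))\<^sup>2) \<le> C' * (\<Sum>i<2 * cdim X - 1. (cmod (U (proj_chart X d k) i))\<^sup>2)" for U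
      using \<open>C \<le> C'\<close> by (intro mult_right_mono sum_nonneg) auto
    ultimately show "Q j C'" unfolding Q_def j prod.case by (meson order_trans)
  qed blast
  show ?thesis
  proof (rule that[OF C(1)])
    fix d b r k q U assume "(d, b, r) \<in> I" "k < cdim X" "q \<in> proj_dom X d k" "proj_map X d k q \<in> proj_box (cdim X) b r 2"
      "U \<in> tangent_space (proj_tangent X) q"
    then show "Re (g q U U) \<le> C * (\<Sum>i<2 * cdim X - 1. (cmod (U (proj_chart X d k) i))\<^sup>2)"
      using C(2)[of "((d, b, r), k)"] unfolding Q_def prod.case by blast
  qed
qed

lemma RC_uniform:
  assumes X: "complex_manifold X" and \<kappa>: "log_metric X s \<kappa>" and I: "patch_cover X I"
    and neg: "\<And>c k Z. c \<in> atlas X \<Longrightarrow> k < cdim X \<Longrightarrow> Z \<in> proj_img X c \<Longrightarrow>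
       \<exists>u\<in>cspace (2 * cdim X - 1). Re (levi (2 * cdim X - 1) (\<lambda>Z. of_real (\<kappa> c k Z)) Z u) < 0"
  obtains R where "R \<ge> 0" "\<And>c a r k Z. (c, a, r) \<in> I \<Longrightarrow> k < cdim X \<Longrightarrow> Z \<in> proj_box (cdim X) a r 1 \<Longrightarrow>
     \<exists>u\<in>cspace (2 * cdim X - 1). Re (levi (2 * cdim X - 1) (\<lambda>Z. of_real (\<kappa> c k Z)) Z u) \<le> -1 \<and> (\<forall>i<2 * cdim X - 1. cmod (u i) \<le> R)"
proof -
  let ?N = "2 * cdim X - 1"
  define Q where "Q = (\<lambda>((c, a, r), k) R. \<forall>Z\<in>proj_box (cdim X) a r 1.
     \<exists>u\<in>cspace ?N. Re (levi ?N (\<lambda>Z. of_real (\<kappa> c k Z)) Z u) \<le> -1 \<and> (\<forall>i<?N. cmod (u i) \<le> R))"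
  have fin: "finite (I \<times> {..<cdim X})" using I by (simp add: patch_cover_def)
  obtain R where R: "R \<ge> 0" "\<And>j. j \<in> I \<times> {..<cdim X} \<Longrightarrow> Q j R"
  proof (rule finite_choice_sum[OF fin, of Q])
    fix j assume jI: "j \<in> I \<times> {..<cdim X}"
    obtain c a r k where j: "j = ((c, a, r), k)" by (metis prod.collapse)
    have P: "is_patch X (c, a, r)" and k: "k < cdim X" using I jI j by (auto simp: patch_cover_def)
    have c: "c \<in> atlas X" "r > 0" using P by (auto simp: is_patch_def)
    have C2: "C_k (Suc (Suc 0)) ?N (proj_img X c) (\<lambda>Z. of_real (\<kappa> c k Z))"
      using \<kappa> c k unfolding log_metric_def by blast
    have ng: "\<exists>u\<in>cspace ?N. Re (levi ?N (\<lambda>Z. of_real (\<kappa> c k Z)) Z u) < 0" if "Z \<in> proj_box (cdim X) a r 1" for Z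
      using neg[OF c(1) k] proj_box_img[OF P] that by blast
    show "\<exists>R\<ge>0. Q j R"
    proof (rule levi_neg_uniform[OF proj_img_open[OF X c(1)] C2 compact_proj_box[OF c(2)] proj_box_img[OF P] ng])
      fix R :: real assume "R \<ge> 0" "\<And>Z. Z \<in> proj_box (cdim X) a r 1 \<Longrightarrow>
         \<exists>u\<in>cspace ?N. Re (levi ?N (\<lambda>Z. of_real (\<kappa> c k Z)) Z u) \<le> -1 \<and> (\<forall>i<?N. cmod (u i) \<le> R)"
      then show "\<exists>R\<ge>0. Q j R" unfolding Q_def j prod.case by blast
    qed
  next
    fix j and C C' :: real assume C: "C \<le> C'" "Q j C"
    obtain c a r k where j: "j = ((c, a, r), k)" by (metis prod.collapse)
    show "Q j C'" unfolding Q_def j prod.case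
    proof
      fix Z assume "Z \<in> proj_box (cdim X) a r 1"
      then obtain u where "u \<in> cspace ?N" "Re (levi ?N (\<lambda>Z. of_real (\<kappa> c k Z)) Z u) \<le> -1" "\<forall>i<?N. cmod (u i) \<le> C"
        using C(2) unfolding Q_def j prod.case by blast
      moreover from this(3) have "\<forall>i<?N. cmod (u i) \<le> C'" using C(1) by (meson order_trans)
      ultimately show "\<exists>u\<in>cspace ?N. Re (levi ?N (\<lambda>Z. of_real (\<kappa> c k Z)) Z u) \<le> -1 \<and> (\<forall>i<?N. cmod (u i) \<le> C')" by blast
    qed
  qed blast
  show ?thesis
  proof (rule that[OF R(1)])
    fix c a r k Z assume "(c, a, r) \<in> I" "k < cdim X" "Z \<in> proj_box (cdim X) a r 1"
    then show "\<exists>u\<in>cspace ?N. Re (levi ?N (\<lambda>Z. of_real (\<kappa> c k Z)) Z u) \<le> -1 \<and> (\<forall>i<?N. cmod (u i) \<le> R)"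
      using R(2)[of "((c, a, r), k)"] unfolding Q_def prod.case by simp
  qed
qed

text \<open>The fibre coordinates belong to the components other than \<open>k\<close>: the
  reindexing \<sigma> is injective and skips \<open>k\<close>, and the omitted summand is
  nonnegative.\<close>

lemma sum_pcoord_le:
  fixes F :: "nat \<Rightarrow> real"
  assumes k: "k < n" and pos: "\<And>a. B a \<ge> 0" and F1: "\<And>i. i < n \<Longrightarrow> F i = A i"
    and F2: "\<And>i. n \<le> i \<Longrightarrow> i < n + k \<Longrightarrow> F i = B (i - n)" and F3: "\<And>i. n + k \<le> i \<Longrightarrow> i < 2 * n - 1 \<Longrightarrow> F i = B (i - n + 1)"
  shows "(\<Sum>i<2 * n - 1. F i) \<le> (\<Sum>i<n. A i) + (\<Sum>a<n. B a)"
proof -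
  define \<sigma> where "\<sigma> i = (if i < n + k then i - n else i - n + 1)" for i
  have split: "{..<2 * n - 1} = {..<n} \<union> {n..<2 * n - 1}" using k by auto
  have "(\<Sum>i\<in>{n..<2 * n - 1}. F i) = (\<Sum>i\<in>{n..<2 * n - 1}. B (\<sigma> i))"
    using F2 F3 by (intro sum.cong) (auto simp: \<sigma>_def)
  also have "\<dots> = (\<Sum>a\<in>\<sigma> ` {n..<2 * n - 1}. B a)"
    by (subst sum.reindex) (auto simp: inj_on_def \<sigma>_def split: if_splits)
  also have "\<dots> \<le> (\<Sum>a<n. B a)"
    using pos k by (intro sum_mono2) (auto simp: \<sigma>_def)
  finally show ?thesis unfolding split using F1 by (subst sum.union_disjoint) auto
qed

lemma levi_cong: "(\<And>i. i < n \<Longrightarrow> u i = v i) \<Longrightarrow> levi n F x u = levi n F x v"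
  by (simp add: levi_def)

section \<open>Velocities of image discs, and why maxima are interior\<close>

context
  fixes M :: "'a cmanifold" and N :: "'b cmanifold" and f :: "'a \<Rightarrow> 'b"
  assumes M: "complex_manifold M" and N: "complex_manifold N" and f: "holomorphic_map M N f"
begin

text \<open>With the bound on the directions from \<open>RC_uniform\<close> this controls the
  velocity in \<open>N\<close> of the image of a disc, independently of \<epsilon>.\<close>

lemma derivative_bound:
  assumes PM: "patch_cover M PM" and PN: "patch_cover N PN"
  obtains B where "B \<ge> 0" "\<And>c a s d b r x i j. (c, a, s) \<in> PM \<Longrightarrow> (d, b, r) \<in> PN \<Longrightarrow> x \<in> cs_ball (cdim M) a s \<Longrightarrow>
     f (cinv c x) \<in> cdom d \<Longrightarrow> sqdist (cdim N) (cmap d (f (cinv c x))) b \<le> r\<^sup>2 \<Longrightarrow> i < cdim N \<Longrightarrow> j < cdim M \<Longrightarrow>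
     cmod (d_z j (\<lambda>x. cmap d (f (cinv c x)) i) x) \<le> B"
proof -
  let ?J = "PM \<times> PN \<times> {..<cdim N} \<times> {..<cdim M}"
  define K where "K = (\<lambda>((c, a, s), (d, b, r), (i :: nat), (j :: nat)). {x \<in> cs_ball (cdim M) a s. f (cinv c x) \<in> cdom d \<and> sqdist (cdim N) (cmap d (f (cinv c x))) b \<le> r\<^sup>2})"
  define F where "F = (\<lambda>((c, a :: nat \<Rightarrow> complex, s :: real), (d, b :: nat \<Rightarrow> complex, r :: real), i, j) x. cmod (d_z j (\<lambda>x. cmap d (f (cinv c x)) i) x))"
  have fin: "finite ?J" using PM PN by (simp add: patch_cover_def)
  have KF: "compact (K t) \<and> continuous_on (K t) (F t)" if t: "t \<in> ?J" for t
  proof -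
    obtain c a s d b r i j where te: "t = ((c, a, s), (d, b, r), i, j)" by (metis prod.collapse)
    have P: "is_patch M (c, a, s)" "is_patch N (d, b, r)" "i < cdim N" "j < cdim M" using t te PM PN by (auto simp: patch_cover_def)
    have cd: "c \<in> atlas M" "d \<in> atlas N" "cs_ball (cdim M) a s \<subseteq> cmap c ` cdom c" using P by (auto simp: is_patch_def)
    have "continuous_on (cmap c ` {p \<in> cdom c. f p \<in> cdom d}) (d_z j (\<lambda>x. cmap d (f (cinv c x)) i))"
      using C1_continuous_d_z(1)[OF holo_fn_C_k[OF map_coord_holo[OF M N f cd(1,2) P(3)], of "Suc 0"] P(4)] .
    moreover have "K t \<subseteq> cmap c ` {p \<in> cdom c. f p \<in> cdom d}"
    proof
      fix x assume "x \<in> K t"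
      then have x: "x \<in> cmap c ` cdom c" "f (cinv c x) \<in> cdom d" using cd(3) by (auto simp: K_def te)
      from cmap_cinv[OF x(1)] x(2) show "x \<in> cmap c ` {p \<in> cdom c. f p \<in> cdom d}"
        by (intro image_eqI[of _ _ "cinv c x"]) auto
    qed
    ultimately have "continuous_on (K t) (d_z j (\<lambda>x. cmap d (f (cinv c x)) i))" by (rule continuous_on_subset)
    then show ?thesis using compact_patch_preimage[OF M N f P(1,2)] by (auto simp: K_def F_def te intro!: continuous_intros)
  qed
  obtain B where B: "B \<ge> 0" "\<And>t x. t \<in> ?J \<Longrightarrow> x \<in> K t \<Longrightarrow> \<bar>F t x\<bar> \<le> B"
    by (rule finite_uniform_bound[OF fin, of K F]) (use KF in blast)+
  show ?thesis
  proof (rule that[OF B(1)])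
    fix c a s d b r x i j assume "(c, a, s) \<in> PM" "(d, b, r) \<in> PN" "x \<in> cs_ball (cdim M) a s"
     "f (cinv c x) \<in> cdom d" "sqdist (cdim N) (cmap d (f (cinv c x))) b \<le> r\<^sup>2" "i < cdim N" "j < cdim M"
    then show "cmod (d_z j (\<lambda>x. cmap d (f (cinv c x)) i) x) \<le> B"
      using B(2)[of "((c, a, s), (d, b, r), i, j)" x] by (simp add: K_def F_def)
  qed
qed

text \<open>Raising \<open>\<bar>w\<^sub>k\<bar>\<close> by choosing the largest component, or moving to a patch in which the point is
  well inside, increases the test function at a boundary point of the admissible region.\<close>

lemma max_interior:
  assumes \<kappa>1: "log_metric N (-1) \<kappa>1" and PN: "patch_cover N PN"
    and C1: "\<And>d b r k Y. (d, b, r) \<in> PN \<Longrightarrow> k < cdim N \<Longrightarrow> Y \<in> proj_box (cdim N) b r 2 \<Longrightarrow> \<bar>\<kappa>1 d k Y\<bar> \<le> C1"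
    and \<eta>: "\<eta> > 0" and \<delta>: "\<delta> = 1 / (4 * real (cdim N))" and \<mu>: "\<mu> = 4 * (C1 + 1)" and C1': "C1 \<ge> 0"
    and D: "(d, b, r) \<in> PN" and k: "k < cdim N" and adm: "admissible M N f (d, b, r) k p v"
    and max: "\<And>D' k'. D' \<in> PN \<Longrightarrow> k' < cdim N \<Longrightarrow> admissible M N f D' k' p v \<Longrightarrow>
       test_fn M N f \<kappa>M \<kappa>N \<eta> \<delta> \<mu> D' k' p v \<le> test_fn M N f \<kappa>M \<kappa>N \<eta> \<delta> \<mu> (d, b, r) k p v"
  shows "sqdist (cdim N) (cmap d (f p)) b < r\<^sup>2" "\<And>a. a < cdim N \<Longrightarrow> cmod (push M N f p v d a) < 2 * cmod (push M N f p v d k)"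
proof -
  let ?n = "cdim N"
  define W where "W = push M N f p v"
  have n: "?n > 0" using k by simp
  have pv: "p \<in> carrier_of M" "v \<in> tangent_space M p" "f p \<in> cdom d" "sqdist ?n (cmap d (f p)) b \<le> r\<^sup>2" "W d k \<noteq> 0"
    "\<And>a. a < ?n \<Longrightarrow> cmod (W d a) \<le> 2 * cmod (W d k)"
    using adm by (auto simp: admissible_def W_def)
  have WT: "W \<in> tangent_space N (f p)" unfolding W_def by (rule push(1)[OF M N f pv(1,2)])
  have W0: "W \<noteq> tzero" using pv(5) by (rule not_tzeroI)
  have d: "d \<in> atlas N" "r > 0" using D PN by (auto simp: patch_cover_def is_patch_def)
  define S where "S d k = (\<Sum>a<?n. (cmod (W d a / W d k))\<^sup>2)" for d k
  define h where "h d b r k = ln ((cmod (W d k))\<^sup>2) + \<delta> * S d k - \<mu> * (sqdist ?n (cmap d (f p)) b / r\<^sup>2)" for d b r k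
  have S0: "\<delta> * S d k \<ge> 0" for d k unfolding S_def \<delta> by (intro mult_nonneg_nonneg sum_nonneg) auto
  \<comment> \<open>The constant \<delta> is made for this: on the admissible region the
    \<delta>-term lies between 0 and 1.\<close>
  have S4: "\<delta> * S d k \<le> 1"
  proof -
    have "(cmod (W d a / W d k))\<^sup>2 \<le> 4" if "a < ?n" for a
    proof -
      have "cmod (W d a / W d k) \<le> 2" using pv(5) pv(6)[OF that] by (simp add: norm_divide divide_le_eq)
      from power_mono[OF this, of 2] show ?thesis by simp
    qed
    then have "S d k \<le> (\<Sum>a<?n. 4)" unfolding S_def by (intro sum_mono) auto
    then have "S d k \<le> 4 * real ?n" by simp
    then show ?thesis using n by (simp add: \<delta> divide_le_eq)
  qed
  \<comment> \<open>At the same vector the two log-norms do not depend on the patch or the component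
    and cancel. Dividing by \<eta> leaves a comparison in which \<kappa>N no longer occurs.\<close>
  have hmax: "h d' b' r' k' \<le> h d b r k" if D': "(d', b', r') \<in> PN" "k' < ?n" "f p \<in> cdom d'" "sqdist ?n (cmap d' (f p)) b' \<le> r'\<^sup>2"
    "W d' k' \<noteq> 0" "\<And>a. a < ?n \<Longrightarrow> cmod (W d' a) \<le> 2 * cmod (W d' k')" for d' b' r' k'
  proof -
    have "admissible M N f (d', b', r') k' p v" using pv(1,2) D' by (simp add: admissible_def W_def)
    from max[OF D'(1,2) this] have "\<eta> * h d' b' r' k' \<le> \<eta> * h d b r k"
      by (simp add: test_fn_def Let_def h_def S_def W_def)
    then show ?thesis using \<eta> by simp
  qed
  show "cmod (push M N f p v d a) < 2 * cmod (push M N f p v d k)" if a: "a < ?n" for a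
  proof (rule ccontr)
    assume "\<not> ?thesis"
    then have wa: "cmod (W d a) = 2 * cmod (W d k)" using pv(6)[OF a] by (simp add: W_def)
    obtain k' where k': "k' < ?n" "W d k' \<noteq> 0" "\<And>a. a < ?n \<Longrightarrow> cmod (W d a) \<le> cmod (W d k')"
      using maximal_component[OF W0 WT d(1) pv(3)] by metis
    have "h d b r k' \<le> h d b r k"
      by (rule hmax[OF D k'(1) pv(3,4) k'(2)]) (use k'(3) in \<open>smt (verit) norm_ge_zero\<close>)
    then have le: "ln ((cmod (W d k'))\<^sup>2) \<le> ln ((cmod (W d k))\<^sup>2) + 1"
      using S0[of d k'] S4 by (simp add: h_def)
    have "(2 * cmod (W d k))\<^sup>2 \<le> (cmod (W d k'))\<^sup>2" using k'(3)[OF a] wa by (intro power_mono) auto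
    then have "4 * (cmod (W d k))\<^sup>2 \<le> (cmod (W d k'))\<^sup>2" by (simp add: power_mult_distrib)
    then have "ln (4 * (cmod (W d k))\<^sup>2) \<le> ln ((cmod (W d k'))\<^sup>2)" using pv(5) k'(2) by (intro ln_mono) auto
    moreover have "ln (4 * (cmod (W d k))\<^sup>2) = ln 4 + ln ((cmod (W d k))\<^sup>2)" using pv(5) by (intro ln_mult_pos) auto
    \<comment> \<open>Passing to a component of at least twice the modulus gains
      \<open>ln 4\<close>, more than the loss of at most 1 in the \<delta>-term.\<close>
    moreover have "ln (4::real) > 1"
    proof -
      have "exp (1::real) < 4" using exp_le by linarith
      then show ?thesis using ln_less_cancel_iff[of "exp 1" 4] by simp
    qed
    ultimately show False using le by linarith
  qed
  show "sqdist ?n (cmap d (f p)) b < r\<^sup>2"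
  proof (rule ccontr)
    assume "\<not> ?thesis"
    then have eq: "sqdist ?n (cmap d (f p)) b / r\<^sup>2 = 1" using pv(4) d(2) by simp
    obtain d' b' r' where D': "(d', b', r') \<in> PN" "f p \<in> cdom d'" "sqdist ?n (cmap d' (f p)) b' < r'\<^sup>2 / 4"
      using PN map_carrier[OF M N f pv(1)] unfolding patch_cover_def by blast
    have d': "d' \<in> atlas N" "r' > 0" using D'(1) PN by (auto simp: patch_cover_def is_patch_def)
    have sq: "sqdist ?n (cmap d' (f p)) b' \<le> r'\<^sup>2" using D'(3) zero_le_power2[of r'] by linarith
    obtain k' where k': "k' < ?n" "W d' k' \<noteq> 0" "\<And>a. a < ?n \<Longrightarrow> cmod (W d' a) \<le> cmod (W d' k')"
      using maximal_component[OF W0 WT d'(1) D'(2)] by metis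
    have k2: "cmod (W d' a) \<le> 2 * cmod (W d' k')" if "a < ?n" for a
      using k'(3)[OF that] norm_ge_zero[of "W d' k'"] by linarith
    have le: "h d' b' r' k' \<le> h d b r k" by (rule hmax[OF D'(1) k'(1) D'(2) sq k'(2) k2])
    \<comment> \<open>The components of \<open>W\<close> in the two charts are compared through the
      fixed metric \<kappa>1: the log-norm of \<open>W\<close> is the same in both, and both
      potentials are bounded by \<open>C1\<close>.\<close>
    have B: "\<bar>\<kappa>1 d k (pcoord ?n k (cmap d (f p)) (W d))\<bar> \<le> C1"
      by (rule C1[OF D k pcoord_proj_box[where v = "W d", OF k pv(4,5,6)]])
    have B': "\<bar>\<kappa>1 d' k' (pcoord ?n k' (cmap d' (f p)) (W d'))\<bar> \<le> C1"
      by (rule C1[OF D'(1) k'(1) pcoord_proj_box[where v = "W d'", OF k'(1) sq k'(2) k2]])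
    have "lognorm N (-1) \<kappa>1 (f p) W = -1 * \<kappa>1 d k (pcoord ?n k (cmap d (f p)) (W d)) + ln ((cmod (W d k))\<^sup>2)"
      by (rule lognorm_eq[OF \<kappa>1 _ d(1) k pv(3) WT pv(5)]) simp
    moreover have "lognorm N (-1) \<kappa>1 (f p) W = -1 * \<kappa>1 d' k' (pcoord ?n k' (cmap d' (f p)) (W d')) + ln ((cmod (W d' k'))\<^sup>2)"
      by (rule lognorm_eq[OF \<kappa>1 _ d'(1) k'(1) D'(2) WT k'(2)]) simp
    ultimately have ln: "ln ((cmod (W d k))\<^sup>2) \<le> ln ((cmod (W d' k'))\<^sup>2) + 2 * C1" using B B' by linarith
    \<comment> \<open>Going from the rim of one patch to the inner half of another gains at least
      \<open>3 * \<mu> / 4 = 3 * (C1 + 1)\<close>, while the other terms lose at most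
      \<open>2 * C1 + 1\<close>.\<close>
    have "sqdist ?n (cmap d' (f p)) b' / r'\<^sup>2 \<le> 1 / 4" using D'(3) d'(2) by (simp add: divide_le_eq)
    then have "\<mu> * (sqdist ?n (cmap d' (f p)) b' / r'\<^sup>2) \<le> \<mu> * (1 / 4)" using \<mu> C1' by (intro mult_left_mono) auto
    then show False using le S0[of d' k'] S4 ln eq \<mu> C1' unfolding h_def by (simp add: eq)
  qed
qed

lemma push_coord_analytic:
  assumes c: "c \<in> atlas M" and d: "d \<in> atlas N" and Z: "adisc (2 * cdim M - 1) Z" and l: "l < cdim M"
    and p: "base_part (cdim M) (Z 0) = cmap c p" "p \<in> cdom c" "f p \<in> cdom d"
  shows "(\<lambda>t. push_coord M N f c l d (Z t) i) analytic_on {0}"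
proof (cases "i < cdim N")
  case i: True
  let ?m = "cdim M"
  have b: "adisc ?m (\<lambda>t. base_part ?m (Z t))"
    by (rule adisc_comp[where \<Psi> = "base_part ?m" and N = "2 * ?m - 1", OF hdiff_base_part[OF M] Z base_part_cspace])
  have "(\<lambda>t. d_z j (\<lambda>x. cmap d (f (cinv c x)) i) (base_part ?m (Z t)) * fibre_part ?m l (Z t) j) analytic_on {0}" if j: "j < ?m" for j
  proof (rule analytic_on_mult)
    obtain E where "hdiff ?m (d_z j (\<lambda>x. cmap d (f (cinv c x)) i)) (cmap c p) E"
      using map_coord_hdiff(2)[OF M N f c d i p(2,3) j] by blast
    then show "(\<lambda>t. d_z j (\<lambda>x. cmap d (f (cinv c x)) i) (base_part ?m (Z t))) analytic_on {0}"
      by (intro hdiffD(1)[where Y = "\<lambda>t. base_part ?m (Z t)", OF _ b]) (simp add: p(1))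
    obtain E where "hdiff (2 * ?m - 1) (\<lambda>Z. fibre_part ?m l Z j) (Z 0) E" using hdiff_fibre_part[OF M j l] by blast
    then show "(\<lambda>t. fibre_part ?m l (Z t) j) analytic_on {0}"
      by (intro hdiffD(1)[where Y = Z and F = "\<lambda>Z. fibre_part ?m l Z j", OF _ Z])
  qed
  then show ?thesis unfolding push_coord_def using i by (auto intro!: analytic_on_sum)
qed (simp add: push_coord_def)

end

section \<open>The inequality for the Laplacian at a maximum\<close>

context
  fixes M :: "'a cmanifold" and N :: "'b cmanifold" and f :: "'a \<Rightarrow> 'b"
  assumes M: "complex_manifold M" and N: "complex_manifold N" and f: "holomorphic_map M N f"
begin

text \<open>In the fibre directions the error \<open>\<epsilon> C0 B\<close> of nefness is cancelled by \<open>\<eta> \<delta> B\<close>; only the base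
  directions, in which the push-forward of \<open>u\<close> is under control, remain.\<close>

lemma max_curvature_inequality:
  assumes \<kappa>M: "log_metric M 1 \<kappa>M" and \<kappa>N: "log_metric N (-1) \<kappa>N"
    and nef: "\<And>q U. q \<in> proj_dom N d k \<Longrightarrow> U \<in> tangent_space (proj_tangent N) q \<Longrightarrow>
       Re (levi (2 * cdim N - 1) (\<lambda>Z. of_real (\<kappa>N d k Z)) (proj_map N d k q) (U (proj_chart N d k))) \<le> \<epsilon> * Re (g q U U)"
    and C0: "\<And>q U. q \<in> proj_dom N d k \<Longrightarrow> proj_map N d k q \<in> proj_box (cdim N) b r 2 \<Longrightarrow> U \<in> tangent_space (proj_tangent N) q \<Longrightarrow>
       Re (g q U U) \<le> C0 * (\<Sum>i<2 * cdim N - 1. (cmod (U (proj_chart N d k) i))\<^sup>2)"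
    and pos: "\<epsilon> > 0" "C0 \<ge> 0" "r > 0" and \<eta>\<delta>: "\<eta> * \<delta> = \<epsilon> * C0" "\<eta> > 0"
    and c: "c \<in> atlas M" "l < cdim M" "Z0 \<in> proj_img M c" and d: "d \<in> atlas N" "k < cdim N"
  defines "p \<equiv> cinv c (base_part (cdim M) Z0)"
  defines "v \<equiv> tvec_of M c p (fibre_part (cdim M) l Z0)"
  assumes fp: "f p \<in> cdom d" and wk: "push M N f p v d k \<noteq> 0"
    and strict: "sqdist (cdim N) (cmap d (f p)) b < r\<^sup>2" "\<And>a. a < cdim N \<Longrightarrow> cmod (push M N f p v d a) < 2 * cmod (push M N f p v d k)"
    and max: "\<And>p' v'. admissible M N f (d, b, r) k p' v' \<Longrightarrow>
       test_fn M N f \<kappa>M \<kappa>N \<eta> \<delta> \<mu> (d, b, r) k p' v' \<le> test_fn M N f \<kappa>M \<kappa>N \<eta> \<delta> \<mu> (d, b, r) k p v"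
    and u: "u \<in> cspace (2 * cdim M - 1)" "Re (levi (2 * cdim M - 1) (\<lambda>Z. of_real (\<kappa>M c l Z)) Z0 u) \<le> -1"
  shows "1 \<le> (\<epsilon> * C0 + \<eta> * \<mu> / r\<^sup>2) * (\<Sum>i<cdim N. (cmod (\<Sum>j<cdim M. d_z j (\<lambda>x. cmap d (f (cinv c x)) i) (base_part (cdim M) Z0) * u j))\<^sup>2)"
proof -
  let ?m = "cdim M" and ?n = "cdim N"
  define Z where "Z = (\<lambda>t i. Z0 i + t * u i)"
  have Z0c: "Z0 \<in> cspace (2 * ?m - 1)" using c(3) by (simp add: proj_img_def)
  have Z: "adisc (2 * ?m - 1) Z" "\<And>i. deriv (\<lambda>t. Z t i) 0 = u i" "Z 0 = Z0"
    using adisc_line[OF Z0c u(1)] by (auto simp: Z_def)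
  define \<gamma> where "\<gamma> = (\<lambda>t. cinv c (base_part ?m (Z t)))"
  define V where "V = (\<lambda>t. tvec_of M c (\<gamma> t) (fibre_part ?m l (Z t)))"
  define W where "W = (\<lambda>t. push M N f (\<gamma> t) (V t))"
  define y where "y = (\<lambda>t. cmap d (f (\<gamma> t)))"
  define w where "w = (\<lambda>t. push_coord M N f c l d (Z t))"
  define Y where "Y = (\<lambda>t. pcoord ?n k (y t) (w t))"
  have g0: "\<gamma> 0 = p" by (simp add: \<gamma>_def p_def Z(3))
  have V0: "V 0 = v" using g0 by (simp add: V_def v_def Z(3))
  note P0 = proj_img_point[OF M c, folded p_def, folded v_def]
  have b: "adisc ?m (\<lambda>t. base_part ?m (Z t))"
    by (rule adisc_comp[where \<Psi> = "base_part ?m" and N = "2 * ?m - 1", OF hdiff_base_part[OF M] Z(1) base_part_cspace])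
  have b0: "base_part ?m (Z 0) \<in> cmap c ` cdom c" using c(3) by (simp add: Z(3) proj_img_def)
  have \<gamma>: "hol_disc M \<gamma>" and ev\<gamma>: "\<forall>\<^sub>F t in nhds 0. \<gamma> t \<in> cdom c \<and> cmap c (\<gamma> t) = base_part ?m (Z t)"
    using hol_disc_chart[where Y = "\<lambda>t. base_part ?m (Z t)", OF M c(1) b b0] by (auto simp: \<gamma>_def)
  have f\<gamma>0: "\<gamma> 0 \<in> cdom c" "f (\<gamma> 0) \<in> cdom d" using P0(1) fp by (auto simp: g0)
  note md = map_disc[OF M N f \<gamma> c(1) f\<gamma>0(1) d(1) f\<gamma>0(2)]
  have evZ: "\<forall>\<^sub>F t in nhds 0. Z t \<in> proj_img M c"
    using c(3) by (intro adisc_ev_in[OF Z(1) proj_img_open[OF M c(1)]]) (simp add: Z(3))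
  have w_an: "(\<lambda>t. push_coord M N f c l d' (Z t) i) analytic_on {0}" if "d' \<in> atlas N" "f (\<gamma> 0) \<in> cdom d'" for d' i
    using P0(1,2) that by (intro push_coord_analytic[OF M N f c(1) that(1) Z(1) c(2), of p]) (auto simp: Z(3) g0)
  have w_an': "(\<lambda>t. w t i) analytic_on {0}" for i using w_an[OF d(1) f\<gamma>0(2)] by (simp add: w_def)
  have pc: "push M N f (\<gamma> t) (V t) d' = push_coord M N f c l d' (Z t)" "\<gamma> t \<in> carrier_of M" "V t \<in> tangent_space M (\<gamma> t)"
    "W t \<in> tangent_space N (f (\<gamma> t))"
    if "Z t \<in> proj_img M c" "d' \<in> atlas N" "f (\<gamma> t) \<in> cdom d'" for t d'
    using push_at_point[OF M N f c(1,2) that(1,2)] that(3) proj_img_point(3)[OF M c(1,2) that(1)] by (auto simp: \<gamma>_def V_def W_def)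
  have w0: "w 0 = push M N f p v d" using pc(1)[of 0 d] c(3) d(1) fp by (simp add: w_def Z(3) g0 V0)
  have wk0: "w 0 k \<noteq> 0" using wk by (simp add: w0)
  have cont_w: "((\<lambda>t. w t i) \<longlongrightarrow> w 0 i) (nhds 0)" for i
    using analytic_at_imp_isCont[OF w_an'] by (simp add: isCont_def tendsto_nhds_iff)
  have ev_wk: "\<forall>\<^sub>F t in nhds 0. w t k \<noteq> 0" using cont_w wk0 by (rule tendsto_imp_eventually_ne)
  have ev_strict: "\<forall>\<^sub>F t in nhds 0. \<forall>a\<in>{..<?n}. cmod (w t a) < 2 * cmod (w t k)"
  proof (intro eventually_ball_finite ballI)
    fix a assume "a \<in> {..<?n}"
    then have "0 < 2 * cmod (w 0 k) - cmod (w 0 a)" using strict(2)[of a] by (simp add: w0)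
    moreover have "((\<lambda>t. 2 * cmod (w t k) - cmod (w t a)) \<longlongrightarrow> 2 * cmod (w 0 k) - cmod (w 0 a)) (nhds 0)"
      by (intro tendsto_intros cont_w)
    ultimately have "\<forall>\<^sub>F t in nhds 0. 0 < 2 * cmod (w t k) - cmod (w t a)" by (intro order_tendstoD(1))
    then show "\<forall>\<^sub>F t in nhds 0. cmod (w t a) < 2 * cmod (w t k)" by eventually_elim simp
  qed simp
  have y_an: "(\<lambda>t. y t j) analytic_on {0}" if "j < ?n" for j using md(2) that by (simp add: adisc_def y_def)
  have ev_sq: "\<forall>\<^sub>F t in nhds 0. sqdist ?n (y t) b < r\<^sup>2"
  proof -
    have "((\<lambda>t. y t j) \<longlongrightarrow> y 0 j) (nhds 0)" if "j < ?n" for j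
      using analytic_at_imp_isCont[OF y_an[OF that]] by (simp add: isCont_def tendsto_nhds_iff)
    then have "((\<lambda>t. sqdist ?n (y t) b) \<longlongrightarrow> sqdist ?n (y 0) b) (nhds 0)"
      unfolding sqdist_def by (intro tendsto_intros) auto
    then show ?thesis using strict(1) by (intro order_tendstoD(2)) (auto simp: y_def g0)
  qed
  define A where "A = (\<Sum>j<?n. (cmod (deriv (\<lambda>t. y t j) 0))\<^sup>2)"
  define Q where "Q = (\<lambda>a t. w t a / w t k)"
  define B where "B = (\<Sum>a<?n. (cmod (deriv (Q a) 0))\<^sup>2)"
  have Q_an: "Q a analytic_on {0}" for a unfolding Q_def by (intro analytic_on_divide w_an') (use wk0 in auto)
  define \<Phi> where "\<Phi> = (\<lambda>t. - \<kappa>N d k (Y t) + (1 + \<eta>) * ln ((cmod (w t k))\<^sup>2)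
    + \<eta> * (\<delta> * (\<Sum>a<?n. (cmod (Q a t))\<^sup>2) - \<mu> * (sqdist ?n (y t) b / r\<^sup>2)) - (1 + \<eta>) * \<kappa>M c l (Z t))"
  \<comment> \<open>The strict inequalities at the centre persist nearby, so the vectors
    \<open>V t\<close> stay admissible and compete with \<open>v\<close>.\<close>
  have ev_test: "\<forall>\<^sub>F t in nhds 0. \<Phi> t \<le> \<Phi> 0"
  proof -
    have expr: "test_fn M N f \<kappa>M \<kappa>N \<eta> \<delta> \<mu> (d, b, r) k (\<gamma> t) (V t) = \<Phi> t"
      if "Z t \<in> proj_img M c" "f (\<gamma> t) \<in> cdom d" "w t k \<noteq> 0" for t
      using test_fn_coord[OF M N f \<kappa>M \<kappa>N c(1,2) that(1) d] that(2,3)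
      by (simp add: \<Phi>_def \<gamma>_def V_def w_def y_def Y_def Q_def)
    have e0: "test_fn M N f \<kappa>M \<kappa>N \<eta> \<delta> \<mu> (d, b, r) k p v = \<Phi> 0"
      using expr[of 0] c(3) fp wk0 by (simp add: Z(3) g0 V0)
    show ?thesis using evZ md(1) ev_wk ev_strict ev_sq
    proof eventually_elim
      case (elim t)
      note p = pc[OF elim(1) d(1) elim(2)]
      have "admissible M N f (d, b, r) k (\<gamma> t) (V t)"
        unfolding admissible_def prod.case p(1)
        using p(2,3) elim by (auto simp: w_def y_def less_imp_le)
      from max[OF this] show ?case using expr[OF elim(1-3)] e0 by simp
    qed
  qed
  have Yd: "adisc (2 * ?n - 1) Y"
    unfolding Y_def by (rule adisc_pcoord[OF N d(2)]) (use md(2) w_an' wk0 in \<open>auto simp: y_def\<close>)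
  have Y0: "Y 0 \<in> proj_img N d" unfolding Y_def y_def by (rule pcoord_img[OF N d f\<gamma>0(2)])
  have C2N: "C_k (Suc (Suc 0)) (2 * ?n - 1) (proj_img N d) (\<lambda>Z. of_real (\<kappa>N d k Z))"
    using \<kappa>N d unfolding log_metric_def by blast
  have C2M: "C_k (Suc (Suc 0)) (2 * ?m - 1) (proj_img M c) (\<lambda>Z. of_real (\<kappa>M c l Z))"
    using \<kappa>M c unfolding log_metric_def by blast
  define LN where "LN = levi (2 * ?n - 1) (\<lambda>Z. of_real (\<kappa>N d k Z)) (Y 0) (\<lambda>j. deriv (\<lambda>t. Y t j) 0)"
  define LM where "LM = levi (2 * ?m - 1) (\<lambda>Z. of_real (\<kappa>M c l Z)) Z0 u"
  have lapN: "has_lap (\<lambda>t. of_real (\<kappa>N d k (Y t))) (4 * LN)"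
    unfolding LN_def by (rule has_lap_comp[where F = "\<lambda>Z. of_real (\<kappa>N d k Z)" and Y = Y, OF proj_img_open[OF N d(1)] Y0 C2N Yd])
  have lapM: "has_lap (\<lambda>t. of_real (\<kappa>M c l (Z t))) (4 * LM)"
    using has_lap_comp[where F = "\<lambda>Z. of_real (\<kappa>M c l Z)" and Y = Z, OF proj_img_open[OF M c(1)] _ C2M Z(1)] c(3)
    by (simp add: LM_def Z(2,3))
  have lapW: "has_lap (\<lambda>t. of_real (ln ((cmod (w t k))\<^sup>2))) 0" by (rule has_lap_ln_norm[OF w_an' wk0])
  have lapsq: "has_lap (\<lambda>t. of_real (\<Sum>j\<in>J. (cmod (h j t))\<^sup>2)) (of_real (4 * (\<Sum>j\<in>J. (cmod (deriv (h j) 0))\<^sup>2)))"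
    if "\<And>j. j \<in> J \<Longrightarrow> h j analytic_on {0}" for h and J :: "nat set"
  proof -
    have "has_lap (\<lambda>t. \<Sum>j\<in>J. h j t * cnj (h j t)) (\<Sum>j\<in>J. 4 * (deriv (h j) 0 * cnj (deriv (h j) 0)))"
      by (intro has_lap_sum has_lap_analytic(3) that)
    then show ?thesis by (simp add: complex_norm_square sum_distrib_left del: of_real_power)
  qed
  have lapQ: "has_lap (\<lambda>t. of_real (\<Sum>a<?n. (cmod (Q a t))\<^sup>2)) (of_real (4 * B))"
    unfolding B_def by (rule lapsq[OF Q_an])
  have "has_lap (\<lambda>t. of_real (\<Sum>j<?n. (cmod (y t j - b j))\<^sup>2)) (of_real (4 * (\<Sum>j<?n. (cmod (deriv (\<lambda>t. y t j - b j) 0))\<^sup>2)))"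
    using y_an by (intro lapsq) (auto intro!: analytic_on_diff)
  moreover have "deriv (\<lambda>t. y t j - b j) 0 = deriv (\<lambda>t. y t j) 0" if "j < ?n" for j
    using analytic_on_imp_differentiable_at[OF y_an[OF that]] by simp
  ultimately have lapy: "has_lap (\<lambda>t. of_real (sqdist ?n (y t) b)) (of_real (4 * A))" by (simp add: A_def sqdist_def)
  \<comment> \<open>The logarithm of the component \<open>k\<close> is harmonic along the disc and
    contributes 0. Here \<open>A\<close> measures the velocity of the image disc in the base and
    \<open>B\<close> that in the fibre coordinates.\<close>
  have "has_lap (\<lambda>t. of_real (\<Phi> t)) (-4 * LN + of_real (\<eta> * \<delta> * (4 * B) - \<eta> * \<mu> / r\<^sup>2 * (4 * A)) - of_real (1 + \<eta>) * (4 * LM))"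
  proof -
    have "has_lap (\<lambda>t. ((-1) * of_real (\<kappa>N d k (Y t)) + of_real (1 + \<eta>) * of_real (ln ((cmod (w t k))\<^sup>2)))
        + (of_real (\<eta> * \<delta>) * of_real (\<Sum>a<?n. (cmod (Q a t))\<^sup>2) + of_real (- (\<eta> * \<mu> / r\<^sup>2)) * of_real (sqdist ?n (y t) b))
        + of_real (- (1 + \<eta>)) * of_real (\<kappa>M c l (Z t)))
      (((-1) * (4 * LN) + of_real (1 + \<eta>) * 0) + (of_real (\<eta> * \<delta>) * of_real (4 * B) + of_real (- (\<eta> * \<mu> / r\<^sup>2)) * of_real (4 * A))
        + of_real (- (1 + \<eta>)) * (4 * LM))"
      by (intro has_lap_add[where \<psi> = "\<lambda>t. of_real (- (1 + \<eta>)) * of_real (\<kappa>M c l (Z t))"] has_lap_add has_lap_lincomb has_lap_cmult lapN lapM lapW lapQ lapy)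
    moreover have "((-1) * complex_of_real (\<kappa>N d k (Y t)) + of_real (1 + \<eta>) * of_real (ln ((cmod (w t k))\<^sup>2)))
        + (of_real (\<eta> * \<delta>) * of_real (\<Sum>a<?n. (cmod (Q a t))\<^sup>2) + of_real (- (\<eta> * \<mu> / r\<^sup>2)) * of_real (sqdist ?n (y t) b))
        + of_real (- (1 + \<eta>)) * of_real (\<kappa>M c l (Z t)) = of_real (\<Phi> t)" for t
    proof -
      have "\<Phi> t = ((-1) * \<kappa>N d k (Y t) + (1 + \<eta>) * ln ((cmod (w t k))\<^sup>2))
        + ((\<eta> * \<delta>) * (\<Sum>a<?n. (cmod (Q a t))\<^sup>2) + (- (\<eta> * \<mu> / r\<^sup>2)) * sqdist ?n (y t) b)
        + (- (1 + \<eta>)) * \<kappa>M c l (Z t)" by (simp add: \<Phi>_def algebra_simps)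
      then show ?thesis by (simp only: of_real_add of_real_mult of_real_minus of_real_1)
    qed
    moreover have "((-1) * (4 * LN) + of_real (1 + \<eta>) * 0) + (of_real (\<eta> * \<delta>) * of_real (4 * B) + of_real (- (\<eta> * \<mu> / r\<^sup>2)) * of_real (4 * A))
        + of_real (- (1 + \<eta>)) * (4 * LM) = -4 * LN + of_real (\<eta> * \<delta> * (4 * B) - \<eta> * \<mu> / r\<^sup>2 * (4 * A)) - of_real (1 + \<eta>) * (4 * LM)"
      by (simp add: algebra_simps)
    ultimately show ?thesis by (simp only:)
  qed
  from has_lap_max[OF this ev_test]
  have "4 * (- Re LN + \<eta> * \<delta> * B - \<eta> * \<mu> / r\<^sup>2 * A - (1 + \<eta>) * Re LM) \<le> 0" by (simp add: algebra_simps)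
  then have ineq: "- Re LN + \<eta> * \<delta> * B - \<eta> * \<mu> / r\<^sup>2 * A - (1 + \<eta>) * Re LM \<le> 0" by simp
  \<comment> \<open>The image disc is lifted to the projectivised bundle of \<open>N\<close> by the
    push-forwards \<open>W t\<close>. \<open>Y\<close> is the lift in coordinates, and nefness is
    applied to its velocity, whose squared length in the chart is at most
    \<open>A + B\<close>.\<close>
  have RN: "Re LN \<le> \<epsilon> * (C0 * (A + B))"
  proof -
    define \<Gamma> where "\<Gamma> = (\<lambda>t. line_at (f (\<gamma> t)) (W t))"
    have evT: "\<forall>\<^sub>F t in nhds 0. W t \<in> tangent_space N (f (\<gamma> t))"
      using evZ md(1) by eventually_elim (rule pc(4)[OF _ d(1)])
    have W_an: "(\<lambda>t. W t d' i) analytic_on {0}" if d': "d' \<in> atlas N" "f (\<gamma> 0) \<in> cdom d'" and "i < ?n" for d' i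
    proof -
      have "\<forall>\<^sub>F t in nhds 0. push_coord M N f c l d' (Z t) i = W t d' i"
        using evZ map_disc(1)[OF M N f \<gamma> c(1) f\<gamma>0(1) d'] by eventually_elim (simp add: W_def pc(1)[OF _ d'(1)])
      from analytic_at_cong_ev(1)[OF this w_an[OF d']] show ?thesis .
    qed
    have W0: "W 0 = push M N f p v" by (simp add: W_def g0 V0)
    have wk1: "W 0 d k \<noteq> 0" using wk W0 by simp
    have Wne: "W 0 \<noteq> tzero" by (rule not_tzeroI[of "W 0" d k, OF wk1])
    have pd: "\<forall>\<^sub>F t in nhds 0. line_at (f (\<gamma> t)) (W t) \<in> proj_dom N d k \<and>
        proj_map N d k (line_at (f (\<gamma> t)) (W t)) = pcoord ?n k (cmap d (f (\<gamma> t))) (W t d)"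
      by (rule proj_disc(1)[where W = W, OF N map_hol_disc[OF M N f \<gamma>] evT _ d(1) f\<gamma>0(2) d(2) wk1]) (rule W_an)
    have hd: "hol_disc (proj_tangent N) \<Gamma>"
      unfolding \<Gamma>_def by (rule proj_disc(2)[where W = W, OF N map_hol_disc[OF M N f \<gamma>] evT _ Wne]) (rule W_an)
    have evY: "\<forall>\<^sub>F t in nhds 0. \<Gamma> t \<in> proj_dom N d k \<and> proj_map N d k (\<Gamma> t) = Y t"
      using pd evZ md(1)
    proof eventually_elim
      case (elim t)
      have "W t d = w t" unfolding W_def w_def by (rule pc(1)[OF elim(2) d(1) elim(3)])
      then show ?case using elim(1) by (simp add: \<Gamma>_def Y_def y_def)
    qed
    have G0: "\<Gamma> 0 \<in> proj_dom N d k" "proj_map N d k (\<Gamma> 0) = Y 0"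
      using eventually_nhds_x_imp_x[where P = "\<lambda>t. \<Gamma> t \<in> proj_dom N d k \<and> proj_map N d k (\<Gamma> t) = Y t", OF evY] by auto
    define U where "U = velocity (proj_tangent N) \<Gamma>"
    have U: "U \<in> tangent_space (proj_tangent N) (\<Gamma> 0)"
      unfolding U_def by (rule velocity_tangent[OF hdiff_atlas_proj[OF N] hd])
    have C: "proj_chart N d k \<in> atlas (proj_tangent N)" unfolding proj_tangent_simps using d by blast
    have Ui: "U (proj_chart N d k) i = deriv (\<lambda>t. Y t i) 0" if "i < 2 * ?n - 1" for i
    proof -
      have "\<forall>\<^sub>F t in nhds 0. proj_map N d k (\<Gamma> t) i = Y t i" using evY by eventually_elim simp
      then have "deriv (\<lambda>t. proj_map N d k (\<Gamma> t) i) 0 = deriv (\<lambda>t. Y t i) 0" by (intro deriv_cong_ev) auto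
      then show ?thesis unfolding U_def velocity_def using C G0(1) that by simp
    qed
    have "Re LN = Re (levi (2 * ?n - 1) (\<lambda>Z. of_real (\<kappa>N d k Z)) (Y 0) (U (proj_chart N d k)))"
      unfolding LN_def using levi_cong[of "2 * ?n - 1" "\<lambda>j. deriv (\<lambda>t. Y t j) 0" "U (proj_chart N d k)"] Ui by metis
    also have "\<dots> \<le> \<epsilon> * Re (g (\<Gamma> 0) U U)" using nef[OF G0(1) U] by (simp add: G0(2))
    also have "Re (g (\<Gamma> 0) U U) \<le> C0 * (\<Sum>i<2 * ?n - 1. (cmod (U (proj_chart N d k) i))\<^sup>2)"
    proof (rule C0[OF G0(1) _ U])
      show "proj_map N d k (\<Gamma> 0) \<in> proj_box ?n b r 2"
        unfolding G0(2) Y_def y_def w0 g0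
        by (rule pcoord_proj_box[where v = "push M N f p v d", OF d(2) less_imp_le[OF strict(1)] wk less_imp_le[OF strict(2)]])
    qed
    also have "(\<Sum>i<2 * ?n - 1. (cmod (U (proj_chart N d k) i))\<^sup>2) \<le> A + B"
      unfolding A_def B_def
    proof (rule sum_pcoord_le[OF d(2)])
      show "(cmod (U (proj_chart N d k) i))\<^sup>2 = (cmod (deriv (\<lambda>t. y t i) 0))\<^sup>2" if "i < ?n" for i
        using that d(2) by (simp add: Ui Y_def pcoord_def)
      show "(cmod (U (proj_chart N d k) i))\<^sup>2 = (cmod (deriv (Q (i - ?n)) 0))\<^sup>2" if "?n \<le> i" "i < ?n + k" for i
        using that d(2) by (simp add: Ui Y_def pcoord_def Q_def)
      show "(cmod (U (proj_chart N d k) i))\<^sup>2 = (cmod (deriv (Q (i - ?n + 1)) 0))\<^sup>2" if "?n + k \<le> i" "i < 2 * ?n - 1" for i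
        using that d(2) by (simp add: Ui Y_def pcoord_def Q_def)
    qed simp
    finally show ?thesis using pos by (simp add: mult_left_mono)
  qed
  have yd: "deriv (\<lambda>t. y t i) 0 = (\<Sum>j<?m. d_z j (\<lambda>x. cmap d (f (cinv c x)) i) (base_part ?m Z0) * u j)" if "i < ?n" for i
  proof -
    have "velocity M \<gamma> c j = u j" if j: "j < ?m" for j
    proof -
      have "\<forall>\<^sub>F t in nhds 0. cmap c (\<gamma> t) j = Z t j" using ev\<gamma> by eventually_elim (simp add: base_part_def j)
      then have "deriv (\<lambda>t. cmap c (\<gamma> t) j) 0 = deriv (\<lambda>t. Z t j) 0" by (intro deriv_cong_ev) auto
      then show ?thesis using c(1) f\<gamma>0(1) j by (simp add: velocity_def Z(2))
    qed
    then show ?thesis using md(3)[OF that] P0(2) by (simp add: y_def g0)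
  qed
  \<comment> \<open>The bound on the Levi form of \<kappa>M contributes \<open>1 + \<eta>\<close>,
    of which 1 is kept. The two multiples of \<open>B\<close> are equal and cancel.\<close>
  have "1 * (1 + \<eta>) \<le> - Re LM * (1 + \<eta>)" using u(2) \<eta>\<delta>(2) by (intro mult_right_mono) (auto simp: LM_def)
  then have "1 + \<eta> \<le> - ((1 + \<eta>) * Re LM)" by (simp add: mult.commute)
  moreover have "\<eta> * \<delta> * B = \<epsilon> * C0 * B" by (simp add: \<eta>\<delta>(1))
  moreover have "\<epsilon> * (C0 * (A + B)) = \<epsilon> * C0 * A + \<epsilon> * C0 * B" by (simp add: algebra_simps)
  ultimately have "1 \<le> \<epsilon> * C0 * A + \<eta> * \<mu> / r\<^sup>2 * A" using ineq RN \<eta>\<delta>(2) by linarith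
  then have "1 \<le> (\<epsilon> * C0 + \<eta> * \<mu> / r\<^sup>2) * A" by (simp add: distrib_right)
  moreover have "A = (\<Sum>i<?n. (cmod (\<Sum>j<?m. d_z j (\<lambda>x. cmap d (f (cinv c x)) i) (base_part ?m Z0) * u j))\<^sup>2)"
    unfolding A_def by (intro sum.cong) (auto simp: yd)
  ultimately show ?thesis by simp
qed

end

section \<open>Choice of the constants and conclusion\<close>

lemma patch_cover_exists:
  assumes "complex_manifold X" "compact_space (mtop X)"
  obtains I where "patch_cover X I"
proof (rule finite_patches[OF assms])
  fix I assume "finite I" "\<And>P. P \<in> I \<Longrightarrow> is_patch X P"
    "\<And>p. p \<in> carrier_of X \<Longrightarrow> \<exists>(c, a, r)\<in>I. p \<in> cdom c \<and> sqdist (cdim X) (cmap c p) a < r\<^sup>2 / 4"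
  then show ?thesis by (intro that[of I]) (simp add: patch_cover_def)
qed

theorem theorem1p1:
  fixes M :: "'a cmanifold" and N :: "'b cmanifold"
    and g :: "'b \<times> 'b tvec set \<Rightarrow> ('b \<times> 'b tvec set) tvec \<Rightarrow> ('b \<times> 'b tvec set) tvec \<Rightarrow> complex"
    and f :: "'a \<Rightarrow> 'b"
  assumes "complex_manifold M" and "compact_space (mtop M)"
    and "complex_manifold N" and "compact_space (mtop N)"
    and "RC_positive (proj_tangent M) (O_cotangent_minus1 M)"
    and "hermitian_metric (proj_tangent N) g"
    and "nef (proj_tangent N) g (O_cotangent_1 N)"
    and "holomorphic_map M N f"
  shows "f constant_on carrier_of M"
proof (rule constant_if_push_zero[OF assms(1,3,8)], rule ccontr)
  note M = assms(1) and N = assms(3) and f = assms(8)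
  let ?m = "cdim M" and ?n = "cdim N"
  fix p0 v0 assume p0: "p0 \<in> carrier_of M" "v0 \<in> tangent_space M p0" and nz: "push M N f p0 v0 \<noteq> tzero"
  obtain PM where PM: "patch_cover M PM" by (rule patch_cover_exists[OF M assms(2)])
  obtain PN where PN: "patch_cover N PN" by (rule patch_cover_exists[OF N assms(4)])
  have PMi: "is_patch M P" if "P \<in> PM" for P using PM that by (simp add: patch_cover_def)
  have PNi: "is_patch N P" if "P \<in> PN" for P using PN that by (simp add: patch_cover_def)
  obtain d0 b0 r0 where D0: "(d0, b0, r0) \<in> PN" "f p0 \<in> cdom d0" "sqdist ?n (cmap d0 (f p0)) b0 < r0\<^sup>2 / 4"
    using PN map_carrier[OF M N f p0(1)] unfolding patch_cover_def by blast
  have d0: "d0 \<in> atlas N" using PNi[OF D0(1)] by (simp add: is_patch_def)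
  obtain k0 where k0: "k0 < ?n" "push M N f p0 v0 d0 k0 \<noteq> 0"
    "\<And>a. a < ?n \<Longrightarrow> cmod (push M N f p0 v0 d0 a) \<le> cmod (push M N f p0 v0 d0 k0)"
    by (rule maximal_component[OF nz push(1)[OF M N f p0] d0 D0(2)]) (rule that; blast)
  have adm0: "admissible M N f (d0, b0, r0) k0 p0 v0"
  proof -
    have "sqdist ?n (cmap d0 (f p0)) b0 \<le> r0\<^sup>2" using D0(3) zero_le_power2[of r0] by linarith
    moreover have "cmod (push M N f p0 v0 d0 a) \<le> 2 * cmod (push M N f p0 v0 d0 k0)" if "a < ?n" for a
      using k0(3)[OF that] norm_ge_zero[of "push M N f p0 v0 d0 k0"] by linarith
    ultimately show ?thesis using p0 D0(2) k0(2) by (simp add: admissible_def)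
  qed
  obtain \<kappa>M where \<kappa>M: "log_metric M 1 \<kappa>M"
    "\<And>c k Z. c \<in> atlas M \<Longrightarrow> k < ?m \<Longrightarrow> Z \<in> proj_img M c \<Longrightarrow>
       \<exists>u\<in>cspace (2 * ?m - 1). Re (levi (2 * ?m - 1) (\<lambda>Z. of_real (\<kappa>M c k Z)) Z u) < 0"
    by (rule RC_positive_log_metric[OF M assms(5)]) (erule that; blast)
  obtain R where R: "R \<ge> 0" "\<And>c a r k Z. (c, a, r) \<in> PM \<Longrightarrow> k < ?m \<Longrightarrow> Z \<in> proj_box ?m a r 1 \<Longrightarrow>
     \<exists>u\<in>cspace (2 * ?m - 1). Re (levi (2 * ?m - 1) (\<lambda>Z. of_real (\<kappa>M c k Z)) Z u) \<le> -1 \<and> (\<forall>i<2 * ?m - 1. cmod (u i) \<le> R)"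
    by (rule RC_uniform[OF M \<kappa>M(1) PM \<kappa>M(2)], assumption+) (rule that; blast)
  obtain C where C: "C \<ge> 0" "\<And>d b r k q U. (d, b, r) \<in> PN \<Longrightarrow> k < ?n \<Longrightarrow> q \<in> proj_dom N d k \<Longrightarrow>
     proj_map N d k q \<in> proj_box ?n b r 2 \<Longrightarrow> U \<in> tangent_space (proj_tangent N) q \<Longrightarrow>
     Re (g q U U) \<le> C * (\<Sum>i<2 * ?n - 1. (cmod (U (proj_chart N d k) i))\<^sup>2)"
    by (rule hermitian_metric_bound[OF N assms(6) PN]) (rule that; blast)
  obtain B where B: "B \<ge> 0" "\<And>c a s d b r x i j. (c, a, s) \<in> PM \<Longrightarrow> (d, b, r) \<in> PN \<Longrightarrow> x \<in> cs_ball ?m a s \<Longrightarrow>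
     f (cinv c x) \<in> cdom d \<Longrightarrow> sqdist ?n (cmap d (f (cinv c x))) b \<le> r\<^sup>2 \<Longrightarrow> i < ?n \<Longrightarrow> j < ?m \<Longrightarrow>
     cmod (d_z j (\<lambda>x. cmap d (f (cinv c x)) i) x) \<le> B"
    by (rule derivative_bound[OF M N f PM PN]) (rule that; blast)
  \<comment> \<open>Nefness for the value 1 of its parameter gives a fixed metric, whose bound
    \<open>C1\<close> determines \<mu> before the small \<epsilon> is chosen.\<close>
  obtain \<kappa>1 where \<kappa>1: "log_metric N (-1) \<kappa>1" by (rule nef_log_metric[OF N assms(7) zero_less_one])
  obtain C1 where C1: "C1 \<ge> 0" "\<And>d b r k Y. (d, b, r) \<in> PN \<Longrightarrow> k < ?n \<Longrightarrow> Y \<in> proj_box ?n b r 2 \<Longrightarrow> \<bar>\<kappa>1 d k Y\<bar> \<le> C1"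
    by (rule log_metric_bound[where \<rho> = 2, OF N \<kappa>1 PN]) (rule that; blast)
  \<comment> \<open>The added 1 makes \<open>C0\<close>, and with it \<eta>, positive.\<close>
  define C0 where "C0 = C + 1"
  define \<delta> where "\<delta> = 1 / (4 * real ?n)"
  define \<mu> where "\<mu> = 4 * (C1 + 1)"
  \<comment> \<open>Bounds \<open>1 / r\<^sup>2\<close> for all patches at once, because \<epsilon>
    is chosen before it is known in which patch the maximum lies.\<close>
  define S where "S = (\<Sum>P\<in>PN. 1 / (snd (snd P))\<^sup>2)"
  define T where "T = real ?n * (real ?m * (B * R))\<^sup>2"
  \<comment> \<open>The curvature inequality will give \<open>1 \<le> \<epsilon> * L\<close>: with
    \<eta> inserted, the factor \<open>\<epsilon> * C0\<close> can be taken out of both error terms.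
    The \<epsilon> below is small enough to contradict this.\<close>
  define L where "L = C0 * (1 + 4 * real ?n * \<mu> * S) * T"
  define \<epsilon> where "\<epsilon> = 1 / (2 * (L + 1))"
  define \<eta> where "\<eta> = 4 * real ?n * \<epsilon> * C0"
  have n: "?n > 0" using k0(1) by simp
  have C0: "C0 > 0" using C(1) by (simp add: C0_def)
  have \<mu>: "\<mu> > 0" using C1(1) by (simp add: \<mu>_def)
  have S: "S \<ge> 0" by (simp add: S_def sum_nonneg)
  have T: "T \<ge> 0" by (simp add: T_def)
  have L: "L \<ge> 0" unfolding L_def using C0 \<mu> S T by (intro mult_nonneg_nonneg add_nonneg_nonneg) auto
  have \<epsilon>: "\<epsilon> > 0" "\<epsilon> * L < 1" using L by (auto simp: \<epsilon>_def divide_simps)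
  have \<eta>: "\<eta> > 0" using n \<epsilon>(1) C0 by (simp add: \<eta>_def)
  have \<eta>\<delta>: "\<eta> * \<delta> = \<epsilon> * C0" using n by (simp add: \<eta>_def \<delta>_def)
  obtain \<kappa>N where \<kappa>N: "log_metric N (-1) \<kappa>N"
    "\<And>c k q u. c \<in> atlas N \<Longrightarrow> k < ?n \<Longrightarrow> q \<in> proj_dom N c k \<Longrightarrow> u \<in> tangent_space (proj_tangent N) q \<Longrightarrow>
       Re (levi (2 * ?n - 1) (\<lambda>Z. of_real (\<kappa>N c k Z)) (proj_map N c k q) (u (proj_chart N c k))) \<le> \<epsilon> * Re (g q u u)"
    by (rule nef_log_metric[OF N assms(7) \<epsilon>(1)]) (erule that; blast)
  let ?T = "test_fn M N f \<kappa>M \<kappa>N \<eta> \<delta> \<mu>"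
  have \<delta>0: "\<delta> \<ge> 0" by (simp add: \<delta>_def)
  obtain D k p1 v1 where D: "D \<in> PN" "k < ?n" "admissible M N f D k p1 v1"
    "\<And>D' k' p' v'. D' \<in> PN \<Longrightarrow> k' < ?n \<Longrightarrow> admissible M N f D' k' p' v' \<Longrightarrow> ?T D' k' p' v' \<le> ?T D k p1 v1"
    by (rule test_fn_max[OF M N f \<kappa>M(1) \<kappa>N(1) PM PN \<eta> \<delta>0 less_imp_le[OF \<mu>] D0(1) k0(1) adm0]) (rule that; blast)
  obtain d b r where Dd: "D = (d, b, r)" by (cases D)
  have d: "(d, b, r) \<in> PN" "d \<in> atlas N" "r > 0" using D(1) PNi[OF D(1)] by (auto simp: Dd is_patch_def)
  have pv: "p1 \<in> carrier_of M" "v1 \<in> tangent_space M p1" "f p1 \<in> cdom d" "push M N f p1 v1 d k \<noteq> 0"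
    using D(3) by (auto simp: admissible_def Dd)
  have "v1 \<noteq> tzero"
  proof
    assume "v1 = tzero"
    then have "v1 = tscale 0 v1" by (simp add: tzero_def tscale_def)
    then have "push M N f p1 v1 = tscale 0 (push M N f p1 v1)" by (metis push_scale[OF M N f])
    then have "push M N f p1 v1 d k = 0" by (metis tscale_def mult_zero_left)
    then show False using pv(4) by simp
  qed
  from normal_form[OF M PM pv(1,2) this] obtain c a s l Z \<alpha> where P: "(c, a, s) \<in> PM" "l < ?m" "p1 \<in> cdom c" "v1 c l \<noteq> 0"
    "Z \<in> proj_box ?m a s 1" "\<alpha> \<noteq> 0" "cinv c (base_part ?m Z) = p1" "tvec_of M c p1 (fibre_part ?m l Z) = tscale \<alpha> v1"
    by metis
  \<comment> \<open>The maximum is transferred to the normalised multiple of \<open>v1\<close>, to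
    which the curvature inequality refers.\<close>
  define v where "v = tvec_of M c p1 (fibre_part ?m l Z)"
  have c: "c \<in> atlas M" using PMi[OF P(1)] by (simp add: is_patch_def)
  have Zi: "Z \<in> proj_img M c" using proj_box_img[OF PMi[OF P(1)]] P(5) by blast
  have adm: "admissible M N f (d, b, r) k p1 v" using admissible_scale[OF M N f P(6) D(3)] by (simp add: v_def P(8) Dd)
  have Tv: "?T (d, b, r) k p1 v = ?T D k p1 v1"
    unfolding v_def P(8) Dd by (rule test_fn_scale[OF M N f \<kappa>M(1) \<kappa>N(1) pv(1,2) P(4) c P(3,2) d(2) pv(3) D(2) pv(4) P(6)])
  have max: "?T D' k' p' v' \<le> ?T (d, b, r) k p1 v" if "D' \<in> PN" "k' < ?n" "admissible M N f D' k' p' v'" for D' k' p' v'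
    using D(4)[OF that] Tv by simp
  have strict: "sqdist ?n (cmap d (f p1)) b < r\<^sup>2"
    by (rule max_interior(1)[OF M N f \<kappa>1 PN _ \<eta> \<delta>_def \<mu>_def C1(1) d(1) D(2) adm])
      (erule (2) C1(2), erule (2) max)
  have strict': "cmod (push M N f p1 v d a) < 2 * cmod (push M N f p1 v d k)" if "a < ?n" for a
    by (rule max_interior(2)[OF M N f \<kappa>1 PN _ \<eta> \<delta>_def \<mu>_def C1(1) d(1) D(2) adm _ that])
      (erule (2) C1(2), erule (2) max)
  have vk: "push M N f p1 v d k \<noteq> 0" using adm by (simp add: admissible_def)
  obtain u where u: "u \<in> cspace (2 * ?m - 1)" "Re (levi (2 * ?m - 1) (\<lambda>Z. of_real (\<kappa>M c l Z)) Z u) \<le> -1" "\<forall>i<2 * ?m - 1. cmod (u i) \<le> R"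
    using R(2)[OF P(1,2,5)] by blast
  let ?A = "\<Sum>i<?n. (cmod (\<Sum>j<?m. d_z j (\<lambda>x. cmap d (f (cinv c x)) i) (base_part ?m Z) * u j))\<^sup>2"
  have C': "Re (g q U U) \<le> C0 * (\<Sum>i<2 * ?n - 1. (cmod (U (proj_chart N d k) i))\<^sup>2)"
    if "q \<in> proj_dom N d k" "proj_map N d k q \<in> proj_box ?n b r 2" "U \<in> tangent_space (proj_tangent N) q" for q U
  proof -
    have "C * (\<Sum>i<2 * ?n - 1. (cmod (U (proj_chart N d k) i))\<^sup>2) \<le> C0 * (\<Sum>i<2 * ?n - 1. (cmod (U (proj_chart N d k) i))\<^sup>2)"
      by (intro mult_right_mono sum_nonneg) (auto simp: C0_def)
    then show ?thesis using C(2)[OF d(1) D(2) that] by linarith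
  qed
  note mci = max_curvature_inequality[where M = M and N = N and f = f and g = g and d = d and k = k and b = b and r = r and c = c
      and l = l and ?Z0.0 = Z and u = u and \<epsilon> = \<epsilon> and ?C0.0 = C0 and \<eta> = \<eta> and \<delta> = \<delta> and \<mu> = \<mu> and \<kappa>M = \<kappa>M and \<kappa>N = \<kappa>N,
      unfolded P(7), folded v_def]
  have ineq: "1 \<le> (\<epsilon> * C0 + \<eta> * \<mu> / r\<^sup>2) * ?A"
  proof (rule mci[OF M N f \<kappa>M(1) \<kappa>N(1)])
    show "Re (levi (2 * ?n - 1) (\<lambda>Z. of_real (\<kappa>N d k Z)) (proj_map N d k q) (U (proj_chart N d k))) \<le> \<epsilon> * Re (g q U U)"
      if "q \<in> proj_dom N d k" "U \<in> tangent_space (proj_tangent N) q" for q U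
      by (rule \<kappa>N(2)[OF d(2) D(2) that])
    show "Re (g q U U) \<le> C0 * (\<Sum>i<2 * ?n - 1. (cmod (U (proj_chart N d k) i))\<^sup>2)"
      if "q \<in> proj_dom N d k" "proj_map N d k q \<in> proj_box ?n b r 2" "U \<in> tangent_space (proj_tangent N) q" for q U
      by (rule C'[OF that])
    show "?T (d, b, r) k p' v' \<le> ?T (d, b, r) k p1 v" if "admissible M N f (d, b, r) k p' v'" for p' v'
      by (rule max[OF d(1) D(2) that])
    show "cmod (push M N f p1 v d a) < 2 * cmod (push M N f p1 v d k)" if "a < ?n" for a
      by (rule strict'[OF that])
  qed (rule \<epsilon>(1) d(3) \<eta>\<delta> \<eta> c P(2) Zi d(2) D(2) pv(3) vk strict u(1) u(2) less_imp_le[OF C0])+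
  have "?A \<le> T"
  proof -
    have x: "base_part ?m Z \<in> cs_ball ?m a s"
      using P(5) by (simp add: cs_ball_def base_part_cspace sqdist_base_part proj_box_def)
    have "(cmod (\<Sum>j<?m. d_z j (\<lambda>x. cmap d (f (cinv c x)) i) (base_part ?m Z) * u j))\<^sup>2 \<le> (real ?m * (B * R))\<^sup>2" if i: "i < ?n" for i
    proof (rule power_mono)
      have "cmod (d_z j (\<lambda>x. cmap d (f (cinv c x)) i) (base_part ?m Z) * u j) \<le> B * R" if j: "j < ?m" for j
      proof -
        have "cmod (d_z j (\<lambda>x. cmap d (f (cinv c x)) i) (base_part ?m Z)) \<le> B"
          using B(2)[OF P(1) d(1) x _ _ i j] pv(3) less_imp_le[OF strict] by (simp add: P(7))
        moreover have "cmod (u j) \<le> R" using u(3) j by simp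
        ultimately show ?thesis unfolding norm_mult using B(1) by (intro mult_mono) auto
      qed
      then have "cmod (\<Sum>j<?m. d_z j (\<lambda>x. cmap d (f (cinv c x)) i) (base_part ?m Z) * u j) \<le> (\<Sum>j<?m. B * R)"
        by (intro order_trans[OF norm_sum] sum_mono) auto
      then show "cmod (\<Sum>j<?m. d_z j (\<lambda>x. cmap d (f (cinv c x)) i) (base_part ?m Z) * u j) \<le> real ?m * (B * R)" by simp
    qed simp
    then have "?A \<le> (\<Sum>i<?n. (real ?m * (B * R))\<^sup>2)" by (intro sum_mono) auto
    then show ?thesis by (simp add: T_def)
  qed
  moreover have "1 / r\<^sup>2 \<le> S"
    unfolding S_def using member_le_sum[of "(d, b, r)" PN "\<lambda>P. 1 / (snd (snd P))\<^sup>2"] d(1) PN by (simp add: patch_cover_def)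
  then have "\<eta> * \<mu> * (1 / r\<^sup>2) \<le> \<eta> * \<mu> * S" using \<eta> \<mu> by (intro mult_left_mono) auto
  ultimately have "(\<epsilon> * C0 + \<eta> * \<mu> / r\<^sup>2) * ?A \<le> (\<epsilon> * C0 + \<eta> * \<mu> * S) * T"
    using \<epsilon>(1) C0 \<eta> \<mu> S by (intro mult_mono add_mono add_nonneg_nonneg mult_nonneg_nonneg sum_nonneg) auto
  also have "\<dots> = \<epsilon> * L" by (simp add: \<eta>_def L_def algebra_simps)
  also have "\<dots> < 1" by (rule \<epsilon>(2))
  finally show False using ineq by simp
qed

end
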